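(* Let $M$ be an infinite-dimensional manifold modelled on a convenient vector space, and let $\eta\in\Omega^1(M)$ be a 1-form such that $d\eta$ is degenerate, i.e. for every $p\in M$ the kernel $\{v\in T_pM : d\eta_p(v,\cdot)=0\}$ is non-zero. Define the horizontal and vertical distributions $\mathcal{H}:=\ker\eta$ and $\mathcal{V}:=\ker d\eta=\ker(v\mapsto d\eta(v,-))$. The following are equivalent: (1) The tangent bundle is the Whitney sum of the horizontal and vertical distributions, $TM=\mathcal{H}\oplus\mathcal{V}$. (2) $d\eta$ is weakly non-degenerate on $\mathcal{H}$, i.e. $d\eta|_{\mathcal{H}}$ has zero kernel; equivalently, $(\mathcal{H},d\eta|_{\mathcal{H}})$ is a weakly symplectic vector bundle. (3) The map $\flat\colon\mathfrak{X}(M)\to\Omega^1(M)$, $\flat(X)=\iota_X d\eta+\eta(X)\eta$, is an injective homomorphism of $C^\infty(M)$-modules; equivalently, $\flat\colon TM\to T'M$ is an injective bundle homomorphism.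
   Context: A convenient vector space is a Hausdorff locally convex real topological vector space $E$ such that every smooth curve $c_1\colon\mathbb{R}\to E$ has a smooth antiderivative $c_2$, $c_2'=c_1$. A map is smooth if it sends smooth curves to smooth curves; manifolds are defined by atlases of charts into $E$ with smooth transition maps. $TM$ is the kinematic tangent bundle (equivalence classes of smooth curves), $T'M$ the bundle with fibres the continuous duals $(T_pM)'$; $\mathfrak{X}(M)$ and $\Omega^1(M)$ are the smooth sections of $TM$ and $T'M$. A $k$-form is a smooth section of the bundle of continuous alternating $k$-linear forms on $TM$, and $d$ is the usual exterior derivative. A (fibrewise) bilinear antisymmetric form $\Omega$ is weakly non-degenerate if $\Omega(v,\cdot)=0$ implies $v=0$; a vector bundle with such a form on each fibre is weakly symplectic.
   Formalization: Condition (3) is taken as injectivity of the bundle map TM→T'M, which is shown to imply the section version; the converse is false (η = z dz − Σ y_i dx_i on ℓ²×ℓ²×ℝ) and is dropped. The Whitney sum is taken fibrewise, without requiring V to be a smooth subbundle. *)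

theory Defs
  imports "HOL-Analysis.Analysis"
begin

section \<open>Convenient vector spaces\<close>

definition has_curve_derivative ::
    "(real \<Rightarrow> 'a::{real_vector,topological_space}) \<Rightarrow> 'a \<Rightarrow> real \<Rightarrow> bool" where
  "has_curve_derivative c d t \<longleftrightarrow> ((\<lambda>h. (c (t + h) - c t) /\<^sub>R h) \<longlongrightarrow> d) (at 0)"

text \<open>\<open>D n\<close> is the \<open>n\<close>-th derivative of \<open>c\<close>. The definition is used for open \<open>S\<close> only.\<close>

definition smooth_curve_on ::
    "real set \<Rightarrow> (real \<Rightarrow> 'a::{real_vector,topological_space}) \<Rightarrow> bool" where
  "smooth_curve_on S c \<longleftrightarrow>
     (\<exists>D. (\<forall>t\<in>S. D 0 t = c t) \<and> (\<forall>n. \<forall>t\<in>S. has_curve_derivative (D n) (D (Suc n) t) t))"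

abbreviation smooth_curve :: "(real \<Rightarrow> 'a::{real_vector,topological_space}) \<Rightarrow> bool" where
  "smooth_curve \<equiv> smooth_curve_on UNIV"

text \<open>The defining properties of the following two classes are spelled out, because \<^const>\<open>convex\<close>
  and \<^const>\<open>smooth_curve_on\<close> are not class operations; see the lemmas after each class for the
  intended form.\<close>

class locally_convex_space = real_vector + t2_space + topological_ab_group_add +
  assumes tendsto_scaleR_nhds:
    "((\<lambda>(r, x). r *\<^sub>R x) \<longlongrightarrow> a *\<^sub>R b) (nhds a \<times>\<^sub>F nhds b)"
  assumes locally_convex_0:
    "open U \<Longrightarrow> 0 \<in> U \<Longrightarrow>
       \<exists>C. open C \<and> 0 \<in> C \<and> C \<subseteq> U \<and>
         (\<forall>x\<in>C. \<forall>y\<in>C. \<forall>r\<ge>0. \<forall>s\<ge>0. r + s = 1 \<longrightarrow> r *\<^sub>R x + s *\<^sub>R y \<in> C)"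

lemma convex_nhds_0:
  fixes U :: "'a::locally_convex_space set"
  assumes "open U" "0 \<in> U"
  shows "\<exists>C. open C \<and> convex C \<and> 0 \<in> C \<and> C \<subseteq> U"
  using locally_convex_0[OF assms] unfolding convex_def by blast

class convenient_vector_space = locally_convex_space +
  assumes antiderivative:
    "(\<And>n t. ((\<lambda>h. (D n (t + h) - D n t) /\<^sub>R h) \<longlongrightarrow> D (Suc n) t) (at (0::real))) \<Longrightarrow>
       \<exists>C. \<forall>t. ((\<lambda>h. (C (t + h) - C t) /\<^sub>R h) \<longlongrightarrow> D 0 t) (at (0::real))"

lemma smooth_antiderivative:
  fixes c :: "real \<Rightarrow> 'a::convenient_vector_space"
  assumes "smooth_curve c"
  shows "\<exists>C. smooth_curve C \<and> (\<forall>t. has_curve_derivative C (c t) t)"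
proof -
  obtain D where D: "D 0 = c" "\<And>n t. has_curve_derivative (D n) (D (Suc n) t) t"
    using assms unfolding smooth_curve_on_def by auto
  obtain C where C: "\<And>t. has_curve_derivative C (D 0 t) t"
    using antiderivative[of D] D(2) unfolding has_curve_derivative_def by blast
  have "smooth_curve C"
    unfolding smooth_curve_on_def
    by (rule exI[of _ "case_nat C D"]) (auto simp: C D(2) split: nat.split)
  then show ?thesis
    using C D(1) by auto
qed

definition infinite_dimensional :: "'e::real_vector itself \<Rightarrow> bool" where
  "infinite_dimensional _ \<longleftrightarrow> \<not> (\<exists>B::'e set. finite B \<and> span B = UNIV)"

text \<open>The \<open>c\<^sup>\<infinity>\<close>-topology is the final topology with respect to all smooth curves. It is the
  topology in which the domains of charts are open.\<close>

definition cinf_open :: "'a::{real_vector,topological_space} set \<Rightarrow> bool" where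
  "cinf_open U \<longleftrightarrow> (\<forall>c. smooth_curve c \<longrightarrow> open (c -` U))"

definition cinf_topology :: "'a::{real_vector,topological_space} topology" where
  "cinf_topology = topology cinf_open"

lemma openin_cinf_topology: "openin cinf_topology U \<longleftrightarrow> cinf_open U"
proof -
  have "istopology (cinf_open :: 'a set \<Rightarrow> bool)"
    unfolding istopology_def cinf_open_def by (auto simp: vimage_Union)
  then show ?thesis
    unfolding cinf_topology_def by simp
qed

lemma topspace_cinf_topology [simp]: "topspace cinf_topology = UNIV"
  unfolding topspace_def openin_cinf_topology cinf_open_def by (auto intro!: exI[of _ UNIV])

definition smooth_on ::
    "'a::{real_vector,topological_space} set \<Rightarrow> ('a \<Rightarrow> 'b::{real_vector,topological_space}) \<Rightarrow> bool" where
  "smooth_on U f \<longleftrightarrow> (\<forall>c. smooth_curve c \<and> range c \<subseteq> U \<longrightarrow> smooth_curve (f \<circ> c))"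


section \<open>The dual space\<close>

text \<open>Continuity of functionals refers to the \<open>c\<^sup>\<infinity>\<close>-topology, which depends only on the
  smooth structure. A linear functional is continuous in this sense iff it is bounded; if the
  given locally convex topology is bornological (for instance Banach or Frechet), this is the same
  as continuity in the given topology. For other topologies, continuity in the given topology is
  not invariant under smooth changes of charts: a linear automorphism that is smooth together with
  its inverse need not be continuous.\<close>

typedef (overloaded) 'e dual =
    "{l :: 'e::{real_vector,topological_space} \<Rightarrow> real.
        linear l \<and> continuous_map cinf_topology euclideanreal l}"
  morphisms dual_apply Abs_dual
  by (rule exI[of _ "\<lambda>_. 0"]) (simp add: linear_zero)

setup_lifting type_definition_dual

instantiation dual :: ("{real_vector,topological_space}") real_vector
begin

lift_definition zero_dual :: "'a dual" is "\<lambda>_. 0"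
  by (simp add: linear_zero)

lift_definition plus_dual :: "'a dual \<Rightarrow> 'a dual \<Rightarrow> 'a dual" is "\<lambda>l m x. l x + m x"
  by (auto intro: linear_compose_add continuous_map_add)

lift_definition uminus_dual :: "'a dual \<Rightarrow> 'a dual" is "\<lambda>l x. - l x"
  by (auto intro: linear_compose_neg continuous_map_minus)

lift_definition minus_dual :: "'a dual \<Rightarrow> 'a dual \<Rightarrow> 'a dual" is "\<lambda>l m x. l x - m x"
  by (auto intro: linear_compose_sub continuous_map_diff)

lift_definition scaleR_dual :: "real \<Rightarrow> 'a dual \<Rightarrow> 'a dual" is "\<lambda>r l x. r *\<^sub>R l x"
  by (auto intro: linear_compose_scale_right[where 'b = real, unfolded real_scaleR_def]
      continuous_map_real_mult_left)

instance
  by standard (transfer; auto simp: algebra_simps)+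

end

definition von_Neumann_bounded :: "'a::{real_vector,topological_space} set \<Rightarrow> bool" where
  "von_Neumann_bounded B \<longleftrightarrow> (\<forall>U. open U \<and> 0 \<in> U \<longrightarrow> (\<exists>r>0. \<forall>s\<ge>r. B \<subseteq> (*\<^sub>R) s ` U))"

lemma von_Neumann_bounded_Un:
  assumes "von_Neumann_bounded B" "von_Neumann_bounded C" shows "von_Neumann_bounded (B \<union> C)"
  unfolding von_Neumann_bounded_def
proof (intro allI impI)
  fix U :: "'a set" assume U: "open U \<and> 0 \<in> U"
  obtain r where r: "r > 0" "\<forall>s\<ge>r. B \<subseteq> (*\<^sub>R) s ` U"
    using assms(1) U unfolding von_Neumann_bounded_def by blast
  obtain q where q: "q > 0" "\<forall>s\<ge>q. C \<subseteq> (*\<^sub>R) s ` U"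
    using assms(2) U unfolding von_Neumann_bounded_def by blast
  have "\<forall>s\<ge>max r q. B \<union> C \<subseteq> (*\<^sub>R) s ` U"
    using r(2) q(2) by (simp add: Un_least)
  then show "\<exists>r>0. \<forall>s\<ge>r. B \<union> C \<subseteq> (*\<^sub>R) s ` U"
    using r(1) by (intro exI[of _ "max r q"]) auto
qed

text \<open>The dual carries the strong topology, i.e. uniform convergence on bounded sets.\<close>

instantiation dual :: ("{real_vector,topological_space}") topological_space
begin

definition open_dual :: "'a dual set \<Rightarrow> bool" where
  "open_dual N \<longleftrightarrow>
     (\<forall>l\<in>N. \<exists>B e. von_Neumann_bounded B \<and> e > 0 \<and>
        {m. \<forall>x\<in>B. \<bar>dual_apply m x - dual_apply l x\<bar> \<le> e} \<subseteq> N)"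

instance
proof
  have "von_Neumann_bounded ({} :: 'a set)"
    unfolding von_Neumann_bounded_def by (auto intro: exI[of _ 1])
  then show "open (UNIV :: 'a dual set)"
    unfolding open_dual_def by (auto intro: exI[of _ 1])
next
  fix S T :: "'a dual set" assume S: "open S" and T: "open T"
  show "open (S \<inter> T)"
    unfolding open_dual_def
  proof
    fix l assume l: "l \<in> S \<inter> T"
    obtain B e where B: "von_Neumann_bounded B" "e > 0"
        "{m. \<forall>x\<in>B. \<bar>dual_apply m x - dual_apply l x\<bar> \<le> e} \<subseteq> S"
      using S l unfolding open_dual_def by blast
    obtain C d where C: "von_Neumann_bounded C" "d > 0"
        "{m. \<forall>x\<in>C. \<bar>dual_apply m x - dual_apply l x\<bar> \<le> d} \<subseteq> T"
      using T l unfolding open_dual_def by blast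
    have "{m. \<forall>x\<in>B \<union> C. \<bar>dual_apply m x - dual_apply l x\<bar> \<le> min e d} \<subseteq> S \<inter> T"
      using B(3) C(3) by auto
    then show "\<exists>B e. von_Neumann_bounded B \<and> e > 0 \<and>
        {m. \<forall>x\<in>B. \<bar>dual_apply m x - dual_apply l x\<bar> \<le> e} \<subseteq> S \<inter> T"
      using von_Neumann_bounded_Un[OF B(1) C(1)] B(2) C(2)
      by (intro exI[of _ "B \<union> C"] exI[of _ "min e d"]) auto
  qed
next
  fix K :: "'a dual set set" assume "\<forall>S\<in>K. open S"
  then show "open (\<Union>K)"
    unfolding open_dual_def by (meson Sup_upper UnionE subset_trans)
qed

end


section \<open>Manifolds and smooth maps\<close>

type_synonym ('m, 'e) chart = "'m set \<times> ('m \<Rightarrow> 'e)"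

definition smooth_manifold ::
    "'m set \<Rightarrow> ('m, 'e::convenient_vector_space) chart set \<Rightarrow> bool" where
  "smooth_manifold M A \<longleftrightarrow>
     \<Union> (fst ` A) = M \<and>
     (\<forall>(U, u)\<in>A. inj_on u U \<and> cinf_open (u ` U)) \<and>
     (\<forall>(U, u)\<in>A. \<forall>(V, v)\<in>A.
        cinf_open (u ` (U \<inter> V)) \<and> smooth_on (u ` (U \<inter> V)) (v \<circ> inv_into U u))"

text \<open>The following notions are also applied to the bundle atlases below, whose model spaces are
  \<open>'e \<times> 'e\<close> and \<open>'e \<times> 'e dual\<close>.\<close>

definition manifold_curve ::
    "('x, 'v::{real_vector,topological_space}) chart set \<Rightarrow> (real \<Rightarrow> 'x) \<Rightarrow> bool" where
  "manifold_curve A c \<longleftrightarrow>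
     (\<forall>t. \<exists>(U, u)\<in>A. \<exists>S. open S \<and> t \<in> S \<and> c ` S \<subseteq> U \<and> smooth_curve_on S (u \<circ> c))"

definition smooth_map ::
    "('x, 'v::{real_vector,topological_space}) chart set \<Rightarrow>
     ('y, 'w::{real_vector,topological_space}) chart set \<Rightarrow> ('x \<Rightarrow> 'y) \<Rightarrow> bool" where
  "smooth_map A B f \<longleftrightarrow> (\<forall>c. manifold_curve A c \<longrightarrow> manifold_curve B (f \<circ> c))"

definition smooth_functions ::
    "('m, 'e::{real_vector,topological_space}) chart set \<Rightarrow> ('m \<Rightarrow> real) set" where
  "smooth_functions A = {f. \<forall>c. manifold_curve A c \<longrightarrow> smooth_curve (f \<circ> c)}"


section \<open>The kinematic tangent bundle\<close>

type_synonym 'm tangent = "(real \<Rightarrow> 'm) set"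

definition curve_equiv ::
    "('m, 'e::{real_vector,topological_space}) chart set \<Rightarrow> ((real \<Rightarrow> 'm) \<times> (real \<Rightarrow> 'm)) set" where
  "curve_equiv A =
     {(c, k). manifold_curve A c \<and> manifold_curve A k \<and> c 0 = k 0 \<and>
        (\<forall>(U, u)\<in>A. c 0 \<in> U \<longrightarrow>
           (\<exists>d. has_curve_derivative (u \<circ> c) d 0 \<and> has_curve_derivative (u \<circ> k) d 0))}"

definition tangent_space ::
    "('m, 'e::{real_vector,topological_space}) chart set \<Rightarrow> 'm \<Rightarrow> 'm tangent set" where
  "tangent_space A p = {c. manifold_curve A c \<and> c 0 = p} // curve_equiv A"

definition tangent_bundle ::
    "'m set \<Rightarrow> ('m, 'e::{real_vector,topological_space}) chart set \<Rightarrow> 'm tangent set" where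
  "tangent_bundle M A = (\<Union>p\<in>M. tangent_space A p)"

definition footpoint :: "'m tangent \<Rightarrow> 'm" where
  "footpoint v = (THE p. \<forall>c\<in>v. c 0 = p)"

text \<open>The tangent map of the chart \<open>u\<close>. It identifies each tangent space with \<open>'e\<close>.\<close>

definition tangent_coord :: "('m \<Rightarrow> 'e::{real_vector,topological_space}) \<Rightarrow> 'm tangent \<Rightarrow> 'e" where
  "tangent_coord u v = (THE d. \<forall>c\<in>v. has_curve_derivative (u \<circ> c) d 0)"

definition tangent_atlas ::
    "('m, 'e::{real_vector,topological_space}) chart set \<Rightarrow> ('m tangent, 'e \<times> 'e) chart set" where
  "tangent_atlas A =
     (\<lambda>(U, u). (tangent_bundle U A, \<lambda>v. (u (footpoint v), tangent_coord u v))) ` A"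

text \<open>The vector space structure of the tangent spaces, for which the tangent map of every chart is
  linear.\<close>

definition tangent_zero ::
    "('m, 'e::{real_vector,topological_space}) chart set \<Rightarrow> 'm \<Rightarrow> 'm tangent" where
  "tangent_zero A p =
     (THE z. z \<in> tangent_space A p \<and> (\<forall>(U, u)\<in>A. p \<in> U \<longrightarrow> tangent_coord u z = 0))"

definition tangent_add ::
    "('m, 'e::{real_vector,topological_space}) chart set \<Rightarrow> 'm \<Rightarrow> 'm tangent \<Rightarrow> 'm tangent \<Rightarrow> 'm tangent"
  where
  "tangent_add A p v w =
     (THE z. z \<in> tangent_space A p \<and>
        (\<forall>(U, u)\<in>A. p \<in> U \<longrightarrow> tangent_coord u z = tangent_coord u v + tangent_coord u w))"

definition tangent_scale ::
    "('m, 'e::{real_vector,topological_space}) chart set \<Rightarrow> 'm \<Rightarrow> real \<Rightarrow> 'm tangent \<Rightarrow> 'm tangent" where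
  "tangent_scale A p r v =
     (THE z. z \<in> tangent_space A p \<and>
        (\<forall>(U, u)\<in>A. p \<in> U \<longrightarrow> tangent_coord u z = r *\<^sub>R tangent_coord u v))"

definition vector_fields ::
    "'m set \<Rightarrow> ('m, 'e::{real_vector,topological_space}) chart set \<Rightarrow> ('m \<Rightarrow> 'm tangent) set" where
  "vector_fields M A =
     {X \<in> Pi\<^sub>E M (tangent_space A). smooth_map A (tangent_atlas A) X}"


section \<open>The kinematic cotangent bundle\<close>

type_synonym 'm cotangent = "'m tangent \<Rightarrow> real"

text \<open>A covector is a functional on the tangent space, extended by \<^term>\<open>undefined\<close>, that is
  continuous and linear when the tangent space is identified with \<open>'e\<close> by means of a chart.\<close>

definition cotangent_space ::
    "('m, 'e::{real_vector,topological_space}) chart set \<Rightarrow> 'm \<Rightarrow> 'm cotangent set" where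
  "cotangent_space A p =
     {\<alpha> \<in> extensional (tangent_space A p).
        \<forall>(U, u)\<in>A. p \<in> U \<longrightarrow>
          (\<exists>l :: 'e dual. \<forall>v\<in>tangent_space A p. \<alpha> v = dual_apply l (tangent_coord u v))}"

definition cotangent_coord ::
    "('m, 'e::{real_vector,topological_space}) chart set \<Rightarrow> ('m \<Rightarrow> 'e) \<Rightarrow> 'm \<Rightarrow> 'm cotangent \<Rightarrow> 'e dual"
  where
  "cotangent_coord A u p \<alpha> =
     (THE l. \<forall>v\<in>tangent_space A p. \<alpha> v = dual_apply l (tangent_coord u v))"

definition cotangent_atlas ::
    "('m, 'e::{real_vector,topological_space}) chart set \<Rightarrow>
     ('m \<times> 'm cotangent, 'e \<times> 'e dual) chart set" where
  "cotangent_atlas A =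
     (\<lambda>(U, u). (SIGMA p:U. cotangent_space A p, \<lambda>(p, \<alpha>). (u p, cotangent_coord A u p \<alpha>))) ` A"

definition one_forms ::
    "'m set \<Rightarrow> ('m, 'e::{real_vector,topological_space}) chart set \<Rightarrow> ('m \<Rightarrow> 'm cotangent) set" where
  "one_forms M A =
     {\<alpha> \<in> Pi\<^sub>E M (cotangent_space A). smooth_map A (cotangent_atlas A) (\<lambda>p. (p, \<alpha> p))}"

text \<open>In a chart, with \<open>l\<close> the local representative of \<open>\<eta>\<close> and \<open>a\<close>, \<open>b\<close> those of \<open>v\<close>, \<open>w\<close>:
  \<open>d\<eta>(v, w) = (D\<^sub>a l) b - (D\<^sub>b l) a\<close>.\<close>

definition local_form ::
    "('m, 'e::{real_vector,topological_space}) chart set \<Rightarrow> ('m, 'e) chart \<Rightarrow> ('m \<Rightarrow> 'm cotangent) \<Rightarrow>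
     'e \<Rightarrow> 'e dual" where
  "local_form A = (\<lambda>(U, u) \<eta> x. cotangent_coord A u (inv_into U u x) (\<eta> (inv_into U u x)))"

definition exterior_derivative ::
    "('m, 'e::{real_vector,topological_space}) chart set \<Rightarrow> ('m \<Rightarrow> 'm cotangent) \<Rightarrow>
     'm \<Rightarrow> 'm tangent \<Rightarrow> 'm tangent \<Rightarrow> real" where
  "exterior_derivative A \<eta> p v w =
     (THE r. \<forall>(U, u)\<in>A. p \<in> U \<longrightarrow>
        (let l = local_form A (U, u) \<eta>; a = tangent_coord u v; b = tangent_coord u w in
         r = deriv (\<lambda>s. dual_apply (l (u p + s *\<^sub>R a)) b) 0
           - deriv (\<lambda>s. dual_apply (l (u p + s *\<^sub>R b)) a) 0))"


section \<open>Distributions\<close>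

definition horizontal ::
    "('m, 'e::{real_vector,topological_space}) chart set \<Rightarrow> ('m \<Rightarrow> 'm cotangent) \<Rightarrow> 'm \<Rightarrow> 'm tangent set"
  where
  "horizontal A \<eta> p = {v \<in> tangent_space A p. \<eta> p v = 0}"

definition vertical ::
    "('m, 'e::{real_vector,topological_space}) chart set \<Rightarrow> ('m \<Rightarrow> 'm cotangent) \<Rightarrow> 'm \<Rightarrow> 'm tangent set"
  where
  "vertical A \<eta> p =
     {v \<in> tangent_space A p. \<forall>w\<in>tangent_space A p. exterior_derivative A \<eta> p v w = 0}"

text \<open>Distributions are families of linear subspaces of the tangent spaces, without any requirement
  of smoothness, and the Whitney sum is formed fibrewise. Indeed, the kernel of \<open>d\<eta>\<close> need not be
  a smooth (or even continuous) line bundle, even if it is a fibrewise complement of the kernel of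
  \<open>\<eta>\<close>: for a smooth family of bounded operators with dense range and one-dimensional kernels, the
  kernels may jump.\<close>

definition tangent_whitney_sum ::
    "'m set \<Rightarrow> ('m, 'e::{real_vector,topological_space}) chart set \<Rightarrow>
     ('m \<Rightarrow> 'm tangent set) \<Rightarrow> ('m \<Rightarrow> 'm tangent set) \<Rightarrow> bool" where
  "tangent_whitney_sum M A H V \<longleftrightarrow>
     (\<forall>p\<in>M. \<forall>v\<in>tangent_space A p. \<exists>!(h, k). h \<in> H p \<and> k \<in> V p \<and> v = tangent_add A p h k)"

definition weakly_nondegenerate_on ::
    "'m set \<Rightarrow> ('m, 'e::{real_vector,topological_space}) chart set \<Rightarrow>
     ('m \<Rightarrow> 'm tangent set) \<Rightarrow> ('m \<Rightarrow> 'm tangent \<Rightarrow> 'm tangent \<Rightarrow> real) \<Rightarrow> bool" where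
  "weakly_nondegenerate_on M A H \<omega> \<longleftrightarrow>
     (\<forall>p\<in>M. \<forall>v\<in>H p. (\<forall>w\<in>H p. \<omega> p v w = 0) \<longrightarrow> v = tangent_zero A p)"

text \<open>A subbundle of the tangent bundle is locally the image of a trivial subbundle, with a
  \<open>c\<^sup>\<infinity>\<close>-closed linear subspace \<open>F\<close> as typical fibre, under a smooth automorphism \<open>\<psi>\<close> of the
  trivialised tangent bundle.\<close>

definition vector_subbundle ::
    "'m set \<Rightarrow> ('m, 'e::{real_vector,topological_space}) chart set \<Rightarrow> ('m \<Rightarrow> 'm tangent set) \<Rightarrow> bool"
  where
  "vector_subbundle M A H \<longleftrightarrow>
     (\<forall>p\<in>M. H p \<subseteq> tangent_space A p) \<and>
     (\<forall>p\<in>M. \<exists>(U, u)\<in>A. \<exists>W F \<psi> \<phi>.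
        p \<in> W \<and> W \<subseteq> U \<and> cinf_open (u ` W) \<and>
        subspace F \<and> closedin cinf_topology F \<and>
        smooth_on (u ` W \<times> UNIV) (\<lambda>(x, y). \<psi> x y) \<and>
        smooth_on (u ` W \<times> UNIV) (\<lambda>(x, y). \<phi> x y) \<and>
        (\<forall>x\<in>u ` W. linear (\<psi> x) \<and> (\<forall>y. \<phi> x (\<psi> x y) = y \<and> \<psi> x (\<phi> x y) = y)) \<and>
        (\<forall>q\<in>W. tangent_coord u ` H q = \<psi> (u q) ` F))"

definition antisymmetric_bilinear_on ::
    "('m, 'e::{real_vector,topological_space}) chart set \<Rightarrow> 'm \<Rightarrow> 'm tangent set \<Rightarrow>
     ('m tangent \<Rightarrow> 'm tangent \<Rightarrow> real) \<Rightarrow> bool" where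
  "antisymmetric_bilinear_on A p S b \<longleftrightarrow>
     (\<forall>v\<in>S. \<forall>w\<in>S. b v w = - b w v) \<and>
     (\<forall>v\<in>S. \<forall>w\<in>S. \<forall>z\<in>S. b (tangent_add A p v w) z = b v z + b w z) \<and>
     (\<forall>r. \<forall>v\<in>S. \<forall>z\<in>S. b (tangent_scale A p r v) z = r * b v z)"

definition weakly_symplectic_bundle ::
    "'m set \<Rightarrow> ('m, 'e::{real_vector,topological_space}) chart set \<Rightarrow>
     ('m \<Rightarrow> 'm tangent set) \<Rightarrow> ('m \<Rightarrow> 'm tangent \<Rightarrow> 'm tangent \<Rightarrow> real) \<Rightarrow> bool" where
  "weakly_symplectic_bundle M A H \<omega> \<longleftrightarrow>
     vector_subbundle M A H \<and>
     (\<forall>p\<in>M. antisymmetric_bilinear_on A p (H p) (\<omega> p)) \<and>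
     weakly_nondegenerate_on M A H \<omega>"


section \<open>Module and bundle homomorphisms\<close>

definition module_hom_fields_forms ::
    "'m set \<Rightarrow> ('m, 'e::{real_vector,topological_space}) chart set \<Rightarrow>
     (('m \<Rightarrow> 'm tangent) \<Rightarrow> ('m \<Rightarrow> 'm cotangent)) \<Rightarrow> bool" where
  "module_hom_fields_forms M A \<Phi> \<longleftrightarrow>
     \<Phi> \<in> vector_fields M A \<rightarrow> one_forms M A \<and>
     (\<forall>X\<in>vector_fields M A. \<forall>Y\<in>vector_fields M A.
        \<Phi> (\<lambda>p\<in>M. tangent_add A p (X p) (Y p)) =
        (\<lambda>p\<in>M. \<lambda>v\<in>tangent_space A p. \<Phi> X p v + \<Phi> Y p v)) \<and>
     (\<forall>f\<in>smooth_functions A. \<forall>X\<in>vector_fields M A.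
        \<Phi> (\<lambda>p\<in>M. tangent_scale A p (f p) (X p)) =
        (\<lambda>p\<in>M. \<lambda>v\<in>tangent_space A p. f p * \<Phi> X p v))"

definition bundle_hom_tangent_cotangent ::
    "'m set \<Rightarrow> ('m, 'e::{real_vector,topological_space}) chart set \<Rightarrow>
     ('m tangent \<Rightarrow> 'm \<times> 'm cotangent) \<Rightarrow> bool" where
  "bundle_hom_tangent_cotangent M A \<Phi> \<longleftrightarrow>
     smooth_map (tangent_atlas A) (cotangent_atlas A) \<Phi> \<and>
     (\<forall>p\<in>M. \<forall>v\<in>tangent_space A p. fst (\<Phi> v) = p \<and> snd (\<Phi> v) \<in> cotangent_space A p) \<and>
     (\<forall>p\<in>M. \<forall>v\<in>tangent_space A p. \<forall>w\<in>tangent_space A p.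
        snd (\<Phi> (tangent_add A p v w)) =
        (\<lambda>z\<in>tangent_space A p. snd (\<Phi> v) z + snd (\<Phi> w) z)) \<and>
     (\<forall>p\<in>M. \<forall>r. \<forall>v\<in>tangent_space A p.
        snd (\<Phi> (tangent_scale A p r v)) = (\<lambda>z\<in>tangent_space A p. r * snd (\<Phi> v) z))"

definition flat_at ::
    "('m, 'e::{real_vector,topological_space}) chart set \<Rightarrow> ('m \<Rightarrow> 'm cotangent) \<Rightarrow>
     'm \<Rightarrow> 'm tangent \<Rightarrow> 'm cotangent" where
  "flat_at A \<eta> p v =
     (\<lambda>w\<in>tangent_space A p. exterior_derivative A \<eta> p v w + \<eta> p v * \<eta> p w)"

text \<open>The musical map on sections and on the tangent bundle. Injectivity on the tangent bundle
  implies injectivity on sections, but not conversely: for \<open>\<eta> = z dz - \<Sum>\<^sub>i y\<^sub>i dx\<^sub>i\<close> on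
  \<open>\<ell>\<^sup>2 \<times> \<ell>\<^sup>2 \<times> \<real>\<close>, a vector field with vanishing image is zero off \<open>z = 0\<close>, hence everywhere,
  while \<open>\<partial>\<^sub>z\<close> at \<open>z = 0\<close> is a kernel vector.\<close>

definition flat_sections ::
    "'m set \<Rightarrow> ('m, 'e::{real_vector,topological_space}) chart set \<Rightarrow> ('m \<Rightarrow> 'm cotangent) \<Rightarrow>
     ('m \<Rightarrow> 'm tangent) \<Rightarrow> ('m \<Rightarrow> 'm cotangent)" where
  "flat_sections M A \<eta> X = (\<lambda>p\<in>M. flat_at A \<eta> p (X p))"

definition flat_bundle ::
    "('m, 'e::{real_vector,topological_space}) chart set \<Rightarrow> ('m \<Rightarrow> 'm cotangent) \<Rightarrow>
     'm tangent \<Rightarrow> 'm \<times> 'm cotangent" where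
  "flat_bundle A \<eta> v = (footpoint v, flat_at A \<eta> (footpoint v) v)"

end

theory Submission
  imports Defs
begin

text \<open>Each of the three conditions says that \<open>ker \<eta>\<^sub>p \<inter> ker d\<eta>\<^sub>p = 0\<close> at every point \<open>p\<close>. Since
  \<open>ker d\<eta>\<^sub>p\<close> contains some \<open>\<xi> \<noteq> 0\<close>, this forces \<open>\<eta>\<^sub>p(\<xi>) \<noteq> 0\<close>, so \<open>\<xi>\<close> spans a complement of
  \<open>ker \<eta>\<^sub>p\<close>, and pairing with \<open>\<xi>\<close> recovers \<open>\<eta>(v)\<close> from \<open>\<flat>(v)\<close>. The analytic content is that
  tangent spaces, \<open>d\<eta>\<close> and \<open>\<flat>\<close> are well defined and smooth.
  Smoothness means smoothness along smooth curves, so this rests on a form of Boman's theorem: if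
  \<open>G(t, s)\<close> is smooth along smooth curves of the plane, then so is \<open>\<partial>\<^sub>s G(t, 0)\<close>. Along special curves
  through fast falling sequences all directional derivatives of \<open>G\<close> are locally bounded;
  polarization of finite differences bounds the \<open>t\<close>-derivatives of \<open>(G(t, s) - G(t, 0)) / s\<close>
  uniformly in \<open>s\<close>, and these quotients converge to \<open>\<partial>\<^sub>s G(t, 0)\<close>. Testing with functionals
  (Hahn-Banach) then gives the chain rule in locally convex spaces, and a curve in the strong dual
  is smooth as soon as its pairing with smooth curves is.\<close>


section \<open>Smooth curves\<close>

text \<open>Smooth maps between the model spaces are controlled only along smooth curves, so
  neighbourhood estimates in the model space are out of reach. Analytic questions are therefore
  pulled back to the plane by surfaces such as \<open>c s + t a\<close>; in the plane, smooth curves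
  do detect the topology. Moreover \<open>smooth_on\<close> tests only curves on the whole line with
  range in the given set, whereas charts and derivatives are local. Germs are therefore
  reparametrised by cutoffs, and results are compared near a point only. Uniform estimates are
  proved by contradiction: bad points are placed at the times 2^-n on one smooth curve. Each
  derivative of such a curve costs a factor 2^n, so offsets and weights of size 2^(-n^2) are used.
  The form is smooth only in charts chosen by its own definition, and a change of charts
  differentiates the transition map. Hence even smoothness of a local representative rests on the
  theorem about partial derivatives. That the kernels of the form are a subbundle is a conclusion:
  nondegeneracy together with a kernel vector makes the form nowhere zero, and this gives the local
  trivialisations.\<close>

lemma tendsto_scaleR_convex:
  fixes g :: "'i \<Rightarrow> 'a::locally_convex_space"
  assumes "(f \<longlongrightarrow> r) F" "(g \<longlongrightarrow> x) F"
  shows "((\<lambda>i. f i *\<^sub>R g i) \<longlongrightarrow> r *\<^sub>R x) F"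
  using filterlim_compose[OF tendsto_scaleR_nhds filterlim_Pair[OF assms]] by simp

text \<open>Scalar factors and pairings are real curves; the instance subjects them to the same
  lemmas as vector-valued curves.\<close>

instance real :: locally_convex_space
proof
  show "((\<lambda>(r, x). r *\<^sub>R x) \<longlongrightarrow> a *\<^sub>R b) (nhds a \<times>\<^sub>F nhds b)" for a b :: real
    unfolding case_prod_beta
    by (intro tendsto_scaleR filterlim_fst filterlim_snd)
next
  fix U :: "real set"
  assume "open U" "0 \<in> U"
  then obtain e where e: "e > 0" "ball 0 e \<subseteq> U"
    using open_contains_ball_eq by blast
  then show "\<exists>C. open C \<and> 0 \<in> C \<and> C \<subseteq> U \<and>
         (\<forall>x\<in>C. \<forall>y\<in>C. \<forall>r\<ge>0. \<forall>s\<ge>0. r + s = 1 \<longrightarrow> r *\<^sub>R x + s *\<^sub>R y \<in> C)"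
    using convex_ball[of 0 e] unfolding convex_def
    by (intro exI[of _ "ball 0 e"]) auto
qed

section \<open>Derivatives of curves\<close>

lemma eventually_nhds_shift:
  fixes t :: real
  assumes "\<forall>\<^sub>F s in nhds t. P s"
  shows "\<forall>\<^sub>F h in nhds 0. P (t + h)"
proof -
  have "((\<lambda>h. t + h) \<longlongrightarrow> t + 0) (nhds 0)"
    by (intro tendsto_add tendsto_const filterlim_ident)
  then show ?thesis
    using assms unfolding filterlim_iff by simp
qed

lemma has_curve_derivative_unique:
  fixes c :: "real \<Rightarrow> 'a::{real_vector,t2_space}"
  shows "has_curve_derivative c d t \<Longrightarrow> has_curve_derivative c e t \<Longrightarrow> d = e"
  unfolding has_curve_derivative_def by (rule tendsto_unique[of "at 0"]) auto

lemma has_curve_derivative_real_iff: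
  "has_curve_derivative c d t \<longleftrightarrow> (c has_real_derivative d) (at t)"
  unfolding has_curve_derivative_def DERIV_def by (simp add: divide_inverse mult.commute)

lemma has_curve_derivative_cong:
  fixes c :: "real \<Rightarrow> 'a::{real_vector,topological_space}"
  assumes "\<forall>\<^sub>F s in nhds t. c s = k s"
  shows "has_curve_derivative c d t \<longleftrightarrow> has_curve_derivative k d t"
proof -
  have "c t = k t"
    using eventually_nhds_x_imp_x[OF assms] .
  moreover have "\<forall>\<^sub>F h in at 0. c (t + h) = k (t + h)"
    using eventually_nhds_shift[OF assms] by (simp add: eventually_nhds_conv_at)
  ultimately show ?thesis
    unfolding has_curve_derivative_def
    by (intro filterlim_cong refl) (auto elim: eventually_mono)
qed

text \<open>Filling the gap of the difference quotient with \<open>d\<close> gives a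
  \<open>q\<close> that is continuous at 0 and satisfies its equation also for \<open>h = 0\<close>.
  Chain rules can then insert an inner increment that may vanish.\<close>

lemma has_curve_derivative_caratheodory:
  fixes c :: "real \<Rightarrow> 'a::{real_vector,topological_space}"
  assumes "has_curve_derivative c d t"
  obtains q where "\<And>h. c (t + h) - c t = h *\<^sub>R q h" "(q \<longlongrightarrow> d) (nhds 0)" "q 0 = d"
proof -
  define q where "q h = (if h = 0 then d else (c (t + h) - c t) /\<^sub>R h)" for h
  have "(q \<longlongrightarrow> d) (at 0)"
    using assms unfolding has_curve_derivative_def
    by (rule Lim_transform_eventually) (auto simp: q_def eventually_at_filter)
  then have "(q \<longlongrightarrow> d) (nhds 0)"
    using tendsto_at_iff_tendsto_nhds[of q 0] by (simp add: q_def)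
  then show ?thesis
    by (intro that[of q]) (auto simp: q_def)
qed

lemma has_curve_derivative_imp_tendsto:
  fixes c :: "real \<Rightarrow> 'a::locally_convex_space"
  assumes "has_curve_derivative c d t"
  shows "(c \<longlongrightarrow> c t) (nhds t)"
proof -
  obtain q where q: "\<And>h. c (t + h) - c t = h *\<^sub>R q h" "(q \<longlongrightarrow> d) (nhds 0)"
    using has_curve_derivative_caratheodory[OF assms] by metis
  have "((\<lambda>s. s - t) \<longlongrightarrow> t - t) (nhds t)"
    by (intro tendsto_diff tendsto_const filterlim_ident)
  then have "((\<lambda>s. s - t) \<longlongrightarrow> 0) (nhds t)"
    by simp
  then have "((\<lambda>s. c t + (s - t) *\<^sub>R q (s - t)) \<longlongrightarrow> c t + 0 *\<^sub>R d) (nhds t)"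
    by (intro tendsto_add tendsto_const tendsto_scaleR_convex
        filterlim_compose[OF q(2)])
  moreover have "c t + (s - t) *\<^sub>R q (s - t) = c s" for s
    using q(1)[of "s - t"] by (simp add: algebra_simps)
  ultimately show ?thesis
    by simp
qed

lemma has_curve_derivative_const: "has_curve_derivative (\<lambda>s. a) 0 t"
  unfolding has_curve_derivative_def by simp

lemma has_curve_derivative_add:
  fixes c k :: "real \<Rightarrow> 'a::locally_convex_space"
  assumes "has_curve_derivative c d t" "has_curve_derivative k e t"
  shows "has_curve_derivative (\<lambda>s. c s + k s) (d + e) t"
  using tendsto_add[OF assms[unfolded has_curve_derivative_def]]
  unfolding has_curve_derivative_def by (simp add: algebra_simps)

lemma has_curve_derivative_scaleR:
  fixes c :: "real \<Rightarrow> 'a::locally_convex_space"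
  assumes "(f has_real_derivative f') (at t)" "has_curve_derivative c d t"
  shows "has_curve_derivative (\<lambda>s. f s *\<^sub>R c s) (f' *\<^sub>R c t + f t *\<^sub>R d) t"
proof -
  have c: "((\<lambda>h. c (t + h)) \<longlongrightarrow> c t) (at 0)"
    using has_curve_derivative_imp_tendsto[OF assms(2)]
    by (rule filterlim_compose) (auto intro!: tendsto_eq_intros)
  have "((\<lambda>h. ((f (t + h) - f t) / h) *\<^sub>R c (t + h) + f t *\<^sub>R ((c (t + h) - c t) /\<^sub>R h))
      \<longlongrightarrow> f' *\<^sub>R c t + f t *\<^sub>R d) (at 0)"
    using assms c unfolding has_curve_derivative_def DERIV_def
    by (intro tendsto_add tendsto_scaleR_convex tendsto_const)
  then show ?thesis
    unfolding has_curve_derivative_def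
    by (rule Lim_transform_eventually)
      (auto intro!: always_eventually simp: algebra_simps divide_inverse)
qed

lemma has_curve_derivative_compose:
  fixes c :: "real \<Rightarrow> 'a::locally_convex_space"
  assumes "(r has_real_derivative r') (at t)" "has_curve_derivative c d (r t)"
  shows "has_curve_derivative (\<lambda>s. c (r s)) (r' *\<^sub>R d) t"
proof -
  obtain q where q: "\<And>h. c (r t + h) - c (r t) = h *\<^sub>R q h" "(q \<longlongrightarrow> d) (nhds 0)"
    using has_curve_derivative_caratheodory[OF assms(2)] by metis
  have r: "((\<lambda>h. r (t + h) - r t) \<longlongrightarrow> 0) (at 0)"
    using DERIV_isCont[OF assms(1)] unfolding isCont_iff by (rule LIM_zero)
  have eq: "((r (t + h) - r t) / h) *\<^sub>R q (r (t + h) - r t) = (c (r (t + h)) - c (r t)) /\<^sub>R h" for h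
    using q(1)[of "r (t + h) - r t"] by (simp add: divide_inverse mult.commute)
  have "((\<lambda>h. ((r (t + h) - r t) / h) *\<^sub>R q (r (t + h) - r t)) \<longlongrightarrow> r' *\<^sub>R d) (at 0)"
    using assms(1) unfolding DERIV_def
    by (intro tendsto_scaleR_convex filterlim_compose[OF q(2) r])
  then show ?thesis
    unfolding has_curve_derivative_def eq .
qed

text \<open>A germ condition: the derivative \<open>d\<close> is fixed only near \<open>t\<close>,
  and the neighbourhood may shrink as the order grows. Products and compositions can then be handled
  by induction on the order, without formulas for their n-th derivatives.\<close>

primrec curve_ck :: "nat \<Rightarrow> (real \<Rightarrow> 'a::{real_vector,topological_space}) \<Rightarrow> real \<Rightarrow> bool" where
  "curve_ck 0 c t \<longleftrightarrow> True"
| "curve_ck (Suc n) c t \<longleftrightarrow>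
    (\<exists>d. (\<forall>\<^sub>F s in nhds t. has_curve_derivative c (d s) s) \<and> curve_ck n d t)"

definition smooth_at :: "(real \<Rightarrow> 'a::{real_vector,topological_space}) \<Rightarrow> real \<Rightarrow> bool" where
  "smooth_at c t \<longleftrightarrow> (\<forall>n. curve_ck n c t)"

definition curve_deriv :: "(real \<Rightarrow> 'a::{real_vector,topological_space}) \<Rightarrow> real \<Rightarrow> 'a" where
  "curve_deriv c t = (THE d. has_curve_derivative c d t)"

lemma curve_deriv_eq:
  fixes c :: "real \<Rightarrow> 'a::{real_vector,t2_space}"
  shows "has_curve_derivative c d t \<Longrightarrow> curve_deriv c t = d"
  unfolding curve_deriv_def by (blast intro: has_curve_derivative_unique)


lemma curve_ck_cong:
  assumes "\<forall>\<^sub>F s in nhds t. c s = k s"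
  shows "curve_ck n c t \<longleftrightarrow> curve_ck n k t"
proof (cases n)
  case (Suc m)
  have "\<forall>\<^sub>F s in nhds t. \<forall>\<^sub>F r in nhds s. c r = k r"
    using assms by (simp add: eventually_eventually)
  then have "\<forall>\<^sub>F s in nhds t. \<forall>d. has_curve_derivative c d s \<longleftrightarrow> has_curve_derivative k d s"
    by (rule eventually_mono) (simp add: has_curve_derivative_cong)
  then have "(\<forall>\<^sub>F s in nhds t. has_curve_derivative c (d s) s) \<longleftrightarrow>
      (\<forall>\<^sub>F s in nhds t. has_curve_derivative k (d s) s)" for d
    by (intro eventually_cong) (auto elim: eventually_mono)
  then show ?thesis
    by (simp add: Suc)
qed simp

lemma smooth_at_cong:
  "\<forall>\<^sub>F s in nhds t. c s = k s \<Longrightarrow> smooth_at c t \<longleftrightarrow> smooth_at k t"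
  unfolding smooth_at_def using curve_ck_cong by blast

text \<open>Needed in the Leibniz and chain rules, where one factor stays undifferentiated and keeps
  the higher order.\<close>

lemma curve_ck_SucD: "curve_ck (Suc n) c t \<Longrightarrow> curve_ck n c t"
proof (induction n arbitrary: c)
  case (Suc n)
  obtain d where "\<forall>\<^sub>F s in nhds t. has_curve_derivative c (d s) s" "curve_ck (Suc n) d t"
    using Suc.prems by auto
  then show ?case
    using Suc.IH by auto
qed simp

lemma curve_ck_deriv:
  fixes c :: "real \<Rightarrow> 'a::{real_vector,t2_space}"
  assumes "curve_ck (Suc n) c t"
  shows "\<forall>\<^sub>F s in nhds t. has_curve_derivative c (curve_deriv c s) s"
    and "curve_ck n (curve_deriv c) t"
proof -
  obtain d where d: "\<forall>\<^sub>F s in nhds t. has_curve_derivative c (d s) s" "curve_ck n d t"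
    using assms by auto
  have eq: "\<forall>\<^sub>F s in nhds t. d s = curve_deriv c s"
    using d(1) by (rule eventually_mono) (simp add: curve_deriv_eq)
  show "curve_ck n (curve_deriv c) t"
    using d(2) curve_ck_cong[OF eq] by simp
  show "\<forall>\<^sub>F s in nhds t. has_curve_derivative c (curve_deriv c s) s"
    using d(1) eq by eventually_elim simp
qed

lemma smooth_at_deriv:
  fixes c :: "real \<Rightarrow> 'a::{real_vector,t2_space}"
  assumes "smooth_at c t"
  shows "\<forall>\<^sub>F s in nhds t. has_curve_derivative c (curve_deriv c s) s"
    and "has_curve_derivative c (curve_deriv c t) t"
    and "smooth_at (curve_deriv c) t"
proof -
  show *: "\<forall>\<^sub>F s in nhds t. has_curve_derivative c (curve_deriv c s) s"
    using assms curve_ck_deriv(1) unfolding smooth_at_def by blast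
  show "has_curve_derivative c (curve_deriv c t) t"
    using eventually_nhds_x_imp_x[OF *] .
  show "smooth_at (curve_deriv c) t"
    using assms curve_ck_deriv(2) unfolding smooth_at_def by blast
qed

lemma smooth_curve_on_imp_smooth_at:
  assumes "smooth_curve_on S c" "open S" "t \<in> S"
  shows "smooth_at c t"
proof -
  obtain D where D: "\<And>s. s \<in> S \<Longrightarrow> D 0 s = c s"
      "\<And>n s. s \<in> S \<Longrightarrow> has_curve_derivative (D n) (D (Suc n) s) s"
    using assms(1) unfolding smooth_curve_on_def by auto
  have ev: "\<forall>\<^sub>F s in nhds t. s \<in> S"
    using assms(2,3) by (rule eventually_nhds_in_open)
  have "curve_ck n (D m) t" for n m
  proof (induction n arbitrary: m)
    case (Suc n)
    have "\<forall>\<^sub>F s in nhds t. has_curve_derivative (D m) (D (Suc m) s) s"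
      using ev by (rule eventually_mono) (rule D(2))
    then show ?case
      using Suc by auto
  qed simp
  then have "smooth_at (D 0) t"
    unfolding smooth_at_def by blast
  moreover have "\<forall>\<^sub>F s in nhds t. D 0 s = c s"
    using ev by (rule eventually_mono) (rule D(1))
  ultimately show ?thesis
    using smooth_at_cong by blast
qed

lemma smooth_at_iterate:
  fixes c :: "real \<Rightarrow> 'a::{real_vector,t2_space}"
  shows "smooth_at c t \<Longrightarrow> smooth_at ((curve_deriv ^^ n) c) t"
  by (induction n) (auto intro: smooth_at_deriv(3))

lemma smooth_curve_onI:
  fixes c :: "real \<Rightarrow> 'a::{real_vector,t2_space}"
  assumes "\<And>t. t \<in> S \<Longrightarrow> smooth_at c t"
  shows "smooth_curve_on S c"
  unfolding smooth_curve_on_def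
  by (rule exI[of _ "\<lambda>n. (curve_deriv ^^ n) c"])
    (auto intro: smooth_at_deriv(2) smooth_at_iterate assms)

lemma smooth_curve_iff_smooth_at:
  fixes c :: "real \<Rightarrow> 'a::{real_vector,t2_space}"
  shows "smooth_curve c \<longleftrightarrow> (\<forall>t. smooth_at c t)"
  using smooth_curve_onI[of UNIV c] smooth_curve_on_imp_smooth_at[of UNIV c] by auto

lemma smooth_curve_deriv:
  fixes c :: "real \<Rightarrow> 'a::{real_vector,t2_space}"
  assumes "smooth_curve c"
  shows "has_curve_derivative c (curve_deriv c t) t" "smooth_curve (curve_deriv c)"
  using assms smooth_at_deriv(2,3) unfolding smooth_curve_iff_smooth_at by blast+

lemma smooth_curve_DERIV:
  fixes f :: "real \<Rightarrow> real"
  assumes "smooth_curve f"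
  shows "(f has_real_derivative deriv f t) (at t)" "smooth_curve (deriv f)"
proof -
  note D = smooth_curve_deriv[OF assms]
  have "deriv f = curve_deriv f"
    using D(1) by (auto simp: fun_eq_iff has_curve_derivative_real_iff intro!: DERIV_imp_deriv)
  then show "(f has_real_derivative deriv f t) (at t)" "smooth_curve (deriv f)"
    using D by (auto simp: has_curve_derivative_real_iff)
qed

text \<open>Flat functions and special curves have derivatives of the same kind; closure of such a
  family under differentiation replaces formulas for the n-th derivatives.\<close>

lemma smooth_at_coinduct:
  assumes "X c" "\<And>c. X c \<Longrightarrow> \<exists>d. (\<forall>\<^sub>F s in nhds t. has_curve_derivative c (d s) s) \<and> X d"
  shows "smooth_at c t"
proof -
  have "\<And>c. X c \<Longrightarrow> curve_ck n c t" for n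
  proof (induction n)
    case (Suc n)
    show ?case
      using assms(2)[OF Suc.prems] Suc.IH by auto
  qed simp
  then show ?thesis
    using assms(1) unfolding smooth_at_def by blast
qed

lemma smooth_at_const: "smooth_at (\<lambda>s. a) t"
  by (rule smooth_at_coinduct[of "\<lambda>c. \<exists>a. c = (\<lambda>s. a)"])
    (auto intro!: has_curve_derivative_const always_eventually exI[of _ "\<lambda>s. 0"])

lemma smooth_at_id: "smooth_at (\<lambda>s::real. s) t"
  unfolding smooth_at_def
proof
  show "curve_ck n (\<lambda>s::real. s) t" for n
  proof (cases n)
    case (Suc m)
    have "curve_ck m (\<lambda>s. 1::real) t"
      using smooth_at_const[of "1::real" t] unfolding smooth_at_def by blast
    then show ?thesis
      unfolding Suc curve_ck.simps
      by (intro exI[of _ "\<lambda>s. 1"]) (auto simp: has_curve_derivative_real_iff)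
  qed simp
qed

lemma curve_ck_add:
  fixes c k :: "real \<Rightarrow> 'a::locally_convex_space"
  shows "curve_ck n c t \<Longrightarrow> curve_ck n k t \<Longrightarrow> curve_ck n (\<lambda>s. c s + k s) t"
proof (induction n arbitrary: c k)
  case (Suc n)
  obtain d e where "\<forall>\<^sub>F s in nhds t. has_curve_derivative c (d s) s" "curve_ck n d t"
      "\<forall>\<^sub>F s in nhds t. has_curve_derivative k (e s) s" "curve_ck n e t"
    using Suc.prems by auto
  moreover have "\<forall>\<^sub>F s in nhds t. has_curve_derivative (\<lambda>s. c s + k s) (d s + e s) s"
    using calculation(1,3) by eventually_elim (rule has_curve_derivative_add)
  ultimately show ?case
    using Suc.IH[of d e] by (auto intro!: exI[of _ "\<lambda>s. d s + e s"])
qed simp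

lemma curve_ck_scaleR:
  fixes c :: "real \<Rightarrow> 'a::locally_convex_space" and f :: "real \<Rightarrow> real"
  shows "curve_ck n f t \<Longrightarrow> curve_ck n c t \<Longrightarrow> curve_ck n (\<lambda>s. f s *\<^sub>R c s) t"
proof (induction n arbitrary: f c)
  case (Suc n)
  obtain d e where de: "\<forall>\<^sub>F s in nhds t. has_curve_derivative f (d s) s" "curve_ck n d t"
      "\<forall>\<^sub>F s in nhds t. has_curve_derivative c (e s) s" "curve_ck n e t"
    using Suc.prems by auto
  have "\<forall>\<^sub>F s in nhds t. has_curve_derivative (\<lambda>s. f s *\<^sub>R c s) (d s *\<^sub>R c s + f s *\<^sub>R e s) s"
    using de(1,3) by eventually_elim
      (simp add: has_curve_derivative_scaleR has_curve_derivative_real_iff)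
  moreover have "curve_ck n (\<lambda>s. d s *\<^sub>R c s + f s *\<^sub>R e s) t"
    using Suc.prems de Suc.IH by (intro curve_ck_add) (auto dest: curve_ck_SucD simp del: curve_ck.simps(2))
  ultimately show ?case
    by auto
qed simp

lemma curve_ck_compose:
  fixes c :: "real \<Rightarrow> 'a::locally_convex_space" and r :: "real \<Rightarrow> real"
  shows "curve_ck n r t \<Longrightarrow> curve_ck n c (r t) \<Longrightarrow> curve_ck n (\<lambda>s. c (r s)) t"
proof (induction n arbitrary: c)
  case (Suc n)
  obtain d e where de: "\<forall>\<^sub>F s in nhds t. has_curve_derivative r (d s) s" "curve_ck n d t"
      "\<forall>\<^sub>F s in nhds (r t). has_curve_derivative c (e s) s" "curve_ck n e (r t)"
    using Suc.prems by auto
  have "(r \<longlongrightarrow> r t) (nhds t)"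
    using has_curve_derivative_imp_tendsto eventually_nhds_x_imp_x[OF de(1)] by blast
  then have "\<forall>\<^sub>F s in nhds t. has_curve_derivative c (e (r s)) (r s)"
    using de(3) unfolding filterlim_iff by blast
  with de(1) have "\<forall>\<^sub>F s in nhds t. has_curve_derivative (\<lambda>s. c (r s)) (d s *\<^sub>R e (r s)) s"
    by eventually_elim (simp add: has_curve_derivative_compose has_curve_derivative_real_iff)
  moreover have "curve_ck n (\<lambda>s. d s *\<^sub>R e (r s)) t"
    using Suc.prems de Suc.IH
    by (intro curve_ck_scaleR) (auto dest: curve_ck_SucD simp del: curve_ck.simps(2))
  ultimately show ?case
    by (auto intro!: exI[of _ "\<lambda>s. d s *\<^sub>R e (r s)"])
qed simp

lemma smooth_at_add:
  fixes c k :: "real \<Rightarrow> 'a::locally_convex_space"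
  shows "smooth_at c t \<Longrightarrow> smooth_at k t \<Longrightarrow> smooth_at (\<lambda>s. c s + k s) t"
  unfolding smooth_at_def using curve_ck_add by blast

lemma smooth_at_scaleR:
  fixes c :: "real \<Rightarrow> 'a::locally_convex_space" and f :: "real \<Rightarrow> real"
  shows "smooth_at f t \<Longrightarrow> smooth_at c t \<Longrightarrow> smooth_at (\<lambda>s. f s *\<^sub>R c s) t"
  unfolding smooth_at_def using curve_ck_scaleR by blast

lemma smooth_at_compose:
  fixes c :: "real \<Rightarrow> 'a::locally_convex_space" and r :: "real \<Rightarrow> real"
  shows "smooth_at r t \<Longrightarrow> smooth_at c (r t) \<Longrightarrow> smooth_at (\<lambda>s. c (r s)) t"
  unfolding smooth_at_def using curve_ck_compose by blast

lemma smooth_at_mult: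
  fixes f g :: "real \<Rightarrow> real"
  shows "smooth_at f t \<Longrightarrow> smooth_at g t \<Longrightarrow> smooth_at (\<lambda>s. f s * g s) t"
  using smooth_at_scaleR[of f t g] by (simp only: real_scaleR_def)

lemma smooth_at_minus:
  fixes c :: "real \<Rightarrow> 'a::locally_convex_space"
  shows "smooth_at c t \<Longrightarrow> smooth_at (\<lambda>s. - c s) t"
  using smooth_at_scaleR[OF smooth_at_const, of c t "- 1"] by simp

lemma smooth_at_diff:
  fixes c k :: "real \<Rightarrow> 'a::locally_convex_space"
  shows "smooth_at c t \<Longrightarrow> smooth_at k t \<Longrightarrow> smooth_at (\<lambda>s. c s - k s) t"
  using smooth_at_add[OF _ smooth_at_minus, of c t k] by simp

text \<open>The derivative \<open>- f' / f^2\<close> contains only \<open>f'\<close> and the inverse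
  itself, so the order climbs by one at each step while \<open>f\<close> stays fixed.\<close>

lemma curve_ck_inverse:
  fixes f :: "real \<Rightarrow> real"
  assumes "f t \<noteq> 0" "smooth_at f t"
  shows "curve_ck n (\<lambda>s. inverse (f s)) t"
proof (induction n)
  case (Suc n)
  note D = smooth_at_deriv[OF assms(2)]
  have "\<forall>\<^sub>F s in nhds t. f s \<noteq> 0"
    using has_curve_derivative_imp_tendsto[OF D(2)] assms(1)
    by (rule tendsto_imp_eventually_ne)
  with D(1) have "\<forall>\<^sub>F s in nhds t. has_curve_derivative (\<lambda>s. inverse (f s))
      ((- curve_deriv f s) *\<^sub>R (inverse (f s) *\<^sub>R inverse (f s))) s"
    by eventually_elim
      (auto simp: has_curve_derivative_real_iff intro!: derivative_eq_intros)
  moreover have "curve_ck n (\<lambda>s. (- curve_deriv f s) *\<^sub>R (inverse (f s) *\<^sub>R inverse (f s))) t"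
    using Suc smooth_at_minus[OF D(3)] unfolding smooth_at_def
    by (intro curve_ck_scaleR) auto
  ultimately show ?case
    by auto
qed simp

lemma smooth_at_divide:
  fixes f g :: "real \<Rightarrow> real"
  assumes "smooth_at f t" "smooth_at g t" "g t \<noteq> 0"
  shows "smooth_at (\<lambda>s. f s / g s) t"
  using smooth_at_mult[OF assms(1), of "\<lambda>s. inverse (g s)"] curve_ck_inverse[OF assms(3,2)]
  by (simp add: smooth_at_def divide_inverse)

lemmas smooth_at_intros =
  smooth_at_const smooth_at_id smooth_at_add smooth_at_scaleR smooth_at_mult smooth_at_minus
  smooth_at_diff smooth_at_divide

lemma smooth_at_imp_tendsto:
  fixes c :: "real \<Rightarrow> 'a::locally_convex_space"
  shows "smooth_at c t \<Longrightarrow> (c \<longlongrightarrow> c t) (nhds t)"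
  using has_curve_derivative_imp_tendsto smooth_at_deriv(2) by blast

lemma smooth_curve_continuous:
  fixes c :: "real \<Rightarrow> 'a::locally_convex_space"
  assumes "smooth_curve c"
  shows "continuous_on S c"
  using assms smooth_at_imp_tendsto tendsto_at_iff_tendsto_nhds
  unfolding smooth_curve_iff_smooth_at continuous_on_def
  by (metis tendsto_within_subset subset_UNIV)


section \<open>Continuous seminorms\<close>

text \<open>Continuity is asked for at 0 only; subadditivity carries it to every point.
  Nonnegativity follows from subadditivity and homogeneity.\<close>

definition continuous_seminorm :: "('a::{real_vector,topological_space} \<Rightarrow> real) \<Rightarrow> bool" where
  "continuous_seminorm p \<longleftrightarrow>
     (\<forall>x y. p (x + y) \<le> p x + p y) \<and> (\<forall>r x. p (r *\<^sub>R x) = \<bar>r\<bar> * p x) \<and>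
     (\<forall>e>0. \<forall>\<^sub>F x in nhds 0. p x < e)"

lemma continuous_seminorm_abs: "continuous_seminorm (abs :: real \<Rightarrow> real)"
  unfolding continuous_seminorm_def
  by (auto simp: abs_mult eventually_nhds_metric intro!: exI)

context
  fixes p :: "'a::locally_convex_space \<Rightarrow> real"
  assumes p: "continuous_seminorm p"
begin

lemma seminorm_triangle: "p (x + y) \<le> p x + p y"
  and seminorm_scaleR: "p (r *\<^sub>R x) = \<bar>r\<bar> * p x"
  using p unfolding continuous_seminorm_def by auto

lemma seminorm_zero [simp]: "p 0 = 0"
  using seminorm_scaleR[of 0 0] by simp

lemma seminorm_minus: "p (- x) = p x"
  using seminorm_scaleR[of "-1" x] by simp

lemma seminorm_nonneg: "0 \<le> p x"
  using seminorm_triangle[of x "-x"] seminorm_minus[of x] by simp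

lemma seminorm_minus_commute: "p (x - y) = p (y - x)"
  using seminorm_minus[of "x - y"] by simp

lemma seminorm_abs_diff: "\<bar>p x - p y\<bar> \<le> p (x - y)"
  using seminorm_triangle[of "x - y" y] seminorm_triangle[of "y - x" x] seminorm_minus_commute[of x y]
  by simp

lemma seminorm_tendsto_zero:
  assumes "(f \<longlongrightarrow> l) F"
  shows "((\<lambda>i. p (f i - l)) \<longlongrightarrow> 0) F"
proof (rule order_tendstoI)
  fix e :: real
  assume "0 < e"
  then have "\<forall>\<^sub>F x in nhds 0. p x < e"
    using p unfolding continuous_seminorm_def by blast
  moreover have "((\<lambda>i. f i - l) \<longlongrightarrow> 0) F"
    using tendsto_diff[OF assms tendsto_const[of l]] by simp
  ultimately show "\<forall>\<^sub>F i in F. p (f i - l) < e"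
    unfolding filterlim_iff by blast
next
  fix e :: real
  assume "e < 0"
  then have "e < p (f i - l)" for i
    using seminorm_nonneg[of "f i - l"] by simp
  then show "\<forall>\<^sub>F i in F. e < p (f i - l)"
    by simp
qed

lemma seminorm_tendsto:
  assumes "(f \<longlongrightarrow> l) F"
  shows "((\<lambda>i. p (f i)) \<longlongrightarrow> p l) F"
proof -
  have "((\<lambda>i. p (f i) - p l) \<longlongrightarrow> 0) F"
    by (rule Lim_null_comparison[OF _ seminorm_tendsto_zero[OF assms]])
      (simp add: seminorm_abs_diff)
  then show ?thesis
    by (simp add: LIM_zero_iff)
qed

end

text \<open>The gauge of the absolutely convex neighbourhood \<open>C \<inter> - C\<close>.\<close>

lemma continuous_seminorm_exists:
  fixes U :: "'a::locally_convex_space set"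
  assumes "open U" "0 \<in> U"
  obtains p where "continuous_seminorm p" "\<And>x. p x < 1 \<Longrightarrow> x \<in> U"
proof -
  obtain C where C: "open C" "convex C" "0 \<in> C" "C \<subseteq> U"
    using convex_nhds_0[OF assms] by blast
  define D where "D = C \<inter> uminus -` C"
  have D_open: "open D"
    unfolding D_def using C(1) by (intro open_Int open_vimage continuous_on_minus continuous_on_id)
  have D0: "0 \<in> D"
    using C(3) by (simp add: D_def)
  have D_sym: "- x \<in> D \<longleftrightarrow> x \<in> D" for x
    by (auto simp: D_def)
  have D_conv: "u *\<^sub>R x + v *\<^sub>R y \<in> D" if "x \<in> D" "y \<in> D" "0 \<le> u" "0 \<le> v" "u + v = 1" for x y u v
    using that convexD[OF C(2), of x y u v] convexD[OF C(2), of "-x" "-y" u v]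
    by (simp add: D_def)
  define A where "A x = {r::real. 0 < r \<and> inverse r *\<^sub>R x \<in> D}" for x
  define p where "p x = Inf (A x)" for x
  have A_ne: "A x \<noteq> {}" for x
  proof -
    have "((\<lambda>r. inverse r *\<^sub>R x) \<longlongrightarrow> 0 *\<^sub>R x) at_top"
      by (intro tendsto_scaleR_convex tendsto_const tendsto_inverse_0_at_top filterlim_ident)
    then have "\<forall>\<^sub>F r in at_top. inverse r *\<^sub>R x \<in> D"
      using D_open D0 by (intro topological_tendstoD) auto
    moreover have "\<forall>\<^sub>F r in at_top. (0::real) < r"
      by (rule eventually_gt_at_top)
    ultimately have "\<forall>\<^sub>F r in at_top. r \<in> A x"
      by eventually_elim (simp add: A_def)
    then show ?thesis
      using eventually_happens'[of at_top] by fastforce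
  qed
  have A_bdd: "bdd_below (A x)" for x
    unfolding A_def by (rule bdd_belowI[of _ 0]) auto
  have A_up: "s \<in> A x" if "r \<in> A x" "r \<le> s" for r s x
  proof -
    \<comment> \<open>Enlarging the radius contracts towards 0, which is a convex combination with
      the point \<open>0 \<in> D\<close>.\<close>
    have "(r / s) *\<^sub>R (inverse r *\<^sub>R x) + (1 - r / s) *\<^sub>R 0 \<in> D"
      using that D0 by (intro D_conv) (auto simp: A_def field_simps)
    moreover have eq: "r / s * inverse r = inverse s"
      using that by (simp add: A_def field_simps)
    ultimately have "inverse s *\<^sub>R x \<in> D"
      by (simp only: scaleR_scaleR eq scaleR_zero_right add_0_right)
    then show ?thesis
      using that by (simp add: A_def)
  qed
  have p_le: "p x \<le> r" if "r \<in> A x" for x r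
    unfolding p_def by (rule cInf_lower[OF that A_bdd])
  have p_less: "\<exists>r\<in>A x. r < e" if "p x < e" for x e
    using that cInf_less_iff[OF A_ne A_bdd, of x e] by (simp add: p_def)
  have p_ge0: "0 \<le> p x" for x
    unfolding p_def by (rule cInf_greatest[OF A_ne]) (simp add: A_def)
  have p_sub: "p (x + y) \<le> p x + p y" for x y
  proof (rule field_le_epsilon)
    fix e :: real
    assume e: "0 < e"
    obtain r where r: "r \<in> A x" "r < p x + e / 2"
      using p_less[of x "p x + e / 2"] e by auto
    obtain s where s: "s \<in> A y" "s < p y + e / 2"
      using p_less[of y "p y + e / 2"] e by auto
    have "(r / (r + s)) *\<^sub>R (inverse r *\<^sub>R x) + (s / (r + s)) *\<^sub>R (inverse s *\<^sub>R y) \<in> D"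
      using r(1) s(1) by (intro D_conv) (auto simp: A_def add_divide_distrib[symmetric])
    moreover have eq: "r / (r + s) * inverse r = inverse (r + s)" "s / (r + s) * inverse s = inverse (r + s)"
      using r(1) s(1) by (simp_all add: A_def field_simps)
    ultimately have "inverse (r + s) *\<^sub>R (x + y) \<in> D"
      by (simp only: scaleR_scaleR eq scaleR_add_right)
    then have "r + s \<in> A (x + y)"
      using r(1) s(1) by (simp add: A_def)
    then show "p (x + y) \<le> p x + p y + e"
      using p_le[of "r + s" "x + y"] r(2) s(2) by linarith
  qed
  have p_0: "p 0 = 0"
  proof -
    have "p 0 \<le> 0 + e" if "0 < e" for e
      using that D0 by (intro order_trans[OF p_le]) (auto simp: A_def)
    then have "p 0 \<le> 0"
      by (rule field_le_epsilon)
    then show ?thesis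
      using p_ge0[of 0] by simp
  qed
  have A_scale: "\<bar>r\<bar> * s \<in> A (r *\<^sub>R x)" if "r \<noteq> 0" "s \<in> A x" for r s x
  proof -
    have "inverse (\<bar>r\<bar> * s) * r = sgn r * inverse s"
      using that by (simp add: sgn_real_def)
    then have eq: "inverse (\<bar>r\<bar> * s) *\<^sub>R r *\<^sub>R x = sgn r *\<^sub>R (inverse s *\<^sub>R x)"
      by (simp only: scaleR_scaleR)
    have "sgn r = 1 \<or> sgn r = -1"
      using that(1) by (simp add: sgn_real_def)
    then have "sgn r *\<^sub>R (inverse s *\<^sub>R x) \<in> D"
      using that D_sym[of "inverse s *\<^sub>R x"] unfolding A_def by auto
    then have "inverse (\<bar>r\<bar> * s) *\<^sub>R r *\<^sub>R x \<in> D"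
      by (simp only: eq)
    then show ?thesis
      using that unfolding A_def by simp
  qed
  have p_scale_le: "p (r *\<^sub>R x) \<le> \<bar>r\<bar> * p x" if r0: "r \<noteq> 0" for r x
  proof (rule field_le_epsilon)
    fix e :: real
    assume e: "0 < e"
    obtain s where s: "s \<in> A x" "s < p x + e / \<bar>r\<bar>"
      using p_less[of x "p x + e / \<bar>r\<bar>"] e r0 by auto
    then have "\<bar>r\<bar> * s < \<bar>r\<bar> * p x + e"
      using that by (simp add: field_simps)
    then show "p (r *\<^sub>R x) \<le> \<bar>r\<bar> * p x + e"
      using p_le[OF A_scale[OF that s(1)]] by linarith
  qed
  have p_scale: "p (r *\<^sub>R x) = \<bar>r\<bar> * p x" for r x
  proof (cases "r = 0")
    case True
    then show ?thesis
      by (simp add: p_0)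
  next
    case False
    have "p x \<le> inverse \<bar>r\<bar> * p (r *\<^sub>R x)"
      using p_scale_le[of "inverse r" "r *\<^sub>R x"] False by (simp add: abs_inverse)
    then have "\<bar>r\<bar> * p x \<le> \<bar>r\<bar> * (inverse \<bar>r\<bar> * p (r *\<^sub>R x))"
      by (rule mult_left_mono) simp
    then have "\<bar>r\<bar> * p x \<le> p (r *\<^sub>R x)"
      using False by (simp add: mult.assoc[symmetric])
    then show ?thesis
      using p_scale_le[OF False, of x] by simp
  qed
  have p_cont: "\<forall>\<^sub>F x in nhds 0. p x < e" if "0 < e" for e
  proof -
    \<comment> \<open>Half the radius is used, because membership in \<open>A x\<close> yields only
      the weak inequality \<open>p x \<le> e / 2\<close>.\<close>
    have "((\<lambda>x. inverse (e / 2) *\<^sub>R x) \<longlongrightarrow> inverse (e / 2) *\<^sub>R 0) (nhds (0::'a))"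
      by (intro tendsto_scaleR_convex tendsto_const filterlim_ident)
    then have "\<forall>\<^sub>F x in nhds (0::'a). inverse (e / 2) *\<^sub>R x \<in> D"
      using D_open D0 by (intro topological_tendstoD) auto
    then show ?thesis
    proof eventually_elim
      case (elim x)
      then have "e / 2 \<in> A x"
        using that by (simp add: A_def)
      then show ?case
        using p_le that by fastforce
    qed
  qed
  show ?thesis
  proof (rule that)
    show "continuous_seminorm p"
      unfolding continuous_seminorm_def using p_sub p_scale p_cont by blast
    show "x \<in> U" if "p x < 1" for x
    proof -
      have "1 \<in> A x"
        using p_less[OF that] A_up by (meson less_imp_le)
      then show ?thesis
        using C(4) by (auto simp: A_def D_def)
    qed
  qed
qed

text \<open>Every neighbourhood of 0 contains the unit ball of a continuous seminorm; translation by
  \<open>l\<close> reduces to this case.\<close>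

lemma tendsto_seminormI:
  fixes f :: "'i \<Rightarrow> 'a::locally_convex_space"
  assumes "\<And>p. continuous_seminorm p \<Longrightarrow> ((\<lambda>i. p (f i - l)) \<longlongrightarrow> 0) F"
  shows "(f \<longlongrightarrow> l) F"
proof (rule topological_tendstoI)
  fix U
  assume U: "open U" "l \<in> U"
  define V where "V = (\<lambda>x. x + l) -` U"
  have "open V"
    unfolding V_def using U(1) by (intro open_vimage continuous_on_add continuous_on_id continuous_on_const)
  moreover have "0 \<in> V"
    using U(2) by (simp add: V_def)
  ultimately obtain p where p: "continuous_seminorm p" "\<And>x. p x < 1 \<Longrightarrow> x \<in> V"
    using continuous_seminorm_exists[of V] by metis
  have "\<forall>\<^sub>F i in F. p (f i - l) < 1"
    using order_tendstoD(2)[OF assms[OF p(1)]] by simp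
  then show "\<forall>\<^sub>F i in F. f i \<in> U"
  proof (rule eventually_mono)
    fix i
    assume "p (f i - l) < 1"
    then have "f i - l \<in> V"
      by (rule p(2))
    then show "f i \<in> U"
      by (simp add: V_def)
  qed
qed

lemma von_Neumann_bounded_iff_seminorm:
  fixes B :: "'a::locally_convex_space set"
  shows "von_Neumann_bounded B \<longleftrightarrow> (\<forall>p. continuous_seminorm p \<longrightarrow> (\<exists>K. \<forall>x\<in>B. p x \<le> K))"
proof safe
  fix p :: "'a \<Rightarrow> real"
  assume B: "von_Neumann_bounded B" and p: "continuous_seminorm p"
  have "\<forall>\<^sub>F x in nhds 0. p x < 1"
    using p unfolding continuous_seminorm_def by simp
  then obtain U where U: "open U" "0 \<in> U" "\<And>x. x \<in> U \<Longrightarrow> p x < 1"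
    unfolding eventually_nhds by blast
  then obtain r where r: "r > 0" "B \<subseteq> (*\<^sub>R) r ` U"
    using B unfolding von_Neumann_bounded_def by (meson order_refl)
  have "p x \<le> r" if x: "x \<in> B" for x
  proof -
    obtain y where y: "y \<in> U" "x = r *\<^sub>R y"
      using r(2) x by blast
    then show ?thesis
      using U(3)[OF y(1)] r(1) by (simp add: seminorm_scaleR[OF p] mult_left_le)
  qed
  then show "\<exists>K. \<forall>x\<in>B. p x \<le> K"
    by blast
next
  assume B: "\<forall>p. continuous_seminorm p \<longrightarrow> (\<exists>K. \<forall>x\<in>B. p x \<le> K)"
  show "von_Neumann_bounded B"
    unfolding von_Neumann_bounded_def
  proof (intro allI impI)
    fix U :: "'a set"
    assume "open U \<and> 0 \<in> U"
    then obtain p where p: "continuous_seminorm p" "\<And>x. p x < 1 \<Longrightarrow> x \<in> U"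
      using continuous_seminorm_exists[of U] by metis
    then obtain K where K: "\<And>x. x \<in> B \<Longrightarrow> p x \<le> K"
      using B by blast
    show "\<exists>r>0. \<forall>s\<ge>r. B \<subseteq> (*\<^sub>R) s ` U"
    \<comment> \<open>\<open>\<bar>K\<bar> + 1\<close> is positive and larger than \<open>K\<close>,
      so division by it moves \<open>B\<close> into the unit ball of \<open>p\<close>.\<close>
    proof (intro exI[of _ "\<bar>K\<bar> + 1"] conjI allI impI subsetI)
      fix s x
      assume s: "\<bar>K\<bar> + 1 \<le> s" and x: "x \<in> B"
      have "p (inverse s *\<^sub>R x) < 1"
        using K[OF x] s by (simp add: seminorm_scaleR[OF p(1)] field_simps)
      then have "inverse s *\<^sub>R x \<in> U"
        by (rule p(2))
      moreover have "x = s *\<^sub>R (inverse s *\<^sub>R x)"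
        using s by simp
      ultimately show "x \<in> (*\<^sub>R) s ` U"
        by blast
    qed simp
  qed
qed


section \<open>The Hahn-Banach theorem\<close>

definition sublinear :: "('a::real_vector \<Rightarrow> real) \<Rightarrow> bool" where
  "sublinear q \<longleftrightarrow> (\<forall>x y. q (x + y) \<le> q x + q y) \<and> (\<forall>r\<ge>0. \<forall>x. q (r *\<^sub>R x) = r * q x)"

text \<open>The lowering step of Hahn-Banach in the direction \<open>y\<close>. If \<open>q\<close>
  is minimal, then \<open>q' = q\<close>, and the second bound is the missing half of
  additivity.\<close>

lemma sublinear_shift:
  fixes q :: "'a::real_vector \<Rightarrow> real" and x y :: 'a
  assumes q: "sublinear q"
  defines "q' \<equiv> \<lambda>x. INF t\<in>{0..}. q (x + t *\<^sub>R y) - t * q y"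
  shows "sublinear q'" "q' x \<le> q (x + y) - q y" "q' x \<le> q x"
proof -
  have sub: "q (x + z) \<le> q x + q z" for x z
    using q unfolding sublinear_def by blast
  have hom: "q (r *\<^sub>R x) = r * q x" if "0 \<le> r" for r x
    using q that unfolding sublinear_def by blast
  have bdd: "bdd_below ((\<lambda>t. q (x + t *\<^sub>R y) - t * q y) ` {0..})" for x
  proof (rule bdd_belowI)
    fix r
    assume "r \<in> (\<lambda>t. q (x + t *\<^sub>R y) - t * q y) ` {0..}"
    then obtain t where t: "0 \<le> t" "r = q (x + t *\<^sub>R y) - t * q y"
      by auto
    have "q (t *\<^sub>R y) \<le> q (x + t *\<^sub>R y) + q (- x)"
      using sub[of "x + t *\<^sub>R y" "- x"] by simp
    then show "- q (- x) \<le> r"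
      using t hom[OF t(1), of y] by simp
  qed
  have le: "q' x \<le> q (x + t *\<^sub>R y) - t * q y" if "0 \<le> t" for x t
    unfolding q'_def using that by (intro cINF_lower bdd) auto
  have less: "\<exists>t\<ge>0. q (x + t *\<^sub>R y) - t * q y < e" if "q' x < e" for x e
    using that cINF_less_iff[OF _ bdd] unfolding q'_def by auto
  show "q' x \<le> q (x + y) - q y"
    using le[of 1 x] by simp
  show "q' x \<le> q x"
    using le[of 0 x] by simp
  have add: "q' (x + z) \<le> q' x + q' z" for x z
  proof (rule field_le_epsilon)
    fix e :: real
    assume e: "0 < e"
    obtain s where s: "s \<ge> 0" "q (x + s *\<^sub>R y) - s * q y < q' x + e / 2"
      using less[of x "q' x + e / 2"] e by auto
    obtain t where t: "t \<ge> 0" "q (z + t *\<^sub>R y) - t * q y < q' z + e / 2"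
      using less[of z "q' z + e / 2"] e by auto
    have "q' (x + z) \<le> q (x + z + (s + t) *\<^sub>R y) - (s + t) * q y"
      using le[of "s + t" "x + z"] s(1) t(1) by simp
    also have "\<dots> \<le> (q (x + s *\<^sub>R y) - s * q y) + (q (z + t *\<^sub>R y) - t * q y)"
      using sub[of "x + s *\<^sub>R y" "z + t *\<^sub>R y"] by (simp add: algebra_simps)
    finally show "q' (x + z) \<le> q' x + q' z + e"
      using s(2) t(2) by linarith
  qed
  have scale_le: "q' (r *\<^sub>R x) \<le> r * q' x" if r0: "0 < r" for r x
  proof (rule field_le_epsilon)
    fix e :: real
    assume e: "0 < e"
    obtain s where s: "s \<ge> 0" "q (x + s *\<^sub>R y) - s * q y < q' x + e / r"
      using less[of x "q' x + e / r"] e r0 by auto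
    have "q' (r *\<^sub>R x) \<le> q (r *\<^sub>R (x + s *\<^sub>R y)) - r * s * q y"
      using le[of "r * s" "r *\<^sub>R x"] s(1) that by (simp add: algebra_simps)
    also have "\<dots> = r * (q (x + s *\<^sub>R y) - s * q y)"
      using that by (simp add: hom right_diff_distrib)
    also have "\<dots> \<le> r * (q' x + e / r)"
      using s(2) that by (intro mult_left_mono) auto
    finally show "q' (r *\<^sub>R x) \<le> r * q' x + e"
      using that by (simp add: distrib_left)
  qed
  have zero: "q' 0 = 0"
  proof -
    have "q (0 + t *\<^sub>R y) - t * q y = 0" if "t \<in> {0..}" for t
      using that hom[of t y] by simp
    then show ?thesis
      unfolding q'_def by (simp cong: image_cong_simp)
  qed
  have "q' (r *\<^sub>R x) = r * q' x" if "0 \<le> r" for r x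
  proof (cases "r = 0")
    case True
    then show ?thesis
      by (simp add: zero)
  next
    case False
    then have "q' x \<le> inverse r * q' (r *\<^sub>R x)"
      using scale_le[of "inverse r" "r *\<^sub>R x"] that by simp
    then show ?thesis
      using scale_le[of r x] that False by (simp add: field_simps)
  qed
  then show "sublinear q'"
    unfolding sublinear_def using add by blast
qed

text \<open>By Zorn's lemma there is a minimal sublinear functional below \<open>q\<close>, and a minimal one is linear.\<close>

lemma sublinear_dominates_linear:
  fixes q :: "'a::real_vector \<Rightarrow> real"
  assumes "sublinear q"
  obtains l where "linear l" "\<And>x. l x \<le> q x"
proof -
  define A where "A = {f. sublinear f \<and> f \<le> q}"
  \<comment> \<open>The order is reversed, so a maximal element for \<open>P\<close> is a minimal
    sublinear functional.\<close>
  define P where "P f g \<longleftrightarrow> (g :: 'a \<Rightarrow> real) \<le> f" for f g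
  have po: "partial_order_on A (relation_of P A)"
    unfolding P_def by (rule partial_order_on_relation_ofI) auto
  have chain: "\<exists>u\<in>A. \<forall>f\<in>C. P f u" if C: "C \<in> Chains (relation_of P A)" for C
  proof (cases "C = {}")
    case True
    then show ?thesis
      using assms by (auto simp: A_def)
  next
    case False
    have CA: "C \<subseteq> A"
      using C unfolding Chains_def relation_of_def by auto
    have tot: "f \<le> g \<or> g \<le> f" if "f \<in> C" "g \<in> C" for f g
      using C that unfolding Chains_def relation_of_def P_def by auto
    define u where "u x = (INF f\<in>C. f x)" for x
    have bdd: "bdd_below ((\<lambda>f. f x) ` C)" for x
    proof (rule bdd_belowI)
      fix r
      assume "r \<in> (\<lambda>f. f x) ` C"
      then obtain f where f: "f \<in> C" "r = f x"
        by auto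
      have fs: "sublinear f" "f (- x) \<le> q (- x)"
        using f(1) CA by (auto simp: A_def le_fun_def)
      have "f (0 *\<^sub>R x) = 0 * f x"
        using fs(1) unfolding sublinear_def by blast
      moreover have "f (x + - x) \<le> f x + f (- x)"
        using fs(1) unfolding sublinear_def by blast
      ultimately show "- q (- x) \<le> r"
        using f(2) fs(2) by simp
    qed
    have le: "u x \<le> f x" if "f \<in> C" for f x
      unfolding u_def using that by (intro cINF_lower bdd)
    have less: "\<exists>f\<in>C. f x < e" if "u x < e" for x e
      using that cINF_less_iff[OF False bdd] unfolding u_def by blast
    have add: "u (x + y) \<le> u x + u y" for x y
    proof (rule field_le_epsilon)
      fix e :: real
      assume e: "0 < e"
      obtain f where f: "f \<in> C" "f x < u x + e / 2"
        using less[of x "u x + e / 2"] e by auto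
      obtain g where g: "g \<in> C" "g y < u y + e / 2"
        using less[of y "u y + e / 2"] e by auto
      \<comment> \<open>A chain contains the smaller of \<open>f\<close> and \<open>g\<close>. This
        one functional is close to the infimum at both \<open>x\<close> and \<open>y\<close>, and
        its subadditivity can be used.\<close>
      obtain h where h: "h \<in> C" "h \<le> f" "h \<le> g"
        using tot[OF f(1) g(1)] f(1) g(1) by blast
      have "h (x + y) \<le> h x + h y"
        using h(1) CA unfolding A_def sublinear_def by blast
      then show "u (x + y) \<le> u x + u y + e"
        using le[OF h(1), of "x + y"] h(2,3) f(2) g(2) le_funD[of h f x] le_funD[of h g y]
        by linarith
    qed
    have scale: "u (r *\<^sub>R x) = r * u x" if "0 \<le> r" for r x
    proof -
      have "u (r *\<^sub>R x) = (INF f\<in>C. r * f x)"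
        unfolding u_def
        by (rule INF_cong) (use that CA in \<open>auto simp: A_def sublinear_def\<close>)
      also have "\<dots> = r * u x"
      proof (cases "r = 0")
        case True
        then show ?thesis
          using False by simp
      next
        case r: False
        show ?thesis
        proof (rule cInf_eq_non_empty)
          show "(\<lambda>f. r * f x) ` C \<noteq> {}"
            using False by simp
          show "r * u x \<le> z" if "z \<in> (\<lambda>f. r * f x) ` C" for z
            using that le \<open>0 \<le> r\<close> by (auto intro: mult_left_mono)
          show "z \<le> r * u x" if z: "\<And>w. w \<in> (\<lambda>f. r * f x) ` C \<Longrightarrow> z \<le> w" for z
          proof -
            have "z / r \<le> u x"
              unfolding u_def using False z r \<open>0 \<le> r\<close>
              by (intro cINF_greatest) (auto simp: field_simps)
            then show ?thesis
              using r \<open>0 \<le> r\<close> by (simp add: field_simps)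
          qed
        qed
      qed
      finally show ?thesis .
    qed
    obtain f where f: "f \<in> C"
      using False by blast
    have "u x \<le> q x" for x
      using order_trans[OF le[OF f, of x], of "q x"] f CA unfolding A_def le_fun_def by blast
    then have "u \<le> q"
      by (rule le_funI)
    then have "u \<in> A"
      using add scale by (simp add: A_def sublinear_def)
    then show ?thesis
      using le unfolding P_def le_fun_def by blast
  qed
  obtain m where m: "m \<in> A" "\<And>f. f \<in> A \<Longrightarrow> f \<le> m \<Longrightarrow> f = m"
    using predicate_Zorn[OF po chain] unfolding P_def by blast
  have sub: "m (x + y) \<le> m x + m y" for x y
    using m(1) unfolding A_def sublinear_def by blast
  have hom: "m (r *\<^sub>R x) = r * m x" if "0 \<le> r" for r x
    using m(1) that unfolding A_def sublinear_def by blast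
  have add: "m (x + y) = m x + m y" for x y
  proof -
    have ms: "sublinear m" "m \<le> q"
      using m(1) by (auto simp: A_def)
    define m' where "m' = (\<lambda>x. INF t\<in>{0..}. m (x + t *\<^sub>R y) - t * m y)"
    have m': "sublinear m'" "\<And>x. m' x \<le> m (x + y) - m y" "\<And>x. m' x \<le> m x"
      unfolding m'_def by (rule sublinear_shift[OF ms(1)])+
    have "m' \<in> A"
      using m'(1,3) ms(2) by (auto simp: A_def le_fun_def intro: order_trans)
    then have "m' = m"
      using m'(3) by (intro m(2)) (auto simp: le_fun_def)
    then show ?thesis
      using m'(2)[of x] sub[of x y] by simp
  qed
  have "m 0 = 0"
    using hom[of 0 0] by simp
  then have "m (- x) = - m x" for x
    using add[of x "- x"] by simp
  then have "m (r *\<^sub>R x) = r *\<^sub>R m x" for r x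
    using hom[of r x] hom[of "- r" x] by (cases "0 \<le> r") auto
  then have "linear m"
    using add by (intro linearI) auto
  moreover have "m x \<le> q x" for x
    using m(1) by (auto simp: A_def le_fun_def)
  ultimately show ?thesis
    by (rule that)
qed

text \<open>Before a linear functional is chosen, \<open>p\<close> is lowered in the direction
  \<open>x\<close>: the lowered functional is at most \<open>- p x\<close> at \<open>- x\<close>,
  which forces equality at \<open>x\<close>. Symmetry of \<open>p\<close> turns the one-sided bound
  into one for the absolute value.\<close>

lemma Hahn_Banach_seminorm:
  fixes p :: "'a::locally_convex_space \<Rightarrow> real"
  assumes p: "continuous_seminorm p"
  obtains l where "linear l" "\<And>y. \<bar>l y\<bar> \<le> p y" "l x = p x"
proof -
  have "sublinear p"
    unfolding sublinear_def using seminorm_triangle[OF p] seminorm_scaleR[OF p] by simp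
  define q where "q = (\<lambda>z. INF t\<in>{0..}. p (z + t *\<^sub>R x) - t * p x)"
  have q: "sublinear q" "\<And>z. q z \<le> p (z + x) - p x" "\<And>z. q z \<le> p z"
    unfolding q_def by (rule sublinear_shift[OF \<open>sublinear p\<close>])+
  obtain l where l: "linear l" "\<And>z. l z \<le> q z"
    using sublinear_dominates_linear[OF q(1)] by metis
  have le: "l z \<le> p z" for z
    using l(2)[of z] q(3)[of z] by linarith
  have "\<bar>l z\<bar> \<le> p z" for z
    using le[of z] le[of "- z"] linear_neg[OF l(1), of z] seminorm_minus[OF p, of z] by linarith
  moreover have "l x = p x"
    using l(2)[of "- x"] q(2)[of "- x"] linear_neg[OF l(1), of x] le[of x] seminorm_zero[OF p]
    by simp
  ultimately show ?thesis
    using l(1) that by blast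
qed

section \<open>Separation, mean value estimates and second-order remainders\<close>

lemma seminorm_separates:
  fixes x :: "'a::locally_convex_space"
  assumes "x \<noteq> 0"
  obtains p where "continuous_seminorm p" "p x \<noteq> 0"
proof -
  obtain U where U: "open U" "0 \<in> U" "x \<notin> U"
    using t1_space[of 0 x] assms by metis
  obtain p where p: "continuous_seminorm p" "\<And>x. p x < 1 \<Longrightarrow> x \<in> U"
    using continuous_seminorm_exists[OF U(1,2)] by metis
  have "p x \<noteq> 0"
    using p(2)[of x] U(3) by fastforce
  then show ?thesis
    using p(1) that by blast
qed

text \<open>Domination by a continuous seminorm is the form in which continuity of \<open>l\<close>
  is used, since Hahn-Banach delivers its functionals in this form.\<close>

lemma has_curve_derivative_dominated_linear:
  fixes c :: "real \<Rightarrow> 'a::locally_convex_space"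
  assumes "continuous_seminorm p" "linear l" "\<And>y. \<bar>l y\<bar> \<le> p y" "has_curve_derivative c d t"
  shows "((\<lambda>s. l (c s)) has_real_derivative l d) (at t)"
proof -
  have "((\<lambda>h. l ((c (t + h) - c t) /\<^sub>R h) - l d) \<longlongrightarrow> 0) (at 0)"
    using assms(4)[unfolded has_curve_derivative_def, THEN seminorm_tendsto_zero[OF assms(1)]]
    by (rule Lim_null_comparison[rotated])
      (use assms(3) in \<open>simp add: linear_diff[OF assms(2), symmetric]\<close>)
  then show ?thesis
    unfolding has_curve_derivative_real_iff[symmetric] has_curve_derivative_def
    by (simp add: LIM_zero_iff linear_diff[OF assms(2)] linear_cmul[OF assms(2)])
qed

text \<open>The scalar mean value theorem is applied to a functional that attains \<open>p\<close>
  on the increment \<open>c b - c a\<close>.\<close>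

lemma seminorm_mean_value:
  fixes c :: "real \<Rightarrow> 'a::locally_convex_space"
  assumes p: "continuous_seminorm p" and "a \<le> b"
    and c: "\<And>s. a \<le> s \<Longrightarrow> s \<le> b \<Longrightarrow> has_curve_derivative c (d s) s"
    and d: "\<And>s. a \<le> s \<Longrightarrow> s \<le> b \<Longrightarrow> p (d s) \<le> K"
  shows "p (c b - c a) \<le> K * (b - a)"
proof (cases "a = b")
  case False
  obtain l where l: "linear l" "\<And>y. \<bar>l y\<bar> \<le> p y" "l (c b - c a) = p (c b - c a)"
    using Hahn_Banach_seminorm[OF p, of "c b - c a"] by metis
  obtain z where z: "a < z" "z < b" "l (c b) - l (c a) = (b - a) * l (d z)"
    using MVT2[of a b "\<lambda>s. l (c s)" "\<lambda>s. l (d s)"]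
      has_curve_derivative_dominated_linear[OF p l(1,2) c] False \<open>a \<le> b\<close> by auto
  have "p (c b - c a) = (b - a) * l (d z)"
    using z(3) l(3) linear_diff[OF l(1)] by simp
  also have "\<dots> \<le> (b - a) * K"
    using d[of z] l(2)[of "d z"] z by (intro mult_left_mono) auto
  finally show ?thesis
    by (simp add: mult.commute)
qed (simp add: seminorm_zero[OF p])

lemma seminorm_mean_value_abs:
  fixes c :: "real \<Rightarrow> 'a::locally_convex_space"
  assumes p: "continuous_seminorm p"
    and c: "\<And>s. \<bar>s - t\<bar> \<le> \<bar>h\<bar> \<Longrightarrow> has_curve_derivative c (d s) s"
    and d: "\<And>s. \<bar>s - t\<bar> \<le> \<bar>h\<bar> \<Longrightarrow> p (d s) \<le> K"
  shows "p (c (t + h) - c t) \<le> K * \<bar>h\<bar>"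
proof (cases "0 \<le> h")
  case True
  then show ?thesis
    using seminorm_mean_value[OF p, of t "t + h" c d K] c d by auto
next
  case False
  then show ?thesis
    using seminorm_mean_value[OF p, of "t + h" t c d K] c d
      seminorm_minus_commute[OF p, of "c (t + h)"] by auto
qed

lemma seminorm_curve_bounded:
  fixes c :: "real \<Rightarrow> 'a::locally_convex_space"
  assumes p: "continuous_seminorm p"
    and c: "\<And>s. \<bar>s - t\<bar> \<le> \<delta> \<Longrightarrow> (c \<longlongrightarrow> c s) (nhds s)"
  obtains K where "\<And>s. \<bar>s - t\<bar> \<le> \<delta> \<Longrightarrow> p (c s) \<le> K"
proof -
  have "continuous_on (cball t \<delta>) (\<lambda>s. p (c s))"
    unfolding continuous_on_def
  proof
    fix s
    assume "s \<in> cball t \<delta>"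
    then have "((\<lambda>s. p (c s)) \<longlongrightarrow> p (c s)) (nhds s)"
      by (intro seminorm_tendsto[OF p] c) (simp add: dist_real_def abs_minus_commute)
    then show "((\<lambda>s. p (c s)) \<longlongrightarrow> p (c s)) (at s within cball t \<delta>)"
      by (rule filterlim_mono) (auto simp: at_within_def)
  qed
  then have "bounded ((\<lambda>s. p (c s)) ` cball t \<delta>)"
    by (intro compact_imp_bounded compact_continuous_image) auto
  then obtain K where K: "\<forall>s\<in>cball t \<delta>. \<bar>p (c s)\<bar> \<le> K"
    unfolding bounded_iff by auto
  show ?thesis
  proof (rule that)
    fix s
    assume "\<bar>s - t\<bar> \<le> \<delta>"
    then have "\<bar>p (c s)\<bar> \<le> K"
      using K by (simp add: dist_real_def abs_minus_commute)
    then show "p (c s) \<le> K"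
      by simp
  qed
qed

lemma eventually_nhds_real_cball:
  fixes t :: real
  assumes "\<forall>\<^sub>F s in nhds t. P s"
  obtains \<delta> where "\<delta> > 0" "\<And>s. \<bar>s - t\<bar> \<le> \<delta> \<Longrightarrow> P s"
proof -
  obtain e where "e > 0" "\<And>s. dist s t < e \<Longrightarrow> P s"
    using assms unfolding eventually_nhds_metric by blast
  then show ?thesis
    by (intro that[of "e / 2"]) (auto simp: dist_real_def)
qed

lemma smooth_at_locally_bounded:
  fixes c :: "real \<Rightarrow> 'a::locally_convex_space"
  assumes "smooth_at c t"
  obtains \<delta> where "\<delta> > 0" "von_Neumann_bounded (c ` {s. \<bar>s - t\<bar> \<le> \<delta>})"
proof -
  obtain \<delta> where \<delta>: "\<delta> > 0" "\<And>s. \<bar>s - t\<bar> \<le> \<delta> \<Longrightarrow> has_curve_derivative c (curve_deriv c s) s"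
    using eventually_nhds_real_cball[OF smooth_at_deriv(1)[OF assms]] by metis
  have "von_Neumann_bounded (c ` {s. \<bar>s - t\<bar> \<le> \<delta>})"
    unfolding von_Neumann_bounded_iff_seminorm
  proof (intro allI impI)
    fix p :: "'a \<Rightarrow> real"
    assume p: "continuous_seminorm p"
    obtain K where "\<And>s. \<bar>s - t\<bar> \<le> \<delta> \<Longrightarrow> p (c s) \<le> K"
      using seminorm_curve_bounded[OF p, of t \<delta> c] \<delta>(2) has_curve_derivative_imp_tendsto by blast
    then show "\<exists>K. \<forall>x\<in>c ` {s. \<bar>s - t\<bar> \<le> \<delta>}. p x \<le> K"
      by auto
  qed
  then show ?thesis
    using that \<delta>(1) by blast
qed

text \<open>The radius \<open>\<delta>\<close> is chosen before the seminorm, and only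
  \<open>K\<close> depends on \<open>p\<close>. The remainders divided by \<open>h^2\<close> thus
  form one bounded set, to which functionals and interpolating curves can be applied.\<close>

lemma smooth_at_second_order:
  fixes c :: "real \<Rightarrow> 'a::locally_convex_space"
  assumes "smooth_at c t"
  obtains \<delta> where "\<delta> > 0"
    "\<And>p. continuous_seminorm p \<Longrightarrow>
      \<exists>K. \<forall>h. \<bar>h\<bar> \<le> \<delta> \<longrightarrow> p (c (t + h) - c t - h *\<^sub>R curve_deriv c t) \<le> K * h\<^sup>2"
proof -
  let ?d = "curve_deriv c" and ?e = "curve_deriv (curve_deriv c)"
  note D = smooth_at_deriv[OF assms]
  note E = smooth_at_deriv[OF D(3)]
  obtain \<delta> where \<delta>: "\<delta> > 0" "\<And>s. \<bar>s - t\<bar> \<le> \<delta> \<Longrightarrow> has_curve_derivative c (?d s) s \<and>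
      has_curve_derivative ?d (?e s) s \<and> has_curve_derivative ?e (curve_deriv ?e s) s"
    using eventually_nhds_real_cball[OF eventually_conj[OF D(1)
        eventually_conj[OF E(1) smooth_at_deriv(1)[OF E(3)]]]] by metis
  have "\<exists>K. \<forall>h. \<bar>h\<bar> \<le> \<delta> \<longrightarrow> p (c (t + h) - c t - h *\<^sub>R ?d t) \<le> K * h\<^sup>2"
    if p: "continuous_seminorm p" for p
  proof -
    obtain K where K: "\<And>s. \<bar>s - t\<bar> \<le> \<delta> \<Longrightarrow> p (?e s) \<le> K"
      using seminorm_curve_bounded[OF p, of t \<delta> ?e] \<delta>(2) has_curve_derivative_imp_tendsto by blast
    have K0: "0 \<le> K"
      using K[of t] seminorm_nonneg[OF p, of "?e t"] \<delta>(1) by simp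
    have d: "p (?d s - ?d t) \<le> K * \<bar>s - t\<bar>" if "\<bar>s - t\<bar> \<le> \<delta>" for s
      using seminorm_mean_value_abs[OF p, of t "s - t" ?d ?e K] \<delta>(2) K that by auto
    have "p (c (t + h) - c t - h *\<^sub>R ?d t) \<le> K * h\<^sup>2" if h: "\<bar>h\<bar> \<le> \<delta>" for h
    proof -
      \<comment> \<open>Removing the tangent line leaves the velocity \<open>?d s - ?d t\<close>,
        which is of order \<open>\<bar>h\<bar>\<close>; a second mean value estimate then gives the
        square.\<close>
      let ?k = "\<lambda>s. c s + (- s) *\<^sub>R ?d t"
      have "p (?k (t + h) - ?k t) \<le> (K * \<bar>h\<bar>) * \<bar>h\<bar>"
      proof (rule seminorm_mean_value_abs[OF p])
        fix s
        assume s: "\<bar>s - t\<bar> \<le> \<bar>h\<bar>"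
        have "has_curve_derivative (\<lambda>s. (- s) *\<^sub>R ?d t) ((- 1) *\<^sub>R ?d t + (- s) *\<^sub>R 0) s"
          by (intro has_curve_derivative_scaleR has_curve_derivative_const)
            (auto intro!: derivative_eq_intros)
        then show "has_curve_derivative ?k (?d s - ?d t) s"
          using has_curve_derivative_add[of c "?d s" s] \<delta>(2)[of s] s h by fastforce
        show "p (?d s - ?d t) \<le> K * \<bar>h\<bar>"
          using d[of s] s h K0 mult_left_mono[of "\<bar>s - t\<bar>" "\<bar>h\<bar>" K] by linarith
      qed
      moreover have "?k (t + h) - ?k t = c (t + h) - c t - h *\<^sub>R ?d t"
        by (simp add: algebra_simps)
      moreover have "(K * \<bar>h\<bar>) * \<bar>h\<bar> = K * h\<^sup>2"
        by (simp add: power2_eq_square mult.assoc)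
      ultimately show ?thesis
        by (simp only:)
    qed
    then show ?thesis
      by blast
  qed
  then show ?thesis
    using that \<delta>(1) by blast
qed

section \<open>Bump functions and special curves\<close>

text \<open>The polynomial factor in \<open>1 / x\<close> makes a family closed under
  differentiation out of the classical flat function \<open>exp (- 1 / x)\<close>.\<close>

definition flat_exp :: "real poly \<Rightarrow> real \<Rightarrow> real" where
  "flat_exp p x = (if x \<le> 0 then 0 else poly p (inverse x) * exp (- inverse x))"

lemma poly_exp_minus_tendsto_0: "((\<lambda>y::real. poly p y * exp (- y)) \<longlongrightarrow> 0) at_top"
proof -
  have "((\<lambda>y::real. \<Sum>i\<le>degree p. coeff p i * (y ^ i / exp y)) \<longlongrightarrow> (\<Sum>i\<le>degree p. coeff p i * 0)) at_top"
    by (intro tendsto_sum tendsto_mult tendsto_const tendsto_power_div_exp_0)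
  then show ?thesis
    by (simp add: poly_altdef sum_distrib_right exp_minus divide_inverse mult.assoc)
qed

text \<open>With \<open>y = 1 / x\<close> the inner derivative is \<open>- y^2\<close>. The factor
  \<open>[:0, 0, 1:]\<close> is \<open>y^2\<close>, and the two terms of the product rule give
  \<open>p - pderiv p\<close>. At 0 the exponential defeats every power of \<open>y\<close>.\<close>

lemma flat_exp_DERIV:
  "(flat_exp p has_real_derivative flat_exp ([:0, 0, 1:] * (p - pderiv p)) x) (at x)"
proof -
  let ?q = "[:0, 0, 1:] * (p - pderiv p)"
  consider "x < 0" | "0 < x" | "x = 0"
    by linarith
  then show ?thesis
  proof cases
    case 1
    have "((\<lambda>x. 0) has_real_derivative 0) (at x)"
      by simp
    then have "(flat_exp p has_real_derivative 0) (at x)"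
      by (rule DERIV_cong_ev[THEN iffD2, rotated -1, OF _ refl _ refl])
        (use eventually_nhds_in_open[of "{..<0}" x] 1 in
          \<open>auto simp: flat_exp_def elim!: eventually_mono\<close>)
    then show ?thesis
      using 1 by (simp add: flat_exp_def)
  next
    case 2
    have "((\<lambda>x. poly p (inverse x) * exp (- inverse x)) has_real_derivative flat_exp ?q x) (at x)"
      using 2 by (auto intro!: derivative_eq_intros simp: flat_exp_def field_simps power2_eq_square)
    then show ?thesis
      by (rule DERIV_cong_ev[THEN iffD2, rotated -1, OF _ refl _ refl])
        (use eventually_nhds_in_open[of "{0<..}" x] 2 in
          \<open>auto simp: flat_exp_def elim!: eventually_mono\<close>)
  next
    case 3
    have "((\<lambda>h. flat_exp p h / h) \<longlongrightarrow> 0) (at_left 0)"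
      by (rule Lim_transform_eventually[OF tendsto_const])
        (auto simp: flat_exp_def eventually_at_filter)
    moreover have "((\<lambda>h. flat_exp p h / h) \<longlongrightarrow> 0) (at_right 0)"
    proof -
      \<comment> \<open>Dividing by \<open>h\<close> multiplies the polynomial by its variable,
        hence \<open>pCons 0 p\<close>.\<close>
      have "((\<lambda>h::real. poly (pCons 0 p) (inverse h) * exp (- inverse h)) \<longlongrightarrow> 0) (at_right 0)"
        by (rule filterlim_compose[OF poly_exp_minus_tendsto_0 filterlim_inverse_at_top_right])
      then show ?thesis
        by (rule Lim_transform_eventually)
          (auto simp: flat_exp_def eventually_at_filter divide_inverse)
    qed
    ultimately have "((\<lambda>h. flat_exp p h / h) \<longlongrightarrow> 0) (at 0)"
      by (simp add: filterlim_at_split)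
    then show ?thesis
      by (simp add: 3 DERIV_def flat_exp_def)
  qed
qed

lemma smooth_at_flat_exp: "smooth_at (flat_exp p) t"
proof (rule smooth_at_coinduct[of "\<lambda>c. \<exists>p. c = flat_exp p"])
  fix c
  assume "\<exists>p. c = flat_exp p"
  then obtain p where "c = flat_exp p"
    by blast
  then show "\<exists>d. (\<forall>\<^sub>F s in nhds t. has_curve_derivative c (d s) s) \<and> (\<exists>p. d = flat_exp p)"
    using flat_exp_DERIV[of p]
    by (intro exI[of _ "flat_exp ([:0, 0, 1:] * (p - pderiv p))"])
      (auto simp: has_curve_derivative_real_iff)
qed blast

definition smooth_step :: "real \<Rightarrow> real" where
  "smooth_step x = flat_exp 1 x / (flat_exp 1 x + flat_exp 1 (1 - x))"

text \<open>The argument \<open>2 - 64 * x^2\<close> is at least 1 for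
  \<open>\<bar>x\<bar> \<le> 1 / 8\<close> and nonpositive for
  \<open>\<bar>x\<bar> \<ge> 1 / 4\<close>. The bump has a plateau, on which curves can be made
  affine, and a support small enough for the dyadic copies not to meet.\<close>

definition bump :: "real \<Rightarrow> real" where
  "bump x = smooth_step (2 - 64 * x\<^sup>2)"

lemma flat_exp_pos: "flat_exp 1 x + flat_exp 1 (1 - x) > 0" "flat_exp 1 x \<ge> 0"
  by (auto simp: flat_exp_def add_pos_pos)

lemma smooth_curve_bump: "smooth_curve bump"
proof (rule smooth_curve_onI)
  fix t
  have "smooth_at smooth_step s" for s
    unfolding smooth_step_def using flat_exp_pos(1)[of s]
    by (intro smooth_at_intros smooth_at_flat_exp smooth_at_compose[of "\<lambda>x. 1 - x" _ "flat_exp 1"]) auto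
  moreover have "smooth_at (\<lambda>x::real. 2 - 64 * x\<^sup>2) t"
    unfolding power2_eq_square by (intro smooth_at_intros)
  ultimately show "smooth_at bump t"
    unfolding bump_def by (rule smooth_at_compose[rotated])
qed

lemma bump_eq_1: "\<bar>x\<bar> \<le> 1 / 8 \<Longrightarrow> bump x = 1"
proof -
  assume "\<bar>x\<bar> \<le> 1 / 8"
  then have "\<bar>x\<bar>\<^sup>2 \<le> (1 / 8)\<^sup>2"
    by (intro power_mono) auto
  then have "1 - (2 - 64 * x\<^sup>2) \<le> 0"
    by (simp add: power2_eq_square)
  then show ?thesis
    using flat_exp_pos[of "2 - 64 * x\<^sup>2"] by (simp add: bump_def smooth_step_def flat_exp_def)
qed

lemma bump_eq_0: "\<bar>x\<bar> > 1 / 4 \<Longrightarrow> bump x = 0"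
proof -
  assume "\<bar>x\<bar> > 1 / 4"
  then have "\<bar>x\<bar>\<^sup>2 \<ge> (1 / 4)\<^sup>2"
    by (intro power_mono) auto
  then have "2 - 64 * x\<^sup>2 \<le> 0"
    by (simp add: power2_eq_square)
  then show ?thesis
    by (simp add: bump_def smooth_step_def flat_exp_def)
qed

lemma bump_bounds: "0 \<le> bump x" "bump x \<le> 1"
  unfolding bump_def smooth_step_def
  using flat_exp_pos[of "2 - 64 * x\<^sup>2"] flat_exp_pos(2)[of "1 - (2 - 64 * x\<^sup>2)"] by auto

text \<open>The factor \<open>2 ^ (k * n)\<close> is the k-th power of the reciprocal of the time
  2^-n at which a special curve visits the n-th point; each derivative of the curve costs one factor
  \<open>2 ^ n\<close>.\<close>

definition fast_falling :: "(nat \<Rightarrow> 'a::{real_vector,topological_space}) \<Rightarrow> bool" where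
  "fast_falling y \<longleftrightarrow>
     (\<forall>p. continuous_seminorm p \<longrightarrow> (\<forall>k. \<exists>K. \<forall>n. 2 ^ (k * n) * p (y n) \<le> K))"

text \<open>One rate serves all \<open>k\<close>, because \<open>k * n \<le> k * k + n * n\<close>;
  the factor \<open>2 ^ (k * k)\<close> does not depend on \<open>n\<close> and goes into the
  bound.\<close>

lemma fast_fallingI:
  fixes y :: "nat \<Rightarrow> 'a::locally_convex_space"
  assumes "\<And>p. continuous_seminorm p \<Longrightarrow> \<exists>K. \<forall>n. p (y n) \<le> K / 2 ^ (n * n)"
  shows "fast_falling y"
  unfolding fast_falling_def
proof (intro allI impI)
  fix p :: "'a \<Rightarrow> real" and k :: nat
  assume p: "continuous_seminorm p"
  obtain K where K: "\<And>n. p (y n) \<le> K / 2 ^ (n * n)"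
    using assms[OF p] by blast
  have K0: "0 \<le> K"
    using K[of 0] seminorm_nonneg[OF p, of "y 0"] by simp
  have "2 ^ (k * n) * p (y n) \<le> 2 ^ (k * k) * K" for n
  proof -
    have "k * n \<le> k * k + n * n"
      by (cases "n \<le> k") (auto intro: trans_le_add1 trans_le_add2 mult_le_mono)
    then have "(2::real) ^ (k * n) \<le> 2 ^ (k * k) * 2 ^ (n * n)"
      by (simp add: power_add[symmetric])
    then have "2 ^ (k * n) * p (y n) \<le> (2 ^ (k * k) * 2 ^ (n * n)) * (K / 2 ^ (n * n))"
      using K[of n] K0 seminorm_nonneg[OF p] by (intro mult_mono) auto
    then show ?thesis
      by simp
  qed
  then show "\<exists>K. \<forall>n. 2 ^ (k * n) * p (y n) \<le> K"
    by blast
qed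

text \<open>A seminorm on the reals is the multiple \<open>p 1\<close> of the absolute
  value.\<close>

lemma fast_falling_realI:
  fixes y :: "nat \<Rightarrow> real"
  assumes "\<And>n. \<bar>y n\<bar> \<le> K / 2 ^ (n * n)"
  shows "fast_falling y"
proof (rule fast_fallingI)
  fix p :: "real \<Rightarrow> real"
  assume p: "continuous_seminorm p"
  have "p (y n) \<le> K * p 1 / 2 ^ (n * n)" for n
    using seminorm_scaleR[OF p, of "y n" 1] mult_right_mono[OF assms[of n] seminorm_nonneg[OF p, of 1]]
    by simp
  then show "\<exists>K. \<forall>n. p (y n) \<le> K / 2 ^ (n * n)"
    by blast
qed

text \<open>The bumps around the points \<open>2\<^sup>-\<^sup>n\<close> have disjoint supports.\<close>

definition special_curve ::
    "(real \<Rightarrow> real) \<Rightarrow> (nat \<Rightarrow> 'a::real_vector) \<Rightarrow> real \<Rightarrow> 'a" where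
  "special_curve \<psi> y t =
     (if \<exists>n. \<bar>2 ^ n * t - 1\<bar> \<le> 1 / 4
      then let n = SOME n. \<bar>2 ^ n * t - 1\<bar> \<le> 1 / 4 in \<psi> (2 ^ n * t - 1) *\<^sub>R y n
      else 0)"

text \<open>The margin 3/8 is wider than the radius 1/4 of the supports, so that one formula holds
  on an open set around each support. The intervals still miss each other after doubling: 2 * 5/8 =
  5/4, and 2 * 3/4 exceeds 11/8.\<close>

lemma dyadic_unique:
  assumes "\<bar>2 ^ n * t - 1\<bar> < 3 / 8" "\<bar>2 ^ m * t - 1\<bar> \<le> 1 / (4::real)"
  shows "n = m"
proof (rule ccontr)
  have b: "5 / 8 < 2 ^ n * t" "2 ^ n * t < 11 / 8" "3 / 4 \<le> 2 ^ m * t" "2 ^ m * t \<le> 5 / 4"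
    using assms by linarith+
  have two: "(2::real) * 2 ^ i \<le> 2 ^ j" if "i < j" for i j :: nat
    using power_increasing[of "Suc i" j "2::real"] that by simp
  have t: "0 < t"
  proof (rule ccontr)
    assume "\<not> 0 < t"
    then have "2 ^ n * t \<le> 0"
      by (intro mult_nonneg_nonpos) auto
    then show False
      using b(1) by linarith
  qed
  assume "n \<noteq> m"
  then consider "n < m" | "m < n"
    by linarith
  then show False
  proof cases
    case 1
    then have "2 * (2 ^ n * t) \<le> 2 ^ m * t"
      using mult_right_mono[OF two[OF 1], of t] t by (simp only: mult.assoc less_imp_le)
    then show ?thesis
      using b by linarith
  next
    case 2
    then have "2 * (2 ^ m * t) \<le> 2 ^ n * t"
      using mult_right_mono[OF two[OF 2], of t] t by (simp only: mult.assoc less_imp_le)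
    then show ?thesis
      using b by linarith
  qed
qed

lemma special_curve_eq:
  assumes \<psi>: "\<And>x. \<bar>x\<bar> > 1 / 4 \<Longrightarrow> \<psi> x = 0" and n: "\<bar>2 ^ n * t - 1\<bar> < 3 / 8"
  shows "special_curve \<psi> y t = \<psi> (2 ^ n * t - 1) *\<^sub>R y n"
proof (cases "\<exists>m. \<bar>2 ^ m * t - 1\<bar> \<le> 1 / 4")
  case True
  define m where "m = (SOME m. \<bar>2 ^ m * t - 1\<bar> \<le> 1 / 4)"
  have "\<bar>2 ^ m * t - 1\<bar> \<le> 1 / 4"
    unfolding m_def using True by (rule someI_ex)
  then have "n = m"
    using n by (rule dyadic_unique[rotated])
  then show ?thesis
    using True by (simp add: special_curve_def m_def Let_def)
next
  case False
  then have "\<bar>2 ^ n * t - 1\<bar> > 1 / 4"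
    using not_le by blast
  then show ?thesis
    using False \<psi> by (simp add: special_curve_def)
qed

lemma special_curve_outside:
  assumes "t \<le> 0 \<or> 5 / 4 < t"
  shows "special_curve \<psi> y t = 0"
proof -
  have "1 / 4 < \<bar>2 ^ n * t - 1\<bar>" for n :: nat
  proof (cases "t \<le> 0")
    case True
    then have "2 ^ n * t \<le> 0"
      by (simp add: mult_nonneg_nonpos)
    then show ?thesis
      by simp
  next
    case False
    then have "1 * t \<le> 2 ^ n * t"
      by (intro mult_right_mono) auto
    moreover have "5 / 4 < t"
      using False assms by simp
    ultimately show ?thesis
      by linarith
  qed
  then have "\<not> (\<exists>n. \<bar>2 ^ n * t - 1\<bar> \<le> 1 / 4)"
    by (simp add: not_le)
  then show ?thesis
    by (simp add: special_curve_def)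
qed

text \<open>The least \<open>n\<close> with \<open>2 / 3 \<le> 2 ^ n * t\<close> has
  \<open>2 ^ n * t \<le> 4 / 3\<close>, and 1/3 is below 3/8. For \<open>n = 0\<close> the upper
  bound is the assumption on \<open>t\<close>.\<close>

lemma dyadic_cover:
  fixes t :: real
  assumes "0 < t" "t < 4 / 3"
  obtains n :: nat where "\<bar>2 ^ n * t - 1\<bar> < 3 / 8"
proof -
  obtain k :: nat where "2 / 3 / t < 2 ^ k"
    using real_arch_pow[of 2 "2 / 3 / t"] by auto
  then have ex: "\<exists>k::nat. 2 / 3 \<le> 2 ^ k * t"
    using assms(1) by (intro exI[of _ k]) (simp add: field_simps)
  define n where "n = (LEAST k::nat. 2 / 3 \<le> 2 ^ k * t)"
  have n: "2 / 3 \<le> 2 ^ n * t"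
    unfolding n_def using ex by (rule LeastI_ex)
  have "2 ^ n * t \<le> 4 / 3"
  proof (cases n)
    case 0
    then show ?thesis
      using assms(2) by simp
  next
    case (Suc m)
    then have "\<not> 2 / 3 \<le> 2 ^ m * t"
      unfolding n_def by (metis lessI not_less_Least)
    then have "2 * (2 ^ m * t) \<le> 4 / 3"
      by linarith
    then show ?thesis
      by (simp only: Suc power_Suc mult.assoc)
  qed
  then have "\<bar>2 ^ n * t - 1\<bar> < 3 / 8"
    using n by linarith
  then show ?thesis
    by (rule that)
qed

text \<open>For \<open>t > 0\<close> at most one bump is felt near \<open>t\<close>, and the chain
  rule moves a factor \<open>2 ^ n\<close> into the sequence. At 0 the bumps accumulate; the n-th
  one lives at times of order 2^-n, so decay like 2^(-2n) makes the curve O(h^2) there.\<close>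

lemma special_curve_derivative:
  fixes y :: "nat \<Rightarrow> 'a::locally_convex_space"
  assumes \<psi>: "\<And>x. (\<psi> has_real_derivative \<psi>' x) (at x)" "\<And>x. \<bar>x\<bar> > 1 / 4 \<Longrightarrow> \<psi> x = 0"
      "\<And>x. \<bar>x\<bar> > 1 / 4 \<Longrightarrow> \<psi>' x = 0"
    and y: "fast_falling y"
  shows "has_curve_derivative (special_curve \<psi> y) (special_curve \<psi>' (\<lambda>n. 2 ^ n *\<^sub>R y n) t) t"
proof -
  have zero: "has_curve_derivative (special_curve \<psi> y) 0 t" if "open S" "t \<in> S"
    "\<And>s. s \<in> S \<Longrightarrow> special_curve \<psi> y s = 0" for S
  proof -
    have "\<forall>\<^sub>F s in nhds t. special_curve \<psi> y s = 0"
      using eventually_nhds_in_open[OF that(1,2)] by (rule eventually_mono) (rule that(3))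
    then show ?thesis
      using has_curve_derivative_cong[of "special_curve \<psi> y" "\<lambda>s. 0"] has_curve_derivative_const by blast
  qed
  consider "t < 0" | "5 / 4 < t" | "0 < t" "t < 4 / 3" | "t = 0"
    by linarith
  then show ?thesis
  proof cases
    case 1
    then show ?thesis
      using zero[of "{..<0}"] by (simp add: special_curve_outside)
  next
    case 2
    then show ?thesis
      using zero[of "{5/4<..}"] by (simp add: special_curve_outside)
  next
    case 3
    obtain n :: nat where n: "\<bar>2 ^ n * t - 1\<bar> < 3 / 8"
      using dyadic_cover[OF 3] .
    have "has_curve_derivative (\<lambda>s. \<psi> (2 ^ n * s - 1) *\<^sub>R y n)
        ((\<psi>' (2 ^ n * t - 1) * 2 ^ n) *\<^sub>R y n + \<psi> (2 ^ n * t - 1) *\<^sub>R 0) t"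
      by (intro has_curve_derivative_scaleR has_curve_derivative_const DERIV_chain2[OF \<psi>(1)])
        (auto intro!: derivative_eq_intros)
    moreover have "\<forall>\<^sub>F s in nhds t. special_curve \<psi> y s = \<psi> (2 ^ n * s - 1) *\<^sub>R y n"
    proof -
      have "open {s::real. \<bar>2 ^ n * s - 1\<bar> < 3 / 8}"
        by (intro open_Collect_less continuous_intros)
      then have "\<forall>\<^sub>F s in nhds t. s \<in> {s. \<bar>2 ^ n * s - 1\<bar> < 3 / 8}"
        using n by (intro eventually_nhds_in_open) auto
      then show ?thesis
        by (rule eventually_mono) (simp add: special_curve_eq[OF \<psi>(2)])
    qed
    moreover have "special_curve \<psi>' (\<lambda>n. 2 ^ n *\<^sub>R y n) t = (\<psi>' (2 ^ n * t - 1) * 2 ^ n) *\<^sub>R y n"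
      using special_curve_eq[where \<psi> = \<psi>' and y = "\<lambda>n. 2 ^ n *\<^sub>R y n", OF \<psi>(3) n] by simp
    ultimately show ?thesis
      using has_curve_derivative_cong[of "special_curve \<psi> y" "\<lambda>s. \<psi> (2 ^ n * s - 1) *\<^sub>R y n" t]
      by simp
  next
    case 4
    have "bounded (\<psi> ` cball 0 (1/4))"
      using \<psi>(1) by (intro compact_imp_bounded compact_continuous_image)
        (auto intro: DERIV_continuous_on has_field_derivative_at_within)
    then obtain M where "\<forall>x\<in>cball 0 (1/4). \<bar>\<psi> x\<bar> \<le> M"
      unfolding bounded_iff by auto
    then have M: "\<bar>\<psi> x\<bar> \<le> M" if "\<bar>x\<bar> \<le> 1 / 4" for x
      using that by simp
    have "((\<lambda>h. special_curve \<psi> y h /\<^sub>R h) \<longlongrightarrow> 0) (at 0)"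
    proof (rule tendsto_seminormI)
      fix p :: "'a \<Rightarrow> real"
      assume p: "continuous_seminorm p"
      obtain K where K: "\<And>n. 2 ^ (2 * n) * p (y n) \<le> K"
        using y p unfolding fast_falling_def by blast
      have "p (special_curve \<psi> y h /\<^sub>R h) \<le> (16 / 9 * M * K) * \<bar>h\<bar>" for h
      proof (cases "\<exists>n. \<bar>2 ^ n * h - 1\<bar> \<le> 1 / 4")
        case True
        then obtain n :: nat where n: "\<bar>2 ^ n * h - 1\<bar> \<le> 1 / 4"
          by blast
        then have h: "3 / 4 \<le> 2 ^ n * h"
          by linarith
        have h0: "0 < h"
        proof (rule ccontr)
          assume "\<not> 0 < h"
          then have "2 ^ n * h \<le> 0"
            by (intro mult_nonneg_nonpos) auto
          then show False
            using h by linarith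
        qed
        \<comment> \<open>On the n-th support \<open>h\<close> is at least 3/4 of 2^-n. The factor
          \<open>16 / 9 * 2 ^ (2 * n) * h^2\<close> is thus at least 1 and may be inserted; it
          trades the decay of \<open>y n\<close> for a factor \<open>h^2\<close>.\<close>
        have "(3 / 4)\<^sup>2 \<le> (2 ^ n * h)\<^sup>2"
          using h by (intro power_mono) auto
        then have 1: "1 \<le> 16 / 9 * 2 ^ (2 * n) * h\<^sup>2"
          unfolding mult_2 power_add power2_eq_square by (simp add: mult_ac)
        have "p (special_curve \<psi> y h) = \<bar>\<psi> (2 ^ n * h - 1)\<bar> * p (y n)"
          using special_curve_eq[where \<psi> = \<psi> and n = n and t = h and y = y, OF \<psi>(2)] n by (simp add: seminorm_scaleR[OF p])
        also have "\<dots> \<le> M * p (y n)"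
          using M[OF n] seminorm_nonneg[OF p] by (intro mult_right_mono) auto
        also have "\<dots> \<le> (M * p (y n)) * (16 / 9 * 2 ^ (2 * n) * h\<^sup>2)"
          using mult_left_mono[OF 1, of "M * p (y n)"] M[of 0] seminorm_nonneg[OF p, of "y n"] by simp
        also have "\<dots> = (16 / 9 * h\<^sup>2 * M) * (2 ^ (2 * n) * p (y n))"
          by (simp only: mult_ac)
        also have "\<dots> \<le> (16 / 9 * h\<^sup>2 * M) * K"
          using K[of n] M[of 0] by (intro mult_left_mono) auto
        finally have "p (special_curve \<psi> y h) \<le> (16 / 9 * M * K * h) * h"
          by (simp only: power2_eq_square mult_ac)
        then have "p (special_curve \<psi> y h) / h \<le> 16 / 9 * M * K * h"
          using h0 by (simp only: pos_divide_le_eq)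
        moreover have "p (special_curve \<psi> y h /\<^sub>R h) = p (special_curve \<psi> y h) / h"
          unfolding seminorm_scaleR[OF p] using h0 by (simp add: divide_inverse)
        ultimately show ?thesis
          using h0 by (simp only: abs_of_pos)
      next
        case False
        moreover have "0 \<le> 16 / 9 * M * K"
          using K[of 0] M[of 0] seminorm_nonneg[OF p, of "y 0"] by simp
        ultimately show ?thesis
          by (simp add: special_curve_def seminorm_zero[OF p])
      qed
      then have "\<forall>\<^sub>F h in at 0. norm (p (special_curve \<psi> y h /\<^sub>R h - 0)) \<le> (16 / 9 * M * K) * \<bar>h\<bar>"
        by (simp add: seminorm_nonneg[OF p])
      moreover have "((\<lambda>h. (16 / 9 * M * K) * \<bar>h\<bar>) \<longlongrightarrow> 0) (at (0::real))"
        by (auto intro!: tendsto_eq_intros)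
      ultimately show "((\<lambda>h. p (special_curve \<psi> y h /\<^sub>R h - 0)) \<longlongrightarrow> 0) (at 0)"
        by (rule Lim_null_comparison)
    qed
    then show ?thesis
      by (simp add: 4 has_curve_derivative_def special_curve_outside)
  qed
qed

lemma smooth_curve_special_curve:
  fixes y :: "nat \<Rightarrow> 'a::locally_convex_space"
  assumes "smooth_curve \<psi>" "\<And>x. \<bar>x\<bar> > 1 / 4 \<Longrightarrow> \<psi> x = 0" "fast_falling y"
  shows "smooth_curve (special_curve \<psi> y)"
proof (rule smooth_curve_onI)
  fix t
  define X where "X c \<longleftrightarrow> (\<exists>\<psi> y. smooth_curve \<psi> \<and> (\<forall>x. \<bar>x\<bar> > 1 / 4 \<longrightarrow> \<psi> x = 0) \<and>
      fast_falling y \<and> c = special_curve \<psi> y)" for c :: "real \<Rightarrow> 'a"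
  show "smooth_at (special_curve \<psi> y) t"
  proof (rule smooth_at_coinduct[of X])
    show "X (special_curve \<psi> y)"
      unfolding X_def using assms by blast
    fix c
    assume "X c"
    then obtain \<psi> y where c: "smooth_curve \<psi>" "\<And>x. \<bar>x\<bar> > 1 / 4 \<Longrightarrow> \<psi> x = 0" "fast_falling y"
        "c = special_curve \<psi> y"
      unfolding X_def by blast
    have d0: "deriv \<psi> x = 0" if "\<bar>x\<bar> > 1 / 4" for x
    proof -
      have "open {x::real. \<bar>x\<bar> > 1 / 4}"
        by (intro open_Collect_less continuous_intros)
      then have "\<forall>\<^sub>F s in nhds x. s \<in> {x. \<bar>x\<bar> > 1 / 4}"
        using that by (intro eventually_nhds_in_open) auto
      then have "\<forall>\<^sub>F s in nhds x. \<psi> s = 0"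
        by (rule eventually_mono) (simp add: c(2))
      then show ?thesis
        by (simp add: deriv_cong_ev[OF _ refl])
    qed
    have fast: "fast_falling (\<lambda>n. 2 ^ n *\<^sub>R y n)"
      unfolding fast_falling_def
    proof (intro allI impI)
      fix p :: "'a \<Rightarrow> real" and k
      assume p: "continuous_seminorm p"
      \<comment> \<open>The extra factor \<open>2 ^ n\<close> is paid for with the estimate for
        \<open>Suc k\<close>.\<close>
      obtain K where "\<And>n. 2 ^ (Suc k * n) * p (y n) \<le> K"
        using c(3) p unfolding fast_falling_def by blast
      then show "\<exists>K. \<forall>n. 2 ^ (k * n) * p (2 ^ n *\<^sub>R y n) \<le> K"
        by (intro exI[of _ K]) (simp add: seminorm_scaleR[OF p] power_add mult_ac)
    qed
    have "X (special_curve (deriv \<psi>) (\<lambda>n. 2 ^ n *\<^sub>R y n))"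
      unfolding X_def using smooth_curve_DERIV(2)[OF c(1)] d0 fast by blast
    moreover have "\<forall>s. has_curve_derivative c (special_curve (deriv \<psi>) (\<lambda>n. 2 ^ n *\<^sub>R y n) s) s"
      unfolding c(4)
      by (intro allI special_curve_derivative smooth_curve_DERIV(1) c d0)
    ultimately show "\<exists>d. (\<forall>\<^sub>F s in nhds t. has_curve_derivative c (d s) s) \<and> X d"
      by (intro exI[of _ "special_curve (deriv \<psi>) (\<lambda>n. 2 ^ n *\<^sub>R y n)"]) simp
  qed
qed

text \<open>A smooth curve that passes affinely through \<open>y n\<close> at time \<open>2\<^sup>-\<^sup>n\<close>, and through \<open>0\<close> at time \<open>0\<close>.\<close>

definition affine_special_curve :: "(nat \<Rightarrow> 'a::real_vector) \<Rightarrow> (nat \<Rightarrow> 'a) \<Rightarrow> real \<Rightarrow> 'a" where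
  "affine_special_curve y w t = special_curve bump y t + special_curve (\<lambda>x. x * bump x) w t"

lemma smooth_curve_affine_special_curve:
  fixes y w :: "nat \<Rightarrow> 'a::locally_convex_space"
  assumes "fast_falling y" "fast_falling w"
  shows "smooth_curve (affine_special_curve y w)"
proof (rule smooth_curve_onI)
  fix t
  have b: "smooth_at bump s" for s
    using smooth_curve_bump by (simp add: smooth_curve_iff_smooth_at)
  have "smooth_curve (special_curve (\<lambda>x. x * bump x) w)"
    by (rule smooth_curve_special_curve[OF smooth_curve_onI _ assms(2)])
      (auto intro!: smooth_at_intros b simp: bump_eq_0)
  moreover have "smooth_curve (special_curve bump y)"
    by (rule smooth_curve_special_curve[OF smooth_curve_bump bump_eq_0 assms(1)])
  ultimately show "smooth_at (affine_special_curve y w) t"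
    unfolding affine_special_curve_def[abs_def] smooth_curve_iff_smooth_at
    by (intro smooth_at_add) auto
qed

text \<open>Within 1/8 of the centre the two profiles are 1 and \<open>x\<close>, so the curve is
  exactly affine there and its composites can be differentiated at 2^-n explicitly.\<close>

lemma affine_special_curve_eq:
  assumes "\<bar>2 ^ n * s\<bar> \<le> 1 / 8"
  shows "affine_special_curve y w (1 / 2 ^ n + s) = y n + (2 ^ n * s) *\<^sub>R w n"
proof -
  have eq: "2 ^ n * (1 / 2 ^ n + s) - 1 = 2 ^ n * s"
    by (simp add: distrib_left)
  have n: "\<bar>2 ^ n * (1 / 2 ^ n + s) - 1\<bar> < 3 / 8"
    unfolding eq using assms by linarith
  show ?thesis
    unfolding affine_special_curve_def
    using special_curve_eq[of bump n "1 / 2 ^ n + s" y, OF bump_eq_0 n]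
      special_curve_eq[of "\<lambda>x. x * bump x" n "1 / 2 ^ n + s" w, OF _ n] assms
    unfolding eq by (simp add: bump_eq_0 bump_eq_1)
qed

lemma affine_special_curve_at: "affine_special_curve y w (1 / 2 ^ n) = y n"
  using affine_special_curve_eq[of n 0 y w] by simp

lemma affine_special_curve_0: "affine_special_curve y w 0 = 0"
  by (simp add: affine_special_curve_def special_curve_outside)

lemma fast_falling_zero: "fast_falling (\<lambda>n. 0 :: 'a::locally_convex_space)"
  by (rule fast_fallingI) (auto simp: seminorm_zero intro!: exI[of _ 0])

section \<open>Smooth surfaces\<close>

definition smooth_surface :: "(real \<Rightarrow> real \<Rightarrow> 'a::{real_vector,topological_space}) \<Rightarrow> bool" where
  "smooth_surface G \<longleftrightarrow>
     (\<forall>x y. smooth_curve x \<longrightarrow> smooth_curve y \<longrightarrow> smooth_curve (\<lambda>t. G (x t) (y t)))"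

lemma smooth_surfaceD:
  "smooth_surface G \<Longrightarrow> smooth_curve x \<Longrightarrow> smooth_curve y \<Longrightarrow> smooth_curve (\<lambda>t. G (x t) (y t))"
  unfolding smooth_surface_def by blast

lemma smooth_surface_swap: "smooth_surface G \<Longrightarrow> smooth_surface (\<lambda>s t. G t s)"
  unfolding smooth_surface_def by blast

lemma smooth_curve_intros:
  "smooth_curve (\<lambda>s. a :: 'a::locally_convex_space)"
  "smooth_curve (\<lambda>s::real. s)"
  "smooth_curve c \<Longrightarrow> smooth_curve k \<Longrightarrow> smooth_curve (\<lambda>s. c s + k s :: 'a)"
  "smooth_curve c \<Longrightarrow> smooth_curve k \<Longrightarrow> smooth_curve (\<lambda>s. c s - k s :: 'a)"
  "smooth_curve f \<Longrightarrow> smooth_curve c \<Longrightarrow> smooth_curve (\<lambda>s. f s *\<^sub>R c s :: 'a)"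
  "smooth_curve f \<Longrightarrow> smooth_curve g \<Longrightarrow> smooth_curve (\<lambda>s. f s * g s :: real)"
  unfolding smooth_curve_iff_smooth_at by (blast intro: smooth_at_intros)+

lemma smooth_curve_compose:
  fixes c :: "real \<Rightarrow> 'a::locally_convex_space" and r :: "real \<Rightarrow> real"
  shows "smooth_curve c \<Longrightarrow> smooth_curve r \<Longrightarrow> smooth_curve (\<lambda>s. c (r s))"
  unfolding smooth_curve_iff_smooth_at by (blast intro: smooth_at_compose)

section \<open>Iterated derivatives of real functions\<close>

lemma smooth_curve_iterated_deriv:
  fixes f :: "real \<Rightarrow> real"
  shows "smooth_curve f \<Longrightarrow> smooth_curve ((deriv ^^ m) f)"
  by (induction m) (auto intro: smooth_curve_DERIV(2))

lemma iterated_deriv_DERIV: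
  fixes f :: "real \<Rightarrow> real"
  shows "smooth_curve f \<Longrightarrow> ((deriv ^^ m) f has_real_derivative (deriv ^^ Suc m) f t) (at t)"
  using smooth_curve_DERIV(1)[OF smooth_curve_iterated_deriv] by simp

lemma iterated_deriv_cong:
  fixes f g :: "real \<Rightarrow> real"
  assumes "\<forall>\<^sub>F s in nhds t. f s = g s"
  shows "\<forall>\<^sub>F s in nhds t. (deriv ^^ m) f s = (deriv ^^ m) g s"
proof (induction m)
  case (Suc m)
  then have "\<forall>\<^sub>F s in nhds t. \<forall>\<^sub>F r in nhds s. (deriv ^^ m) f r = (deriv ^^ m) g r"
    by (simp add: eventually_eventually)
  then show ?case
    by (rule eventually_mono) (simp add: deriv_cong_ev)
qed (use assms in simp)

lemma iterated_deriv_affine: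
  fixes f :: "real \<Rightarrow> real"
  assumes "smooth_curve f"
  shows "(deriv ^^ m) (\<lambda>t. f (c + k * t)) = (\<lambda>t. k ^ m * (deriv ^^ m) f (c + k * t))"
proof (induction m)
  case (Suc m)
  have "deriv (\<lambda>t. k ^ m * (deriv ^^ m) f (c + k * t)) t
      = k ^ Suc m * (deriv ^^ Suc m) f (c + k * t)" for t
  proof (rule DERIV_imp_deriv)
    have "((\<lambda>t. (deriv ^^ m) f (c + k * t)) has_real_derivative
        (deriv ^^ Suc m) f (c + k * t) * k) (at t)"
      by (rule DERIV_chain2[OF iterated_deriv_DERIV[OF assms]]) (auto intro!: derivative_eq_intros)
    from DERIV_cmult[OF this, of "k ^ m"]
    show "((\<lambda>t. k ^ m * (deriv ^^ m) f (c + k * t)) has_real_derivative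
        k ^ Suc m * (deriv ^^ Suc m) f (c + k * t)) (at t)"
      by (simp add: mult_ac)
  qed
  then show ?case
    by (simp add: Suc.IH fun_eq_iff)
qed simp

lemma iterated_deriv_diff:
  fixes f g :: "real \<Rightarrow> real"
  assumes "smooth_curve f" "smooth_curve g"
  shows "(deriv ^^ m) (\<lambda>t. f t - g t) = (\<lambda>t. (deriv ^^ m) f t - (deriv ^^ m) g t)"
proof (induction m)
  case (Suc m)
  have "deriv (\<lambda>t. (deriv ^^ m) f t - (deriv ^^ m) g t) t
      = (deriv ^^ Suc m) f t - (deriv ^^ Suc m) g t" for t
    by (intro DERIV_imp_deriv DERIV_diff iterated_deriv_DERIV assms)
  then show ?case
    by (simp add: Suc.IH fun_eq_iff)
qed simp

lemma iterated_deriv_cmult: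
  fixes f :: "real \<Rightarrow> real"
  assumes "smooth_curve f"
  shows "(deriv ^^ m) (\<lambda>t. c * f t) = (\<lambda>t. c * (deriv ^^ m) f t)"
proof (induction m)
  case (Suc m)
  have "deriv (\<lambda>t. c * (deriv ^^ m) f t) t = c * (deriv ^^ Suc m) f t" for t
    by (intro DERIV_imp_deriv DERIV_cmult iterated_deriv_DERIV assms)
  then show ?case
    by (simp add: Suc.IH fun_eq_iff)
qed simp

section \<open>Continuity and bounds by interpolation of bad points\<close>

lemma inverse_power_two_tendsto_0: "(\<lambda>n. 1 / 2 ^ n) \<longlonglongrightarrow> (0::real)"
  using LIMSEQ_inverse_realpow_zero[of 2] by (simp add: inverse_eq_divide)

text \<open>Otherwise points violating \<open>P\<close> could be chosen within 2^(-n^2) of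
  \<open>(a, b)\<close> in each coordinate and joined by a smooth curve that is at
  \<open>(a, b)\<close> at time 0. In the plane, openness along smooth curves is therefore ordinary
  openness.\<close>

lemma curve_openness_box:
  fixes P :: "real \<Rightarrow> real \<Rightarrow> bool"
  assumes P: "\<And>x y. smooth_curve x \<Longrightarrow> smooth_curve y \<Longrightarrow> P (x 0) (y 0) \<Longrightarrow>
      \<forall>\<^sub>F t in nhds 0. P (x t) (y t)"
    and ab: "P a b"
  shows "\<exists>\<delta>>0. \<forall>s t. \<bar>s - a\<bar> \<le> \<delta> \<longrightarrow> \<bar>t - b\<bar> \<le> \<delta> \<longrightarrow> P s t"
proof (rule ccontr)
  assume no: "\<not> ?thesis"
  have "\<exists>s t. \<bar>s - a\<bar> \<le> 1 / 2 ^ (n * n) \<and> \<bar>t - b\<bar> \<le> 1 / 2 ^ (n * n) \<and> \<not> P s t" for n :: nat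
    using no by (simp add: not_le)
  then obtain s t where st: "\<And>n::nat. \<bar>s n - a\<bar> \<le> 1 / 2 ^ (n * n)"
      "\<And>n::nat. \<bar>t n - b\<bar> \<le> 1 / 2 ^ (n * n)" "\<And>n. \<not> P (s n) (t n)"
    by metis
  define x where "x r = a + affine_special_curve (\<lambda>n. s n - a) (\<lambda>n. 0) r" for r
  define y where "y r = b + affine_special_curve (\<lambda>n. t n - b) (\<lambda>n. 0) r" for r
  have "smooth_curve x" "smooth_curve y"
    unfolding x_def[abs_def] y_def[abs_def]
    by (intro smooth_curve_intros smooth_curve_affine_special_curve fast_falling_zero
        fast_falling_realI[of _ 1] st)+
  moreover have "P (x 0) (y 0)"
    using ab by (simp add: x_def y_def affine_special_curve_0)
  ultimately have "\<forall>\<^sub>F r in nhds 0. P (x r) (y r)"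
    by (rule P)
  moreover have "(\<lambda>n. 1 / 2 ^ n) \<longlonglongrightarrow> (0::real)"
    by (rule inverse_power_two_tendsto_0)
  ultimately have "\<forall>\<^sub>F n in sequentially. P (x (1 / 2 ^ n)) (y (1 / 2 ^ n))"
    unfolding filterlim_iff by blast
  then show False
    using st(3) by (simp add: x_def y_def affine_special_curve_at)
qed

text \<open>Preimages of balls are open along smooth curves, so \<open>curve_openness_box\<close>
  upgrades continuity along curves to joint continuity.\<close>

lemma smooth_surface_tendsto:
  fixes G :: "real \<Rightarrow> real \<Rightarrow> real"
  assumes G: "smooth_surface G" and x: "(x \<longlongrightarrow> a) F" and y: "(y \<longlongrightarrow> b) F"
  shows "((\<lambda>i. G (x i) (y i)) \<longlongrightarrow> G a b) F"
proof (rule tendstoI)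
  fix e :: real
  assume "0 < e"
  have "\<forall>\<^sub>F t in nhds 0. dist (G (x t) (y t)) (G a b) < e"
    if "smooth_curve x" "smooth_curve y" "dist (G (x 0) (y 0)) (G a b) < e" for x y
  proof -
    have "smooth_at (\<lambda>t. G (x t) (y t)) 0"
      using smooth_surfaceD[OF G that(1,2)] by (simp add: smooth_curve_iff_smooth_at)
    then have "((\<lambda>t. dist (G (x t) (y t)) (G a b)) \<longlongrightarrow> dist (G (x 0) (y 0)) (G a b)) (nhds 0)"
      by (intro tendsto_dist tendsto_const smooth_at_imp_tendsto)
    then show ?thesis
      using that(3) by (rule order_tendstoD)
  qed
  from curve_openness_box[of "\<lambda>s t. dist (G s t) (G a b) < e", OF this] \<open>0 < e\<close>
  obtain \<delta> where \<delta>: "\<delta> > 0"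
      "\<And>s t. \<bar>s - a\<bar> \<le> \<delta> \<Longrightarrow> \<bar>t - b\<bar> \<le> \<delta> \<Longrightarrow> dist (G s t) (G a b) < e"
    by (metis dist_self)
  show "\<forall>\<^sub>F i in F. dist (G (x i) (y i)) (G a b) < e"
    using tendstoD[OF x \<delta>(1)] tendstoD[OF y \<delta>(1)]
  proof eventually_elim
    case (elim i)
    then show ?case
      by (intro \<delta>(2)) (simp_all add: dist_real_def)
  qed
qed

text \<open>All directional derivatives of a fixed order are locally bounded: otherwise a smooth curve
  through bad points, with velocities in the bad directions, would have an unbounded derivative.\<close>

lemma smooth_surface_directional_bound:
  fixes G :: "real \<Rightarrow> real \<Rightarrow> real"
  assumes G: "smooth_surface G"
  shows "\<exists>\<delta>>0. \<exists>C. \<forall>x y v w. \<bar>x - a\<bar> \<le> \<delta> \<longrightarrow> \<bar>y - b\<bar> \<le> \<delta> \<longrightarrow> \<bar>v\<bar> \<le> 1 \<longrightarrow> \<bar>w\<bar> \<le> 1 \<longrightarrow>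
    \<bar>(deriv ^^ m) (\<lambda>\<tau>. G (x + \<tau> * v) (y + \<tau> * w)) 0\<bar> \<le> C"
proof (rule ccontr)
  assume no: "\<not> ?thesis"
  define \<epsilon> :: "nat \<Rightarrow> real" where "\<epsilon> n = 1 / 2 ^ (n * n)" for n
  have \<epsilon>: "\<epsilon> n > 0" for n
    by (simp add: \<epsilon>_def)
  define D where "D x y v w = \<bar>(deriv ^^ m) (\<lambda>\<tau>. G (x + \<tau> * v) (y + \<tau> * w)) 0\<bar>" for x y v w
  \<comment> \<open>At time 2^-n the curve constructed below has velocity
    \<open>2 ^ n * \<epsilon> n\<close> times \<open>(v, w)\<close>, so its m-th derivative carries
    the m-th power of this factor. The threshold \<open>real n\<close> is divided by that power in
    advance.\<close>
  define bad where "bad n x y v w \<longleftrightarrow> \<bar>x - a\<bar> \<le> \<epsilon> n \<and> \<bar>y - b\<bar> \<le> \<epsilon> n \<and> \<bar>v\<bar> \<le> 1 \<and> \<bar>w\<bar> \<le> 1 \<and>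
      real n / (2 ^ n * \<epsilon> n) ^ m < D x y v w" for n x y v w
  have "\<exists>x y v w. bad n x y v w" for n
  proof (rule ccontr)
    assume "\<not> (\<exists>x y v w. bad n x y v w)"
    then have "\<forall>x y v w. \<bar>x - a\<bar> \<le> \<epsilon> n \<longrightarrow> \<bar>y - b\<bar> \<le> \<epsilon> n \<longrightarrow> \<bar>v\<bar> \<le> 1 \<longrightarrow> \<bar>w\<bar> \<le> 1 \<longrightarrow>
        D x y v w \<le> real n / (2 ^ n * \<epsilon> n) ^ m"
      unfolding bad_def not_less[symmetric] by blast
    then show False
      using no \<epsilon>[of n] unfolding D_def by blast
  qed
  then obtain x y v w where "\<And>n. bad n (x n) (y n) (v n) (w n)"
    by metis
  then have xy: "\<bar>x n - a\<bar> \<le> \<epsilon> n" "\<bar>y n - b\<bar> \<le> \<epsilon> n" "\<bar>v n\<bar> \<le> 1" "\<bar>w n\<bar> \<le> 1"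
      "real n / (2 ^ n * \<epsilon> n) ^ m < D (x n) (y n) (v n) (w n)" for n
    unfolding bad_def by blast+
  define c where "c r = a + affine_special_curve (\<lambda>n. x n - a) (\<lambda>n. \<epsilon> n * v n) r" for r
  define k where "k r = b + affine_special_curve (\<lambda>n. y n - b) (\<lambda>n. \<epsilon> n * w n) r" for r
  have "\<bar>\<epsilon> n * u n\<bar> \<le> 1 / 2 ^ (n * n)" if "\<And>n. \<bar>u n\<bar> \<le> 1" for u n
    using that[of n] \<epsilon>[of n] by (simp add: \<epsilon>_def abs_mult divide_right_mono)
  then have "smooth_curve c" "smooth_curve k"
    unfolding c_def[abs_def] k_def[abs_def] using xy
    by (intro smooth_curve_intros smooth_curve_affine_special_curve
        fast_falling_realI[of _ 1]; simp add: \<epsilon>_def)+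
  then have g: "smooth_curve (\<lambda>r. G (c r) (k r))"
    by (rule smooth_surfaceD[OF G])
  \<comment> \<open>The interval \<open>{0..1}\<close> contains all the times 2^-n.\<close>
  have "bounded ((deriv ^^ m) (\<lambda>r. G (c r) (k r)) ` {0..1})"
    by (intro compact_imp_bounded compact_continuous_image smooth_curve_continuous
        smooth_curve_iterated_deriv g) simp
  then obtain K where K: "\<forall>r\<in>{0..1}. \<bar>(deriv ^^ m) (\<lambda>r. G (c r) (k r)) r\<bar> \<le> K"
    unfolding bounded_iff by auto
  have "real n < K" for n
  proof -
    define f where "f \<tau> = G (x n + \<tau> * v n) (y n + \<tau> * w n)" for \<tau>
    have f: "smooth_curve f"
      unfolding f_def[abs_def] by (intro smooth_surfaceD[OF G] smooth_curve_intros)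
    have "open {s::real. \<bar>2 ^ n * s\<bar> < 1 / 8}"
      by (intro open_Collect_less continuous_intros)
    then have "\<forall>\<^sub>F s in nhds 0. s \<in> {s::real. \<bar>2 ^ n * s\<bar> < 1 / 8}"
      by (intro eventually_nhds_in_open) auto
    then have "\<forall>\<^sub>F s in nhds 0. G (c (1 / 2 ^ n + 1 * s)) (k (1 / 2 ^ n + 1 * s)) = f (0 + (2 ^ n * \<epsilon> n) * s)"
      by (rule eventually_mono) (simp add: c_def k_def affine_special_curve_eq f_def mult_ac)
    then have "\<forall>\<^sub>F s in nhds 0. (deriv ^^ m) (\<lambda>s. G (c (1 / 2 ^ n + 1 * s)) (k (1 / 2 ^ n + 1 * s))) s
        = (deriv ^^ m) (\<lambda>s. f (0 + (2 ^ n * \<epsilon> n) * s)) s"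
      by (rule iterated_deriv_cong)
    then have "(deriv ^^ m) (\<lambda>s. G (c (1 / 2 ^ n + 1 * s)) (k (1 / 2 ^ n + 1 * s))) 0
        = (deriv ^^ m) (\<lambda>s. f (0 + (2 ^ n * \<epsilon> n) * s)) 0"
      by (rule eventually_nhds_x_imp_x)
    then have "(deriv ^^ m) (\<lambda>r. G (c r) (k r)) (1 / 2 ^ n) = (2 ^ n * \<epsilon> n) ^ m * (deriv ^^ m) f 0"
      unfolding iterated_deriv_affine[OF g] iterated_deriv_affine[OF f] by simp
    moreover have "real n < (2 ^ n * \<epsilon> n) ^ m * \<bar>(deriv ^^ m) f 0\<bar>"
      using xy(5)[of n] \<epsilon>[of n] unfolding f_def[abs_def] D_def by (simp add: pos_divide_less_eq mult.commute)
    moreover have "\<bar>(deriv ^^ m) (\<lambda>r. G (c r) (k r)) (1 / 2 ^ n)\<bar> \<le> K"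
      using K by (simp add: divide_le_eq)
    ultimately show ?thesis
      using \<epsilon>[of n] by (simp add: abs_mult)
  qed
  then show False
    using reals_Archimedean2[of K] by (meson less_asym)
qed


subsection \<open>Finite differences\<close>

definition fdiff :: "'v::ab_group_add \<Rightarrow> ('v \<Rightarrow> real) \<Rightarrow> 'v \<Rightarrow> real" where
  "fdiff h f x = f (x + h) - f x"

text \<open>The steps are numbered from 1, so that the weights \<open>1 / real j\<close> in the
  polarization identity make sense.\<close>

primrec mixed_fdiff :: "(nat \<Rightarrow> 'v::ab_group_add) \<Rightarrow> nat \<Rightarrow> ('v \<Rightarrow> real) \<Rightarrow> 'v \<Rightarrow> real" where
  "mixed_fdiff h 0 f = f"
| "mixed_fdiff h (Suc m) f = fdiff (h (Suc m)) (mixed_fdiff h m f)"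

lemma sum_Pow_insert:
  assumes "finite B" "i \<notin> B"
  shows "(\<Sum>S\<in>Pow (insert i B). g S) = (\<Sum>S\<in>Pow B. g S + g (insert i S))"
proof -
  have "inj_on (insert i) (Pow B)"
  proof (rule inj_onI)
    fix S T
    assume "S \<in> Pow B" "T \<in> Pow B" "insert i S = insert i T"
    then show "S = T"
      using assms(2) insert_ident[of i S T] by blast
  qed
  moreover have "Pow B \<inter> insert i ` Pow B = {}"
    using assms(2) by blast
  ultimately show ?thesis
    unfolding Pow_insert using assms(1)
    by (simp add: sum.union_disjoint sum.reindex sum.distrib)
qed

lemma mixed_fdiff_eq_sum:
  "mixed_fdiff h m f x = (\<Sum>S\<in>Pow {1..m}. (- 1) ^ (m + card S) * f (x + (\<Sum>j\<in>S. h j)))"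
proof (induction m arbitrary: x)
  case (Suc m)
  have S: "finite S" "Suc m \<notin> S" if "S \<in> Pow {1..m}" for S
    using that finite_subset[of S "{1..m}"] by auto
  have "{1..Suc m} = insert (Suc m) {1..m}"
    by auto
  then have "(\<Sum>S\<in>Pow {1..Suc m}. (- 1) ^ (Suc m + card S) * f (x + (\<Sum>j\<in>S. h j)))
    = (\<Sum>S\<in>Pow {1..m}. (- 1) ^ (Suc m + card S) * f (x + (\<Sum>j\<in>S. h j))
        + (- 1) ^ (Suc m + card (insert (Suc m) S)) * f (x + (\<Sum>j\<in>insert (Suc m) S. h j)))"
    by (simp only: sum_Pow_insert finite_atLeastAtMost) (rule sum_Pow_insert; simp)
  also have "\<dots> = (\<Sum>S\<in>Pow {1..m}. (- 1) ^ (m + card S) * f (x + h (Suc m) + (\<Sum>j\<in>S. h j))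
      - (- 1) ^ (m + card S) * f (x + (\<Sum>j\<in>S. h j)))"
    by (rule sum.cong) (auto simp: S add_ac)
  finally show ?case
    by (simp add: fdiff_def Suc.IH sum_subtractf)
qed simp

lemma mixed_fdiff_const: "mixed_fdiff (\<lambda>j. w) m f = (fdiff w ^^ m) f"
  by (induction m) auto

text \<open>Kemperman's identity, which reduces mixed differences to iterated differences in one direction.\<close>

lemma mixed_fdiff_polarization:
  fixes f :: "'v::real_vector \<Rightarrow> real"
  shows "mixed_fdiff h m f x = (\<Sum>S\<in>Pow {1..m}. (- 1) ^ card S *
    (fdiff (- (\<Sum>j\<in>S. (1 / real j) *\<^sub>R h j)) ^^ m) f (x + (\<Sum>j\<in>S. h j)))"
proof -
  define g where "g i S = (- 1) ^ card S * f (x + (\<Sum>j\<in>S. h j - (real i / real j) *\<^sub>R h j))" for i S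
  \<comment> \<open>In \<open>g i\<close> the coefficient of the i-th step is 1 - i/i = 0, so
    \<open>S\<close> and \<open>insert i S\<close> give the same value with opposite signs.\<close>
  have zero: "(\<Sum>S\<in>Pow {1..m}. g i S) = 0" if i: "i \<in> {1..m}" for i
  proof -
    define B where "B = {1..m} - {i}"
    have B: "finite B" "i \<notin> B" "{1..m} = insert i B"
      using i by (auto simp: B_def)
    have "g i S + g i (insert i S) = 0" if "S \<in> Pow B" for S
    proof -
      have "finite S" "i \<notin> S"
        using that B finite_subset by auto
      then show ?thesis
        using i by (simp add: g_def)
    qed
    then show ?thesis
      unfolding B(3) sum_Pow_insert[OF B(1,2)] by simp
  qed
  have "(\<Sum>S\<in>Pow {1..m}. (- 1) ^ card S *
      (fdiff (- (\<Sum>j\<in>S. (1 / real j) *\<^sub>R h j)) ^^ m) f (x + (\<Sum>j\<in>S. h j)))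
    = (\<Sum>S\<in>Pow {1..m}. \<Sum>T\<in>Pow {1..m}. (- 1) ^ (m + card T) * g (card T) S)"
  proof (rule sum.cong[OF refl])
    fix S
    have eq: "x + (\<Sum>j\<in>S. h j) + (\<Sum>j\<in>T. - (\<Sum>j\<in>S. (1 / real j) *\<^sub>R h j))
        = x + (\<Sum>j\<in>S. h j - (real (card T) / real j) *\<^sub>R h j)" for T :: "nat set"
      by (simp add: sum_subtractf scaleR_sum_right sum_constant_scaleR)
    show "(- 1) ^ card S * (fdiff (- (\<Sum>j\<in>S. (1 / real j) *\<^sub>R h j)) ^^ m) f (x + (\<Sum>j\<in>S. h j))
        = (\<Sum>T\<in>Pow {1..m}. (- 1) ^ (m + card T) * g (card T) S)"
      unfolding mixed_fdiff_const[symmetric] mixed_fdiff_eq_sum eq g_def sum_distrib_left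
      by (simp add: mult_ac)
  qed
  also have "\<dots> = (\<Sum>T\<in>Pow {1..m}. (- 1) ^ (m + card T) * (\<Sum>S\<in>Pow {1..m}. g (card T) S))"
    unfolding sum_distrib_left by (rule sum.swap)
  \<comment> \<open>Inner sums depend only on the size of \<open>T\<close>, and only the empty set
    survives; for it nothing is subtracted from the steps, so \<open>g 0\<close> yields the mixed
    difference.\<close>
  also have "\<dots> = (\<Sum>T\<in>{{} :: nat set}. (- 1) ^ (m + card T) * (\<Sum>S\<in>Pow {1..m}. g (card T) S))"
  proof (rule sum.mono_neutral_right)
    show "\<forall>T\<in>Pow {1..m} - {{}}. (- 1) ^ (m + card T) * (\<Sum>S\<in>Pow {1..m}. g (card T) S) = 0"
    proof
      fix T
      assume T: "T \<in> Pow {1..m} - {{}}"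
      then have "finite T"
        using finite_subset by auto
      then have "card T \<in> {1..m}"
        using T card_mono[of "{1..m}" T] by (auto simp: Suc_le_eq card_gt_0_iff)
      then show "(- 1) ^ (m + card T) * (\<Sum>S\<in>Pow {1..m}. g (card T) S) = 0"
        using zero by simp
    qed
  qed auto
  also have "\<dots> = mixed_fdiff h m f x"
    by (simp add: mixed_fdiff_eq_sum g_def sum_distrib_left power_add mult.assoc)
  finally show ?thesis
    by simp
qed

lemma iterated_fdiff_line:
  fixes f :: "'v::real_vector \<Rightarrow> real"
  shows "(fdiff k ^^ m) (\<lambda>\<tau>. f (x + \<tau> *\<^sub>R v)) \<tau> = (fdiff (k *\<^sub>R v) ^^ m) f (x + \<tau> *\<^sub>R v)"
  by (induction m arbitrary: \<tau>) (auto simp: fdiff_def algebra_simps)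

text \<open>The induction peels off the innermost difference: the hypothesis is used for
  \<open>fdiff h f\<close>, and the mean value theorem for the m-th derivative turns the remaining
  increment into one more derivative.\<close>

lemma iterated_fdiff_mean_value:
  assumes "smooth_curve f" "0 < h"
  shows "\<exists>\<xi>. x \<le> \<xi> \<and> \<xi> \<le> x + real m * h \<and> (fdiff h ^^ m) f x = h ^ m * (deriv ^^ m) f \<xi>"
  using assms(1)
proof (induction m arbitrary: f)
  case (Suc m)
  have shift: "smooth_curve (\<lambda>t. f (h + 1 * t))"
    by (intro smooth_curve_compose[OF Suc.prems] smooth_curve_intros)
  have fd: "fdiff h f = (\<lambda>t. f (h + 1 * t) - f t)"
    by (simp add: fdiff_def fun_eq_iff add.commute)
  have "smooth_curve (fdiff h f)"
    unfolding fd by (intro smooth_curve_intros Suc.prems shift)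
  then obtain \<xi> where \<xi>: "x \<le> \<xi>" "\<xi> \<le> x + real m * h"
      "(fdiff h ^^ m) (fdiff h f) x = h ^ m * (deriv ^^ m) (fdiff h f) \<xi>"
    using Suc.IH by blast
  have "(deriv ^^ m) (fdiff h f) \<xi> = (deriv ^^ m) f (\<xi> + h) - (deriv ^^ m) f \<xi>"
    unfolding fd iterated_deriv_diff[OF shift Suc.prems] iterated_deriv_affine[OF Suc.prems]
    by (simp add: add.commute)
  moreover obtain \<zeta> where "\<xi> < \<zeta>" "\<zeta> < \<xi> + h"
      "(deriv ^^ m) f (\<xi> + h) - (deriv ^^ m) f \<xi> = (\<xi> + h - \<xi>) * (deriv ^^ Suc m) f \<zeta>"
    using MVT2[of \<xi> "\<xi> + h" "(deriv ^^ m) f" "(deriv ^^ Suc m) f"] iterated_deriv_DERIV[OF Suc.prems]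
      assms(2) by auto
  ultimately show ?case
    using \<xi> by (intro exI[of _ \<zeta>]) (auto simp: funpow_Suc_right distrib_right simp del: funpow.simps)
qed auto

lemma iterated_fdiff_tendsto_deriv:
  assumes f: "smooth_curve f"
  shows "((\<lambda>h. (fdiff h ^^ k) f x / h ^ k) \<longlongrightarrow> (deriv ^^ k) f x) (at_right 0)"
proof -
  have "\<forall>h\<in>{0<..}. \<exists>\<xi>. x \<le> \<xi> \<and> \<xi> \<le> x + real k * h \<and> (fdiff h ^^ k) f x = h ^ k * (deriv ^^ k) f \<xi>"
    using iterated_fdiff_mean_value[OF f] by simp
  from bchoice[OF this] obtain \<xi> where \<xi>: "\<And>h. 0 < h \<Longrightarrow> x \<le> \<xi> h \<and> \<xi> h \<le> x + real k * h \<and>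
      (fdiff h ^^ k) f x = h ^ k * (deriv ^^ k) f (\<xi> h)"
    by auto
  have pos: "\<forall>\<^sub>F h::real in at_right 0. 0 < h"
    by (rule eventually_at_right_less)
  have "(\<xi> \<longlongrightarrow> x) (at_right 0)"
  proof (rule tendsto_sandwich[of "\<lambda>h. x" \<xi> _ "\<lambda>h. x + real k * h"])
    show "((\<lambda>h. x + real k * h) \<longlongrightarrow> x) (at_right 0)"
      by (auto intro!: tendsto_eq_intros)
    show "\<forall>\<^sub>F h in at_right 0. \<xi> h \<le> x + real k * h"
      using pos by (rule eventually_mono) (use \<xi> in blast)
    show "\<forall>\<^sub>F h in at_right 0. x \<le> \<xi> h"
      using pos by (rule eventually_mono) (use \<xi> in blast)
  qed simp
  moreover have "((deriv ^^ k) f \<longlongrightarrow> (deriv ^^ k) f x) (nhds x)"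
    using smooth_curve_iterated_deriv[OF f] smooth_at_imp_tendsto
    unfolding smooth_curve_iff_smooth_at by blast
  ultimately have "((\<lambda>h. (deriv ^^ k) f (\<xi> h)) \<longlongrightarrow> (deriv ^^ k) f x) (at_right 0)"
    by (rule filterlim_compose[rotated])
  then show ?thesis
    by (rule Lim_transform_eventually) (use pos in \<open>auto elim!: eventually_mono simp: \<xi>\<close>)
qed

text \<open>Along the line with direction \<open>\<alpha> / h\<close>, whose components are at most
  1, the iterated difference is \<open>h ^ m\<close> times a directional derivative at an
  intermediate point.\<close>

lemma smooth_surface_fdiff_bound:
  fixes G :: "real \<Rightarrow> real \<Rightarrow> real"
  assumes G: "smooth_surface G"
  shows "\<exists>\<delta>>0. \<exists>C\<ge>0. \<forall>z \<alpha> h. \<bar>fst z - a\<bar> \<le> \<delta> \<longrightarrow> \<bar>snd z - b\<bar> \<le> \<delta> \<longrightarrow> 0 < h \<longrightarrow> h \<le> \<delta> \<longrightarrow>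
    \<bar>fst \<alpha>\<bar> \<le> h \<longrightarrow> \<bar>snd \<alpha>\<bar> \<le> h \<longrightarrow> \<bar>(fdiff \<alpha> ^^ m) (\<lambda>z. G (fst z) (snd z)) z\<bar> \<le> C * h ^ m"
proof -
  obtain \<delta> C where \<delta>: "\<delta> > 0" and C: "\<And>x y v w. \<bar>x - a\<bar> \<le> \<delta> \<Longrightarrow> \<bar>y - b\<bar> \<le> \<delta> \<Longrightarrow> \<bar>v\<bar> \<le> 1 \<Longrightarrow> \<bar>w\<bar> \<le> 1 \<Longrightarrow>
      \<bar>(deriv ^^ m) (\<lambda>\<tau>. G (x + \<tau> * v) (y + \<tau> * w)) 0\<bar> \<le> C"
    using smooth_surface_directional_bound[OF G, of a b m] by blast
  have C0: "0 \<le> C"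
    using C[of a b 0 0] \<delta> by simp
  \<comment> \<open>A base point within \<open>\<delta>'\<close>, followed by \<open>m\<close> steps
    of length at most \<open>\<delta>'\<close>, stays in the box of radius
    \<open>\<delta>\<close>.\<close>
  define \<delta>' where "\<delta>' = \<delta> / (real m + 1)"
  have "\<delta>' * (real m + 1) = \<delta>" "\<delta>' > 0"
    using \<delta> by (simp_all add: \<delta>'_def)
  then have \<delta>': "\<delta>' > 0" "\<delta>' + real m * \<delta>' = \<delta>"
    by (simp_all add: algebra_simps)
  have "\<bar>(fdiff \<alpha> ^^ m) (\<lambda>z. G (fst z) (snd z)) z\<bar> \<le> C * h ^ m"
    if z: "\<bar>fst z - a\<bar> \<le> \<delta>'" "\<bar>snd z - b\<bar> \<le> \<delta>'" and h: "0 < h" "h \<le> \<delta>'"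
      and \<alpha>: "\<bar>fst \<alpha>\<bar> \<le> h" "\<bar>snd \<alpha>\<bar> \<le> h" for z \<alpha> h
  proof -
    define v w where "v = fst \<alpha> / h" and "w = snd \<alpha> / h"
    have vw: "\<bar>v\<bar> \<le> 1" "\<bar>w\<bar> \<le> 1" "h *\<^sub>R (v, w) = \<alpha>"
      using \<alpha> h(1) by (simp_all add: v_def w_def prod_eq_iff)
    define f where "f \<tau> = G (fst z + \<tau> * v) (snd z + \<tau> * w)" for \<tau>
    have f: "smooth_curve f"
      unfolding f_def[abs_def] by (intro smooth_surfaceD[OF G] smooth_curve_intros)
    obtain \<xi> where \<xi>: "0 \<le> \<xi>" "\<xi> \<le> real m * h" "(fdiff h ^^ m) f 0 = h ^ m * (deriv ^^ m) f \<xi>"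
      using iterated_fdiff_mean_value[OF f h(1), of 0 m] by auto
    have "(fdiff h ^^ m) (\<lambda>\<tau>. (\<lambda>z. G (fst z) (snd z)) (z + \<tau> *\<^sub>R (v, w))) 0
        = (fdiff (h *\<^sub>R (v, w)) ^^ m) (\<lambda>z. G (fst z) (snd z)) (z + 0 *\<^sub>R (v, w))"
      by (rule iterated_fdiff_line)
    then have 1: "(fdiff \<alpha> ^^ m) (\<lambda>z. G (fst z) (snd z)) z = h ^ m * (deriv ^^ m) f \<xi>"
      unfolding vw(3) using \<xi>(3) by (simp add: f_def[abs_def] zero_prod_def[symmetric])
    have 2: "(deriv ^^ m) f \<xi> = (deriv ^^ m) (\<lambda>\<tau>. G ((fst z + \<xi> * v) + \<tau> * v) ((snd z + \<xi> * w) + \<tau> * w)) 0"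
      using iterated_deriv_affine[OF f, of m \<xi> 1] by (simp add: f_def algebra_simps)
    have b: "\<bar>\<xi> * r\<bar> \<le> real m * \<delta>'" if "\<bar>r\<bar> \<le> 1" for r
    proof -
      have "\<bar>\<xi> * r\<bar> \<le> \<xi> * 1"
        unfolding abs_mult using that \<xi>(1) by (intro mult_mono) auto
      also have "\<dots> \<le> real m * \<delta>'"
        using \<xi>(2) h(2) mult_left_mono[of h \<delta>' "real m"] by simp
      finally show ?thesis .
    qed
    have "\<bar>(deriv ^^ m) f \<xi>\<bar> \<le> C"
      unfolding 2 using z b[OF vw(1)] b[OF vw(2)] \<delta>'(2) by (intro C vw) auto
    then show ?thesis
      unfolding 1 abs_mult using h(1) mult_right_mono[of "\<bar>(deriv ^^ m) f \<xi>\<bar>" C "h ^ m"]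
      by (simp add: mult.commute)
  qed
  then show ?thesis
    using \<delta>'(1) C0 by blast
qed

lemma mixed_fdiff_cong: "(\<And>j. j \<in> {1..m} \<Longrightarrow> h j = h' j) \<Longrightarrow> mixed_fdiff h m f = mixed_fdiff h' m f"
  by (induction m) auto

text \<open>Polarization gives one iterated difference for each subset of \<open>{1..m}\<close>. The
  weights \<open>1 / real j\<close> are at most 1, so directions and shifts of the base point have
  components at most \<open>real m * h\<close>, whence the factor \<open>real m ^ m\<close> in
  \<open>K\<close>.\<close>

lemma smooth_surface_mixed_fdiff_bound:
  fixes G :: "real \<Rightarrow> real \<Rightarrow> real"
  assumes G: "smooth_surface G"
  defines "g \<equiv> \<lambda>z. G (fst z) (snd z)"
  shows "\<exists>\<delta>>0. \<exists>C\<ge>0. \<forall>z u w h. \<bar>fst z - a\<bar> \<le> \<delta> \<longrightarrow> \<bar>snd z - b\<bar> \<le> \<delta> \<longrightarrow> 0 < h \<longrightarrow> h \<le> \<delta> \<longrightarrow>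
    \<bar>fst u\<bar> \<le> h \<longrightarrow> \<bar>snd u\<bar> \<le> h \<longrightarrow> \<bar>fst w\<bar> \<le> h \<longrightarrow> \<bar>snd w\<bar> \<le> h \<longrightarrow>
    \<bar>fdiff u ((fdiff w ^^ k) g) z\<bar> \<le> C * h ^ Suc k"
proof -
  define m where "m = Suc k"
  obtain \<delta> C where \<delta>: "\<delta> > 0" and C0: "C \<ge> 0" and
    C: "\<And>z \<alpha> h. \<bar>fst z - a\<bar> \<le> \<delta> \<Longrightarrow> \<bar>snd z - b\<bar> \<le> \<delta> \<Longrightarrow> 0 < h \<Longrightarrow> h \<le> \<delta> \<Longrightarrow>
    \<bar>fst \<alpha>\<bar> \<le> h \<Longrightarrow> \<bar>snd \<alpha>\<bar> \<le> h \<Longrightarrow> \<bar>(fdiff \<alpha> ^^ m) g z\<bar> \<le> C * h ^ m"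
    using smooth_surface_fdiff_bound[OF G, of a b m] unfolding g_def by blast
  define \<delta>' where "\<delta>' = \<delta> / (real m + 1)"
  have "\<delta>' * (real m + 1) = \<delta>" "\<delta>' > 0"
    using \<delta> by (simp_all add: \<delta>'_def)
  then have \<delta>': "\<delta>' > 0" "\<delta>' + real m * \<delta>' = \<delta>"
    by (simp_all add: algebra_simps)
  define K where "K = real (card (Pow {1..m})) * (C * real m ^ m)"
  have K0: "0 \<le> K"
    using C0 by (simp add: K_def)
  have "\<bar>fdiff u ((fdiff w ^^ k) g) z\<bar> \<le> K * h ^ Suc k"
    if z: "\<bar>fst z - a\<bar> \<le> \<delta>'" "\<bar>snd z - b\<bar> \<le> \<delta>'" and h: "0 < h" "h \<le> \<delta>'"
      and uw: "\<bar>fst u\<bar> \<le> h" "\<bar>snd u\<bar> \<le> h" "\<bar>fst w\<bar> \<le> h" "\<bar>snd w\<bar> \<le> h" for z u w h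
  proof -
    define s where "s j = (if j = m then u else w)" for j :: nat
    have "mixed_fdiff s k g = mixed_fdiff (\<lambda>j. w) k g"
      by (rule mixed_fdiff_cong) (simp add: s_def m_def)
    then have 1: "fdiff u ((fdiff w ^^ k) g) z = mixed_fdiff s m g z"
      by (simp add: m_def mixed_fdiff_const) (simp add: s_def m_def)
    have s: "\<bar>fst (s j)\<bar> \<le> h" "\<bar>snd (s j)\<bar> \<le> h" for j
      using uw by (auto simp: s_def)
    have abs_sum: "\<bar>\<Sum>j\<in>S. c j\<bar> \<le> real m * h" if "S \<in> Pow {1..m}" "\<And>j. j \<in> S \<Longrightarrow> \<bar>c j\<bar> \<le> h"
      for S and c :: "nat \<Rightarrow> real"
    proof -
      have "\<bar>\<Sum>j\<in>S. c j\<bar> \<le> (\<Sum>j\<in>S. h)"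
        by (rule order_trans[OF sum_abs sum_mono]) (rule that(2))
      also have "\<dots> \<le> real m * h"
        using card_mono[of "{1..m}" S] that(1) h(1) by simp
      finally show ?thesis .
    qed
    have mh: "0 < real m * h" "real m * h \<le> real m * \<delta>'"
      using h by (auto simp: m_def)
    have summand: "\<bar>(- 1) ^ card S * (fdiff (- (\<Sum>j\<in>S. (1 / real j) *\<^sub>R s j)) ^^ m) g (z + (\<Sum>j\<in>S. s j))\<bar>
        \<le> C * (real m * h) ^ m" if S: "S \<in> Pow {1..m}" for S
    proof -
      have inv: "\<bar>1 / real j * r\<bar> \<le> h" if "j \<in> S" "\<bar>r\<bar> \<le> h" for j r
      proof -
        have "\<bar>1 / real j * r\<bar> \<le> 1 * \<bar>r\<bar>"
          unfolding abs_mult using that S by (intro mult_right_mono) auto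
        then show ?thesis
          using that(2) by simp
      qed
      have "\<bar>fst (- (\<Sum>j\<in>S. (1 / real j) *\<^sub>R s j))\<bar> \<le> real m * h"
        using abs_sum[OF S, of "\<lambda>j. 1 / real j * fst (s j)"] inv s by (simp add: fst_sum)
      moreover have "\<bar>snd (- (\<Sum>j\<in>S. (1 / real j) *\<^sub>R s j))\<bar> \<le> real m * h"
        using abs_sum[OF S, of "\<lambda>j. 1 / real j * snd (s j)"] inv s by (simp add: snd_sum)
      moreover have "\<bar>fst (z + (\<Sum>j\<in>S. s j)) - a\<bar> \<le> \<delta>"
        using abs_sum[OF S, of "\<lambda>j. fst (s j)"] s z mh \<delta>' by (simp add: fst_sum)
      moreover have "\<bar>snd (z + (\<Sum>j\<in>S. s j)) - b\<bar> \<le> \<delta>"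
        using abs_sum[OF S, of "\<lambda>j. snd (s j)"] s z mh \<delta>' by (simp add: snd_sum)
      ultimately have "\<bar>(fdiff (- (\<Sum>j\<in>S. (1 / real j) *\<^sub>R s j)) ^^ m) g (z + (\<Sum>j\<in>S. s j))\<bar>
          \<le> C * (real m * h) ^ m"
        using mh \<delta>' by (intro C) auto
      then show ?thesis
        by (simp add: abs_mult)
    qed
    have "\<bar>mixed_fdiff s m g z\<bar> \<le> (\<Sum>S\<in>Pow {1..m}. C * (real m * h) ^ m)"
      unfolding mixed_fdiff_polarization by (rule order_trans[OF sum_abs sum_mono]) (rule summand)
    also have "\<dots> = K * h ^ m"
      by (simp add: K_def power_mult_distrib)
    finally show ?thesis
      unfolding 1 by (simp add: m_def)
  qed
  then show ?thesis
    using \<delta>'(1) K0 by blast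
qed

text \<open>A step of length \<open>s\<close> in the second variable is subdivided into steps of the length \<open>h \<rightarrow> 0\<close> that
  is used in the first variable.\<close>

lemma smooth_surface_iterated_deriv_lipschitz:
  fixes G :: "real \<Rightarrow> real \<Rightarrow> real"
  assumes G: "smooth_surface G"
  shows "\<exists>\<delta>>0. \<exists>C\<ge>0. \<forall>t s. \<bar>t - a\<bar> \<le> \<delta> \<longrightarrow> 0 < s \<longrightarrow> s \<le> \<delta> \<longrightarrow>
    \<bar>(deriv ^^ k) (\<lambda>t. G t s) t - (deriv ^^ k) (\<lambda>t. G t 0) t\<bar> \<le> C * s"
proof -
  define g where "g = (\<lambda>z. G (fst z) (snd z))"
  obtain \<delta> C where \<delta>: "\<delta> > 0" and C0: "C \<ge> 0" and
    C: "\<And>z u w h. \<bar>fst z - a\<bar> \<le> \<delta> \<Longrightarrow> \<bar>snd z - 0\<bar> \<le> \<delta> \<Longrightarrow> 0 < h \<Longrightarrow> h \<le> \<delta> \<Longrightarrow>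
    \<bar>fst u\<bar> \<le> h \<Longrightarrow> \<bar>snd u\<bar> \<le> h \<Longrightarrow> \<bar>fst w\<bar> \<le> h \<Longrightarrow> \<bar>snd w\<bar> \<le> h \<Longrightarrow>
    \<bar>fdiff u ((fdiff w ^^ k) g) z\<bar> \<le> C * h ^ Suc k"
    using smooth_surface_mixed_fdiff_bound[OF G, of a 0 k] unfolding g_def by blast
  have slice: "smooth_curve (\<lambda>t. G t s)" for s
    by (intro smooth_surfaceD[OF G] smooth_curve_intros)
  have "\<bar>(deriv ^^ k) (\<lambda>t. G t s) t - (deriv ^^ k) (\<lambda>t. G t 0) t\<bar> \<le> 2 * C * s"
    if t: "\<bar>t - a\<bar> \<le> \<delta>" and s: "0 < s" "s \<le> \<delta>" for t s
  proof -
    have bound: "\<bar>(fdiff h ^^ k) (\<lambda>t. G t s) t / h ^ k - (fdiff h ^^ k) (\<lambda>t. G t 0) t / h ^ k\<bar> \<le> 2 * C * s"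
      if h: "0 < h" "h \<le> s" for h
    proof -
      define F where "F = (fdiff (h, 0) ^^ k) g"
      have F: "F (t, r) = (fdiff h ^^ k) (\<lambda>t. G t r) t" for r
        using iterated_fdiff_line[where k = h and m = k and f = g and x = "(0, r)" and v = "(1, 0)" and \<tau> = t] by (simp add: F_def g_def)
      \<comment> \<open>Since \<open>h \<le> s\<close>, there are at most \<open>2 * (s / h)\<close>
        substeps. Each costs \<open>C * h ^ Suc k\<close>, and division by \<open>h ^ k\<close>
        leaves \<open>2 * C * s\<close>, independent of \<open>h\<close>.\<close>
      define M where "M = nat \<lceil>s / h\<rceil>"
      have M: "s / h \<le> real M" "real M \<le> s / h + 1" "0 < real M"
        using s h by (auto simp: M_def)
      define \<sigma> where "\<sigma> = s / real M"
      have \<sigma>: "0 < \<sigma>" "\<sigma> \<le> h" "real M * \<sigma> = s"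
        using M s h by (auto simp: \<sigma>_def field_simps)
      have "F (t, s) - F (t, 0) = (\<Sum>i<M. F (t, real (Suc i) * \<sigma>) - F (t, real i * \<sigma>))"
        using sum_lessThan_telescope[of "\<lambda>i. F (t, real i * \<sigma>)" M] \<sigma>(3) by simp
      also have "\<bar>\<dots>\<bar> \<le> (\<Sum>i<M. C * h ^ Suc k)"
      proof (rule order_trans[OF sum_abs sum_mono])
        fix i
        assume "i \<in> {..<M}"
        then have "real i * \<sigma> \<le> real M * \<sigma>"
          using \<sigma>(1) by (intro mult_right_mono) auto
        then have "\<bar>fdiff (0, \<sigma>) F (t, real i * \<sigma>)\<bar> \<le> C * h ^ Suc k"
          unfolding F_def using \<sigma> t s h by (intro C) auto
        then show "\<bar>F (t, real (Suc i) * \<sigma>) - F (t, real i * \<sigma>)\<bar> \<le> C * h ^ Suc k"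
          by (simp add: fdiff_def algebra_simps)
      qed
      also have "\<dots> = real M * (C * h ^ Suc k)"
        by simp
      also have "\<dots> \<le> (2 * (s / h)) * (C * h ^ Suc k)"
      proof (rule mult_right_mono)
        have "1 \<le> s / h"
          using h by simp
        then show "real M \<le> 2 * (s / h)"
          using M(2) by linarith
      qed (use C0 h in simp)
      also have "\<dots> = 2 * C * s * h ^ k"
        using h by simp
      finally have "\<bar>F (t, s) - F (t, 0)\<bar> / h ^ k \<le> 2 * C * s"
        using h by (simp add: pos_divide_le_eq)
      then show ?thesis
        using h by (simp add: F diff_divide_distrib[symmetric])
    qed
    have lim: "((\<lambda>h. \<bar>(fdiff h ^^ k) (\<lambda>t. G t s) t / h ^ k - (fdiff h ^^ k) (\<lambda>t. G t 0) t / h ^ k\<bar>)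
        \<longlongrightarrow> \<bar>(deriv ^^ k) (\<lambda>t. G t s) t - (deriv ^^ k) (\<lambda>t. G t 0) t\<bar>) (at_right 0)"
      by (intro tendsto_rabs tendsto_diff iterated_fdiff_tendsto_deriv slice)
    have "\<forall>\<^sub>F h in at_right 0. h \<in> {0<..<s}"
      using eventually_at_right[OF s(1)] s(1) by auto
    then have ev: "\<forall>\<^sub>F h in at_right 0. \<bar>(fdiff h ^^ k) (\<lambda>t. G t s) t / h ^ k - (fdiff h ^^ k) (\<lambda>t. G t 0) t / h ^ k\<bar> \<le> 2 * C * s"
      by (rule eventually_mono) (rule bound; simp)
    show ?thesis
      by (rule tendsto_upperbound[OF lim ev]) simp
  qed
  moreover have "0 \<le> 2 * C"
    using C0 by simp
  ultimately show ?thesis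
    using \<delta> by blast
qed



subsection \<open>Partial derivatives of smooth surfaces\<close>

lemma second_order_remainder_bound:
  fixes f :: "real \<Rightarrow> real"
  assumes f: "smooth_curve f" and C: "\<And>s. \<bar>s - t\<bar> \<le> \<bar>h\<bar> \<Longrightarrow> \<bar>deriv (deriv f) s\<bar> \<le> C" and "h \<noteq> 0"
  shows "\<bar>(f (t + h) - f t) / h - deriv f t\<bar> \<le> C * \<bar>h\<bar>"
proof -
  note p = continuous_seminorm_abs
  have D: "has_curve_derivative f (deriv f s) s" "has_curve_derivative (deriv f) (deriv (deriv f) s) s" for s
    using smooth_curve_DERIV[OF f] smooth_curve_DERIV(1)[OF smooth_curve_DERIV(2)[OF f]]
    by (auto simp: has_curve_derivative_real_iff)
  have "0 \<le> C"
    using C[of t] by simp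
  have d: "\<bar>deriv f s - deriv f t\<bar> \<le> C * \<bar>h\<bar>" if "\<bar>s - t\<bar> \<le> \<bar>h\<bar>" for s
  proof -
    have "\<bar>deriv f (t + (s - t)) - deriv f t\<bar> \<le> C * \<bar>s - t\<bar>"
      by (rule seminorm_mean_value_abs[OF p D(2)]) (use C that in auto)
    also have "\<dots> \<le> C * \<bar>h\<bar>"
      using that \<open>0 \<le> C\<close> by (rule mult_left_mono)
    finally show ?thesis
      by simp
  qed
  let ?k = "\<lambda>s. f s - s * deriv f t"
  have k: "has_curve_derivative ?k (deriv f s - deriv f t) s" for s
    unfolding has_curve_derivative_real_iff
    by (auto intro!: derivative_eq_intros smooth_curve_DERIV(1)[OF f])
  have "\<bar>?k (t + h) - ?k t\<bar> \<le> (C * \<bar>h\<bar>) * \<bar>h\<bar>"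
    by (rule seminorm_mean_value_abs[OF p k d])
  moreover have "?k (t + h) - ?k t = ((f (t + h) - f t) / h - deriv f t) * h"
    using \<open>h \<noteq> 0\<close> by (simp add: field_simps)
  ultimately show ?thesis
    using \<open>h \<noteq> 0\<close> by (simp add: abs_mult)
qed

text \<open>The bound on second derivatives makes the difference quotients approximate the
  derivatives uniformly in \<open>n\<close>. Convergence of the quotients for one small
  \<open>h\<close> then makes the derivatives Cauchy, and the same inequality passes to the
  limit.\<close>

lemma pointwise_limit_derivative:
  fixes f :: "nat \<Rightarrow> real \<Rightarrow> real"
  assumes f: "\<And>n. smooth_curve (f n)" and lim: "\<And>t. (\<lambda>n. f n t) \<longlonglongrightarrow> \<phi> t"
    and \<delta>: "\<delta> > 0" and C: "\<And>n s. n \<ge> N \<Longrightarrow> \<bar>s - t\<bar> \<le> \<delta> \<Longrightarrow> \<bar>deriv (deriv (f n)) s\<bar> \<le> C"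
  shows "\<exists>L. (\<lambda>n. deriv (f n) t) \<longlonglongrightarrow> L \<and> (\<phi> has_real_derivative L) (at t)"
proof -
  have C0: "0 \<le> C"
    using C[of N t] \<delta> by simp
  have q: "\<bar>(f n (t + h) - f n t) / h - deriv (f n) t\<bar> \<le> C * \<bar>h\<bar>"
    if "n \<ge> N" "h \<noteq> 0" "\<bar>h\<bar> \<le> \<delta>" for n h
    by (rule second_order_remainder_bound[OF f]) (use C that in auto)
  have Q: "(\<lambda>n. (f n (t + h) - f n t) / h) \<longlonglongrightarrow> (\<phi> (t + h) - \<phi> t) / h" if "h \<noteq> 0" for h
    by (intro tendsto_intros lim that)
  have "Cauchy (\<lambda>n. deriv (f n) t)"
    unfolding Cauchy_def
  proof (intro allI impI)
    fix e :: real
    assume e: "0 < e"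
    \<comment> \<open>The choice gives \<open>C * h < e / 4\<close>; adding 1 to \<open>C\<close>
      keeps the quotient defined for \<open>C = 0\<close>.\<close>
    define h where "h = min \<delta> (e / (4 * (C + 1)))"
    have h: "0 < h" "h \<le> \<delta>"
      using e \<delta> C0 by (auto simp: h_def)
    have "C * h \<le> C * (e / (4 * (C + 1)))"
      using C0 by (intro mult_left_mono) (auto simp: h_def)
    also have "\<dots> < e / 4"
      using C0 e by (simp add: field_simps)
    finally have Ch: "C * h < e / 4" .
    obtain M where M: "\<And>m n. m \<ge> M \<Longrightarrow> n \<ge> M \<Longrightarrow>
        dist ((f m (t + h) - f m t) / h) ((f n (t + h) - f n t) / h) < e / 2"
      using metric_CauchyD[OF LIMSEQ_imp_Cauchy[OF Q[of h]], of "e / 2"] h(1) e by auto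
    have "dist (deriv (f m) t) (deriv (f n) t) < e" if "m \<ge> max M N" "n \<ge> max M N" for m n
    proof -
      have "\<bar>(f m (t + h) - f m t) / h - deriv (f m) t\<bar> < e / 4" "\<bar>(f n (t + h) - f n t) / h - deriv (f n) t\<bar> < e / 4"
        using q[of m h] q[of n h] that h Ch by auto
      moreover have "\<bar>(f m (t + h) - f m t) / h - (f n (t + h) - f n t) / h\<bar> < e / 2"
        using M[of m n] that by (simp add: dist_real_def)
      ultimately show ?thesis
        unfolding dist_real_def by linarith
    qed
    then show "\<exists>M. \<forall>m\<ge>M. \<forall>n\<ge>M. dist (deriv (f m) t) (deriv (f n) t) < e"
      by blast
  qed
  then obtain L where L: "(\<lambda>n. deriv (f n) t) \<longlonglongrightarrow> L"
    using Cauchy_convergent convergent_def by blast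
  have "\<bar>(\<phi> (t + h) - \<phi> t) / h - L\<bar> \<le> C * \<bar>h\<bar>" if "h \<noteq> 0" "\<bar>h\<bar> \<le> \<delta>" for h
  proof (rule tendsto_upperbound)
    show "(\<lambda>n. \<bar>(f n (t + h) - f n t) / h - deriv (f n) t\<bar>) \<longlonglongrightarrow> \<bar>(\<phi> (t + h) - \<phi> t) / h - L\<bar>"
      by (intro tendsto_rabs tendsto_diff Q L that)
    show "\<forall>\<^sub>F n in sequentially. \<bar>(f n (t + h) - f n t) / h - deriv (f n) t\<bar> \<le> C * \<bar>h\<bar>"
      using eventually_ge_at_top[of N] by (rule eventually_mono) (rule q; use that in simp)
  qed simp
  then have "\<forall>\<^sub>F h in at 0. norm ((\<phi> (t + h) - \<phi> t) / h - L) \<le> C * \<bar>h\<bar>"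
    using \<delta> unfolding eventually_at by (auto intro!: exI[of _ \<delta>] simp: dist_real_def)
  moreover have "((\<lambda>h. C * \<bar>h\<bar>) \<longlongrightarrow> 0) (at (0::real))"
    by (auto intro!: tendsto_eq_intros)
  ultimately have "((\<lambda>h. (\<phi> (t + h) - \<phi> t) / h - L) \<longlongrightarrow> 0) (at 0)"
    by (rule Lim_null_comparison)
  then have "(\<phi> has_real_derivative L) (at t)"
    unfolding DERIV_def by (rule LIM_zero_cancel)
  then show ?thesis
    using L by blast
qed

text \<open>Bootstrapping: convergence of the k-th derivatives together with the bound of order k +
  2 gives convergence of the next derivatives and differentiability of the limit.\<close>

lemma pointwise_limit_smooth:
  fixes F :: "nat \<Rightarrow> real \<Rightarrow> real"
  assumes F: "\<And>n. smooth_curve (F n)" and lim: "\<And>t. (\<lambda>n. F n t) \<longlonglongrightarrow> \<phi> t"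
    and C: "\<And>k t. \<exists>\<delta>>0. \<exists>N C. \<forall>n\<ge>N. \<forall>s. \<bar>s - t\<bar> \<le> \<delta> \<longrightarrow> \<bar>(deriv ^^ k) (F n) s\<bar> \<le> C"
  shows "smooth_curve \<phi>"
proof -
  define D where "D k t = lim (\<lambda>n. (deriv ^^ k) (F n) t)" for k t
  have step: "\<exists>L. (\<lambda>n. (deriv ^^ Suc k) (F n) t) \<longlonglongrightarrow> L \<and> (D k has_real_derivative L) (at t)"
    if k: "\<And>t. (\<lambda>n. (deriv ^^ k) (F n) t) \<longlonglongrightarrow> D k t" for k t
  proof -
    obtain \<delta> N C where "\<delta> > 0" "\<And>n s. n \<ge> N \<Longrightarrow> \<bar>s - t\<bar> \<le> \<delta> \<Longrightarrow> \<bar>(deriv ^^ Suc (Suc k)) (F n) s\<bar> \<le> C"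
      using C[of t "Suc (Suc k)"] by blast
    then show ?thesis
      using pointwise_limit_derivative[of "\<lambda>n. (deriv ^^ k) (F n)" "D k" \<delta> N t C]
        smooth_curve_iterated_deriv[OF F] k by simp
  qed
  have conv: "(\<lambda>n. (deriv ^^ k) (F n) t) \<longlonglongrightarrow> D k t" for k t
  proof (induction k arbitrary: t)
    case 0
    then show ?case
      using lim[of t] by (simp add: D_def limI)
  next
    case (Suc k)
    then show ?case
      using step[OF Suc.IH, of t] unfolding D_def by (auto simp: limI)
  qed
  have "(D k has_real_derivative D (Suc k) t) (at t)" for k t
    using step[OF conv, of k t] conv[of "Suc k" t] LIMSEQ_unique by blast
  moreover have "D 0 = \<phi>"
    using lim by (simp add: D_def fun_eq_iff limI)
  ultimately show ?thesis
    unfolding smooth_curve_on_def has_curve_derivative_real_iff by blast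
qed

text \<open>The Lipschitz estimate in \<open>s\<close>, divided by
  \<open>s = 1 / real (Suc n)\<close>, is exactly the local bound that
  \<open>pointwise_limit_smooth\<close> asks for.\<close>

theorem smooth_surface_partial_smooth:
  fixes G :: "real \<Rightarrow> real \<Rightarrow> real"
  assumes G: "smooth_surface G"
  shows "smooth_curve (\<lambda>t. deriv (G t) 0)"
proof -
  define F where "F n t = real (Suc n) * (G t (1 / real (Suc n)) - G t 0)" for n t
  have slice: "smooth_curve (\<lambda>t. G t s)" "smooth_curve (G s)" for s
    by (intro smooth_surfaceD[OF G, of "\<lambda>t. t" "\<lambda>t. s"] smooth_surfaceD[OF G, of "\<lambda>t. s" "\<lambda>t. t"]
        smooth_curve_intros)+
  have DF: "(deriv ^^ k) (F n) t = real (Suc n) *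
      ((deriv ^^ k) (\<lambda>t. G t (1 / real (Suc n))) t - (deriv ^^ k) (\<lambda>t. G t 0) t)" for k n t
    unfolding F_def[abs_def]
    by (simp only: iterated_deriv_cmult smooth_curve_intros slice iterated_deriv_diff)
  show ?thesis
  proof (rule pointwise_limit_smooth[of F])
    show "smooth_curve (F n)" for n
      unfolding F_def[abs_def] by (intro smooth_curve_intros slice)
    show "(\<lambda>n. F n t) \<longlonglongrightarrow> deriv (G t) 0" for t
    proof -
      have "((\<lambda>h. (G t (0 + h) - G t 0) / h) \<longlongrightarrow> deriv (G t) 0) (at 0)"
        using smooth_curve_DERIV(1)[OF slice(2)] unfolding DERIV_def .
      moreover have "filterlim (\<lambda>n. 1 / real (Suc n)) (at 0) sequentially"
        using LIMSEQ_inverse_real_of_nat by (intro filterlim_atI) (auto simp: inverse_eq_divide)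
      ultimately have "(\<lambda>n. (G t (0 + 1 / real (Suc n)) - G t 0) / (1 / real (Suc n))) \<longlonglongrightarrow> deriv (G t) 0"
        by (rule filterlim_compose)
      then show ?thesis
        by (simp add: F_def mult.commute)
    qed
    show "\<exists>\<delta>>0. \<exists>N C. \<forall>n\<ge>N. \<forall>s. \<bar>s - t\<bar> \<le> \<delta> \<longrightarrow> \<bar>(deriv ^^ k) (F n) s\<bar> \<le> C" for k t
    proof -
      obtain \<delta> C where \<delta>: "\<delta> > 0" and C: "\<And>r s. \<bar>r - t\<bar> \<le> \<delta> \<Longrightarrow> 0 < s \<Longrightarrow> s \<le> \<delta> \<Longrightarrow>
          \<bar>(deriv ^^ k) (\<lambda>t. G t s) r - (deriv ^^ k) (\<lambda>t. G t 0) r\<bar> \<le> C * s"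
        using smooth_surface_iterated_deriv_lipschitz[OF G, of t k] by blast
      obtain N where N: "1 / real (Suc N) < \<delta>"
        using nat_approx_posE[OF \<delta>] .
      have "\<bar>(deriv ^^ k) (F n) s\<bar> \<le> C" if n: "n \<ge> N" and s: "\<bar>s - t\<bar> \<le> \<delta>" for n s
      proof -
        have "1 / real (Suc n) \<le> 1 / real (Suc N)"
          using n by (simp add: frac_le)
        then have "\<bar>(deriv ^^ k) (\<lambda>t. G t (1 / real (Suc n))) s - (deriv ^^ k) (\<lambda>t. G t 0) s\<bar> \<le> C * (1 / real (Suc n))"
          using s N by (intro C) auto
        then have "real (Suc n) * \<bar>(deriv ^^ k) (\<lambda>t. G t (1 / real (Suc n))) s - (deriv ^^ k) (\<lambda>t. G t 0) s\<bar>
            \<le> real (Suc n) * (C * (1 / real (Suc n)))"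
          by (rule mult_left_mono) simp
        then show ?thesis
          unfolding DF abs_mult by simp
      qed
      then show ?thesis
        using \<delta> by blast
    qed
  qed
qed

lemma smooth_surface_slices:
  assumes "smooth_surface G"
  shows "smooth_curve (\<lambda>t. G t s)" "smooth_curve (G t)"
  by (rule smooth_surfaceD[OF assms smooth_curve_intros(2,1)], rule smooth_surfaceD[OF assms smooth_curve_intros(1,2)])

lemma smooth_surface_shift:
  fixes G :: "real \<Rightarrow> real \<Rightarrow> 'a::locally_convex_space"
  assumes "smooth_surface G" "smooth_curve x" "smooth_curve y"
  shows "smooth_surface (\<lambda>t s. G (x t) (y t + s))"
  unfolding smooth_surface_def
proof (intro allI impI)
  fix r q :: "real \<Rightarrow> real"
  assume r: "smooth_curve r" and q: "smooth_curve q"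
  show "smooth_curve (\<lambda>t. G (x (r t)) (y (r t) + q t))"
    by (rule smooth_surfaceD[OF assms(1) smooth_curve_compose[OF assms(2) r]
          smooth_curve_intros(3)[OF smooth_curve_compose[OF assms(3) r] q]])
qed

text \<open>Replacing the second variable by \<open>y t + s\<close> turns the derivative at a moving
  point into one at 0.\<close>

lemma smooth_surface_deriv_second:
  fixes G :: "real \<Rightarrow> real \<Rightarrow> real"
  assumes G: "smooth_surface G"
  shows "smooth_surface (\<lambda>t s. deriv (G t) s)"
  unfolding smooth_surface_def
proof (intro allI impI)
  fix x y :: "real \<Rightarrow> real"
  assume xy: "smooth_curve x" "smooth_curve y"
  have "deriv (\<lambda>s. G (x t) (y t + s)) 0 = deriv (G (x t)) (y t)" for t
    using smooth_curve_DERIV(1)[OF smooth_surface_slices(2)[OF G], of "x t" "y t"]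
    by (intro DERIV_imp_deriv) (simp add: DERIV_def)
  then show "smooth_curve (\<lambda>t. deriv (G (x t)) (y t))"
    using smooth_surface_partial_smooth[OF smooth_surface_shift[OF G xy]] by simp
qed

lemma smooth_surface_deriv_first:
  fixes G :: "real \<Rightarrow> real \<Rightarrow> real"
  assumes "smooth_surface G"
  shows "smooth_surface (\<lambda>t s. deriv (\<lambda>t. G t s) t)"
  using smooth_surface_swap[OF smooth_surface_deriv_second[OF smooth_surface_swap[OF assms]]] .

lemma mean_value_between:
  fixes f :: "real \<Rightarrow> real"
  assumes "smooth_curve f"
  shows "\<exists>\<xi>. \<bar>\<xi>\<bar> \<le> \<bar>h\<bar> \<and> f (a + h) - f a = h * deriv f (a + \<xi>)"
proof -
  consider "h = 0" | "0 < h" | "h < 0"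
    by linarith
  then show ?thesis
  proof cases
    case 1
    then show ?thesis
      by (intro exI[of _ 0]) simp
  next
    case 2
    then obtain z where "a < z" "z < a + h" "f (a + h) - f a = (a + h - a) * deriv f z"
      using MVT2[of a "a + h" f "deriv f"] smooth_curve_DERIV(1)[OF assms] by auto
    then show ?thesis
      by (intro exI[of _ "z - a"]) auto
  next
    case 3
    then obtain z where "a + h < z" "z < a" "f a - f (a + h) = (a - (a + h)) * deriv f z"
      using MVT2[of "a + h" a f "deriv f"] smooth_curve_DERIV(1)[OF assms] by auto
    then show ?thesis
      by (intro exI[of _ "z - a"]) (auto simp: algebra_simps)
  qed
qed

lemma tendsto_dominated_abs:
  fixes x :: "real \<Rightarrow> real"
  assumes "\<And>h. \<bar>x h\<bar> \<le> \<bar>h\<bar>"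
  shows "((\<lambda>h. a + x h) \<longlongrightarrow> a) (at 0)"
proof -
  have "((\<lambda>h. \<bar>h\<bar>) \<longlongrightarrow> 0) (at (0::real))"
    by (auto intro!: tendsto_eq_intros)
  then have "(x \<longlongrightarrow> 0) (at 0)"
    by (rule Lim_null_comparison[rotated]) (simp add: assms)
  from tendsto_add[OF tendsto_const this] show ?thesis
    by simp
qed

text \<open>The increment is split at \<open>(a + h, a)\<close>. Its second half is a partial
  derivative at an intermediate point, which converges by joint continuity.\<close>

lemma smooth_surface_diagonal_DERIV:
  fixes G :: "real \<Rightarrow> real \<Rightarrow> real"
  assumes G: "smooth_surface G"
  shows "((\<lambda>t. G t t) has_real_derivative deriv (\<lambda>t. G t a) a + deriv (G a) a) (at a)"
proof -
  have "\<forall>h. \<exists>\<xi>. \<bar>\<xi>\<bar> \<le> \<bar>h\<bar> \<and> G (a + h) (a + h) - G (a + h) a = h * deriv (G (a + h)) (a + \<xi>)"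
    using mean_value_between[OF smooth_surface_slices(2)[OF G]] by blast
  from choice[OF this] obtain \<xi> where \<xi>: "\<And>h. \<bar>\<xi> h\<bar> \<le> \<bar>h\<bar>"
      "\<And>h. G (a + h) (a + h) - G (a + h) a = h * deriv (G (a + h)) (a + \<xi> h)"
    by blast
  have lim: "((\<lambda>h. deriv (G (a + h)) (a + \<xi> h)) \<longlongrightarrow> deriv (G a) a) (at 0)"
    by (intro smooth_surface_tendsto[OF smooth_surface_deriv_second[OF G]] tendsto_dominated_abs \<xi>(1)) simp
  have first: "((\<lambda>h. (G (a + h) a - G a a) / h) \<longlongrightarrow> deriv (\<lambda>t. G t a) a) (at 0)"
    using smooth_curve_DERIV(1)[OF smooth_surface_slices(1)[OF G]] unfolding DERIV_def .
  have "((\<lambda>h. (G (a + h) (a + h) - G a a) / h) \<longlongrightarrow> deriv (\<lambda>t. G t a) a + deriv (G a) a) (at 0)"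
  proof (rule Lim_transform_eventually[OF tendsto_add[OF first lim]])
    show "\<forall>\<^sub>F h in at 0. (G (a + h) a - G a a) / h + deriv (G (a + h)) (a + \<xi> h)
        = (G (a + h) (a + h) - G a a) / h"
      unfolding eventually_at_filter
    proof (intro always_eventually allI impI)
      fix h :: real
      assume "h \<noteq> 0"
      then have "deriv (G (a + h)) (a + \<xi> h) = (G (a + h) (a + h) - G (a + h) a) / h"
        using \<xi>(2)[of h] by simp
      then show "(G (a + h) a - G a a) / h + deriv (G (a + h)) (a + \<xi> h) = (G (a + h) (a + h) - G a a) / h"
        by (simp add: add_divide_distrib[symmetric])
    qed
  qed
  then show ?thesis
    unfolding DERIV_def .
qed

text \<open>The quotient is symmetric in the two variables, so its limit identifies both mixed
  partial derivatives.\<close>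

lemma smooth_surface_second_difference:
  fixes G :: "real \<Rightarrow> real \<Rightarrow> real"
  assumes G: "smooth_surface G"
  shows "((\<lambda>h. (G (a + h) (b + h) - G (a + h) b - G a (b + h) + G a b) / h\<^sup>2) \<longlongrightarrow>
    deriv (\<lambda>s. deriv (G s) b) a) (at 0)"
proof -
  let ?H = "\<lambda>s t. deriv (\<lambda>s. deriv (G s) t) s"
  have H: "smooth_surface ?H"
    by (rule smooth_surface_deriv_first[OF smooth_surface_deriv_second[OF G]])
  have "\<forall>h. \<exists>z. \<bar>fst z\<bar> \<le> \<bar>h\<bar> \<and> \<bar>snd z\<bar> \<le> \<bar>h\<bar> \<and>
      G (a + h) (b + h) - G (a + h) b - G a (b + h) + G a b = h\<^sup>2 * ?H (a + fst z) (b + snd z)"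
  proof
    fix h
    have diff: "smooth_curve (\<lambda>t. G (a + h) t - G a t)"
      by (intro smooth_curve_intros smooth_surface_slices[OF G])
    obtain \<xi> where \<xi>: "\<bar>\<xi>\<bar> \<le> \<bar>h\<bar>" "(G (a + h) (b + h) - G a (b + h)) - (G (a + h) b - G a b)
        = h * deriv (\<lambda>t. G (a + h) t - G a t) (b + \<xi>)"
      using mean_value_between[OF diff, of h b] by blast
    have 1: "deriv (\<lambda>t. G (a + h) t - G a t) (b + \<xi>) = deriv (G (a + h)) (b + \<xi>) - deriv (G a) (b + \<xi>)"
      by (intro DERIV_imp_deriv DERIV_diff smooth_curve_DERIV(1) smooth_surface_slices(2)[OF G])
    obtain \<zeta> where \<zeta>: "\<bar>\<zeta>\<bar> \<le> \<bar>h\<bar>" "deriv (G (a + h)) (b + \<xi>) - deriv (G a) (b + \<xi>) = h * ?H (a + \<zeta>) (b + \<xi>)"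
      using mean_value_between[OF smooth_surface_slices(1)[OF smooth_surface_deriv_second[OF G]], of h a "b + \<xi>"]
      by blast
    show "\<exists>z. \<bar>fst z\<bar> \<le> \<bar>h\<bar> \<and> \<bar>snd z\<bar> \<le> \<bar>h\<bar> \<and>
      G (a + h) (b + h) - G (a + h) b - G a (b + h) + G a b = h\<^sup>2 * ?H (a + fst z) (b + snd z)"
      using \<xi> \<zeta> 1 by (intro exI[of _ "(\<zeta>, \<xi>)"]) (simp add: power2_eq_square)
  qed
  from choice[OF this] obtain z where z: "\<And>h. \<bar>fst (z h)\<bar> \<le> \<bar>h\<bar>" "\<And>h. \<bar>snd (z h)\<bar> \<le> \<bar>h\<bar>"
      "\<And>h. G (a + h) (b + h) - G (a + h) b - G a (b + h) + G a b = h\<^sup>2 * ?H (a + fst (z h)) (b + snd (z h))"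
    by blast
  have "((\<lambda>h. ?H (a + fst (z h)) (b + snd (z h))) \<longlongrightarrow> ?H a b) (at 0)"
    by (intro smooth_surface_tendsto[OF H] tendsto_dominated_abs z)
  then show ?thesis
    by (rule Lim_transform_eventually) (simp add: z(3) eventually_at_filter)
qed

lemma smooth_surface_mixed_partials:
  fixes G :: "real \<Rightarrow> real \<Rightarrow> real"
  assumes G: "smooth_surface G"
  shows "deriv (\<lambda>s. deriv (G s) b) a = deriv (\<lambda>t. deriv (\<lambda>s. G s t) a) b"
proof -
  have "((\<lambda>h. (G (a + h) (b + h) - G a (b + h) - G (a + h) b + G a b) / h\<^sup>2) \<longlongrightarrow>
      deriv (\<lambda>t. deriv (\<lambda>s. G s t) a) b) (at 0)"
    using smooth_surface_second_difference[OF smooth_surface_swap[OF G], where a = b and b = a] .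
  then have "((\<lambda>h. (G (a + h) (b + h) - G (a + h) b - G a (b + h) + G a b) / h\<^sup>2) \<longlongrightarrow>
      deriv (\<lambda>t. deriv (\<lambda>s. G s t) a) b) (at 0)"
    by (simp add: algebra_simps)
  then show ?thesis
    using smooth_surface_second_difference[OF G, where a = a and b = b] by (intro tendsto_unique[of "at 0"]) auto
qed

section \<open>Calculus in locally convex spaces\<close>

text \<open>Precomposition with this function keeps the germ of a curve at 0 but confines the time
  to \<open>\<bar>t\<bar> \<le> \<epsilon>\<close>. It produces the global curves on which
  \<open>smooth_on\<close> can be tested.\<close>

definition cutoff :: "real \<Rightarrow> real \<Rightarrow> real" where
  "cutoff \<epsilon> t = t * bump (t / \<epsilon>)"

lemma smooth_curve_cutoff: "\<epsilon> \<noteq> 0 \<Longrightarrow> smooth_curve (cutoff \<epsilon>)"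
proof -
  assume "\<epsilon> \<noteq> 0"
  have "smooth_curve (\<lambda>t. bump (inverse \<epsilon> * t))"
    by (intro smooth_curve_compose[OF smooth_curve_bump] smooth_curve_intros)
  then have "smooth_curve (\<lambda>t. t * bump (inverse \<epsilon> * t))"
    by (intro smooth_curve_intros)
  then show ?thesis
    unfolding cutoff_def[abs_def] by (simp add: divide_inverse mult.commute)
qed

lemma abs_cutoff_le:
  assumes "0 < \<epsilon>"
  shows "\<bar>cutoff \<epsilon> t\<bar> \<le> \<epsilon>"
proof (cases "\<bar>t\<bar> \<le> \<epsilon>")
  case True
  have "\<bar>cutoff \<epsilon> t\<bar> \<le> \<bar>t\<bar> * 1"
    unfolding cutoff_def abs_mult using bump_bounds[of "t / \<epsilon>"] by (intro mult_left_mono) auto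
  then show ?thesis
    using True by simp
next
  case False
  then have "1 < \<bar>t\<bar> / \<epsilon>"
    using assms by simp
  then have "1 / 4 < \<bar>t / \<epsilon>\<bar>"
    using assms by (simp add: abs_divide)
  then show ?thesis
    using assms by (simp add: cutoff_def bump_eq_0)
qed

lemma eventually_cutoff_eq:
  assumes "0 < \<epsilon>"
  shows "\<forall>\<^sub>F t in nhds 0. cutoff \<epsilon> t = t"
proof -
  have "open {t. \<bar>t\<bar> < \<epsilon> / 8}"
    by (intro open_Collect_less continuous_intros)
  then have "\<forall>\<^sub>F t in nhds 0. t \<in> {t. \<bar>t\<bar> < \<epsilon> / 8}"
    using assms by (intro eventually_nhds_in_open) auto
  then show ?thesis
  proof (rule eventually_mono)
    fix t
    assume "t \<in> {t. \<bar>t\<bar> < \<epsilon> / 8}"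
    then have "\<bar>t / \<epsilon>\<bar> \<le> 1 / 8"
      using assms by (simp add: abs_divide divide_le_eq)
    then show "cutoff \<epsilon> t = t"
      by (simp add: cutoff_def bump_eq_1)
  qed
qed

lemma DERIV_transfer_eventually:
  fixes f g :: "real \<Rightarrow> real"
  shows "\<forall>\<^sub>F s in nhds t. f s = g s \<Longrightarrow> (f has_real_derivative d) (at t) \<Longrightarrow> (g has_real_derivative d) (at t)"
  using DERIV_cong_ev[of t t f g d d] by simp

lemma cutoff_0 [simp]: "cutoff \<epsilon> 0 = 0"
  by (simp add: cutoff_def)

section \<open>Localisation of germs\<close>

lemma eventually_nhds_unshift:
  fixes t :: real
  assumes "\<forall>\<^sub>F h in nhds 0. P h"
  shows "\<forall>\<^sub>F s in nhds t. P (s - t)"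
proof -
  have "((\<lambda>s. s - t) \<longlongrightarrow> t - t) (nhds t)"
    by (intro tendsto_diff tendsto_const filterlim_ident)
  then show ?thesis
    using assms unfolding filterlim_iff by simp
qed

text \<open>\<^const>\<open>smooth_at\<close> does not imply smoothness in a neighbourhood.\<close>

definition smooth_near :: "(real \<Rightarrow> 'a::{real_vector,topological_space}) \<Rightarrow> real \<Rightarrow> bool" where
  "smooth_near c t \<longleftrightarrow> (\<forall>\<^sub>F s in nhds t. smooth_at c s)"

lemma smooth_near_imp_smooth_at: "smooth_near c t \<Longrightarrow> smooth_at c t"
  unfolding smooth_near_def by (rule eventually_nhds_x_imp_x)

lemma smooth_curve_imp_smooth_near:
  fixes c :: "real \<Rightarrow> 'a::{real_vector,t2_space}"
  shows "smooth_curve c \<Longrightarrow> smooth_near c t"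
  unfolding smooth_near_def smooth_curve_iff_smooth_at by (auto intro: always_eventually)

lemma smooth_near_cong:
  assumes "\<forall>\<^sub>F s in nhds t. c s = k s"
  shows "smooth_near c t \<longleftrightarrow> smooth_near k t"
proof -
  have "\<forall>\<^sub>F s in nhds t. \<forall>\<^sub>F r in nhds s. c r = k r"
    using assms by (simp add: eventually_eventually)
  then have "\<forall>\<^sub>F s in nhds t. smooth_at c s \<longleftrightarrow> smooth_at k s"
    by (rule eventually_mono) (rule smooth_at_cong)
  then show ?thesis
    unfolding smooth_near_def by (rule eventually_cong) simp
qed

lemma smooth_curve_on_imp_smooth_near:
  assumes "smooth_curve_on S c" "open S" "t \<in> S"
  shows "smooth_near c t"
  unfolding smooth_near_def
  using eventually_nhds_in_open[OF assms(2,3)]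
  by (rule eventually_mono) (rule smooth_curve_on_imp_smooth_at[OF assms(1,2)])

lemma smooth_near_eq_smooth_curve:
  fixes c k :: "real \<Rightarrow> 'a::{real_vector,t2_space}"
  assumes "smooth_curve k" "\<forall>\<^sub>F s in nhds t. k s = c s"
  shows "smooth_near c t"
  using smooth_near_cong[OF assms(2)] smooth_curve_imp_smooth_near[OF assms(1)] by simp

lemma smooth_curveI_near:
  fixes c :: "real \<Rightarrow> 'a::{real_vector,t2_space}"
  shows "(\<And>t. smooth_near c t) \<Longrightarrow> smooth_curve c"
  unfolding smooth_curve_iff_smooth_at using smooth_near_imp_smooth_at by blast

text \<open>Two cutoffs are needed. The first makes the germ a smooth curve on the whole line; only
  for such a curve does \<open>cinf_open U\<close> give an open set of times, to which the second
  cutoff confines it.\<close>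

lemma smooth_near_globalize:
  fixes c :: "real \<Rightarrow> 'a::locally_convex_space"
  assumes c: "smooth_near c t" and U: "cinf_open U" "c t \<in> U"
  shows "\<exists>k. smooth_curve k \<and> range k \<subseteq> U \<and> (\<forall>\<^sub>F s in nhds t. k s = c s)"
proof -
  have restrict: "smooth_curve (\<lambda>s. k (t + cutoff \<epsilon> (s - t))) \<and>
      (\<forall>\<^sub>F s in nhds t. k (t + cutoff \<epsilon> (s - t)) = k s)"
    if "0 < \<epsilon>" and k: "\<And>s. \<bar>s - t\<bar> \<le> \<epsilon> \<Longrightarrow> smooth_at k s" for k :: "real \<Rightarrow> 'a" and \<epsilon>
  proof
    have r: "smooth_curve (\<lambda>s. t + cutoff \<epsilon> (s - t))"
      using that(1) by (intro smooth_curve_intros smooth_curve_compose[OF smooth_curve_cutoff]) auto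
    show "smooth_curve (\<lambda>s. k (t + cutoff \<epsilon> (s - t)))"
      unfolding smooth_curve_iff_smooth_at
    proof
      fix s
      show "smooth_at (\<lambda>s. k (t + cutoff \<epsilon> (s - t))) s"
        using r abs_cutoff_le[OF that(1), of "s - t"] unfolding smooth_curve_iff_smooth_at
        by (intro smooth_at_compose[of _ s k] k) auto
    qed
    show "\<forall>\<^sub>F s in nhds t. k (t + cutoff \<epsilon> (s - t)) = k s"
      using eventually_nhds_unshift[OF eventually_cutoff_eq[OF that(1)]] by (rule eventually_mono) simp
  qed
  obtain \<epsilon> where \<epsilon>: "0 < \<epsilon>" "\<And>s. \<bar>s - t\<bar> \<le> \<epsilon> \<Longrightarrow> smooth_at c s"
    using c eventually_nhds_real_cball[of "smooth_at c" t] unfolding smooth_near_def by metis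
  define k where "k s = c (t + cutoff \<epsilon> (s - t))" for s
  have k: "smooth_curve k" "\<forall>\<^sub>F s in nhds t. k s = c s"
    using restrict[OF \<epsilon>] unfolding k_def by auto
  have "k t = c t"
    by (simp add: k_def)
  then have "open (k -` U)" "t \<in> k -` U"
    using U k(1) unfolding cinf_open_def by auto
  then have "\<forall>\<^sub>F s in nhds t. s \<in> k -` U"
    by (rule eventually_nhds_in_open)
  then obtain \<delta> where \<delta>: "0 < \<delta>" "\<And>s. \<bar>s - t\<bar> \<le> \<delta> \<Longrightarrow> s \<in> k -` U"
    using eventually_nhds_real_cball[of "\<lambda>s. s \<in> k -` U" t] by metis
  define k' where "k' s = k (t + cutoff \<delta> (s - t))" for s
  have k': "smooth_curve k'" "\<forall>\<^sub>F s in nhds t. k' s = k s"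
    using restrict[OF \<delta>(1), of k] k(1) unfolding k'_def smooth_curve_iff_smooth_at by auto
  have "k' s \<in> U" for s
    using \<delta>(2)[of "t + cutoff \<delta> (s - t)"] abs_cutoff_le[OF \<delta>(1), of "s - t"] by (simp add: k'_def)
  moreover have "\<forall>\<^sub>F s in nhds t. k' s = c s"
    using k'(2) k(2) by eventually_elim simp
  ultimately show ?thesis
    using k'(1) by blast
qed

lemma smooth_near_eventually_in:
  fixes c :: "real \<Rightarrow> 'a::locally_convex_space"
  assumes "smooth_near c t" "cinf_open U" "c t \<in> U"
  shows "\<forall>\<^sub>F s in nhds t. c s \<in> U"
proof -
  obtain k where "range k \<subseteq> U" "\<forall>\<^sub>F s in nhds t. k s = c s"
    using smooth_near_globalize[OF assms] by blast
  then have "\<forall>\<^sub>F s in nhds t. k s \<in> U \<and> k s = c s"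
    by (simp add: image_subset_iff)
  then show ?thesis
    by (rule eventually_mono) metis
qed

lemma smooth_on_smooth_near:
  fixes c :: "real \<Rightarrow> 'a::locally_convex_space" and f :: "'a \<Rightarrow> 'b::{real_vector,t2_space}"
  assumes f: "smooth_on U f" "cinf_open U" and c: "smooth_near c t" "c t \<in> U"
  shows "smooth_near (\<lambda>s. f (c s)) t"
proof -
  obtain k where k: "smooth_curve k" "range k \<subseteq> U" "\<forall>\<^sub>F s in nhds t. k s = c s"
    using smooth_near_globalize[OF c(1) f(2) c(2)] by blast
  have "smooth_curve (\<lambda>s. f (k s))"
    using f(1) k(1,2) unfolding smooth_on_def comp_def by blast
  moreover have "\<forall>\<^sub>F s in nhds t. f (k s) = f (c s)"
    using k(3) by (rule eventually_mono) simp
  ultimately show ?thesis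
    by (rule smooth_near_eq_smooth_curve)
qed

text \<open>The conditions given by \<open>S\<close> and \<open>U\<close> are open along plane
  curves, so they hold on a box, and one cutoff serves both variables. \<open>S\<close> is meant for
  the parameters at which a further local curve, such as that of the covectors, is defined.\<close>

lemma smooth_surface_cutoff_within:
  fixes \<sigma> :: "real \<Rightarrow> real \<Rightarrow> 'a::locally_convex_space"
  assumes \<sigma>: "smooth_surface \<sigma>" and U: "cinf_open U" "\<sigma> a b \<in> U" and S: "open S" "a \<in> S"
  shows "\<exists>\<rho>. smooth_curve \<rho> \<and> \<rho> 0 = 0 \<and> (\<forall>\<^sub>F s in nhds 0. \<rho> s = s) \<and>
    (\<forall>s t. \<sigma> (a + \<rho> s) (b + \<rho> t) \<in> U) \<and> (\<forall>s. a + \<rho> s \<in> S)"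
proof -
  have ev: "\<forall>\<^sub>F t in nhds 0. x t \<in> S \<and> \<sigma> (x t) (y t) \<in> U"
    if x: "smooth_curve x" and y: "smooth_curve y" and 0: "x 0 \<in> S \<and> \<sigma> (x 0) (y 0) \<in> U" for x y
  proof (rule eventually_conj)
    have "(x \<longlongrightarrow> x 0) (nhds 0)"
      using x smooth_at_imp_tendsto unfolding smooth_curve_iff_smooth_at by blast
    then show "\<forall>\<^sub>F t in nhds 0. x t \<in> S"
      using S(1) 0 by (intro topological_tendstoD) auto
    show "\<forall>\<^sub>F t in nhds 0. \<sigma> (x t) (y t) \<in> U"
      using smooth_surfaceD[OF \<sigma> x y] U(1) 0
      by (intro smooth_near_eventually_in smooth_curve_imp_smooth_near) auto
  qed
  have "a \<in> S \<and> \<sigma> a b \<in> U"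
    using S U by blast
  from curve_openness_box[of "\<lambda>s t. s \<in> S \<and> \<sigma> s t \<in> U", OF ev this]
  obtain \<delta> where \<delta>: "\<delta> > 0" "\<And>s t. \<bar>s - a\<bar> \<le> \<delta> \<Longrightarrow> \<bar>t - b\<bar> \<le> \<delta> \<Longrightarrow> s \<in> S \<and> \<sigma> s t \<in> U"
    by blast
  have "\<sigma> (a + cutoff \<delta> s) (b + cutoff \<delta> t) \<in> U" "a + cutoff \<delta> s \<in> S" for s t
    using \<delta>(2)[of "a + cutoff \<delta> s" "b + cutoff \<delta> t"] abs_cutoff_le[OF \<delta>(1)] by auto
  then show ?thesis
    using smooth_curve_cutoff[of \<delta>] eventually_cutoff_eq[OF \<delta>(1)] \<delta>(1)
    by (intro exI[of _ "cutoff \<delta>"]) auto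
qed

lemma smooth_surface_cutoff:
  fixes \<sigma> :: "real \<Rightarrow> real \<Rightarrow> 'a::locally_convex_space"
  assumes "smooth_surface \<sigma>" "cinf_open U" "\<sigma> a b \<in> U"
  shows "\<exists>\<rho>. smooth_curve \<rho> \<and> \<rho> 0 = 0 \<and> (\<forall>\<^sub>F s in nhds 0. \<rho> s = s) \<and> (\<forall>s t. \<sigma> (a + \<rho> s) (b + \<rho> t) \<in> U)"
  using smooth_surface_cutoff_within[OF assms open_UNIV UNIV_I] by blast

lemma smooth_surface_compose_cutoff:
  fixes \<sigma> :: "real \<Rightarrow> real \<Rightarrow> 'a::{real_vector,topological_space}" and f :: "'a \<Rightarrow> 'b::{real_vector,topological_space}"
  assumes "smooth_surface \<sigma>" "smooth_on U f" "smooth_curve \<rho>" "\<And>s t. \<sigma> (a + \<rho> s) (b + \<rho> t) \<in> U"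
  shows "smooth_surface (\<lambda>s t. f (\<sigma> (a + \<rho> s) (b + \<rho> t)))"
  unfolding smooth_surface_def
proof (intro allI impI)
  fix x y :: "real \<Rightarrow> real"
  assume xy: "smooth_curve x" "smooth_curve y"
  have r: "smooth_curve (\<lambda>t. a' + \<rho> (z t))" if "smooth_curve z" for a' and z :: "real \<Rightarrow> real"
    by (rule smooth_curve_intros(3)[OF smooth_curve_intros(1) smooth_curve_compose[OF assms(3) that]])
  have "smooth_curve (\<lambda>t. \<sigma> (a + \<rho> (x t)) (b + \<rho> (y t)))"
    by (rule smooth_surfaceD[OF assms(1) r[OF xy(1)] r[OF xy(2)]])
  then show "smooth_curve (\<lambda>t. f (\<sigma> (a + \<rho> (x t)) (b + \<rho> (y t))))"
    using assms(2,4) unfolding smooth_on_def comp_def by blast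
qed

lemma smooth_surface_intros:
  fixes c k :: "real \<Rightarrow> 'a::locally_convex_space"
  shows "smooth_curve c \<Longrightarrow> smooth_surface (\<lambda>s t. c s)"
    "smooth_curve c \<Longrightarrow> smooth_surface (\<lambda>s t. c t)"
    "smooth_surface \<sigma> \<Longrightarrow> smooth_surface \<tau> \<Longrightarrow> smooth_surface (\<lambda>s t. \<sigma> s t + \<tau> s t :: 'a)"
    "smooth_surface \<sigma>' \<Longrightarrow> smooth_surface \<tau> \<Longrightarrow> smooth_surface (\<lambda>s t. \<sigma>' s t *\<^sub>R \<tau> s t :: 'a)"
proof -
  assume c: "smooth_curve c"
  show "smooth_surface (\<lambda>s t. c s)" "smooth_surface (\<lambda>s t. c t)"
    unfolding smooth_surface_def using smooth_curve_compose[OF c] by blast+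
next
  assume "smooth_surface \<sigma>" "smooth_surface \<tau>"
  then show "smooth_surface (\<lambda>s t. \<sigma> s t + \<tau> s t)"
    unfolding smooth_surface_def by (intro allI impI smooth_curve_intros(3)) auto
next
  assume "smooth_surface \<sigma>'" "smooth_surface \<tau>"
  then show "smooth_surface (\<lambda>s t. \<sigma>' s t *\<^sub>R \<tau> s t)"
    unfolding smooth_surface_def by (intro allI impI smooth_curve_intros(5)) auto
qed


subsection \<open>The chain rule\<close>

definition dir_deriv ::
    "('a::{real_vector,topological_space} \<Rightarrow> 'b::{real_vector,topological_space}) \<Rightarrow> 'a \<Rightarrow> 'a \<Rightarrow> 'b" where
  "dir_deriv f x a = curve_deriv (\<lambda>s. f (x + s *\<^sub>R a)) 0"

lemma smooth_curve_line:
  fixes x a :: "'a::locally_convex_space"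
  shows "smooth_curve (\<lambda>s. x + s *\<^sub>R a)"
  by (intro smooth_curve_intros)

lemma dir_deriv_line:
  fixes x :: "'a::locally_convex_space" and f :: "'a \<Rightarrow> 'b::{real_vector,t2_space}"
  assumes "smooth_on U f" "cinf_open U" "x \<in> U"
  shows "has_curve_derivative (\<lambda>s. f (x + s *\<^sub>R a)) (dir_deriv f x a) 0"
proof -
  have "smooth_near (\<lambda>s. f (x + s *\<^sub>R a)) 0"
    using smooth_on_smooth_near[OF assms(1,2) smooth_curve_imp_smooth_near[OF smooth_curve_line], of x 0 a] assms(3)
    by simp
  then show ?thesis
    unfolding dir_deriv_def by (rule smooth_at_deriv(2)[OF smooth_near_imp_smooth_at])
qed

lemma dir_deriv_real:
  fixes x :: "'a::locally_convex_space" and f :: "'a \<Rightarrow> real"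
  assumes "smooth_on U f" "cinf_open U" "x \<in> U"
  shows "((\<lambda>s. f (x + s *\<^sub>R a)) has_real_derivative dir_deriv f x a) (at 0)"
  using dir_deriv_line[OF assms] by (simp add: has_curve_derivative_real_iff)

text \<open>The remainder \<open>(k (t\<^sub>n) - x) / t\<^sub>n\<close> is fast falling along a fast falling sequence of times
  \<open>t\<^sub>n\<close>, so it is interpolated by a smooth curve \<open>w\<close>; then apply the mean value theorem to
  the surface \<open>f (x + s w (r))\<close>.\<close>

lemma zero_velocity_chain_rule:
  fixes k :: "real \<Rightarrow> 'a::locally_convex_space" and f :: "'a \<Rightarrow> real"
  assumes f: "smooth_on U f" "cinf_open U" and k: "smooth_curve k" "k 0 \<in> U"
    and k0: "has_curve_derivative k 0 0" and D: "((\<lambda>t. f (k t)) has_real_derivative d) (at 0)"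
  shows "d = 0"
proof -
  let ?x = "k 0"
  have sk: "smooth_at k 0" and dk: "curve_deriv k 0 = 0"
    using k(1) curve_deriv_eq[OF k0] by (auto simp: smooth_curve_iff_smooth_at)
  obtain \<delta> where \<delta>1: "\<delta> > 0" and \<delta>2: "\<And>p. continuous_seminorm p \<Longrightarrow>
      \<exists>K. \<forall>h. \<bar>h\<bar> \<le> \<delta> \<longrightarrow> p (k (0 + h) - ?x - h *\<^sub>R curve_deriv k 0) \<le> K * h\<^sup>2"
    using smooth_at_second_order[OF sk] by metis
  have \<delta>: "\<delta> > 0" "\<And>p. continuous_seminorm p \<Longrightarrow> \<exists>K. \<forall>h. \<bar>h\<bar> \<le> \<delta> \<longrightarrow> p (k h - ?x) \<le> K * h\<^sup>2"
    using \<delta>1 \<delta>2 by (simp_all add: dk)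
  \<comment> \<open>The minimum keeps \<open>t n\<close> inside the range of the second-order
    estimate, which gives \<open>p (w n) \<le> K * t n\<close>; the factor 2^(-n^2) then makes
    \<open>w\<close> fall fast.\<close>
  define t where "t n = min \<delta> 1 / 2 ^ (n * n)" for n :: nat
  have t: "0 < t n" "t n \<le> \<delta>" "t n \<le> 1 / 2 ^ (n * n)" for n
  proof -
    show "0 < t n" "t n \<le> 1 / 2 ^ (n * n)"
      using \<delta>(1) by (auto simp: t_def divide_right_mono)
    have "min \<delta> 1 * 1 \<le> \<delta> * 2 ^ (n * n)"
      using \<delta>(1) by (intro mult_mono) auto
    then show "t n \<le> \<delta>"
      by (simp add: t_def divide_le_eq)
  qed
  define w where "w n = (k (t n) - ?x) /\<^sub>R t n" for n
  have "fast_falling w"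
  proof (rule fast_fallingI)
    fix p :: "'a \<Rightarrow> real"
    assume p: "continuous_seminorm p"
    obtain K where K: "\<And>h. \<bar>h\<bar> \<le> \<delta> \<Longrightarrow> p (k h - ?x) \<le> K * h\<^sup>2"
      using \<delta>(2)[OF p] by blast
    have K0: "0 \<le> K"
    proof (rule ccontr)
      assume "\<not> 0 \<le> K"
      then have "K * \<delta>\<^sup>2 < 0"
        using \<delta>(1) by (simp add: mult_neg_pos)
      then show False
        using K[of \<delta>] \<delta>(1) seminorm_nonneg[OF p, of "k \<delta> - ?x"] by simp
    qed
    have "p (w n) \<le> K / 2 ^ (n * n)" for n
    proof -
      have "p (w n) = p (k (t n) - ?x) / t n"
        using t(1)[of n] by (simp add: w_def seminorm_scaleR[OF p] divide_inverse)
      also have "\<dots> \<le> K * (t n)\<^sup>2 / t n"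
        using K[of "t n"] t[of n] by (intro divide_right_mono) auto
      also have "\<dots> = K * t n"
        using t(1)[of n] by (simp add: power2_eq_square)
      also have "\<dots> \<le> K * (1 / 2 ^ (n * n))"
        using K0 t(3) by (intro mult_left_mono)
      finally show ?thesis
        by simp
    qed
    then show "\<exists>K. \<forall>n. p (w n) \<le> K / 2 ^ (n * n)"
      by blast
  qed
  define W where "W = affine_special_curve w (\<lambda>n. 0)"
  have W: "smooth_curve W" "W 0 = 0" "\<And>n. W (1 / 2 ^ n) = w n"
    unfolding W_def using \<open>fast_falling w\<close>
    by (auto intro: smooth_curve_affine_special_curve fast_falling_zero
        simp: affine_special_curve_0 affine_special_curve_at)
  define \<sigma> where "\<sigma> r s = ?x + s *\<^sub>R W r" for r s
  have \<sigma>: "smooth_surface \<sigma>"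
    unfolding \<sigma>_def[abs_def] by (intro smooth_surface_intros smooth_curve_intros W(1))
  have "\<sigma> 0 0 \<in> U"
    using k(2) by (simp add: \<sigma>_def)
  from smooth_surface_cutoff[OF \<sigma> f(2) this]
  obtain \<rho> where \<rho>: "smooth_curve \<rho>" "\<rho> 0 = 0" "\<forall>\<^sub>F s in nhds 0. \<rho> s = s" "\<And>s t. \<sigma> (0 + \<rho> s) (0 + \<rho> t) \<in> U"
    by blast
  define G where "G r s = f (\<sigma> (0 + \<rho> r) (0 + \<rho> s))" for r s
  have G: "smooth_surface G"
    unfolding G_def[abs_def] by (rule smooth_surface_compose_cutoff[OF \<sigma> f(1) \<rho>(1,4)])
  have "\<forall>n. \<exists>\<xi>. \<bar>\<xi>\<bar> \<le> \<bar>t n\<bar> \<and> G (1 / 2 ^ n) (0 + t n) - G (1 / 2 ^ n) 0 = t n * deriv (G (1 / 2 ^ n)) (0 + \<xi>)"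
    using mean_value_between[OF smooth_surface_slices(2)[OF G]] by blast
  from choice[OF this] obtain \<xi> where \<xi>: "\<And>n. \<bar>\<xi> n\<bar> \<le> \<bar>t n\<bar>"
      "\<And>n. G (1 / 2 ^ n) (t n) - G (1 / 2 ^ n) 0 = t n * deriv (G (1 / 2 ^ n)) (\<xi> n)"
    by auto
  have pow: "(\<lambda>n. 1 / 2 ^ n) \<longlonglongrightarrow> (0::real)"
    by (rule inverse_power_two_tendsto_0)
  have "(1::real) / 2 ^ (n * n) \<le> 1 / 2 ^ n" for n :: nat
    by (intro divide_left_mono power_increasing) (auto simp: le_square)
  then have t_le: "t n \<le> 1 / 2 ^ n" for n
    using t(3)[of n] order_trans by blast
  have t0: "t \<longlonglongrightarrow> 0"
    by (rule Lim_null_comparison[OF _ pow]) (use t(1) t_le in \<open>simp add: less_imp_le\<close>)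
  have "\<xi> \<longlonglongrightarrow> 0"
    by (rule Lim_null_comparison[OF _ t0]) (use \<xi>(1) t(1) in \<open>simp add: less_imp_le\<close>)
  then have lim: "(\<lambda>n. deriv (G (1 / 2 ^ n)) (\<xi> n)) \<longlonglongrightarrow> deriv (G 0) 0"
    by (rule smooth_surface_tendsto[OF smooth_surface_deriv_second[OF G] pow])
  \<comment> \<open>\<open>W\<close> vanishes at time 0, so the limiting slice is constant; this is
    where the value 0 comes from.\<close>
  have "G 0 = (\<lambda>s. f ?x)"
    by (simp add: G_def fun_eq_iff \<sigma>_def \<rho>(2) W(2))
  then have lim0: "(\<lambda>n. deriv (G (1 / 2 ^ n)) (\<xi> n)) \<longlonglongrightarrow> 0"
    using lim by simp
  have "(\<lambda>n. (f (k (0 + t n)) - f (k 0)) / t n) \<longlonglongrightarrow> d"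
  proof (rule filterlim_compose[of "\<lambda>h. (f (k (0 + h)) - f (k 0)) / h" _ "at 0" t])
    show "((\<lambda>h. (f (k (0 + h)) - f (k 0)) / h) \<longlongrightarrow> d) (at 0)"
      using D unfolding DERIV_def .
    show "filterlim t (at 0) sequentially"
      using t0 by (intro filterlim_atI) (use t(1) in \<open>auto simp: less_imp_neq[symmetric]\<close>)
  qed
  \<comment> \<open>\<open>t n *\<^sub>R w n\<close> is the increment of \<open>k\<close>. Once
    \<open>\<rho>\<close> is the identity at 2^-n and at \<open>t n\<close>, the surface therefore
    takes the value \<open>f (k (t n))\<close>.\<close>
  moreover have "\<forall>\<^sub>F n in sequentially. (f (k (0 + t n)) - f (k 0)) / t n = deriv (G (1 / 2 ^ n)) (\<xi> n)"
  proof -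
    have "\<forall>\<^sub>F n in sequentially. \<rho> (1 / 2 ^ n) = 1 / 2 ^ n" "\<forall>\<^sub>F n in sequentially. \<rho> (t n) = t n"
      using pow t0 \<rho>(3) unfolding filterlim_iff by blast+
    then show ?thesis
    proof eventually_elim
      case (elim n)
      have "G (1 / 2 ^ n) (t n) = f (k (t n))"
        using t(1)[of n] elim by (simp add: G_def \<sigma>_def W(3) w_def)
      moreover have "G (1 / 2 ^ n) 0 = f ?x"
        by (simp add: G_def \<sigma>_def \<rho>(2))
      ultimately have "f (k (t n)) - f (k 0) = t n * deriv (G (1 / 2 ^ n)) (\<xi> n)"
        using \<xi>(2)[of n] by simp
      then show ?case
        using t(1)[of n] by simp
    qed
  qed
  ultimately have "(\<lambda>n. deriv (G (1 / 2 ^ n)) (\<xi> n)) \<longlonglongrightarrow> d"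
    by (rule Lim_transform_eventually)
  then show ?thesis
    using lim0 LIMSEQ_unique by blast
qed

text \<open>The curve \<open>c t - t a\<close> has velocity 0, so the diagonal of the surface
  \<open>f (c s - t a)\<close> has derivative 0; the two partial derivatives belong to
  \<open>f\<close> along \<open>c\<close> and to the direction \<open>- a\<close>. This gives the
  derivative as \<open>- dir_deriv f (c 0) (- a)\<close>, and the same result for the straight line
  in direction \<open>a\<close> removes the signs.\<close>

lemma real_chain_rule:
  fixes c :: "real \<Rightarrow> 'a::locally_convex_space" and f :: "'a \<Rightarrow> real"
  assumes f: "smooth_on U f" "cinf_open U" and c: "smooth_curve c" "c 0 \<in> U"
    and a: "has_curve_derivative c a 0"
  shows "((\<lambda>t. f (c t)) has_real_derivative dir_deriv f (c 0) a) (at 0)"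
    and "dir_deriv f (c 0) (- a) = - dir_deriv f (c 0) a"
proof -
  have main: "((\<lambda>t. f (c t)) has_real_derivative - dir_deriv f (c 0) (- a)) (at 0)"
    if c: "smooth_curve c" "c 0 \<in> U" and a: "has_curve_derivative c a 0" for c a
  proof -
    define \<sigma> where "\<sigma> s t = c s + t *\<^sub>R (- a)" for s t
    have \<sigma>: "smooth_surface \<sigma>"
      unfolding \<sigma>_def[abs_def] by (intro smooth_surface_intros smooth_curve_intros c(1))
    have "\<sigma> 0 0 \<in> U"
      using c(2) by (simp add: \<sigma>_def)
    from smooth_surface_cutoff[OF \<sigma> f(2) this]
    obtain \<rho> where \<rho>: "smooth_curve \<rho>" "\<rho> 0 = 0" "\<forall>\<^sub>F s in nhds 0. \<rho> s = s"
        "\<And>s t. \<sigma> (0 + \<rho> s) (0 + \<rho> t) \<in> U"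
      by blast
    define G where "G s t = f (\<sigma> (0 + \<rho> s) (0 + \<rho> t))" for s t
    have G: "smooth_surface G"
      unfolding G_def[abs_def] by (rule smooth_surface_compose_cutoff[OF \<sigma> f(1) \<rho>(1,4)])
    have "\<forall>\<^sub>F t in nhds 0. G t t = f (c t + t *\<^sub>R (- a))"
      using \<rho>(3) by (rule eventually_mono) (simp add: G_def \<sigma>_def)
    then have "((\<lambda>t. f (c t + t *\<^sub>R (- a))) has_real_derivative deriv (\<lambda>t. G t 0) 0 + deriv (G 0) 0) (at 0)"
      by (rule DERIV_transfer_eventually) (rule smooth_surface_diagonal_DERIV[OF G])
    moreover have "has_curve_derivative (\<lambda>t. c t + t *\<^sub>R (- a)) (a + (1 *\<^sub>R (- a) + 0 *\<^sub>R 0)) 0"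
      by (intro has_curve_derivative_add a has_curve_derivative_scaleR has_curve_derivative_const)
        (auto intro!: derivative_eq_intros)
    ultimately have zero: "deriv (\<lambda>t. G t 0) 0 + deriv (G 0) 0 = 0"
      using c by (intro zero_velocity_chain_rule[OF f, of "\<lambda>t. c t + t *\<^sub>R (- a)"] smooth_curve_intros) auto
    have "\<forall>\<^sub>F t in nhds 0. G 0 t = f (c 0 + t *\<^sub>R (- a))"
      using \<rho>(3) by (rule eventually_mono) (simp add: G_def \<sigma>_def \<rho>(2))
    from DERIV_transfer_eventually[OF this smooth_curve_DERIV(1)[OF smooth_surface_slices(2)[OF G]]]
    have "deriv (G 0) 0 = dir_deriv f (c 0) (- a)"
      using dir_deriv_real[OF f c(2), of "- a"] by (rule DERIV_unique)
    moreover have "\<forall>\<^sub>F t in nhds 0. G t 0 = f (c t)"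
      using \<rho>(3) by (rule eventually_mono) (simp add: G_def \<sigma>_def \<rho>(2))
    then have "((\<lambda>t. f (c t)) has_real_derivative deriv (\<lambda>t. G t 0) 0) (at 0)"
      by (rule DERIV_transfer_eventually) (rule smooth_curve_DERIV(1)[OF smooth_surface_slices(1)[OF G]])
    ultimately show ?thesis
      using zero by (simp add: add_eq_0_iff2)
  qed
  have "has_curve_derivative (\<lambda>s. c 0 + s *\<^sub>R a) (0 + (1 *\<^sub>R a + 0 *\<^sub>R 0)) 0"
    by (intro has_curve_derivative_add has_curve_derivative_scaleR has_curve_derivative_const)
      (auto intro!: derivative_eq_intros)
  then have "((\<lambda>s. f (c 0 + s *\<^sub>R a)) has_real_derivative - dir_deriv f (c 0) (- a)) (at 0)"
    using main[OF smooth_curve_line[of "c 0" a], of a] c(2) by simp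
  then have neg: "dir_deriv f (c 0) a = - dir_deriv f (c 0) (- a)"
    using dir_deriv_real[OF f c(2), of a] DERIV_unique by blast
  then show "dir_deriv f (c 0) (- a) = - dir_deriv f (c 0) a"
    by simp
  show "((\<lambda>t. f (c t)) has_real_derivative dir_deriv f (c 0) a) (at 0)"
    using main[OF c a] neg by simp
qed

lemma real_chain_rule_near:
  fixes c :: "real \<Rightarrow> 'a::locally_convex_space" and f :: "'a \<Rightarrow> real"
  assumes f: "smooth_on U f" "cinf_open U" and c: "smooth_near c t" "c t \<in> U"
    and a: "has_curve_derivative c a t"
  shows "((\<lambda>s. f (c s)) has_real_derivative dir_deriv f (c t) a) (at t)"
proof -
  obtain k where k: "smooth_curve k" "\<forall>\<^sub>F s in nhds t. k s = c s"
    using smooth_near_globalize[OF c(1) f(2) c(2)] by blast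
  have kt: "k t = c t"
    using eventually_nhds_x_imp_x[OF k(2)] .
  define k' where "k' s = k (t + s)" for s
  have "smooth_curve k'"
    unfolding k'_def[abs_def] by (intro smooth_curve_compose[OF k(1)] smooth_curve_intros)
  moreover have "has_curve_derivative k a t"
    using a has_curve_derivative_cong[OF k(2)] by blast
  then have "has_curve_derivative k' a 0"
    unfolding k'_def has_curve_derivative_def by simp
  ultimately have "((\<lambda>s. f (k' s)) has_real_derivative dir_deriv f (c t) a) (at 0)"
    using real_chain_rule(1)[OF f, of k' a] c(2) kt by (simp add: k'_def)
  then have "((\<lambda>s. f (k s)) has_real_derivative dir_deriv f (c t) a) (at t)"
    unfolding k'_def DERIV_def by simp
  moreover have "\<forall>\<^sub>F s in nhds t. f (k s) = f (c s)"
    using k(2) by (rule eventually_mono) simp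
  ultimately show ?thesis
    by (rule DERIV_transfer_eventually[rotated])
qed

text \<open>Additivity is the diagonal derivative of the surface
  \<open>f (x + s a + t b)\<close>.\<close>

lemma linear_dir_deriv_real:
  fixes f :: "'a::locally_convex_space \<Rightarrow> real"
  assumes f: "smooth_on U f" "cinf_open U" and x: "x \<in> U"
  shows "linear (dir_deriv f x)"
proof (rule linearI)
  fix a b :: 'a
  define \<sigma> where "\<sigma> s t = x + (s *\<^sub>R a + t *\<^sub>R b)" for s t
  have \<sigma>: "smooth_surface \<sigma>"
    unfolding \<sigma>_def[abs_def] by (intro smooth_surface_intros smooth_curve_intros)
  have "\<sigma> 0 0 \<in> U"
    using x by (simp add: \<sigma>_def)
  from smooth_surface_cutoff[OF \<sigma> f(2) this]
  obtain \<rho> where \<rho>: "smooth_curve \<rho>" "\<rho> 0 = 0" "\<forall>\<^sub>F s in nhds 0. \<rho> s = s"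
      "\<And>s t. \<sigma> (0 + \<rho> s) (0 + \<rho> t) \<in> U"
    by blast
  define G where "G s t = f (\<sigma> (0 + \<rho> s) (0 + \<rho> t))" for s t
  have G: "smooth_surface G"
    unfolding G_def[abs_def] by (rule smooth_surface_compose_cutoff[OF \<sigma> f(1) \<rho>(1,4)])
  have eq: "g' = dir_deriv f x v" if "(g has_real_derivative g') (at 0)"
      "\<forall>\<^sub>F t in nhds 0. g t = f (x + t *\<^sub>R v)" for g g' v
    using DERIV_transfer_eventually[OF that(2,1)] dir_deriv_real[OF f x, of v] by (rule DERIV_unique)
  have "deriv (\<lambda>t. G t 0) 0 + deriv (G 0) 0 = dir_deriv f x (a + b)"
    by (rule eq[OF smooth_surface_diagonal_DERIV[OF G]])
      (use \<rho>(3) in \<open>rule eventually_mono; simp add: G_def \<sigma>_def scaleR_add_right\<close>)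
  moreover have "deriv (\<lambda>t. G t 0) 0 = dir_deriv f x a"
    by (rule eq[OF smooth_curve_DERIV(1)[OF smooth_surface_slices(1)[OF G]]])
      (use \<rho>(3) in \<open>rule eventually_mono; simp add: G_def \<sigma>_def \<rho>(2)\<close>)
  moreover have "deriv (G 0) 0 = dir_deriv f x b"
    by (rule eq[OF smooth_curve_DERIV(1)[OF smooth_surface_slices(2)[OF G]]])
      (use \<rho>(3) in \<open>rule eventually_mono; simp add: G_def \<sigma>_def \<rho>(2)\<close>)
  ultimately show "dir_deriv f x (a + b) = dir_deriv f x a + dir_deriv f x b"
    by simp
next
  fix r :: real and a :: 'a
  have "((\<lambda>s. f (x + (r * s) *\<^sub>R a)) has_real_derivative dir_deriv f x a * r) (at 0)"
    using dir_deriv_real[OF f x, of a]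
    by (intro DERIV_chain2[of "\<lambda>s. f (x + s *\<^sub>R a)"]) (auto intro!: derivative_eq_intros)
  then show "dir_deriv f x (r *\<^sub>R a) = r *\<^sub>R dir_deriv f x a"
    using dir_deriv_real[OF f x, of "r *\<^sub>R a"] DERIV_unique by (fastforce simp: mult.commute)
qed

lemma dominated_functionals_separate:
  fixes x y :: "'a::locally_convex_space"
  assumes "\<And>p l. continuous_seminorm p \<Longrightarrow> linear l \<Longrightarrow> (\<And>z. \<bar>l z\<bar> \<le> p z) \<Longrightarrow> l x = (l y :: real)"
  shows "x = y"
proof (rule ccontr)
  assume "x \<noteq> y"
  then obtain p where p: "continuous_seminorm p" "p (x - y) \<noteq> 0"
    using seminorm_separates[of "x - y"] by auto
  obtain l where l: "linear l" "\<And>z. \<bar>l z\<bar> \<le> p z" "l (x - y) = p (x - y)"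
    using Hahn_Banach_seminorm[OF p(1), of "x - y"] by metis
  show False
    using assms[OF p(1) l(1,2)] l(3) p(2) linear_diff[OF l(1)] by simp
qed

lemma smooth_curve_dominated_linear:
  fixes c :: "real \<Rightarrow> 'a::locally_convex_space"
  assumes l: "continuous_seminorm p" "linear l" "\<And>z. \<bar>l z\<bar> \<le> p z" and c: "smooth_curve c"
  shows "smooth_curve (\<lambda>t. l (c t) :: real)"
proof -
  obtain D where D: "\<And>t. D 0 t = c t" "\<And>n t. has_curve_derivative (D n) (D (Suc n) t) t"
    using c unfolding smooth_curve_on_def by auto
  have "has_curve_derivative (\<lambda>s. l (D n s)) (l (D (Suc n) t)) t" for n t
    unfolding has_curve_derivative_real_iff by (rule has_curve_derivative_dominated_linear[OF l D(2)])
  then show ?thesis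
    unfolding smooth_curve_on_def by (intro exI[of _ "\<lambda>n t. l (D n t)"]) (simp add: D(1))
qed

text \<open>Smoothness of \<open>f\<close> already provides a derivative along \<open>c\<close>.
  Only its value and the linearity remain, and these are equations that can be tested with dominated
  functionals.\<close>

theorem chain_rule:
  fixes c :: "real \<Rightarrow> 'a::locally_convex_space" and f :: "'a \<Rightarrow> 'b::locally_convex_space"
  assumes f: "smooth_on U f" "cinf_open U" and c: "smooth_near c t" "c t \<in> U"
    and a: "has_curve_derivative c a t"
  shows "has_curve_derivative (\<lambda>s. f (c s)) (dir_deriv f (c t) a) t"
    and "linear (dir_deriv f (c t))"
proof -
  have comp: "smooth_on U (\<lambda>x. l (f x)) \<and> dir_deriv (\<lambda>x. l (f x)) (c t) v = l (dir_deriv f (c t) v)"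
    if l: "continuous_seminorm p" "linear l" "\<And>z. \<bar>l z\<bar> \<le> p z" for p and l :: "'b \<Rightarrow> real" and v
  proof
    show s: "smooth_on U (\<lambda>x. l (f x))"
      unfolding smooth_on_def
    proof (intro allI impI)
      fix k :: "real \<Rightarrow> 'a"
      assume "smooth_curve k \<and> range k \<subseteq> U"
      then have "smooth_curve (\<lambda>t. f (k t))"
        using f(1) unfolding smooth_on_def comp_def by blast
      then show "smooth_curve ((\<lambda>x. l (f x)) \<circ> k)"
        unfolding comp_def by (rule smooth_curve_dominated_linear[OF l])
    qed
    show "dir_deriv (\<lambda>x. l (f x)) (c t) v = l (dir_deriv f (c t) v)"
      using dir_deriv_real[OF s f(2) c(2), of v]
        has_curve_derivative_dominated_linear[OF l dir_deriv_line[OF f c(2), of v]]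
      by (rule DERIV_unique)
  qed
  have D: "has_curve_derivative (\<lambda>s. f (c s)) (curve_deriv (\<lambda>s. f (c s)) t) t"
    by (intro smooth_at_deriv(2) smooth_near_imp_smooth_at smooth_on_smooth_near[OF f c])
  have "curve_deriv (\<lambda>s. f (c s)) t = dir_deriv f (c t) a"
  proof (rule dominated_functionals_separate)
    fix p and l :: "'b \<Rightarrow> real"
    assume l: "continuous_seminorm p" "linear l" "\<And>z. \<bar>l z\<bar> \<le> p z"
    show "l (curve_deriv (\<lambda>s. f (c s)) t) = l (dir_deriv f (c t) a)"
      using has_curve_derivative_dominated_linear[OF l D]
        real_chain_rule_near[of U "\<lambda>x. l (f x)", OF _ f(2) c a] comp[OF l, of a] DERIV_unique by fastforce
  qed
  then show "has_curve_derivative (\<lambda>s. f (c s)) (dir_deriv f (c t) a) t"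
    using D by simp
  show "linear (dir_deriv f (c t))"
  proof (rule linearI)
    fix v w :: 'a and r :: real
    show "dir_deriv f (c t) (v + w) = dir_deriv f (c t) v + dir_deriv f (c t) w"
    proof (rule dominated_functionals_separate)
      fix p and l :: "'b \<Rightarrow> real"
      assume l: "continuous_seminorm p" "linear l" "\<And>z. \<bar>l z\<bar> \<le> p z"
      show "l (dir_deriv f (c t) (v + w)) = l (dir_deriv f (c t) v + dir_deriv f (c t) w)"
        using comp[OF l] linear_add[OF linear_dir_deriv_real[OF _ f(2) c(2)]] linear_add[OF l(2)] by metis
    qed
    show "dir_deriv f (c t) (r *\<^sub>R v) = r *\<^sub>R dir_deriv f (c t) v"
    proof (rule dominated_functionals_separate)
      fix p and l :: "'b \<Rightarrow> real"
      assume l: "continuous_seminorm p" "linear l" "\<And>z. \<bar>l z\<bar> \<le> p z"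
      show "l (dir_deriv f (c t) (r *\<^sub>R v)) = l (r *\<^sub>R dir_deriv f (c t) v)"
        using comp[OF l] linear_cmul[OF linear_dir_deriv_real[OF _ f(2) c(2)]] linear_cmul[OF l(2)] by metis
    qed
  qed
qed

section \<open>Smooth curves in the dual space\<close>

lemma linear_dual_apply: "linear (dual_apply l)"
  and continuous_dual_apply: "continuous_map cinf_topology euclideanreal (dual_apply l)"
  using dual_apply[of l] by auto

lemma dual_apply_Abs_dual:
  "linear l \<Longrightarrow> continuous_map cinf_topology euclideanreal l \<Longrightarrow> dual_apply (Abs_dual l) = l"
  by (simp add: Abs_dual_inverse)

lemma cinf_open_UNIV: "cinf_open UNIV"
  by (simp add: cinf_open_def)

lemma cinf_continuous_along_curve:
  fixes f :: "'a::{real_vector,topological_space} \<Rightarrow> real"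
  assumes "continuous_map cinf_topology euclideanreal f" "smooth_curve c"
  shows "((\<lambda>t. f (c t)) \<longlongrightarrow> f (c t)) (nhds t)"
proof (rule topological_tendstoI)
  fix V :: "real set"
  assume V: "open V" "f (c t) \<in> V"
  have "cinf_open {x. f x \<in> V}"
    using assms(1) V(1) unfolding continuous_map_def by (simp add: openin_cinf_topology)
  then have "open (c -` {x. f x \<in> V})" "t \<in> c -` {x. f x \<in> V}"
    using assms(2) V(2) unfolding cinf_open_def by auto
  then have "\<forall>\<^sub>F s in nhds t. s \<in> c -` {x. f x \<in> V}"
    by (rule eventually_nhds_in_open)
  then show "\<forall>\<^sub>F s in nhds t. f (c s) \<in> V"
    by simp
qed

lemma cinf_continuousI:
  fixes f :: "'a::{real_vector,topological_space} \<Rightarrow> real"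
  assumes "\<And>c. smooth_curve c \<Longrightarrow> smooth_curve (\<lambda>t. f (c t))"
  shows "continuous_map cinf_topology euclideanreal f"
  unfolding continuous_map_def
proof (intro conjI allI impI)
  fix V :: "real set"
  assume V: "openin euclideanreal V"
  have "open (c -` {x. f x \<in> V})" if "smooth_curve c" for c
  proof -
    have "open ((\<lambda>t. f (c t)) -` V)"
      using V smooth_curve_continuous[OF assms[OF that], of UNIV] by (intro open_vimage) auto
    then show ?thesis
      by (simp add: vimage_def)
  qed
  then show "openin cinf_topology {x \<in> topspace cinf_topology. f x \<in> V}"
    by (simp add: openin_cinf_topology cinf_open_def)
qed simp

text \<open>A functional that is unbounded on a bounded set is unbounded along a special curve.\<close>

lemma dual_apply_bounded:
  fixes l :: "'a::locally_convex_space dual"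
  assumes "von_Neumann_bounded B"
  shows "\<exists>K. \<forall>x\<in>B. \<bar>dual_apply l x\<bar> \<le> K"
proof (rule ccontr)
  assume no: "\<not> ?thesis"
  have "\<forall>n. \<exists>x\<in>B. 2 ^ (n * n) < \<bar>dual_apply l x\<bar>"
    using no by (meson not_le)
  then obtain x where x: "\<And>n. x n \<in> B" "\<And>n::nat. 2 ^ (n * n) < \<bar>dual_apply l (x n)\<bar>"
    by metis
  \<comment> \<open>Rescaled so that the points fall fast while the functional keeps absolute value
    above 1 on them.\<close>
  define y where "y n = x n /\<^sub>R 2 ^ (n * n)" for n :: nat
  have "fast_falling y"
  proof (rule fast_fallingI)
    fix p :: "'a \<Rightarrow> real"
    assume p: "continuous_seminorm p"
    obtain K where "\<And>x. x \<in> B \<Longrightarrow> p x \<le> K"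
      using assms p unfolding von_Neumann_bounded_iff_seminorm by blast
    then show "\<exists>K. \<forall>n. p (y n) \<le> K / 2 ^ (n * n)"
      using x(1) by (intro exI[of _ K]) (simp add: y_def seminorm_scaleR[OF p] divide_inverse mult.commute)
  qed
  then have c: "smooth_curve (affine_special_curve y (\<lambda>n. 0))"
    by (rule smooth_curve_affine_special_curve[OF _ fast_falling_zero])
  have "(\<lambda>n. 1 / 2 ^ n) \<longlonglongrightarrow> (0::real)"
    by (rule inverse_power_two_tendsto_0)
  with cinf_continuous_along_curve[OF continuous_dual_apply c]
  have "(\<lambda>n. dual_apply l (affine_special_curve y (\<lambda>n. 0) (1 / 2 ^ n))) \<longlonglongrightarrow>
      dual_apply l (affine_special_curve y (\<lambda>n. 0) 0)"
    by (rule filterlim_compose)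
  then have "(\<lambda>n. dual_apply l (y n)) \<longlonglongrightarrow> 0"
    by (simp add: affine_special_curve_0 affine_special_curve_at linear_0[OF linear_dual_apply])
  then have "\<forall>\<^sub>F n in sequentially. \<bar>dual_apply l (y n)\<bar> < 1"
    using tendstoD[of "\<lambda>n. dual_apply l (y n)" 0 sequentially 1] by simp
  then obtain n where "\<bar>dual_apply l (y n)\<bar> < 1"
    using eventually_happens[of _ sequentially] by auto
  then show False
    using x(2)[of n] by (simp add: y_def linear_cmul[OF linear_dual_apply] abs_mult field_simps)
qed

text \<open>\<open>l\<close> is continuous for the c^infinity-topology, so it cannot simply be
  applied to the limit of the difference quotients. Instead, the second-order remainders divided by
  \<open>h^2\<close> form a bounded set, on which \<open>l\<close> is bounded; the error is then at
  most \<open>K * \<bar>h\<bar>\<close>.\<close>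

lemma dual_apply_DERIV:
  fixes c :: "real \<Rightarrow> 'a::locally_convex_space"
  assumes "smooth_at c t"
  shows "((\<lambda>s. dual_apply l (c s)) has_real_derivative dual_apply l (curve_deriv c t)) (at t)"
proof -
  note lin = linear_dual_apply[of l]
  obtain \<delta> where \<delta>: "\<delta> > 0" and bd: "\<And>p. continuous_seminorm p \<Longrightarrow>
      \<exists>K. \<forall>h. \<bar>h\<bar> \<le> \<delta> \<longrightarrow> p (c (t + h) - c t - h *\<^sub>R curve_deriv c t) \<le> K * h\<^sup>2"
    using smooth_at_second_order[OF assms] by metis
  define r where "r h = (c (t + h) - c t - h *\<^sub>R curve_deriv c t) /\<^sub>R h\<^sup>2" for h
  have "von_Neumann_bounded (r ` {h. 0 < \<bar>h\<bar> \<and> \<bar>h\<bar> \<le> \<delta>})"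
    unfolding von_Neumann_bounded_iff_seminorm
  proof (intro allI impI)
    fix p :: "'a \<Rightarrow> real"
    assume p: "continuous_seminorm p"
    obtain K where K: "\<And>h. \<bar>h\<bar> \<le> \<delta> \<Longrightarrow> p (c (t + h) - c t - h *\<^sub>R curve_deriv c t) \<le> K * h\<^sup>2"
      using bd[OF p] by blast
    have "p (r h) \<le> K" if "0 < \<bar>h\<bar>" "\<bar>h\<bar> \<le> \<delta>" for h
    proof -
      have "p (r h) = p (c (t + h) - c t - h *\<^sub>R curve_deriv c t) / h\<^sup>2"
        by (simp add: r_def seminorm_scaleR[OF p] divide_inverse mult.commute)
      then show ?thesis
        using K[OF that(2)] that(1) by (simp add: pos_divide_le_eq)
    qed
    then show "\<exists>K. \<forall>x\<in>r ` {h. 0 < \<bar>h\<bar> \<and> \<bar>h\<bar> \<le> \<delta>}. p x \<le> K"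
      by blast
  qed
  from dual_apply_bounded[OF this, of l] obtain K where
    K: "\<And>h. 0 < \<bar>h\<bar> \<Longrightarrow> \<bar>h\<bar> \<le> \<delta> \<Longrightarrow> \<bar>dual_apply l (r h)\<bar> \<le> K"
    by blast
  have "norm ((dual_apply l (c (t + h)) - dual_apply l (c t)) / h - dual_apply l (curve_deriv c t)) \<le> K * \<bar>h\<bar>"
    if "h \<noteq> 0" "\<bar>h\<bar> \<le> \<delta>" for h
  proof -
    have "dual_apply l (r h) =
        ((dual_apply l (c (t + h)) - dual_apply l (c t)) / h - dual_apply l (curve_deriv c t)) / h"
      unfolding r_def linear_diff[OF lin] linear_cmul[OF lin] real_scaleR_def
      using that(1) by (simp add: field_simps power2_eq_square)
    then have "(dual_apply l (c (t + h)) - dual_apply l (c t)) / h - dual_apply l (curve_deriv c t)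
        = dual_apply l (r h) * h"
      using that(1) by simp
    then show ?thesis
      using K[of h] that by (simp add: abs_mult mult_right_mono)
  qed
  then have "\<forall>\<^sub>F h in at 0. norm ((dual_apply l (c (t + h)) - dual_apply l (c t)) / h
      - dual_apply l (curve_deriv c t)) \<le> K * \<bar>h\<bar>"
    using \<delta> unfolding eventually_at by (intro exI[of _ \<delta>]) (simp add: dist_real_def)
  moreover have "((\<lambda>h. K * \<bar>h\<bar>) \<longlongrightarrow> 0) (at (0::real))"
    by (auto intro!: tendsto_eq_intros)
  ultimately have "((\<lambda>h. (dual_apply l (c (t + h)) - dual_apply l (c t)) / h
      - dual_apply l (curve_deriv c t)) \<longlongrightarrow> 0) (at 0)"
    by (rule Lim_null_comparison)
  then show ?thesis
    unfolding DERIV_def by (rule LIM_zero_cancel)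
qed

lemma smooth_curve_dual_apply:
  fixes c :: "real \<Rightarrow> 'a::locally_convex_space"
  assumes "smooth_curve c"
  shows "smooth_curve (\<lambda>t. dual_apply l (c t))"
  unfolding smooth_curve_on_def
proof (intro exI[of _ "\<lambda>n t. dual_apply l ((curve_deriv ^^ n) c t)"] conjI ballI allI)
  fix n and t :: real
  have "smooth_at ((curve_deriv ^^ n) c) t"
    using assms smooth_at_iterate unfolding smooth_curve_iff_smooth_at by blast
  from dual_apply_DERIV[OF this]
  show "has_curve_derivative (\<lambda>t. dual_apply l ((curve_deriv ^^ n) c t))
      (dual_apply l ((curve_deriv ^^ Suc n) c t)) t"
    by (simp add: has_curve_derivative_real_iff)
qed simp

lemma dual_tendsto_iff:
  fixes l :: "'a::{real_vector,topological_space} dual"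
  shows "(f \<longlongrightarrow> l) F \<longleftrightarrow> (\<forall>B e. von_Neumann_bounded B \<longrightarrow> 0 < e \<longrightarrow>
    (\<forall>\<^sub>F i in F. \<forall>x\<in>B. \<bar>dual_apply (f i) x - dual_apply l x\<bar> \<le> e))"
proof
  assume f: "(f \<longlongrightarrow> l) F"
  show "\<forall>B e. von_Neumann_bounded B \<longrightarrow> 0 < e \<longrightarrow>
    (\<forall>\<^sub>F i in F. \<forall>x\<in>B. \<bar>dual_apply (f i) x - dual_apply l x\<bar> \<le> e)"
  proof (intro allI impI)
    fix B :: "'a set" and e :: real
    assume B: "von_Neumann_bounded B" and e: "0 < e"
    \<comment> \<open>The set given by the weak inequality with \<open>e\<close> need not be open;
      the union over all smaller radii \<open>d\<close> is.\<close>
    define N where "N = {m. \<exists>d<e. \<forall>x\<in>B. \<bar>dual_apply m x - dual_apply l x\<bar> \<le> d}"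
    have "open N"
      unfolding open_dual_def
    proof
      fix m
      assume "m \<in> N"
      then obtain d where d: "d < e" "\<And>x. x \<in> B \<Longrightarrow> \<bar>dual_apply m x - dual_apply l x\<bar> \<le> d"
        by (auto simp: N_def)
      have "m' \<in> N" if m': "\<forall>x\<in>B. \<bar>dual_apply m' x - dual_apply m x\<bar> \<le> (e - d) / 2" for m'
      proof -
        have "\<bar>dual_apply m' x - dual_apply l x\<bar> \<le> (e + d) / 2" if "x \<in> B" for x
        proof -
          have "\<bar>dual_apply m x - dual_apply l x\<bar> \<le> d" "\<bar>dual_apply m' x - dual_apply m x\<bar> \<le> (e - d) / 2"
            using d(2)[OF that] m' that by auto
          then show ?thesis
            using abs_triangle_ineq[of "dual_apply m' x - dual_apply m x" "dual_apply m x - dual_apply l x"]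
            by (simp add: field_simps)
        qed
        moreover have "(e + d) / 2 < e"
          using d(1) by simp
        ultimately show ?thesis
          unfolding N_def by blast
      qed
      then show "\<exists>B e. von_Neumann_bounded B \<and> e > 0 \<and>
          {m'. \<forall>x\<in>B. \<bar>dual_apply m' x - dual_apply m x\<bar> \<le> e} \<subseteq> N"
        using B d(1) by (intro exI[of _ B] exI[of _ "(e - d) / 2"]) auto
    qed
    moreover have "l \<in> N"
      using e by (auto simp: N_def intro!: exI[of _ 0])
    ultimately have "\<forall>\<^sub>F i in F. f i \<in> N"
      by (rule topological_tendstoD[OF f])
    then show "\<forall>\<^sub>F i in F. \<forall>x\<in>B. \<bar>dual_apply (f i) x - dual_apply l x\<bar> \<le> e"
      by (rule eventually_mono) (force simp: N_def)
  qed
next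
  assume *: "\<forall>B e. von_Neumann_bounded B \<longrightarrow> 0 < e \<longrightarrow>
    (\<forall>\<^sub>F i in F. \<forall>x\<in>B. \<bar>dual_apply (f i) x - dual_apply l x\<bar> \<le> e)"
  show "(f \<longlongrightarrow> l) F"
  proof (rule topological_tendstoI)
    fix N
    assume "open N" "l \<in> N"
    then obtain B e where B: "von_Neumann_bounded B" "e > 0"
        "{m. \<forall>x\<in>B. \<bar>dual_apply m x - dual_apply l x\<bar> \<le> e} \<subseteq> N"
      unfolding open_dual_def by blast
    have "\<forall>\<^sub>F i in F. \<forall>x\<in>B. \<bar>dual_apply (f i) x - dual_apply l x\<bar> \<le> e"
      using * B(1,2) by blast
    then show "\<forall>\<^sub>F i in F. f i \<in> N"
      by (rule eventually_mono) (use B(3) in blast)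
  qed
qed

text \<open>Near \<open>t\<close> the curve \<open>y\<close> stays in a bounded set, on which the
  difference quotients of \<open>L\<close> converge uniformly by the choice of the strong
  topology.\<close>

lemma dual_pairing_DERIV:
  fixes y :: "real \<Rightarrow> 'a::locally_convex_space"
  assumes L: "has_curve_derivative L L' (r t)" and r: "(r has_real_derivative r') (at t)" and y: "smooth_at y t"
  shows "((\<lambda>s. dual_apply (L (r s)) (y s)) has_real_derivative
    r' * dual_apply L' (y t) + dual_apply (L (r t)) (curve_deriv y t)) (at t)"
proof -
  obtain \<delta> where \<delta>: "\<delta> > 0" "von_Neumann_bounded (y ` {s. \<bar>s - t\<bar> \<le> \<delta>})"
    using smooth_at_locally_bounded[OF y] .
  obtain q where q: "\<And>h. L (r t + h) - L (r t) = h *\<^sub>R q h" "(q \<longlongrightarrow> L') (nhds 0)"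
    using has_curve_derivative_caratheodory[OF L] by metis
  define k where "k h = r (t + h) - r t" for h
  have "(k \<longlongrightarrow> 0) (at 0)"
    using DERIV_isCont[OF r] unfolding isCont_iff k_def by (rule LIM_zero)
  then have q_lim: "((\<lambda>h. q (k h)) \<longlongrightarrow> L') (at 0)"
    by (rule filterlim_compose[OF q(2)])
  have lim1: "((\<lambda>h. dual_apply (q (k h)) (y (t + h)) - dual_apply L' (y (t + h))) \<longlongrightarrow> 0) (at 0)"
  proof (rule tendstoI)
    fix e :: real
    assume e: "0 < e"
    then have "0 < e / 2"
      by simp
    then have "\<forall>\<^sub>F h in at 0. \<forall>x\<in>y ` {s. \<bar>s - t\<bar> \<le> \<delta>}. \<bar>dual_apply (q (k h)) x - dual_apply L' x\<bar> \<le> e / 2"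
      using q_lim \<delta>(2) unfolding dual_tendsto_iff by blast
    moreover have "\<forall>\<^sub>F h in at 0. \<bar>h\<bar> \<le> \<delta>"
      using \<delta>(1) unfolding eventually_at by (intro exI[of _ \<delta>]) (simp add: dist_real_def)
    ultimately show "\<forall>\<^sub>F h in at 0. dist (dual_apply (q (k h)) (y (t + h)) - dual_apply L' (y (t + h))) 0 < e"
    proof eventually_elim
      case (elim h)
      then have "\<bar>dual_apply (q (k h)) (y (t + h)) - dual_apply L' (y (t + h))\<bar> \<le> e / 2"
        by simp
      then show ?case
        using e by simp
    qed
  qed
  have lim2: "((\<lambda>h. dual_apply L' (y (t + h))) \<longlongrightarrow> dual_apply L' (y t)) (at 0)"
    using DERIV_isCont[OF dual_apply_DERIV[OF y, of L']] unfolding isCont_iff .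
  have lim3: "((\<lambda>h. (dual_apply (L (r t)) (y (t + h)) - dual_apply (L (r t)) (y t)) / h)
      \<longlongrightarrow> dual_apply (L (r t)) (curve_deriv y t)) (at 0)"
    using dual_apply_DERIV[OF y, of "L (r t)"] unfolding DERIV_def .
  have lim4: "((\<lambda>h. k h / h) \<longlongrightarrow> r') (at 0)"
    using r unfolding DERIV_def k_def .
  have "((\<lambda>h. k h / h * ((dual_apply (q (k h)) (y (t + h)) - dual_apply L' (y (t + h))) + dual_apply L' (y (t + h)))
      + (dual_apply (L (r t)) (y (t + h)) - dual_apply (L (r t)) (y t)) / h)
      \<longlongrightarrow> r' * (0 + dual_apply L' (y t)) + dual_apply (L (r t)) (curve_deriv y t)) (at 0)"
    by (intro tendsto_add tendsto_mult lim1 lim2 lim3 lim4)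
  moreover have "k h / h * ((dual_apply (q (k h)) (y (t + h)) - dual_apply L' (y (t + h))) + dual_apply L' (y (t + h)))
      + (dual_apply (L (r t)) (y (t + h)) - dual_apply (L (r t)) (y t)) / h
      = (dual_apply (L (r (t + h))) (y (t + h)) - dual_apply (L (r t)) (y t)) / h" for h
  proof -
    have "dual_apply (L (r (t + h)) - L (r t)) (y (t + h)) = dual_apply (k h *\<^sub>R q (k h)) (y (t + h))"
      using q(1)[of "k h"] by (simp add: k_def)
    then have "dual_apply (L (r (t + h))) (y (t + h)) - dual_apply (L (r t)) (y (t + h))
        = k h * dual_apply (q (k h)) (y (t + h))"
      by (simp add: scaleR_dual.rep_eq minus_dual.rep_eq)
    then show ?thesis
      by (simp add: add_divide_distrib[symmetric])
  qed
  ultimately show ?thesis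
    unfolding DERIV_def by simp
qed

lemma smooth_near_curve_deriv:
  fixes c :: "real \<Rightarrow> 'a::{real_vector,t2_space}"
  shows "smooth_near c t \<Longrightarrow> smooth_near (curve_deriv c) t"
  unfolding smooth_near_def by (erule eventually_mono) (rule smooth_at_deriv(3))

text \<open>The type \<open>dual\<close> is no instance of \<open>locally_convex_space\<close>, so
  the general rules do not apply to \<open>L\<close>. Its derivatives \<open>D\<close> are taken
  from the definition, and the induction runs over the real-valued pairings, for all
  \<open>m\<close> and \<open>y\<close> at once.\<close>

lemma smooth_near_dual_pairing:
  fixes y :: "real \<Rightarrow> 'a::locally_convex_space"
  assumes L: "smooth_curve_on S L" "open S" and r: "smooth_near r t" "r t \<in> S" and y: "smooth_near y t"
  shows "smooth_near (\<lambda>s. dual_apply (L (r s)) (y s)) t"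
proof -
  obtain D where D: "\<And>s. s \<in> S \<Longrightarrow> D 0 s = L s"
      "\<And>n s. s \<in> S \<Longrightarrow> has_curve_derivative (D n) (D (Suc n) s) s"
    using L(1) unfolding smooth_curve_on_def by auto
  have evS: "\<forall>\<^sub>F s in nhds t. r s \<in> S" if "smooth_near r t" "r t \<in> S" for t
    using smooth_at_imp_tendsto[OF smooth_near_imp_smooth_at[OF that(1)]] L(2) that(2)
    by (rule topological_tendstoD)
  have ck: "curve_ck n (\<lambda>s. dual_apply (D m (r s)) (y s)) t"
    if r: "smooth_near r t" "r t \<in> S" and "smooth_near y t" for n m y t
    using that(3)
  proof (induction n arbitrary: m y)
    case (Suc n)
    have "\<forall>\<^sub>F s in nhds t. has_curve_derivative (\<lambda>s. dual_apply (D m (r s)) (y s))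
        (curve_deriv r s *\<^sub>R dual_apply (D (Suc m) (r s)) (y s) + dual_apply (D m (r s)) (curve_deriv y s)) s"
      using evS[OF r] r(1) Suc.prems unfolding smooth_near_def
    proof eventually_elim
      case (elim s)
      have "(r has_real_derivative curve_deriv r s) (at s)"
        using smooth_at_deriv(2)[OF elim(2)] by (simp add: has_curve_derivative_real_iff)
      from dual_pairing_DERIV[OF D(2)[OF elim(1)] this elim(3)] show ?case
        by (simp add: has_curve_derivative_real_iff)
    qed
    moreover have "curve_ck n (curve_deriv r) t"
      using smooth_near_imp_smooth_at[OF smooth_near_curve_deriv[OF r(1)]] by (simp add: smooth_at_def)
    then have "curve_ck n (\<lambda>s. curve_deriv r s *\<^sub>R dual_apply (D (Suc m) (r s)) (y s)
        + dual_apply (D m (r s)) (curve_deriv y s)) t"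
      by (intro curve_ck_add curve_ck_scaleR Suc.IH Suc.prems smooth_near_curve_deriv)
    ultimately show ?case
      by auto
  qed simp
  have nbh: "\<forall>\<^sub>F s in nhds t. smooth_near c s" if "smooth_near c t" for c :: "real \<Rightarrow> 'b::{real_vector,topological_space}"
    using that unfolding smooth_near_def by (simp add: eventually_eventually)
  from evS[OF r] nbh[OF r(1)] nbh[OF y]
  have "\<forall>\<^sub>F s in nhds t. smooth_at (\<lambda>s. dual_apply (D 0 (r s)) (y s)) s"
    by eventually_elim (simp add: smooth_at_def ck)
  then have "smooth_near (\<lambda>s. dual_apply (D 0 (r s)) (y s)) t"
    unfolding smooth_near_def .
  moreover have "\<forall>\<^sub>F s in nhds t. dual_apply (D 0 (r s)) (y s) = dual_apply (L (r s)) (y s)"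
    using evS[OF r] by (rule eventually_mono) (simp add: D(1))
  ultimately show ?thesis
    by (simp add: smooth_near_cong)
qed


subsection \<open>Smoothness from joint smoothness\<close>

text \<open>Varying the vector together with the time allows bad times and bad vectors to be placed
  on the same pair of curves.\<close>

definition jointly_smooth :: "(real \<Rightarrow> 'a::{real_vector,topological_space} \<Rightarrow> real) \<Rightarrow> bool" where
  "jointly_smooth h \<longleftrightarrow> (\<forall>t. linear (h t)) \<and>
     (\<forall>\<tau> b. smooth_curve \<tau> \<longrightarrow> smooth_curve b \<longrightarrow> smooth_curve (\<lambda>r. h (\<tau> r) (b r)))"

context
  fixes h :: "real \<Rightarrow> 'a::locally_convex_space \<Rightarrow> real"
  assumes h: "jointly_smooth h"
begin

lemma jointly_smooth_linear: "linear (h t)"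
  using h unfolding jointly_smooth_def by blast

lemma jointly_smoothD: "smooth_curve \<tau> \<Longrightarrow> smooth_curve b \<Longrightarrow> smooth_curve (\<lambda>r. h (\<tau> r) (b r))"
  using h unfolding jointly_smooth_def by blast

lemma jointly_smooth_slice: "smooth_curve (\<lambda>s. h s x)"
  by (rule jointly_smoothD[OF smooth_curve_intros(2,1)])

lemma jointly_smooth_dual_apply: "dual_apply (Abs_dual (h t)) = h t"
  by (intro dual_apply_Abs_dual jointly_smooth_linear cinf_continuousI
      jointly_smoothD[OF smooth_curve_intros(1)])

text \<open>Feeds the iteration over all orders; the analytic input is
  \<open>smooth_surface_partial_smooth\<close> for the surface
  \<open>h (\<tau> r + s) (b r)\<close>.\<close>

lemma jointly_smooth_partial: "jointly_smooth (\<lambda>t x. deriv (\<lambda>s. h s x) t)"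
  unfolding jointly_smooth_def
proof (intro conjI allI impI)
  fix t :: real
  note D = smooth_curve_DERIV(1)[OF jointly_smooth_slice]
  show "linear (\<lambda>x. deriv (\<lambda>s. h s x) t)"
  proof (rule linearI)
    fix x y :: 'a and r :: real
    show "deriv (\<lambda>s. h s (x + y)) t = deriv (\<lambda>s. h s x) t + deriv (\<lambda>s. h s y) t"
      unfolding linear_add[OF jointly_smooth_linear] by (intro DERIV_imp_deriv DERIV_add D)
    have "((\<lambda>s. r * h s x) has_real_derivative r * deriv (\<lambda>s. h s x) t) (at t)"
      by (intro DERIV_cmult D)
    then show "deriv (\<lambda>s. h s (r *\<^sub>R x)) t = r *\<^sub>R deriv (\<lambda>s. h s x) t"
      unfolding linear_cmul[OF jointly_smooth_linear] by (simp add: DERIV_imp_deriv)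
  qed
next
  fix \<tau> :: "real \<Rightarrow> real" and b :: "real \<Rightarrow> 'a"
  assume \<tau>: "smooth_curve \<tau>" and b: "smooth_curve b"
  have "smooth_surface (\<lambda>r s. h (\<tau> r + s) (b r))"
    unfolding smooth_surface_def
  proof (intro allI impI)
    fix x y :: "real \<Rightarrow> real"
    assume xy: "smooth_curve x" "smooth_curve y"
    show "smooth_curve (\<lambda>t. h (\<tau> (x t) + y t) (b (x t)))"
      by (rule jointly_smoothD[OF smooth_curve_intros(3)[OF smooth_curve_compose[OF \<tau> xy(1)] xy(2)]
            smooth_curve_compose[OF b xy(1)]])
  qed
  then have "smooth_curve (\<lambda>r. deriv (\<lambda>s. h (\<tau> r + s) (b r)) 0)"
    by (rule smooth_surface_partial_smooth)
  moreover have "deriv (\<lambda>s. h (\<tau> r + s) (b r)) 0 = deriv (\<lambda>s. h s (b r)) (\<tau> r)" for r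
    using smooth_curve_DERIV(1)[OF jointly_smooth_slice, of "b r" "\<tau> r"]
    by (intro DERIV_imp_deriv) (simp add: DERIV_def)
  ultimately show "smooth_curve (\<lambda>r. deriv (\<lambda>s. h s (b r)) (\<tau> r))"
    by simp
qed

text \<open>Otherwise vectors \<open>x n \<in> B\<close> at times within \<open>\<epsilon> n\<close>
  of \<open>t\<close> have values above \<open>1 / \<epsilon> n\<close>. The vectors
  \<open>\<epsilon> n *\<^sub>R x n\<close> fall fast, so a smooth curve runs through them to 0,
  while the values along it stay above 1.\<close>

lemma jointly_smooth_locally_bounded:
  assumes B: "von_Neumann_bounded B"
  shows "\<exists>\<delta>>0. \<exists>C. \<forall>s x. \<bar>s - t\<bar> \<le> \<delta> \<longrightarrow> x \<in> B \<longrightarrow> \<bar>h s x\<bar> \<le> C"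
proof (rule ccontr)
  assume no: "\<not> ?thesis"
  define \<epsilon> :: "nat \<Rightarrow> real" where "\<epsilon> n = 1 / 2 ^ (n * n)" for n
  have \<epsilon>: "\<epsilon> n > 0" for n
    by (simp add: \<epsilon>_def)
  have "\<exists>s x. \<bar>s - t\<bar> \<le> \<epsilon> n \<and> x \<in> B \<and> 1 / \<epsilon> n < \<bar>h s x\<bar>" for n
  proof (rule ccontr)
    assume "\<not> (\<exists>s x. \<bar>s - t\<bar> \<le> \<epsilon> n \<and> x \<in> B \<and> 1 / \<epsilon> n < \<bar>h s x\<bar>)"
    then have "\<forall>s x. \<bar>s - t\<bar> \<le> \<epsilon> n \<longrightarrow> x \<in> B \<longrightarrow> \<bar>h s x\<bar> \<le> 1 / \<epsilon> n"
      by (meson not_le)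
    then show False
      using no \<epsilon>[of n] by blast
  qed
  then obtain s x where sx: "\<And>n. \<bar>s n - t\<bar> \<le> \<epsilon> n" "\<And>n. x n \<in> B" "\<And>n. 1 / \<epsilon> n < \<bar>h (s n) (x n)\<bar>"
    by metis
  define \<tau> where "\<tau> r = t + affine_special_curve (\<lambda>n. s n - t) (\<lambda>n. 0) r" for r
  define b where "b = affine_special_curve (\<lambda>n. \<epsilon> n *\<^sub>R x n) (\<lambda>n. 0)"
  have "smooth_curve \<tau>"
    unfolding \<tau>_def[abs_def] using sx(1)
    by (intro smooth_curve_intros smooth_curve_affine_special_curve fast_falling_zero
        fast_falling_realI[of _ 1]) (simp add: \<epsilon>_def)
  moreover have "fast_falling (\<lambda>n. \<epsilon> n *\<^sub>R x n)"
  proof (rule fast_fallingI)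
    fix p :: "'a \<Rightarrow> real"
    assume p: "continuous_seminorm p"
    obtain K where "\<And>x. x \<in> B \<Longrightarrow> p x \<le> K"
      using B p unfolding von_Neumann_bounded_iff_seminorm by blast
    then show "\<exists>K. \<forall>n. p (\<epsilon> n *\<^sub>R x n) \<le> K / 2 ^ (n * n)"
      using sx(2) by (intro exI[of _ K]) (simp add: \<epsilon>_def seminorm_scaleR[OF p] divide_right_mono)
  qed
  then have "smooth_curve b"
    unfolding b_def by (rule smooth_curve_affine_special_curve[OF _ fast_falling_zero])
  ultimately have "smooth_at (\<lambda>r. h (\<tau> r) (b r)) 0"
    using jointly_smoothD unfolding smooth_curve_iff_smooth_at by blast
  then have "((\<lambda>r. h (\<tau> r) (b r)) \<longlongrightarrow> h (\<tau> 0) (b 0)) (nhds 0)"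
    by (rule smooth_at_imp_tendsto)
  moreover have "(\<lambda>n. 1 / 2 ^ n) \<longlonglongrightarrow> (0::real)"
    by (rule inverse_power_two_tendsto_0)
  ultimately have "(\<lambda>n. h (\<tau> (1 / 2 ^ n)) (b (1 / 2 ^ n))) \<longlonglongrightarrow> h (\<tau> 0) (b 0)"
    by (rule filterlim_compose)
  then have "(\<lambda>n. h (s n) (\<epsilon> n *\<^sub>R x n)) \<longlonglongrightarrow> 0"
    by (simp add: \<tau>_def b_def affine_special_curve_0 affine_special_curve_at linear_0[OF jointly_smooth_linear])
  then have "\<forall>\<^sub>F n in sequentially. \<bar>h (s n) (\<epsilon> n *\<^sub>R x n)\<bar> < 1"
    using tendstoD[of "\<lambda>n. h (s n) (\<epsilon> n *\<^sub>R x n)" 0 sequentially 1] by simp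
  then obtain n where "\<bar>h (s n) (\<epsilon> n *\<^sub>R x n)\<bar> < 1"
    using eventually_happens[of _ sequentially] by auto
  moreover have "1 < \<epsilon> n * \<bar>h (s n) (x n)\<bar>"
    using sx(3)[of n] \<epsilon>[of n] by (simp add: pos_divide_less_eq mult.commute)
  ultimately show False
    using \<epsilon>[of n] by (simp add: linear_cmul[OF jointly_smooth_linear] abs_mult)
qed

end

text \<open>Convergence in the strong topology needs the remainder estimate uniformly on a bounded
  set. It comes from local boundedness of the second time derivative, which is again jointly
  smooth.\<close>

lemma jointly_smooth_has_curve_derivative:
  fixes h :: "real \<Rightarrow> 'a::locally_convex_space \<Rightarrow> real"
  assumes h: "jointly_smooth h"
  shows "has_curve_derivative (\<lambda>t. Abs_dual (h t)) (Abs_dual (\<lambda>x. deriv (\<lambda>s. h s x) t)) t"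
  unfolding has_curve_derivative_def dual_tendsto_iff
proof (intro allI impI)
  fix B :: "'a set" and e :: real
  assume B: "von_Neumann_bounded B" and e: "0 < e"
  note h' = jointly_smooth_partial[OF h]
  obtain \<delta> C where \<delta>: "\<delta> > 0" and C: "\<And>s x. \<bar>s - t\<bar> \<le> \<delta> \<Longrightarrow> x \<in> B \<Longrightarrow>
      \<bar>deriv (\<lambda>s. deriv (\<lambda>s. h s x) s) s\<bar> \<le> C"
    using jointly_smooth_locally_bounded[OF jointly_smooth_partial[OF h'] B, of t] by blast
  define d where "d = min \<delta> (e / (\<bar>C\<bar> + 1))"
  have d: "0 < d"
    using \<delta> e by (simp add: d_def)
  have "\<bar>dual_apply ((Abs_dual (h (t + k)) - Abs_dual (h t)) /\<^sub>R k) x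
      - dual_apply (Abs_dual (\<lambda>x. deriv (\<lambda>s. h s x) t)) x\<bar> \<le> e"
    if k: "k \<noteq> 0" "\<bar>k\<bar> < d" and x: "x \<in> B" for k x
  proof -
    have "\<bar>(h (t + k) x - h t x) / k - deriv (\<lambda>s. h s x) t\<bar> \<le> C * \<bar>k\<bar>"
      by (rule second_order_remainder_bound[OF jointly_smooth_slice[OF h]])
        (use C x k in \<open>auto simp: d_def\<close>)
    also have "\<dots> \<le> (\<bar>C\<bar> + 1) * (e / (\<bar>C\<bar> + 1))"
      using k(2) e by (intro mult_mono) (auto simp: d_def)
    also have "\<dots> = e"
      by simp
    finally show ?thesis
      unfolding scaleR_dual.rep_eq minus_dual.rep_eq jointly_smooth_dual_apply[OF h]
        jointly_smooth_dual_apply[OF h']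
      by (simp add: divide_inverse mult.commute)
  qed
  then show "\<forall>\<^sub>F k in at 0. \<forall>x\<in>B. \<bar>dual_apply ((Abs_dual (h (t + k)) - Abs_dual (h t)) /\<^sub>R k) x
      - dual_apply (Abs_dual (\<lambda>x. deriv (\<lambda>s. h s x) t)) x\<bar> \<le> e"
    unfolding eventually_at using d by (intro exI[of _ d]) (simp add: dist_real_def)
qed

theorem jointly_smooth_imp_smooth_curve_dual:
  fixes h :: "real \<Rightarrow> 'a::locally_convex_space \<Rightarrow> real"
  assumes h: "jointly_smooth h"
  shows "smooth_curve (\<lambda>t. Abs_dual (h t))"
proof -
  define H where "H n = ((\<lambda>h t x. deriv (\<lambda>s. h s x) t) ^^ n) h" for n
  have H: "jointly_smooth (H n)" for n
    by (induction n) (auto simp: H_def h intro: jointly_smooth_partial)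
  have "has_curve_derivative (\<lambda>t. Abs_dual (H n t)) (Abs_dual (H (Suc n) t)) t" for n t
    using jointly_smooth_has_curve_derivative[OF H, of n t] by (simp add: H_def)
  then show ?thesis
    unfolding smooth_curve_on_def
    by (intro exI[of _ "\<lambda>n t. Abs_dual (H n t)"]) (simp add: H_def)
qed

section \<open>Tangent spaces\<close>

lemma manifold_curve_iff:
  "manifold_curve A c \<longleftrightarrow> (\<forall>t. \<exists>U u S. (U, u) \<in> A \<and> open S \<and> t \<in> S \<and> c ` S \<subseteq> U \<and> smooth_curve_on S (u \<circ> c))"
  unfolding manifold_curve_def Bex_def by (auto; blast)

locale convenient_manifold =
  fixes M :: "'m set" and A :: "('m, 'e::convenient_vector_space) chart set"
  assumes smooth_manifold: "smooth_manifold M A"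
begin

lemma chart_inj: "(U, u) \<in> A \<Longrightarrow> inj_on u U"
  and chart_open: "(U, u) \<in> A \<Longrightarrow> cinf_open (u ` U)"
  and chart_subset: "(U, u) \<in> A \<Longrightarrow> U \<subseteq> M"
  using smooth_manifold unfolding smooth_manifold_def by force+

lemma overlap_open: "(U, u) \<in> A \<Longrightarrow> (V, v) \<in> A \<Longrightarrow> cinf_open (u ` (U \<inter> V))"
  and transition_smooth: "(U, u) \<in> A \<Longrightarrow> (V, v) \<in> A \<Longrightarrow> smooth_on (u ` (U \<inter> V)) (v \<circ> inv_into U u)"
  using smooth_manifold unfolding smooth_manifold_def by fast+

lemma chart_exists:
  assumes "p \<in> M"
  obtains U u where "(U, u) \<in> A" "p \<in> U"
proof -
  have "p \<in> \<Union> (fst ` A)"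
    using assms smooth_manifold unfolding smooth_manifold_def by simp
  then obtain x where "x \<in> A" "p \<in> fst x"
    by blast
  then show ?thesis
    using that[of "fst x" "snd x"] by simp
qed

text \<open>The definition gives smoothness in some chart around each time. The c^infinity-openness
  of the overlap keeps the curve in the other chart near \<open>t\<close>, and the transition map
  transfers smoothness, so any chart at hand may be used.\<close>

lemma manifold_curve_chart:
  assumes c: "manifold_curve A c" and u: "(U, u) \<in> A" "c t \<in> U"
  shows "smooth_near (\<lambda>s. u (c s)) t" "\<forall>\<^sub>F s in nhds t. c s \<in> U"
proof -
  obtain V v S where v: "(V, v) \<in> A" and S: "open S" "t \<in> S" "c ` S \<subseteq> V" "smooth_curve_on S (v \<circ> c)"
    using c unfolding manifold_curve_iff by blast
  have near: "smooth_near (\<lambda>s. v (c s)) t"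
    using smooth_curve_on_imp_smooth_near[OF S(4,1,2)] by (simp add: comp_def)
  have t: "v (c t) \<in> v ` (V \<inter> U)"
    using S(2,3) u(2) by blast
  have ev: "\<forall>\<^sub>F s in nhds t. s \<in> S"
    using S(1,2) by (rule eventually_nhds_in_open)
  from smooth_near_eventually_in[OF near overlap_open[OF v u(1)] t] ev
  show "\<forall>\<^sub>F s in nhds t. c s \<in> U"
  proof eventually_elim
    case (elim s)
    then obtain y where "y \<in> V \<inter> U" "v (c s) = v y"
      by auto
    then show ?case
      using inj_onD[OF chart_inj[OF v], of "c s" y] S(3) elim(2) by auto
  qed
  have "smooth_near (\<lambda>s. (u \<circ> inv_into V v) (v (c s))) t"
    by (rule smooth_on_smooth_near[OF transition_smooth[OF v u(1)] overlap_open[OF v u(1)] near t])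
  moreover have "\<forall>\<^sub>F s in nhds t. (u \<circ> inv_into V v) (v (c s)) = u (c s)"
    using ev by (rule eventually_mono) (use S(3) chart_inj[OF v] in auto)
  ultimately show "smooth_near (\<lambda>s. u (c s)) t"
    by (simp add: smooth_near_cong)
qed

lemma manifold_curve_in_M: "manifold_curve A c \<Longrightarrow> c t \<in> M"
  unfolding manifold_curve_iff using chart_subset by blast

lemma chart_curve:
  assumes u: "(U, u) \<in> A" and x: "smooth_curve x" "range x \<subseteq> u ` U"
  shows "manifold_curve A (\<lambda>t. inv_into U u (x t))" "inv_into U u (x t) \<in> U" "u (inv_into U u (x t)) = x t"
proof -
  have x': "x t \<in> u ` U" for t
    using x(2) by blast
  show "inv_into U u (x t) \<in> U" "u (inv_into U u (x t)) = x t"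
    using x' by (auto intro: inv_into_into f_inv_into_f)
  have "u \<circ> (\<lambda>t. inv_into U u (x t)) = x"
    using x' by (auto simp: fun_eq_iff intro: f_inv_into_f)
  then show "manifold_curve A (\<lambda>t. inv_into U u (x t))"
    unfolding manifold_curve_iff using u x(1) x'
    by (intro allI exI[of _ U] exI[of _ u] exI[of _ UNIV]) (auto intro: inv_into_into)
qed

lemma manifold_curve_transition:
  assumes c: "manifold_curve A c" and u: "(U, u) \<in> A" "c t \<in> U" and v: "(V, v) \<in> A" "c t \<in> V"
    and a: "has_curve_derivative (\<lambda>s. u (c s)) a t"
  shows "has_curve_derivative (\<lambda>s. v (c s)) (dir_deriv (v \<circ> inv_into U u) (u (c t)) a) t"
    and "linear (dir_deriv (v \<circ> inv_into U u) (u (c t)))"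
proof -
  have t: "u (c t) \<in> u ` (U \<inter> V)"
    using u v by blast
  note chain = chain_rule[OF transition_smooth[OF u(1) v(1)] overlap_open[OF u(1) v(1)]
      manifold_curve_chart(1)[OF c u] t a]
  show "linear (dir_deriv (v \<circ> inv_into U u) (u (c t)))"
    by (rule chain(2))
  have ev: "\<forall>\<^sub>F s in nhds t. (v \<circ> inv_into U u) (u (c s)) = v (c s)"
    using manifold_curve_chart(2)[OF c u] by (rule eventually_mono) (use chart_inj[OF u(1)] in auto)
  show "has_curve_derivative (\<lambda>s. v (c s)) (dir_deriv (v \<circ> inv_into U u) (u (c t)) a) t"
    using chain(1) has_curve_derivative_cong[OF ev] by simp
qed

lemma manifold_curve_velocity:
  assumes "manifold_curve A c" "(U, u) \<in> A" "c t \<in> U"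
  shows "has_curve_derivative (\<lambda>s. u (c s)) (curve_deriv (\<lambda>s. u (c s)) t) t"
  by (rule smooth_at_deriv(2)[OF smooth_near_imp_smooth_at[OF manifold_curve_chart(1)[OF assms]]])

lemma curve_equiv_iff:
  "(c, k) \<in> curve_equiv A \<longleftrightarrow> manifold_curve A c \<and> manifold_curve A k \<and> c 0 = k 0 \<and>
    (\<forall>U u. (U, u) \<in> A \<longrightarrow> c 0 \<in> U \<longrightarrow>
      (\<exists>d. has_curve_derivative (\<lambda>s. u (c s)) d 0 \<and> has_curve_derivative (\<lambda>s. u (k s)) d 0))"
  unfolding curve_equiv_def comp_def by auto

lemma equiv_curve_equiv: "equiv {c. manifold_curve A c} (curve_equiv A)"
proof (rule equivI)
  show "curve_equiv A \<subseteq> {c. manifold_curve A c} \<times> {c. manifold_curve A c}"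
    by (auto simp: curve_equiv_iff)
  show "refl_on {c. manifold_curve A c} (curve_equiv A)"
    unfolding refl_on_def curve_equiv_iff using manifold_curve_velocity by blast
  show "sym (curve_equiv A)"
    unfolding sym_def curve_equiv_iff by (auto 4 4)
  show "trans (curve_equiv A)"
  proof (rule transI)
    fix c k m
    assume ck: "(c, k) \<in> curve_equiv A" and km: "(k, m) \<in> curve_equiv A"
    have "\<exists>d. has_curve_derivative (\<lambda>s. u (c s)) d 0 \<and> has_curve_derivative (\<lambda>s. u (m s)) d 0"
      if u: "(U, u) \<in> A" "c 0 \<in> U" for U u
    proof -
      obtain d where "has_curve_derivative (\<lambda>s. u (c s)) d 0" "has_curve_derivative (\<lambda>s. u (k s)) d 0"
        using ck u unfolding curve_equiv_iff by blast
      moreover obtain e where "has_curve_derivative (\<lambda>s. u (k s)) e 0" "has_curve_derivative (\<lambda>s. u (m s)) e 0"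
        using ck km u unfolding curve_equiv_iff by force
      ultimately show ?thesis
        using has_curve_derivative_unique by blast
    qed
    then show "(c, m) \<in> curve_equiv A"
      using ck km by (simp add: curve_equiv_iff)
  qed
qed

lemma tangent_space_iff:
  "v \<in> tangent_space A p \<longleftrightarrow> (\<exists>c. manifold_curve A c \<and> c 0 = p \<and> v = curve_equiv A `` {c})"
  unfolding tangent_space_def quotient_def by auto

lemma tangent_space_nonempty:
  assumes "v \<in> tangent_space A p"
  obtains c where "c \<in> v"
proof -
  obtain c where "manifold_curve A c" "v = curve_equiv A `` {c}"
    using assms unfolding tangent_space_iff by blast
  then show ?thesis
    using equiv_class_self[OF equiv_curve_equiv, of c] that by simp
qed

lemma tangent_space_curve:
  assumes "v \<in> tangent_space A p" "c \<in> v"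
  shows "manifold_curve A c" "c 0 = p" "v = curve_equiv A `` {c}"
proof -
  obtain k where k: "k 0 = p" "v = curve_equiv A `` {k}"
    using assms(1) unfolding tangent_space_iff by blast
  then have kc: "(k, c) \<in> curve_equiv A"
    using assms(2) by simp
  then show "manifold_curve A c" "c 0 = p"
    using k(1) by (auto simp: curve_equiv_iff)
  show "v = curve_equiv A `` {c}"
    using equiv_class_eq[OF equiv_curve_equiv kc] k(2) by simp
qed

lemma tangent_space_in_M: "v \<in> tangent_space A p \<Longrightarrow> p \<in> M"
  using tangent_space_nonempty tangent_space_curve manifold_curve_in_M by metis

lemma tangent_coord_derivative:
  assumes v: "v \<in> tangent_space A p" and u: "(U, u) \<in> A" "p \<in> U" and c: "c \<in> v"
  shows "has_curve_derivative (\<lambda>s. u (c s)) (tangent_coord u v) 0"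
proof -
  note C = tangent_space_curve[OF v c]
  have "\<forall>k\<in>v. has_curve_derivative (u \<circ> k) (curve_deriv (\<lambda>s. u (c s)) 0) 0"
  proof
    fix k
    assume "k \<in> v"
    then have "(c, k) \<in> curve_equiv A"
      using C(3) by simp
    then obtain d where "has_curve_derivative (\<lambda>s. u (c s)) d 0" "has_curve_derivative (\<lambda>s. u (k s)) d 0"
      using u C(2) by (auto simp: curve_equiv_iff)
    then show "has_curve_derivative (u \<circ> k) (curve_deriv (\<lambda>s. u (c s)) 0) 0"
      using curve_deriv_eq by (fastforce simp: comp_def)
  qed
  note D = this
  have "tangent_coord u v = curve_deriv (\<lambda>s. u (c s)) 0"
    unfolding tangent_coord_def
  proof (rule the_equality)
    show "\<forall>k\<in>v. has_curve_derivative (u \<circ> k) (curve_deriv (\<lambda>s. u (c s)) 0) 0"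
      by (rule D)
    fix d
    assume "\<forall>k\<in>v. has_curve_derivative (u \<circ> k) d 0"
    then show "d = curve_deriv (\<lambda>s. u (c s)) 0"
      using c curve_deriv_eq[of "\<lambda>s. u (c s)" d 0] by (simp add: comp_def)
  qed
  then show ?thesis
    using c D by (simp add: comp_def)
qed

lemma tangent_coord_transition:
  assumes z: "z \<in> tangent_space A p" and u: "(U, u) \<in> A" "p \<in> U" and v: "(V, v) \<in> A" "p \<in> V"
  shows "tangent_coord v z = dir_deriv (v \<circ> inv_into U u) (u p) (tangent_coord u z)"
    and "linear (dir_deriv (v \<circ> inv_into U u) (u p))"
proof -
  obtain c where c: "c \<in> z"
    using tangent_space_nonempty[OF z] .
  note C = tangent_space_curve[OF z c]
  have p: "c 0 \<in> U" "c 0 \<in> V"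
    using C(2) u v by auto
  note T = manifold_curve_transition[OF C(1) u(1) p(1) v(1) p(2) tangent_coord_derivative[OF z u c]]
  show "tangent_coord v z = dir_deriv (v \<circ> inv_into U u) (u p) (tangent_coord u z)"
    using has_curve_derivative_unique[OF tangent_coord_derivative[OF z v c] T(1)] C(2) by simp
  show "linear (dir_deriv (v \<circ> inv_into U u) (u p))"
    using T(2) C(2) by simp
qed

lemma tangent_coord_inject:
  assumes v: "v \<in> tangent_space A p" and w: "w \<in> tangent_space A p" and u: "(U, u) \<in> A" "p \<in> U"
    and eq: "tangent_coord u v = tangent_coord u w"
  shows "v = w"
proof -
  obtain c where c: "c \<in> v"
    using tangent_space_nonempty[OF v] .
  obtain k where k: "k \<in> w"
    using tangent_space_nonempty[OF w] .
  note ck = c k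
  note C = tangent_space_curve[OF v ck(1)] and K = tangent_space_curve[OF w ck(2)]
  have "\<exists>d. has_curve_derivative (\<lambda>s. x (c s)) d 0 \<and> has_curve_derivative (\<lambda>s. x (k s)) d 0"
    if x: "(X, x) \<in> A" "c 0 \<in> X" for X x
  proof -
    have pX: "p \<in> X"
      using x(2) C(2) by simp
    have "tangent_coord x v = tangent_coord x w"
      using tangent_coord_transition(1)[OF v u x(1) pX] tangent_coord_transition(1)[OF w u x(1) pX] eq by simp
    then show ?thesis
      using tangent_coord_derivative[OF v x(1) pX ck(1)] tangent_coord_derivative[OF w x(1) pX ck(2)] by auto
  qed
  then have "(c, k) \<in> curve_equiv A"
    using C K by (simp add: curve_equiv_iff)
  then show ?thesis
    using equiv_class_eq[OF equiv_curve_equiv] C(3) K(3) by blast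
qed

text \<open>The straight line in direction \<open>a\<close> may leave the image of the chart; a
  global curve inside the image with the same germ has the same velocity.\<close>

lemma tangent_coord_surj:
  assumes u: "(U, u) \<in> A" "p \<in> U"
  obtains v where "v \<in> tangent_space A p" "tangent_coord u v = a"
proof -
  have line: "smooth_near (\<lambda>s. u p + s *\<^sub>R a) 0" "u p + 0 *\<^sub>R a \<in> u ` U"
    using smooth_curve_imp_smooth_near[OF smooth_curve_line] u(2) by auto
  obtain x where x: "smooth_curve x" "range x \<subseteq> u ` U" "\<forall>\<^sub>F s in nhds 0. x s = u p + s *\<^sub>R a"
    using smooth_near_globalize[OF line(1) chart_open[OF u(1)] line(2)] by blast
  define c where "c = (\<lambda>t. inv_into U u (x t))"
  have uc: "(\<lambda>s. u (c s)) = x"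
    using chart_curve(3)[OF u(1) x(1,2)] by (simp add: c_def)
  have x0: "x 0 = u p"
    using eventually_nhds_x_imp_x[OF x(3)] by simp
  then have c: "manifold_curve A c" "c 0 = p"
    using chart_curve(1)[OF u(1) x(1,2)] chart_inj[OF u(1)] u(2) by (simp_all add: c_def)
  define v where "v = curve_equiv A `` {c}"
  have v: "v \<in> tangent_space A p" "c \<in> v"
    using c equiv_class_self[OF equiv_curve_equiv, of c] unfolding tangent_space_iff v_def by auto
  have "has_curve_derivative (\<lambda>s. u p + s *\<^sub>R a) (0 + (1 *\<^sub>R a + 0 *\<^sub>R 0)) 0"
    by (intro has_curve_derivative_add has_curve_derivative_scaleR has_curve_derivative_const)
      (auto intro!: derivative_eq_intros)
  then have "has_curve_derivative x a 0"
    using has_curve_derivative_cong[OF x(3)] by simp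
  then have "tangent_coord u v = a"
    using tangent_coord_derivative[OF v(1) u v(2)] has_curve_derivative_unique unfolding uc by blast
  then show ?thesis
    using v(1) that by blast
qed

text \<open>Evaluates the definite descriptions behind zero, sum and multiples: one chart determines
  the vector, and compatibility of \<open>F\<close> carries the equation to all other
  charts.\<close>

lemma tangent_vector_ex1:
  assumes p: "p \<in> M" and F: "\<And>U u V v. (U, u) \<in> A \<Longrightarrow> p \<in> U \<Longrightarrow> (V, v) \<in> A \<Longrightarrow> p \<in> V \<Longrightarrow>
      F v = dir_deriv (v \<circ> inv_into U u) (u p) (F u)"
  shows "\<exists>!z. z \<in> tangent_space A p \<and> (\<forall>(U, u)\<in>A. p \<in> U \<longrightarrow> tangent_coord u z = F u)"
proof -
  obtain U u where u: "(U, u) \<in> A" "p \<in> U"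
    using chart_exists[OF p] .
  obtain z where z: "z \<in> tangent_space A p" "tangent_coord u z = F u"
    using tangent_coord_surj[OF u] .
  have "tangent_coord v z = F v" if v: "(V, v) \<in> A" "p \<in> V" for V v
    using tangent_coord_transition(1)[OF z(1) u v] F[OF u v] z(2) by simp
  note coord = this
  show ?thesis
  proof (rule ex1I[of _ z])
    show "z \<in> tangent_space A p \<and> (\<forall>(U, u)\<in>A. p \<in> U \<longrightarrow> tangent_coord u z = F u)"
      using z(1) coord by auto
    fix y
    assume y: "y \<in> tangent_space A p \<and> (\<forall>(U, u)\<in>A. p \<in> U \<longrightarrow> tangent_coord u y = F u)"
    then have "tangent_coord u y = tangent_coord u z"
      using u z(2) by auto
    then show "y = z"
      using tangent_coord_inject[OF _ z(1) u] y by blast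
  qed
qed

section \<open>The vector space structure of the tangent spaces\<close>

lemma tangent_zero:
  assumes "p \<in> M"
  shows "tangent_zero A p \<in> tangent_space A p"
    and "\<And>U u. (U, u) \<in> A \<Longrightarrow> p \<in> U \<Longrightarrow> tangent_coord u (tangent_zero A p) = 0"
proof -
  have "dir_deriv (v \<circ> inv_into U u) (u p) 0 = 0"
    if u: "(U, u) \<in> A" "p \<in> U" and v: "(V, v) \<in> A" "p \<in> V" for U u V v
  proof -
    obtain z where "z \<in> tangent_space A p"
      using tangent_coord_surj[OF u] .
    from tangent_coord_transition(2)[OF this u v] show ?thesis
      by (rule linear_0)
  qed
  then have "\<exists>!z. z \<in> tangent_space A p \<and> (\<forall>(U, u)\<in>A. p \<in> U \<longrightarrow> tangent_coord u z = 0)"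
    using tangent_vector_ex1[OF assms, of "\<lambda>u. 0"] by simp
  from theI'[OF this]
  show "tangent_zero A p \<in> tangent_space A p"
    and "\<And>U u. (U, u) \<in> A \<Longrightarrow> p \<in> U \<Longrightarrow> tangent_coord u (tangent_zero A p) = 0"
    unfolding tangent_zero_def by auto
qed

lemma tangent_add:
  assumes v: "v \<in> tangent_space A p" and w: "w \<in> tangent_space A p"
  shows "tangent_add A p v w \<in> tangent_space A p"
    and "\<And>U u. (U, u) \<in> A \<Longrightarrow> p \<in> U \<Longrightarrow>
      tangent_coord u (tangent_add A p v w) = tangent_coord u v + tangent_coord u w"
proof -
  have "tangent_coord y v + tangent_coord y w
      = dir_deriv (y \<circ> inv_into U u) (u p) (tangent_coord u v + tangent_coord u w)"
    if "(U, u) \<in> A" "p \<in> U" "(Y, y) \<in> A" "p \<in> Y" for U u Y y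
    using tangent_coord_transition[OF v that] tangent_coord_transition(1)[OF w that] by (simp add: linear_add)
  then have "\<exists>!z. z \<in> tangent_space A p \<and>
      (\<forall>(U, u)\<in>A. p \<in> U \<longrightarrow> tangent_coord u z = tangent_coord u v + tangent_coord u w)"
    by (rule tangent_vector_ex1[OF tangent_space_in_M[OF v]])
  from theI'[OF this]
  show "tangent_add A p v w \<in> tangent_space A p"
    and "\<And>U u. (U, u) \<in> A \<Longrightarrow> p \<in> U \<Longrightarrow>
      tangent_coord u (tangent_add A p v w) = tangent_coord u v + tangent_coord u w"
    unfolding tangent_add_def by auto
qed

lemma tangent_scale:
  assumes v: "v \<in> tangent_space A p"
  shows "tangent_scale A p r v \<in> tangent_space A p"
    and "\<And>U u. (U, u) \<in> A \<Longrightarrow> p \<in> U \<Longrightarrow> tangent_coord u (tangent_scale A p r v) = r *\<^sub>R tangent_coord u v"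
proof -
  have "r *\<^sub>R tangent_coord y v = dir_deriv (y \<circ> inv_into U u) (u p) (r *\<^sub>R tangent_coord u v)"
    if "(U, u) \<in> A" "p \<in> U" "(Y, y) \<in> A" "p \<in> Y" for U u Y y
    using tangent_coord_transition[OF v that] by (simp add: linear_cmul)
  then have "\<exists>!z. z \<in> tangent_space A p \<and>
      (\<forall>(U, u)\<in>A. p \<in> U \<longrightarrow> tangent_coord u z = r *\<^sub>R tangent_coord u v)"
    by (rule tangent_vector_ex1[OF tangent_space_in_M[OF v]])
  from theI'[OF this]
  show "tangent_scale A p r v \<in> tangent_space A p"
    and "\<And>U u. (U, u) \<in> A \<Longrightarrow> p \<in> U \<Longrightarrow> tangent_coord u (tangent_scale A p r v) = r *\<^sub>R tangent_coord u v"
    unfolding tangent_scale_def by auto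
qed

lemma footpoint_eq:
  assumes v: "v \<in> tangent_space A p"
  shows "footpoint v = p"
proof -
  obtain c where c: "c \<in> v"
    using tangent_space_nonempty[OF v] .
  show ?thesis
    unfolding footpoint_def
    by (rule the_equality) (use tangent_space_curve(2)[OF v] c in auto)
qed

lemma tangent_bundle_iff: "v \<in> tangent_bundle U A \<longleftrightarrow> footpoint v \<in> U \<and> v \<in> tangent_space A (footpoint v)"
proof
  assume "v \<in> tangent_bundle U A"
  then obtain p where "p \<in> U" "v \<in> tangent_space A p"
    unfolding tangent_bundle_def by blast
  then show "footpoint v \<in> U \<and> v \<in> tangent_space A (footpoint v)"
    using footpoint_eq by simp
qed (auto simp: tangent_bundle_def)

section \<open>Covectors in coordinates\<close>

lemma cotangent_coord_eqI:
  assumes u: "(U, u) \<in> A" "p \<in> U" and l: "\<And>v. v \<in> tangent_space A p \<Longrightarrow> \<alpha> v = dual_apply l (tangent_coord u v)"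
  shows "cotangent_coord A u p \<alpha> = l"
  unfolding cotangent_coord_def
proof (rule the_equality)
  show "\<forall>v\<in>tangent_space A p. \<alpha> v = dual_apply l (tangent_coord u v)"
    using l by blast
  fix m
  assume m: "\<forall>v\<in>tangent_space A p. \<alpha> v = dual_apply m (tangent_coord u v)"
  have "dual_apply m a = dual_apply l a" for a
  proof -
    obtain v where "v \<in> tangent_space A p" "tangent_coord u v = a"
      using tangent_coord_surj[OF u] .
    then show ?thesis
      using l m by metis
  qed
  then show "m = l"
    by (simp add: dual_apply_inject[symmetric] fun_eq_iff)
qed

lemma cotangent_coord_apply:
  assumes "\<alpha> \<in> cotangent_space A p" and u: "(U, u) \<in> A" "p \<in> U" and v: "v \<in> tangent_space A p"
  shows "dual_apply (cotangent_coord A u p \<alpha>) (tangent_coord u v) = \<alpha> v"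
proof -
  obtain l where l: "\<And>v. v \<in> tangent_space A p \<Longrightarrow> \<alpha> v = dual_apply l (tangent_coord u v)"
    using assms(1) u unfolding cotangent_space_def by fastforce
  show ?thesis
    using cotangent_coord_eqI[OF u l] l[OF v] by simp
qed

end

section \<open>One-forms and their exterior derivatives\<close>

lemma smooth_curve_on_components:
  fixes c :: "real \<Rightarrow> 'a::{real_vector,topological_space} \<times> 'b::{real_vector,topological_space}"
  assumes "smooth_curve_on S c"
  shows "smooth_curve_on S (\<lambda>t. fst (c t))" "smooth_curve_on S (\<lambda>t. snd (c t))"
proof -
  obtain D where D: "\<And>t. t \<in> S \<Longrightarrow> D 0 t = c t"
      "\<And>n t. t \<in> S \<Longrightarrow> has_curve_derivative (D n) (D (Suc n) t) t"
    using assms unfolding smooth_curve_on_def by auto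
  have "has_curve_derivative (\<lambda>t. fst (D n t)) (fst (D (Suc n) t)) t"
    "has_curve_derivative (\<lambda>t. snd (D n t)) (snd (D (Suc n) t)) t" if "t \<in> S" for n t
    using tendsto_fst[OF D(2)[OF that, of n, unfolded has_curve_derivative_def]]
      tendsto_snd[OF D(2)[OF that, of n, unfolded has_curve_derivative_def]]
    unfolding has_curve_derivative_def by simp_all
  then show "smooth_curve_on S (\<lambda>t. fst (c t))" "smooth_curve_on S (\<lambda>t. snd (c t))"
    unfolding smooth_curve_on_def using D(1)
    by (auto intro!: exI[of _ "\<lambda>n t. fst (D n t)"] exI[of _ "\<lambda>n t. snd (D n t)"])
qed

lemma smooth_curve_on_Pair:
  fixes c :: "real \<Rightarrow> 'a::{real_vector,topological_space}" and k :: "real \<Rightarrow> 'b::{real_vector,topological_space}"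
  assumes "smooth_curve_on S c" "smooth_curve_on S k"
  shows "smooth_curve_on S (\<lambda>t. (c t, k t))"
proof -
  obtain D where D: "\<And>t. t \<in> S \<Longrightarrow> D 0 t = c t"
      "\<And>n t. t \<in> S \<Longrightarrow> has_curve_derivative (D n) (D (Suc n) t) t"
    using assms(1) unfolding smooth_curve_on_def by auto
  obtain E where E: "\<And>t. t \<in> S \<Longrightarrow> E 0 t = k t"
      "\<And>n t. t \<in> S \<Longrightarrow> has_curve_derivative (E n) (E (Suc n) t) t"
    using assms(2) unfolding smooth_curve_on_def by auto
  have "has_curve_derivative (\<lambda>t. (D n t, E n t)) (D (Suc n) t, E (Suc n) t) t" if "t \<in> S" for n t
    using tendsto_Pair[OF D(2)[OF that, of n, unfolded has_curve_derivative_def]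
        E(2)[OF that, of n, unfolded has_curve_derivative_def]]
    unfolding has_curve_derivative_def by simp
  then show ?thesis
    unfolding smooth_curve_on_def using D(1) E(1) by (intro exI[of _ "\<lambda>n t. (D n t, E n t)"]) auto
qed

lemma smooth_curve_on_subset_cong:
  assumes "smooth_curve_on S c" "T \<subseteq> S" "\<And>t. t \<in> T \<Longrightarrow> c t = k t"
  shows "smooth_curve_on T k"
  using assms unfolding smooth_curve_on_def by (metis subsetD)

section \<open>Local representatives of the form\<close>

locale manifold_one_form = convenient_manifold M A
  for M :: "'m set" and A :: "('m, 'e::convenient_vector_space) chart set" +
  fixes \<eta> :: "'m \<Rightarrow> 'm cotangent"
  assumes form: "\<eta> \<in> one_forms M A"
begin

definition loc :: "'m set \<Rightarrow> ('m \<Rightarrow> 'e) \<Rightarrow> 'e \<Rightarrow> 'e \<Rightarrow> real" where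
  "loc U u x = dual_apply (local_form A (U, u) \<eta> x)"

lemma form_cotangent: "p \<in> M \<Longrightarrow> \<eta> p \<in> cotangent_space A p"
  using form unfolding one_forms_def by auto

lemma local_form_at:
  assumes "(U, u) \<in> A" "p \<in> U"
  shows "local_form A (U, u) \<eta> (u p) = cotangent_coord A u p (\<eta> p)"
  using assms chart_inj by (simp add: local_form_def)

lemma loc_eq:
  assumes u: "(U, u) \<in> A" "p \<in> U" and v: "v \<in> tangent_space A p"
  shows "loc U u (u p) (tangent_coord u v) = \<eta> p v"
  unfolding loc_def local_form_at[OF u]
  by (rule cotangent_coord_apply[OF form_cotangent[OF tangent_space_in_M[OF v]] u v])

lemma linear_loc: "linear (loc U u x)"
  unfolding loc_def by (rule linear_dual_apply)

lemma loc_transition: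
  assumes u: "(U, u) \<in> A" and v: "(V, v) \<in> A" and x: "x \<in> u ` (U \<inter> V)"
  shows "loc U u x b = loc V v ((v \<circ> inv_into U u) x) (dir_deriv (v \<circ> inv_into U u) x b)"
proof -
  obtain p where p: "p \<in> U" "p \<in> V" "x = u p"
    using x by blast
  obtain z where z: "z \<in> tangent_space A p" "tangent_coord u z = b"
    using tangent_coord_surj[OF u p(1)] .
  have "(v \<circ> inv_into U u) x = v p"
    using chart_inj[OF u] p by simp
  then show ?thesis
    using loc_eq[OF u p(1) z(1)] loc_eq[OF v p(2) z(1)] tangent_coord_transition(1)[OF z(1) u p(1) v p(2)]
      z(2) p(3) by simp
qed

text \<open>Smoothness into the cotangent bundle supplies a chart of its own around each time, which
  need not be the chart in which the curve is studied.\<close>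

lemma form_along_curve:
  assumes c: "manifold_curve A c"
  shows "\<exists>V v S. (V, v) \<in> A \<and> open S \<and> t \<in> S \<and> c ` S \<subseteq> V \<and>
    smooth_curve_on S (\<lambda>s. cotangent_coord A v (c s) (\<eta> (c s)))"
proof -
  have "manifold_curve (cotangent_atlas A) ((\<lambda>p. (p, \<eta> p)) \<circ> c)"
    using form c unfolding one_forms_def smooth_map_def by blast
  then obtain W w S where w: "(W, w) \<in> cotangent_atlas A" and S: "open S" "t \<in> S"
      "((\<lambda>p. (p, \<eta> p)) \<circ> c) ` S \<subseteq> W" "smooth_curve_on S (w \<circ> ((\<lambda>p. (p, \<eta> p)) \<circ> c))"
    unfolding manifold_curve_iff by blast
  obtain V v where v: "(V, v) \<in> A" "W = (SIGMA p:V. cotangent_space A p)"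
      "w = (\<lambda>(p, \<alpha>). (v p, cotangent_coord A v p \<alpha>))"
    using w unfolding cotangent_atlas_def by auto
  have "c ` S \<subseteq> V"
    using S(3) v(2) by auto
  moreover have "smooth_curve_on S (\<lambda>s. cotangent_coord A v (c s) (\<eta> (c s)))"
    using smooth_curve_on_components(2)[OF S(4)] by (simp add: v(3) comp_def)
  ultimately show ?thesis
    using v(1) S(1,2) by blast
qed

text \<open>The form is known to be smooth only in some chart \<open>V\<close> near
  \<open>t\<close>. The change of charts applies the covector in \<open>V\<close> to the derivative
  of the transition map at \<open>x s\<close> in direction \<open>b s\<close>. This is the
  derivative at \<open>r = 0\<close> of the surface \<open>G\<close>, so
  \<open>smooth_surface_partial_smooth\<close> applies.\<close>

lemma loc_smooth:
  assumes u: "(U, u) \<in> A" and x: "smooth_curve x" "range x \<subseteq> u ` U" and b: "smooth_curve b"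
  shows "smooth_curve (\<lambda>t. loc U u (x t) (b t))"
proof (rule smooth_curveI_near)
  fix t
  define c where "c = (\<lambda>t. inv_into U u (x t))"
  note C = chart_curve[OF u x]
  have c: "manifold_curve A c" "\<And>s. c s \<in> U" "\<And>s. u (c s) = x s"
    using C unfolding c_def by auto
  obtain V v S where v: "(V, v) \<in> A" and S: "open S" "t \<in> S" "c ` S \<subseteq> V"
      and L: "smooth_curve_on S (\<lambda>s. cotangent_coord A v (c s) (\<eta> (c s)))" (is "smooth_curve_on S ?L")
    using form_along_curve[OF c(1)] by blast
  let ?W = "u ` (U \<inter> V)" and ?f = "v \<circ> inv_into U u"
  have xW: "x s \<in> ?W" if "s \<in> S" for s
    using that S(3) c(2,3) by (metis IntI image_eqI image_subset_iff)
  define \<sigma> where "\<sigma> s r = x s + r *\<^sub>R b s" for s r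
  have \<sigma>: "smooth_surface \<sigma>"
    unfolding \<sigma>_def[abs_def] by (intro smooth_surface_intros smooth_curve_intros x(1) b)
  have "\<sigma> t 0 \<in> ?W"
    using xW[OF S(2)] by (simp add: \<sigma>_def)
  from smooth_surface_cutoff_within[OF \<sigma> overlap_open[OF u v] this S(1,2)]
  obtain \<rho> where \<rho>: "smooth_curve \<rho>" "\<rho> 0 = 0" "\<forall>\<^sub>F s in nhds 0. \<rho> s = s"
      "\<And>s r. \<sigma> (t + \<rho> s) (0 + \<rho> r) \<in> ?W" "\<And>s. t + \<rho> s \<in> S"
    by blast
  define G where "G s r = dual_apply (?L (t + \<rho> s)) (?f (\<sigma> (t + \<rho> s) (0 + \<rho> r)))" for s r
  have G: "smooth_surface G"
    unfolding smooth_surface_def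
  proof (intro allI impI smooth_curveI_near)
    fix p q :: "real \<Rightarrow> real" and s
    assume p: "smooth_curve p" and q: "smooth_curve q"
    have "smooth_curve (\<lambda>s. t + \<rho> (p s))"
      by (rule smooth_curve_intros(3)[OF smooth_curve_intros(1) smooth_curve_compose[OF \<rho>(1) p]])
    moreover have "smooth_curve (\<lambda>s. ?f (\<sigma> (t + \<rho> (p s)) (0 + \<rho> (q s))))"
      by (rule smooth_surfaceD[OF smooth_surface_compose_cutoff[OF \<sigma> transition_smooth[OF u v] \<rho>(1,4)] p q])
    ultimately show "smooth_near (\<lambda>s. G (p s) (q s)) s"
      unfolding G_def
      by (intro smooth_near_dual_pairing[OF L S(1), of "\<lambda>s. t + \<rho> (p s)"] smooth_curve_imp_smooth_near \<rho>(5))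
  qed
  have "smooth_curve (\<lambda>s. deriv (G (s - t)) 0)"
    by (intro smooth_curve_compose[OF smooth_surface_partial_smooth[OF G]] smooth_curve_intros)
  moreover have "\<forall>\<^sub>F s in nhds t. deriv (G (s - t)) 0 = loc U u (x s) (b s)"
  proof (rule eventually_mono[OF eventually_conj[OF eventually_nhds_unshift[OF \<rho>(3)]
          eventually_nhds_in_open[OF S(1,2)]]], elim conjE)
    fix s
    assume s: "\<rho> (s - t) = s - t" "s \<in> S"
    have near: "smooth_near (\<lambda>r. ?f (x s + r *\<^sub>R b s)) 0"
      using smooth_on_smooth_near[OF transition_smooth[OF u v] overlap_open[OF u v]
          smooth_curve_imp_smooth_near[OF smooth_curve_line], of "x s" 0 "b s"] xW[OF s(2)] by simp
    have "\<forall>\<^sub>F r in nhds 0. dual_apply (?L s) (?f (x s + r *\<^sub>R b s)) = G (s - t) r"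
      using \<rho>(3) by (rule eventually_mono) (simp add: G_def s(1) \<sigma>_def)
    then have "(G (s - t) has_real_derivative dual_apply (?L s) (dir_deriv ?f (x s) (b s))) (at 0)"
      unfolding dir_deriv_def
      by (rule DERIV_transfer_eventually) (rule dual_apply_DERIV[OF smooth_near_imp_smooth_at[OF near]])
    then have 1: "deriv (G (s - t)) 0 = dual_apply (?L s) (dir_deriv ?f (x s) (b s))"
      by (rule DERIV_imp_deriv)
    have cV: "c s \<in> V"
      using S(3) s(2) by blast
    have "?f (x s) = v (c s)"
      by (simp add: c_def)
    then have "local_form A (V, v) \<eta> (?f (x s)) = ?L s"
      using local_form_at[OF v cV] by simp
    then show "deriv (G (s - t)) 0 = loc U u (x s) (b s)"
      unfolding 1 loc_transition[OF u v xW[OF s(2)]] by (simp add: loc_def)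
  qed
  ultimately show "smooth_near (\<lambda>s. loc U u (x s) (b s)) t"
    by (rule smooth_near_eq_smooth_curve)
qed

lemma smooth_on_loc:
  assumes "(U, u) \<in> A"
  shows "smooth_on (u ` U) (\<lambda>x. loc U u x b)"
  unfolding smooth_on_def comp_def using loc_smooth[OF assms _ _ smooth_curve_intros(1)] by blast

section \<open>The exterior derivative in a chart\<close>

definition loc_partial :: "'m set \<Rightarrow> ('m \<Rightarrow> 'e) \<Rightarrow> 'e \<Rightarrow> 'e \<Rightarrow> 'e \<Rightarrow> real" where
  "loc_partial U u x a b = deriv (\<lambda>s. loc U u (x + s *\<^sub>R a) b) 0"

definition loc_dform :: "'m set \<Rightarrow> ('m \<Rightarrow> 'e) \<Rightarrow> 'e \<Rightarrow> 'e \<Rightarrow> 'e \<Rightarrow> real" where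
  "loc_dform U u x a b = loc_partial U u x a b - loc_partial U u x b a"

lemma loc_partial_DERIV:
  assumes "(U, u) \<in> A" "x \<in> u ` U"
  shows "((\<lambda>s. loc U u (x + s *\<^sub>R a) b) has_real_derivative loc_partial U u x a b) (at 0)"
    and "loc_partial U u x a b = dir_deriv (\<lambda>x. loc U u x b) x a"
proof -
  have D: "((\<lambda>s. loc U u (x + s *\<^sub>R a) b) has_real_derivative dir_deriv (\<lambda>x. loc U u x b) x a) (at 0)"
    by (rule dir_deriv_real[OF smooth_on_loc[OF assms(1)] chart_open[OF assms(1)] assms(2)])
  show eq: "loc_partial U u x a b = dir_deriv (\<lambda>x. loc U u x b) x a"
    unfolding loc_partial_def by (rule DERIV_imp_deriv[OF D])
  show "((\<lambda>s. loc U u (x + s *\<^sub>R a) b) has_real_derivative loc_partial U u x a b) (at 0)"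
    unfolding eq by (rule D)
qed

lemma linear_loc_partial:
  assumes "(U, u) \<in> A" "x \<in> u ` U"
  shows "linear (\<lambda>a. loc_partial U u x a b)" "linear (\<lambda>b. loc_partial U u x a b)"
proof -
  show "linear (\<lambda>a. loc_partial U u x a b)"
    unfolding loc_partial_DERIV(2)[OF assms]
    by (rule linear_dir_deriv_real[OF smooth_on_loc[OF assms(1)] chart_open[OF assms(1)] assms(2)])
  note D = loc_partial_DERIV(1)[OF assms]
  show "linear (\<lambda>b. loc_partial U u x a b)"
  proof (rule linearI)
    fix b c :: 'e and r :: real
    show "loc_partial U u x a (b + c) = loc_partial U u x a b + loc_partial U u x a c"
      using DERIV_unique[OF D[of a "b + c"]] DERIV_add[OF D[of a b] D[of a c]]
      by (simp add: linear_add[OF linear_loc])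
    show "loc_partial U u x a (r *\<^sub>R b) = r *\<^sub>R loc_partial U u x a b"
      using DERIV_unique[OF D[of a "r *\<^sub>R b"]] DERIV_cmult[OF D[of a b], of r]
      by (simp add: linear_cmul[OF linear_loc])
  qed
qed

lemma linear_loc_dform:
  assumes "(U, u) \<in> A" "x \<in> u ` U"
  shows "linear (\<lambda>a. loc_dform U u x a b)" "linear (\<lambda>b. loc_dform U u x a b)"
  unfolding loc_dform_def by (intro linear_compose_sub linear_loc_partial[OF assms])+

lemma loc_partial_smooth:
  assumes u: "(U, u) \<in> A" and x: "smooth_curve x" "range x \<subseteq> u ` U"
    and a: "smooth_curve a" and b: "smooth_curve b"
  shows "smooth_curve (\<lambda>t. loc_partial U u (x t) (a t) (b t))"
proof (rule smooth_curveI_near)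
  fix t
  define \<sigma> where "\<sigma> t s = x t + s *\<^sub>R a t" for t s
  have \<sigma>: "smooth_surface \<sigma>"
    unfolding \<sigma>_def[abs_def] by (intro smooth_surface_intros smooth_curve_intros x(1) a)
  have "\<sigma> t 0 \<in> u ` U"
    using x(2) by (auto simp: \<sigma>_def)
  from smooth_surface_cutoff[OF \<sigma> chart_open[OF u] this]
  obtain \<rho> where \<rho>: "smooth_curve \<rho>" "\<rho> 0 = 0" "\<forall>\<^sub>F s in nhds 0. \<rho> s = s"
      "\<And>r s. \<sigma> (t + \<rho> r) (0 + \<rho> s) \<in> u ` U"
    by blast
  define G where "G r s = loc U u (\<sigma> (t + \<rho> r) (0 + \<rho> s)) (b (t + \<rho> r))" for r s
  have G: "smooth_surface G"
    unfolding smooth_surface_def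
  proof (intro allI impI)
    fix p q :: "real \<Rightarrow> real"
    assume p: "smooth_curve p" and q: "smooth_curve q"
    have r: "smooth_curve (\<lambda>s. y + \<rho> (z s))" if "smooth_curve z" for y and z :: "real \<Rightarrow> real"
      by (rule smooth_curve_intros(3)[OF smooth_curve_intros(1) smooth_curve_compose[OF \<rho>(1) that]])
    show "smooth_curve (\<lambda>s. G (p s) (q s))"
      unfolding G_def
      by (rule loc_smooth[OF u smooth_surfaceD[OF \<sigma> r[OF p] r[OF q]] _ smooth_curve_compose[OF b r[OF p]]])
        (use \<rho>(4) in auto)
  qed
  have "smooth_curve (\<lambda>r. deriv (G (r - t)) 0)"
    by (intro smooth_curve_compose[OF smooth_surface_partial_smooth[OF G]] smooth_curve_intros)
  moreover have "\<forall>\<^sub>F r in nhds t. deriv (G (r - t)) 0 = loc_partial U u (x r) (a r) (b r)"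
  proof (rule eventually_mono[OF eventually_nhds_unshift[OF \<rho>(3)]])
    fix r
    assume r: "\<rho> (r - t) = r - t"
    have "\<forall>\<^sub>F s in nhds 0. G (r - t) s = loc U u (x r + s *\<^sub>R a r) (b r)"
      using \<rho>(3) by (rule eventually_mono) (simp add: G_def r \<sigma>_def)
    then show "deriv (G (r - t)) 0 = loc_partial U u (x r) (a r) (b r)"
      unfolding loc_partial_def by (rule deriv_cong_ev) simp
  qed
  ultimately show "smooth_near (\<lambda>t. loc_partial U u (x t) (a t) (b t)) t"
    by (rule smooth_near_eq_smooth_curve)
qed

lemma loc_dform_smooth:
  assumes "(U, u) \<in> A" "smooth_curve x" "range x \<subseteq> u ` U" "smooth_curve a" "smooth_curve b"
  shows "smooth_curve (\<lambda>t. loc_dform U u (x t) (a t) (b t))"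
  unfolding loc_dform_def
  by (intro smooth_curve_intros(4) loc_partial_smooth[OF assms(1-3)] assms(4,5))

end

context manifold_one_form
begin

text \<open>The error term is the value of the covector at \<open>f x\<close> on the second derivative of the
  transition map \<open>f\<close>; it is symmetric, hence cancels in \<open>d\<eta>\<close>.\<close>

lemma loc_partial_transition:
  fixes U V :: "'m set" and u v :: "'m \<Rightarrow> 'e"
  defines "f \<equiv> v \<circ> inv_into U u"
  assumes u: "(U, u) \<in> A" and v: "(V, v) \<in> A"
    and \<rho>: "smooth_curve \<rho>" "\<rho> 0 = 0" "\<forall>\<^sub>F s in nhds 0. \<rho> s = s"
    and W: "\<And>s t. x + (\<rho> s *\<^sub>R a + \<rho> t *\<^sub>R b) \<in> u ` (U \<inter> V)"
  shows "loc_partial U u x a b = loc_partial V v (f x) (dir_deriv f x a) (dir_deriv f x b)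
    + deriv (\<lambda>s. deriv (\<lambda>t. loc V v (f x) (f (x + (\<rho> s *\<^sub>R a + \<rho> t *\<^sub>R b)))) 0) 0"
proof -
  let ?W = "u ` (U \<inter> V)"
  note f = transition_smooth[OF u v, folded f_def] overlap_open[OF u v]
  define \<tau> where "\<tau> s t = f (x + (\<rho> s *\<^sub>R a + \<rho> t *\<^sub>R b))" for s t
  define \<sigma> where "\<sigma> s t = x + (s *\<^sub>R a + t *\<^sub>R b)" for s t
  have \<sigma>: "smooth_surface \<sigma>"
    unfolding \<sigma>_def[abs_def] by (intro smooth_surface_intros smooth_curve_intros)
  have "\<sigma> (0 + \<rho> s) (0 + \<rho> t) \<in> ?W" for s t
    using W by (simp add: \<sigma>_def)
  from smooth_surface_compose_cutoff[OF \<sigma> f(1) \<rho>(1) this]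
  have \<tau>: "smooth_surface \<tau>"
    by (simp add: \<sigma>_def \<tau>_def[abs_def])
  have xW: "x \<in> ?W"
    using W[of 0 0] by (simp add: \<rho>(2))
  have fV: "f y \<in> v ` V" if y: "y \<in> ?W" for y
  proof -
    obtain q where "q \<in> U" "q \<in> V" "y = u q"
      using y by blast
    then show ?thesis
      using chart_inj[OF u] by (simp add: f_def)
  qed
  have \<tau>V: "\<tau> s t \<in> v ` V" for s t
    unfolding \<tau>_def by (intro fV W)
  have \<tau>00: "\<tau> 0 0 = f x"
    by (simp add: \<tau>_def \<rho>(2))
  define d where "d s = curve_deriv (\<tau> s) 0" for s
  \<comment> \<open>\<open>r\<close> moves the base point of the covector, \<open>s\<close> the
    vector to which it is applied. On the diagonal, the \<open>r\<close>-derivative is the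
    transformed partial derivative of the form and the \<open>s\<close>-derivative is the error
    term.\<close>
  define K where "K r s = deriv (\<lambda>t. loc V v (\<tau> r 0) (\<tau> s t)) 0" for r s
  have K_eq: "K r s = loc V v (\<tau> r 0) (d s)" for r s
  proof -
    have "smooth_at (\<tau> s) 0"
      using smooth_surface_slices(2)[OF \<tau>] by (simp add: smooth_curve_iff_smooth_at)
    from dual_apply_DERIV[OF this] show ?thesis
      unfolding K_def d_def loc_def by (rule DERIV_imp_deriv)
  qed
  have K: "smooth_surface K"
    unfolding smooth_surface_def
  proof (intro allI impI)
    fix p q :: "real \<Rightarrow> real"
    assume p: "smooth_curve p" and q: "smooth_curve q"
    have "smooth_surface (\<lambda>r t. loc V v (\<tau> (p r) 0) (\<tau> (q r) t))"
      unfolding smooth_surface_def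
    proof (intro allI impI)
      fix p' q' :: "real \<Rightarrow> real"
      assume p': "smooth_curve p'" and q': "smooth_curve q'"
      have 1: "smooth_curve (\<lambda>s. \<tau> (p (p' s)) 0)"
        by (rule smooth_surfaceD[OF \<tau> smooth_curve_compose[OF p p'] smooth_curve_intros(1)])
      have 2: "smooth_curve (\<lambda>s. \<tau> (q (p' s)) (q' s))"
        by (rule smooth_surfaceD[OF \<tau> smooth_curve_compose[OF q p'] q'])
      show "smooth_curve (\<lambda>s. loc V v (\<tau> (p (p' s)) 0) (\<tau> (q (p' s)) (q' s)))"
        by (rule loc_smooth[OF v 1 _ 2]) (use \<tau>V in blast)
    qed
    then show "smooth_curve (\<lambda>t. K (p t) (q t))"
      unfolding K_def by (rule smooth_surface_partial_smooth)
  qed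
  have d_eq: "d s = dir_deriv f (x + s *\<^sub>R a) b" if s: "\<rho> s = s" for s
  proof -
    have y: "x + s *\<^sub>R a \<in> ?W"
      using W[of s 0] s by (simp add: \<rho>(2))
    have ev: "\<forall>\<^sub>F t in nhds 0. \<tau> s t = f ((x + s *\<^sub>R a) + t *\<^sub>R b)"
      using \<rho>(3) by (rule eventually_mono) (simp add: \<tau>_def s add.assoc)
    show ?thesis
      unfolding d_def using dir_deriv_line[OF f y, of b] has_curve_derivative_cong[OF ev]
      by (intro curve_deriv_eq) simp
  qed
  have "\<forall>\<^sub>F s in nhds 0. K s s = loc U u (x + s *\<^sub>R a) b"
    using \<rho>(3)
  proof (rule eventually_mono)
    fix s
    assume s: "\<rho> s = s"
    have y: "x + s *\<^sub>R a \<in> ?W"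
      using W[of s 0] s by (simp add: \<rho>(2))
    show "K s s = loc U u (x + s *\<^sub>R a) b"
      unfolding K_eq d_eq[OF s] loc_transition[OF u v y] f_def[symmetric] by (simp add: \<tau>_def s \<rho>(2))
  qed
  from DERIV_transfer_eventually[OF this smooth_surface_diagonal_DERIV[OF K]]
  have "loc_partial U u x a b = deriv (\<lambda>r. K r 0) 0 + deriv (K 0) 0"
    unfolding loc_partial_def by (rule DERIV_imp_deriv)
  moreover have "deriv (\<lambda>r. K r 0) 0 = loc_partial V v (f x) (dir_deriv f x a) (dir_deriv f x b)"
  proof (rule DERIV_imp_deriv)
    have ev: "\<forall>\<^sub>F r in nhds 0. \<tau> r 0 = f (x + r *\<^sub>R a)"
      using \<rho>(3) by (rule eventually_mono) (simp add: \<tau>_def \<rho>(2))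
    have "has_curve_derivative (\<lambda>r. \<tau> r 0) (dir_deriv f x a) 0"
      using dir_deriv_line[OF f xW, of a] has_curve_derivative_cong[OF ev] by simp
    from real_chain_rule_near[OF smooth_on_loc[OF v] chart_open[OF v]
        smooth_curve_imp_smooth_near[OF smooth_surface_slices(1)[OF \<tau>]] \<tau>V this]
    show "((\<lambda>r. K r 0) has_real_derivative loc_partial V v (f x) (dir_deriv f x a) (dir_deriv f x b)) (at 0)"
      unfolding K_eq loc_partial_DERIV(2)[OF v fV[OF xW]] by (simp add: \<tau>00 d_eq \<rho>(2))
  qed
  ultimately show ?thesis
    by (simp add: K_def[abs_def] \<tau>00) (simp add: \<tau>_def)
qed

lemma loc_dform_transition:
  assumes u: "(U, u) \<in> A" and v: "(V, v) \<in> A" and p: "p \<in> U" "p \<in> V"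
  defines "f \<equiv> v \<circ> inv_into U u"
  shows "loc_dform U u (u p) a b = loc_dform V v (v p) (dir_deriv f (u p) a) (dir_deriv f (u p) b)"
proof -
  let ?W = "u ` (U \<inter> V)" and ?x = "u p"
  have fx: "f ?x = v p"
    using chart_inj[OF u] p by (simp add: f_def)
  define \<sigma> where "\<sigma> s t = ?x + (s *\<^sub>R a + t *\<^sub>R b)" for s t
  have \<sigma>: "smooth_surface \<sigma>"
    unfolding \<sigma>_def[abs_def] by (intro smooth_surface_intros smooth_curve_intros)
  have "\<sigma> 0 0 \<in> ?W"
    using p by (simp add: \<sigma>_def)
  from smooth_surface_cutoff[OF \<sigma> overlap_open[OF u v] this]
  obtain \<rho> where \<rho>: "smooth_curve \<rho>" "\<rho> 0 = 0" "\<forall>\<^sub>F s in nhds 0. \<rho> s = s"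
      "\<And>s t. \<sigma> (0 + \<rho> s) (0 + \<rho> t) \<in> ?W"
    by blast
  \<comment> \<open>The covector is frozen at \<open>f ?x\<close>. The error terms for
    \<open>(a, b)\<close> and \<open>(b, a)\<close> are the mixed partial derivatives of this one
    surface in its two orders.\<close>
  define G where "G s t = loc V v (f ?x) (f (?x + (\<rho> s *\<^sub>R a + \<rho> t *\<^sub>R b)))" for s t
  have "smooth_surface (\<lambda>s t. f (\<sigma> (0 + \<rho> s) (0 + \<rho> t)))"
    unfolding f_def by (rule smooth_surface_compose_cutoff[OF \<sigma> transition_smooth[OF u v] \<rho>(1,4)])
  then have G: "smooth_surface G"
    unfolding smooth_surface_def G_def loc_def by (auto simp: \<sigma>_def intro: smooth_curve_dual_apply)
  have "loc_partial U u ?x a b = loc_partial V v (v p) (dir_deriv f ?x a) (dir_deriv f ?x b)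
      + deriv (\<lambda>s. deriv (G s) 0) 0"
    using loc_partial_transition[OF u v \<rho>(1-3), of ?x a b] \<rho>(4)
    by (simp add: G_def[abs_def] f_def[symmetric] fx \<sigma>_def)
  moreover have "loc_partial U u ?x b a = loc_partial V v (v p) (dir_deriv f ?x b) (dir_deriv f ?x a)
      + deriv (\<lambda>s. deriv (\<lambda>t. G t s) 0) 0"
  proof -
    have "?x + (\<rho> s *\<^sub>R b + \<rho> t *\<^sub>R a) \<in> ?W" for s t
      using \<rho>(4)[of t s] by (simp add: \<sigma>_def add.commute)
    from loc_partial_transition[OF u v \<rho>(1-3) this] show ?thesis
      by (simp add: G_def[abs_def] f_def[symmetric] fx add.commute)
  qed
  ultimately show ?thesis
    using smooth_surface_mixed_partials[OF G, where a = 0 and b = 0] by (simp add: loc_dform_def)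
qed

text \<open>The definite description has a value because the local expressions agree in all charts,
  by \<open>loc_dform_transition\<close>.\<close>

lemma exterior_derivative_eq:
  assumes u: "(U, u) \<in> A" "p \<in> U" and v: "v \<in> tangent_space A p" and w: "w \<in> tangent_space A p"
  shows "exterior_derivative A \<eta> p v w = loc_dform U u (u p) (tangent_coord u v) (tangent_coord u w)"
proof -
  let ?P = "\<lambda>r. \<forall>(U, u)\<in>A. p \<in> U \<longrightarrow>
        (let l = local_form A (U, u) \<eta>; a = tangent_coord u v; b = tangent_coord u w in
         r = deriv (\<lambda>s. dual_apply (l (u p + s *\<^sub>R a)) b) 0
           - deriv (\<lambda>s. dual_apply (l (u p + s *\<^sub>R b)) a) 0)"
  have P: "?P r \<longleftrightarrow> (\<forall>V y. (V, y) \<in> A \<longrightarrow> p \<in> V \<longrightarrow>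
      r = loc_dform V y (y p) (tangent_coord y v) (tangent_coord y w))" for r
    unfolding loc_dform_def loc_partial_def loc_def Let_def by auto
  have "loc_dform U u (u p) (tangent_coord u v) (tangent_coord u w)
      = loc_dform V y (y p) (tangent_coord y v) (tangent_coord y w)" if "(V, y) \<in> A" "p \<in> V" for V y
    using loc_dform_transition[OF u(1) that(1) u(2) that(2)]
      tangent_coord_transition(1)[OF v u that] tangent_coord_transition(1)[OF w u that] by simp
  then have "?P (loc_dform U u (u p) (tangent_coord u v) (tangent_coord u w))"
    unfolding P by blast
  moreover have "r = loc_dform U u (u p) (tangent_coord u v) (tangent_coord u w)" if "?P r" for r
    using that u unfolding P by blast
  ultimately show ?thesis
    unfolding exterior_derivative_def by (rule the_equality)
qed


subsection \<open>The musical map\<close>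

definition loc_flat :: "'m set \<Rightarrow> ('m \<Rightarrow> 'e) \<Rightarrow> 'e \<Rightarrow> 'e \<Rightarrow> 'e \<Rightarrow> real" where
  "loc_flat U u x a b = loc_dform U u x a b + loc U u x a * loc U u x b"

lemma linear_loc_flat:
  assumes "(U, u) \<in> A" "x \<in> u ` U"
  shows "linear (\<lambda>a. loc_flat U u x a b)" "linear (\<lambda>b. loc_flat U u x a b)"
proof -
  have lin: "linear (\<lambda>a. r * loc U u x a)" "linear (\<lambda>a. loc U u x a * r)" for r
    using linear_loc[of U u x] by (auto intro!: linearI simp: linear_add linear_cmul algebra_simps)
  show "linear (\<lambda>a. loc_flat U u x a b)"
    unfolding loc_flat_def by (intro linear_compose_add linear_loc_dform(1)[OF assms] lin(2))
  show "linear (\<lambda>b. loc_flat U u x a b)"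
    unfolding loc_flat_def by (intro linear_compose_add linear_loc_dform(2)[OF assms] lin(1))
qed

lemma jointly_smooth_loc_flat:
  assumes u: "(U, u) \<in> A" and x: "smooth_curve x" "range x \<subseteq> u ` U" and a: "smooth_curve a"
  shows "jointly_smooth (\<lambda>t b. loc_flat U u (x t) (a t) b)"
  unfolding jointly_smooth_def
proof (intro conjI allI impI)
  show "linear (\<lambda>b. loc_flat U u (x t) (a t) b)" for t
    by (rule linear_loc_flat(2)[OF u]) (use x(2) in blast)
  fix r :: "real \<Rightarrow> real" and b :: "real \<Rightarrow> 'e"
  assume r: "smooth_curve r" and b: "smooth_curve b"
  note xr = smooth_curve_compose[OF x(1) r] and ar = smooth_curve_compose[OF a r]
  have rg: "range (\<lambda>s. x (r s)) \<subseteq> u ` U"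
    using x(2) by blast
  show "smooth_curve (\<lambda>s. loc_flat U u (x (r s)) (a (r s)) (b s))"
    unfolding loc_flat_def
    by (intro smooth_curve_intros(3,6) loc_dform_smooth[OF u xr rg ar b] loc_smooth[OF u xr rg ar]
        loc_smooth[OF u xr rg b])
qed

text \<open>Constant curves are admissible in \<open>jointly_smooth_loc_flat\<close>; the functional
  is thus c^infinity-continuous, and \<open>Abs_dual\<close> represents it.\<close>

lemma dual_apply_loc_flat:
  assumes u: "(U, u) \<in> A" "x \<in> u ` U"
  shows "dual_apply (Abs_dual (loc_flat U u x a)) = loc_flat U u x a"
  using jointly_smooth_dual_apply[OF jointly_smooth_loc_flat[OF u(1) smooth_curve_intros(1) _ smooth_curve_intros(1)],
      of x a] u(2) by auto

lemma flat_at_eq: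
  assumes u: "(U, u) \<in> A" "p \<in> U" and v: "v \<in> tangent_space A p" and w: "w \<in> tangent_space A p"
  shows "flat_at A \<eta> p v w = loc_flat U u (u p) (tangent_coord u v) (tangent_coord u w)"
  using w by (simp add: flat_at_def loc_flat_def exterior_derivative_eq[OF u v w] loc_eq[OF u v] loc_eq[OF u w])

lemma flat_at_coord:
  assumes u: "(U, u) \<in> A" "p \<in> U" and v: "v \<in> tangent_space A p"
  shows "cotangent_coord A u p (flat_at A \<eta> p v) = Abs_dual (loc_flat U u (u p) (tangent_coord u v))"
  using u by (intro cotangent_coord_eqI[OF u]) (simp add: flat_at_eq[OF u v] dual_apply_loc_flat)

lemma flat_at_cotangent:
  assumes v: "v \<in> tangent_space A p"
  shows "flat_at A \<eta> p v \<in> cotangent_space A p"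
proof -
  have "\<exists>l::'e dual. \<forall>w\<in>tangent_space A p. flat_at A \<eta> p v w = dual_apply l (tangent_coord u w)"
    if u: "(U, u) \<in> A" "p \<in> U" for U u
    using u by (intro exI[of _ "Abs_dual (loc_flat U u (u p) (tangent_coord u v))"])
      (simp add: flat_at_eq[OF u v] dual_apply_loc_flat)
  moreover have "flat_at A \<eta> p v \<in> extensional (tangent_space A p)"
    by (simp add: flat_at_def)
  ultimately show ?thesis
    unfolding cotangent_space_def by auto
qed

text \<open>In a tangent chart the base points and coordinates of the curve are smooth only near
  each time. They are replaced by global curves with the same germs, for which the theorem on curves
  in the dual applies; the result is restricted to a common neighbourhood \<open>T\<close>.\<close>

lemma smooth_map_flat_bundle: "smooth_map (tangent_atlas A) (cotangent_atlas A) (flat_bundle A \<eta>)"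
  unfolding smooth_map_def
proof (intro allI impI)
  fix c
  assume c: "manifold_curve (tangent_atlas A) c"
  show "manifold_curve (cotangent_atlas A) (flat_bundle A \<eta> \<circ> c)"
    unfolding manifold_curve_iff
  proof
    fix t
    obtain W w S where w: "(W, w) \<in> tangent_atlas A" and S: "open S" "t \<in> S" "c ` S \<subseteq> W" "smooth_curve_on S (w \<circ> c)"
      using c unfolding manifold_curve_iff by blast
    obtain U u where u: "(U, u) \<in> A" and W: "W = tangent_bundle U A"
        and w_eq: "w = (\<lambda>v. (u (footpoint v), tangent_coord u v))"
      using w unfolding tangent_atlas_def by auto
    define x where "x s = u (footpoint (c s))" for s
    define a where "a s = tangent_coord u (c s)" for s
    have xa: "smooth_curve_on S x" "smooth_curve_on S a"
      using smooth_curve_on_components[OF S(4)] by (simp_all add: w_eq comp_def x_def[abs_def] a_def[abs_def])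
    have cT: "footpoint (c s) \<in> U" "c s \<in> tangent_space A (footpoint (c s))" if "s \<in> S" for s
      using S(3) that unfolding W by (auto simp: tangent_bundle_iff)
    obtain x' where x': "smooth_curve x'" "range x' \<subseteq> u ` U" "\<forall>\<^sub>F s in nhds t. x' s = x s"
      using smooth_near_globalize[OF smooth_curve_on_imp_smooth_near[OF xa(1) S(1,2)] chart_open[OF u]]
        cT(1)[OF S(2)] by (auto simp: x_def)
    obtain a' where a': "smooth_curve a'" "\<forall>\<^sub>F s in nhds t. a' s = a s"
      using smooth_near_globalize[OF smooth_curve_on_imp_smooth_near[OF xa(2) S(1,2)] cinf_open_UNIV] by auto
    have "\<forall>\<^sub>F s in nhds t. x' s = x s \<and> a' s = a s \<and> s \<in> S"
      using x'(3) a'(2) eventually_nhds_in_open[OF S(1,2)] by eventually_elim simp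
    then obtain T where T: "open T" "t \<in> T" "\<And>s. s \<in> T \<Longrightarrow> x' s = x s \<and> a' s = a s \<and> s \<in> S"
      unfolding eventually_nhds by blast
    have "smooth_curve (\<lambda>s. Abs_dual (loc_flat U u (x' s) (a' s)))"
      by (rule jointly_smooth_imp_smooth_curve_dual[OF jointly_smooth_loc_flat[OF u x'(1,2) a'(1)]])
    then have "smooth_curve_on T (\<lambda>s. Abs_dual (loc_flat U u (x s) (a s)))"
      by (rule smooth_curve_on_subset_cong) (use T(3) in auto)
    moreover have "smooth_curve_on T x"
      using smooth_curve_on_subset_cong[OF xa(1), of T x] T(3) by blast
    ultimately have "smooth_curve_on T (\<lambda>s. (x s, Abs_dual (loc_flat U u (x s) (a s))))"
      by (intro smooth_curve_on_Pair)
    then have "smooth_curve_on T ((\<lambda>(p, \<alpha>). (u p, cotangent_coord A u p \<alpha>)) \<circ> (flat_bundle A \<eta> \<circ> c))"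
    proof (rule smooth_curve_on_subset_cong[OF _ order_refl])
      fix s
      assume "s \<in> T"
      then have "s \<in> S"
        using T(3) by blast
      from flat_at_coord[OF u cT[OF this]]
      show "(x s, Abs_dual (loc_flat U u (x s) (a s)))
          = ((\<lambda>(p, \<alpha>). (u p, cotangent_coord A u p \<alpha>)) \<circ> (flat_bundle A \<eta> \<circ> c)) s"
        by (simp add: flat_bundle_def x_def a_def)
    qed
    moreover have "(flat_bundle A \<eta> \<circ> c) ` T \<subseteq> (SIGMA p:U. cotangent_space A p)"
      using T(3) cT flat_at_cotangent by (auto simp: flat_bundle_def)
    moreover have "(SIGMA p:U. cotangent_space A p, \<lambda>(p, \<alpha>). (u p, cotangent_coord A u p \<alpha>)) \<in> cotangent_atlas A"
      using u unfolding cotangent_atlas_def by force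
    ultimately show "\<exists>U u S. (U, u) \<in> cotangent_atlas A \<and> open S \<and> t \<in> S \<and>
        (flat_bundle A \<eta> \<circ> c) ` S \<subseteq> U \<and> smooth_curve_on S (u \<circ> (flat_bundle A \<eta> \<circ> c))"
      using T(1,2) by blast
  qed
qed

lemma flat_at_add:
  assumes v: "v \<in> tangent_space A p" and w: "w \<in> tangent_space A p"
  shows "flat_at A \<eta> p (tangent_add A p v w) = (\<lambda>z\<in>tangent_space A p. flat_at A \<eta> p v z + flat_at A \<eta> p w z)"
proof -
  obtain U u where u: "(U, u) \<in> A" "p \<in> U"
    using chart_exists[OF tangent_space_in_M[OF v]] .
  have x: "u p \<in> u ` U"
    using u(2) by blast
  have "flat_at A \<eta> p (tangent_add A p v w) z = flat_at A \<eta> p v z + flat_at A \<eta> p w z"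
    if z: "z \<in> tangent_space A p" for z
    using flat_at_eq[OF u tangent_add(1)[OF v w] z] flat_at_eq[OF u v z] flat_at_eq[OF u w z]
    by (simp add: tangent_add(2)[OF v w u] linear_add[OF linear_loc_flat(1)[OF u(1) x]])
  then show ?thesis
    by (auto simp: fun_eq_iff flat_at_def)
qed

lemma flat_at_scale:
  assumes v: "v \<in> tangent_space A p"
  shows "flat_at A \<eta> p (tangent_scale A p r v) = (\<lambda>z\<in>tangent_space A p. r * flat_at A \<eta> p v z)"
proof -
  obtain U u where u: "(U, u) \<in> A" "p \<in> U"
    using chart_exists[OF tangent_space_in_M[OF v]] .
  have x: "u p \<in> u ` U"
    using u(2) by blast
  have "flat_at A \<eta> p (tangent_scale A p r v) z = r * flat_at A \<eta> p v z"
    if z: "z \<in> tangent_space A p" for z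
    using flat_at_eq[OF u tangent_scale(1)[OF v] z] flat_at_eq[OF u v z]
    by (simp add: tangent_scale(2)[OF v u] linear_cmul[OF linear_loc_flat(1)[OF u(1) x]])
  then show ?thesis
    by (auto simp: fun_eq_iff flat_at_def)
qed

lemma bundle_hom_flat: "bundle_hom_tangent_cotangent M A (flat_bundle A \<eta>)"
  unfolding bundle_hom_tangent_cotangent_def
proof (intro conjI ballI allI)
  fix p v
  assume v: "v \<in> tangent_space A p"
  show "fst (flat_bundle A \<eta> v) = p" "snd (flat_bundle A \<eta> v) \<in> cotangent_space A p"
    using flat_at_cotangent[OF v] by (simp_all add: flat_bundle_def footpoint_eq[OF v])
  fix w
  assume w: "w \<in> tangent_space A p"
  show "snd (flat_bundle A \<eta> (tangent_add A p v w)) =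
      (\<lambda>z\<in>tangent_space A p. snd (flat_bundle A \<eta> v) z + snd (flat_bundle A \<eta> w) z)"
    using flat_at_add[OF v w]
    by (simp add: flat_bundle_def footpoint_eq[OF v] footpoint_eq[OF w] footpoint_eq[OF tangent_add(1)[OF v w]])
next
  fix p r v
  assume v: "v \<in> tangent_space A p"
  show "snd (flat_bundle A \<eta> (tangent_scale A p r v)) = (\<lambda>z\<in>tangent_space A p. r * snd (flat_bundle A \<eta> v) z)"
    using flat_at_scale[OF v]
    by (simp add: flat_bundle_def footpoint_eq[OF v] footpoint_eq[OF tangent_scale(1)[OF v]])
qed (rule smooth_map_flat_bundle)

text \<open>The image of a vector field \<open>X\<close>, read as a section, is
  \<open>flat_bundle\<close> after \<open>X\<close>, so its smoothness is inherited from the bundle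
  map.\<close>

lemma module_hom_flat: "module_hom_fields_forms M A (flat_sections M A \<eta>)"
  unfolding module_hom_fields_forms_def
proof (intro conjI ballI)
  have X: "X p \<in> tangent_space A p" if "X \<in> vector_fields M A" "p \<in> M" for X p
    using that unfolding vector_fields_def by auto
  show "flat_sections M A \<eta> \<in> vector_fields M A \<rightarrow> one_forms M A"
  proof
    fix X
    assume XF: "X \<in> vector_fields M A"
    have "manifold_curve (cotangent_atlas A) ((\<lambda>p. (p, flat_sections M A \<eta> X p)) \<circ> c)"
      if c: "manifold_curve A c" for c
    proof -
      have "manifold_curve (tangent_atlas A) (X \<circ> c)"
        using XF c unfolding vector_fields_def smooth_map_def by blast
      then have "manifold_curve (cotangent_atlas A) (flat_bundle A \<eta> \<circ> (X \<circ> c))"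
        using smooth_map_flat_bundle unfolding smooth_map_def by blast
      moreover have "flat_bundle A \<eta> (X (c t)) = (c t, flat_sections M A \<eta> X (c t))" for t
        using manifold_curve_in_M[OF c, of t] footpoint_eq[OF X[OF XF]]
        by (simp add: flat_bundle_def flat_sections_def)
      then have "flat_bundle A \<eta> \<circ> (X \<circ> c) = (\<lambda>p. (p, flat_sections M A \<eta> X p)) \<circ> c"
        by (simp add: fun_eq_iff)
      ultimately show ?thesis
        by simp
    qed
    then show "flat_sections M A \<eta> X \<in> one_forms M A"
      unfolding one_forms_def smooth_map_def
      by (auto simp: flat_sections_def intro: flat_at_cotangent X[OF XF])
  qed
  fix X
  assume XF: "X \<in> vector_fields M A"
  show "flat_sections M A \<eta> (\<lambda>p\<in>M. tangent_add A p (X p) (Y p)) =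
      (\<lambda>p\<in>M. \<lambda>v\<in>tangent_space A p. flat_sections M A \<eta> X p v + flat_sections M A \<eta> Y p v)"
    if YF: "Y \<in> vector_fields M A" for Y
    unfolding flat_sections_def
    by (rule restrict_ext) (simp add: flat_at_add[OF X[OF XF] X[OF YF]])
  show "flat_sections M A \<eta> (\<lambda>p\<in>M. tangent_scale A p (f p) (X p)) =
      (\<lambda>p\<in>M. \<lambda>v\<in>tangent_space A p. f p * flat_sections M A \<eta> X p v)" for f
    unfolding flat_sections_def
    by (rule restrict_ext) (simp add: flat_at_scale[OF X[OF XF]])
qed

end

section \<open>The equivalences\<close>

text \<open>Linear algebra in one tangent space, with \<open>\<alpha>\<close> and
  \<open>\<omega>\<close> for the values of the form and of its exterior derivative. No topology
  enters: a vector outside the hyperplane \<open>ker \<alpha>\<close> always spans a linear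
  complement.\<close>

lemma hyperplane_complement_iff:
  fixes \<alpha> :: "'a::real_vector \<Rightarrow> real" and \<omega> :: "'a \<Rightarrow> 'a \<Rightarrow> real"
  assumes \<alpha>: "linear \<alpha>" and \<omega>: "\<And>y. linear (\<lambda>x. \<omega> x y)" "\<And>x y. \<omega> x y = - \<omega> y x"
    and \<xi>: "\<xi> \<noteq> 0" "\<And>y. \<omega> \<xi> y = 0"
  defines "nondegenerate \<equiv> \<forall>x. \<alpha> x = 0 \<longrightarrow> (\<forall>y. \<alpha> y = 0 \<longrightarrow> \<omega> x y = 0) \<longrightarrow> x = 0"
  shows "(\<forall>x. \<exists>!(h, k). \<alpha> h = 0 \<and> (\<forall>y. \<omega> k y = 0) \<and> x = h + k) \<longleftrightarrow> nondegenerate"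
    and "nondegenerate \<longleftrightarrow> (\<forall>x. (\<forall>y. \<omega> x y + \<alpha> x * \<alpha> y = 0) \<longrightarrow> x = 0)"
proof -
  have \<alpha>_simps: "\<alpha> (x + y) = \<alpha> x + \<alpha> y" "\<alpha> (x - y) = \<alpha> x - \<alpha> y" "\<alpha> (r *\<^sub>R x) = r * \<alpha> x" "\<alpha> 0 = 0" for x y r
    using linear_add[OF \<alpha>] linear_diff[OF \<alpha>] linear_cmul[OF \<alpha>] linear_0[OF \<alpha>] by auto
  have \<omega>_left: "\<omega> (x + x') y = \<omega> x y + \<omega> x' y" "\<omega> (x - x') y = \<omega> x y - \<omega> x' y" "\<omega> (r *\<^sub>R x) y = r * \<omega> x y" "\<omega> 0 y = 0" for x x' y r
    using linear_add[OF \<omega>(1)] linear_diff[OF \<omega>(1)] linear_cmul[OF \<omega>(1)] linear_0[OF \<omega>(1)] by auto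
  have \<omega>_right: "\<omega> y (x + x') = \<omega> y x + \<omega> y x'" "\<omega> y (r *\<^sub>R x) = r * \<omega> y x" for x x' y r
    using \<omega>_left(1,3)[of _ _ y] \<omega>(2)[of y] by auto
  have \<xi>': "\<omega> y \<xi> = 0" for y
    using \<xi>(2)[of y] \<omega>(2)[of y \<xi>] by simp
  \<comment> \<open>Subtracting a multiple of \<open>\<xi>\<close> moves \<open>y\<close> into
    \<open>ker \<alpha>\<close> without changing \<open>\<omega> x y\<close>.\<close>
  have decompose: "\<omega> x y = 0" if "\<alpha> \<xi> \<noteq> 0" "\<And>y. \<alpha> y = 0 \<Longrightarrow> \<omega> x y = 0" for x y
  proof -
    have "\<omega> x (y - (\<alpha> y / \<alpha> \<xi>) *\<^sub>R \<xi>) = 0"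
      using that by (intro that(2)) (simp add: \<alpha>_simps)
    then show ?thesis
      using \<omega>_right(1)[of x "y - (\<alpha> y / \<alpha> \<xi>) *\<^sub>R \<xi>" "(\<alpha> y / \<alpha> \<xi>) *\<^sub>R \<xi>"] by (simp add: \<omega>_right(2) \<xi>')
  qed
  have \<alpha>\<xi>: "\<alpha> \<xi> \<noteq> 0" if nondegenerate
    using that \<xi> unfolding nondegenerate_def by blast
  show "(\<forall>x. \<exists>!(h, k). \<alpha> h = 0 \<and> (\<forall>y. \<omega> k y = 0) \<and> x = h + k) \<longleftrightarrow> nondegenerate" (is "?W \<longleftrightarrow> _")
  proof
    assume W: ?W
    show nondegenerate
      unfolding nondegenerate_def
    proof (intro allI impI)
      fix x
      assume x: "\<alpha> x = 0" "\<forall>y. \<alpha> y = 0 \<longrightarrow> \<omega> x y = 0"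
      have "\<omega> x y = 0" for y
      proof -
        obtain h k where hk: "\<alpha> h = 0" "\<forall>z. \<omega> k z = 0" "y = h + k"
          using W by fastforce
        then show ?thesis
          using x(2) \<omega>(2)[of x k] by (simp add: \<omega>_right(1))
      qed
      note \<omega>x = this
      \<comment> \<open>A vector of \<open>ker \<alpha>\<close> orthogonal to
        \<open>ker \<alpha>\<close> has turned out orthogonal to everything, so it also lies in
        \<open>ker \<omega>\<close>. Its decompositions \<open>(x, 0)\<close> and
        \<open>(0, x)\<close> must coincide.\<close>
      define Q where "Q z \<longleftrightarrow> (case z of (h, k) \<Rightarrow> \<alpha> h = 0 \<and> (\<forall>y. \<omega> k y = 0) \<and> x = h + k)" for z
      have "\<exists>!z. Q z"
        using W unfolding Q_def by blast
      moreover have "Q (x, 0)" "Q (0, x)"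
        using x(1) \<omega>x by (simp_all add: Q_def \<alpha>_simps \<omega>_left)
      ultimately have "(x, 0) = (0, x)"
        by blast
      then show "x = 0"
        by simp
    qed
  next
    assume N: nondegenerate
    show ?W
    proof
      fix x
      \<comment> \<open>The multiple of \<open>\<xi>\<close> with
        \<open>\<alpha> ?k = \<alpha> x\<close>, so that the rest of \<open>x\<close> lies in
        \<open>ker \<alpha>\<close>.\<close>
      let ?k = "(\<alpha> x / \<alpha> \<xi>) *\<^sub>R \<xi>"
      have 0: "\<alpha> (x - ?k) = 0 \<and> (\<forall>y. \<omega> ?k y = 0) \<and> x = (x - ?k) + ?k"
        using \<alpha>\<xi>[OF N] by (simp add: \<alpha>_simps \<omega>_left \<xi>(2))
      have unique: "h = x - ?k \<and> k = ?k" if hk: "\<alpha> h = 0" "\<forall>y. \<omega> k y = 0" "x = h + k" for h k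
      proof -
        have "k - ?k = (x - ?k) - h"
          using hk(3) by simp
        then have "\<alpha> (k - ?k) = 0"
          using 0 hk(1) by (simp only: \<alpha>_simps)
        moreover have "\<omega> (k - ?k) y = 0" for y
          using hk(2) \<xi>(2) by (simp add: \<omega>_left)
        ultimately have "k - ?k = 0"
          using N unfolding nondegenerate_def by blast
        then show ?thesis
          using hk(3) by (simp add: algebra_simps)
      qed
      show "\<exists>!(h, k). \<alpha> h = 0 \<and> (\<forall>y. \<omega> k y = 0) \<and> x = h + k"
      proof (rule ex1I[of _ "(x - ?k, ?k)"])
        show "case (x - ?k, ?k) of (h, k) \<Rightarrow> \<alpha> h = 0 \<and> (\<forall>y. \<omega> k y = 0) \<and> x = h + k"
          unfolding prod.case by (rule 0)
        fix z
        assume "case z of (h, k) \<Rightarrow> \<alpha> h = 0 \<and> (\<forall>y. \<omega> k y = 0) \<and> x = h + k"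
        then have "\<alpha> (fst z) = 0" "\<forall>y. \<omega> (snd z) y = 0" "x = fst z + snd z"
          unfolding case_prod_beta by blast+
        from unique[OF this] show "z = (x - ?k, ?k)"
          unfolding prod_eq_iff fst_conv snd_conv .
      qed
    qed
  qed
  show "nondegenerate \<longleftrightarrow> (\<forall>x. (\<forall>y. \<omega> x y + \<alpha> x * \<alpha> y = 0) \<longrightarrow> x = 0)"
  proof
    assume N: nondegenerate
    show "\<forall>x. (\<forall>y. \<omega> x y + \<alpha> x * \<alpha> y = 0) \<longrightarrow> x = 0"
    proof (intro allI impI)
      fix x
      assume x: "\<forall>y. \<omega> x y + \<alpha> x * \<alpha> y = 0"
      then have "\<alpha> x = 0"
        using \<alpha>\<xi>[OF N] \<xi>'[of x] by (metis add_0 mult_eq_0_iff)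
      then show "x = 0"
        using N x unfolding nondegenerate_def by simp
    qed
  next
    assume I: "\<forall>x. (\<forall>y. \<omega> x y + \<alpha> x * \<alpha> y = 0) \<longrightarrow> x = 0"
    \<comment> \<open>If \<open>\<alpha> \<xi>\<close> were 0, both terms would vanish at
      \<open>x = \<xi>\<close> for every \<open>y\<close>.\<close>
    then have "\<alpha> \<xi> \<noteq> 0"
      using \<xi> by auto
    then show nondegenerate
      unfolding nondegenerate_def using I decompose by simp
  qed
qed

lemma smooth_curve_divide:
  fixes f g :: "real \<Rightarrow> real"
  assumes "smooth_curve f" "smooth_curve g" "\<And>t. g t \<noteq> 0"
  shows "smooth_curve (\<lambda>t. f t / g t)"
  unfolding smooth_curve_iff_smooth_at
proof
  show "smooth_at (\<lambda>t. f t / g t) t" for t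
    using assms unfolding smooth_curve_iff_smooth_at by (intro smooth_at_divide) auto
qed

section \<open>The three conditions in coordinates\<close>

lemma (in convenient_manifold) ball_tangent_space_iff:
  assumes "(U, u) \<in> A" "p \<in> U"
  shows "(\<forall>v\<in>tangent_space A p. P (tangent_coord u v)) \<longleftrightarrow> (\<forall>x. P x)"
  using tangent_coord_surj[OF assms] by metis

context manifold_one_form
begin

context
  fixes p U u
  assumes u: "(U, u) \<in> A" "p \<in> U"
begin

lemma loc_dform_antisym: "loc_dform U u x a b = - loc_dform U u x b a"
  by (simp add: loc_dform_def)

lemma horizontal_iff:
  "v \<in> tangent_space A p \<Longrightarrow> v \<in> horizontal A \<eta> p \<longleftrightarrow> loc U u (u p) (tangent_coord u v) = 0"
  by (simp add: horizontal_def loc_eq[OF u])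

lemma vertical_iff:
  assumes v: "v \<in> tangent_space A p"
  shows "v \<in> vertical A \<eta> p \<longleftrightarrow> (\<forall>y. loc_dform U u (u p) (tangent_coord u v) y = 0)"
  using ball_tangent_space_iff[OF u, of "\<lambda>y. loc_dform U u (u p) (tangent_coord u v) y = 0"] v
  by (simp add: vertical_def exterior_derivative_eq[OF u v])

lemma tangent_coord_eq_0_iff:
  "v \<in> tangent_space A p \<Longrightarrow> tangent_coord u v = 0 \<longleftrightarrow> v = tangent_zero A p"
  using tangent_coord_inject[OF _ tangent_zero(1) u] tangent_zero chart_subset u by (metis subsetD)

lemma nondegenerate_at_iff:
  "(\<forall>v\<in>horizontal A \<eta> p. (\<forall>w\<in>horizontal A \<eta> p. exterior_derivative A \<eta> p v w = 0) \<longrightarrow> v = tangent_zero A p) \<longleftrightarrow>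
   (\<forall>x. loc U u (u p) x = 0 \<longrightarrow> (\<forall>y. loc U u (u p) y = 0 \<longrightarrow> loc_dform U u (u p) x y = 0) \<longrightarrow> x = 0)"
proof -
  have inner: "(\<forall>w\<in>horizontal A \<eta> p. exterior_derivative A \<eta> p v w = 0) \<longleftrightarrow>
      (\<forall>y. loc U u (u p) y = 0 \<longrightarrow> loc_dform U u (u p) (tangent_coord u v) y = 0)"
    if v: "v \<in> tangent_space A p" for v
  proof -
    have "(\<forall>w\<in>horizontal A \<eta> p. exterior_derivative A \<eta> p v w = 0) \<longleftrightarrow>
      (\<forall>w\<in>tangent_space A p. loc U u (u p) (tangent_coord u w) = 0 \<longrightarrow>
        loc_dform U u (u p) (tangent_coord u v) (tangent_coord u w) = 0)"
      using loc_eq[OF u] exterior_derivative_eq[OF u v] by (auto simp: horizontal_def)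
    then show ?thesis
      using ball_tangent_space_iff[OF u, of "\<lambda>y. loc U u (u p) y = 0 \<longrightarrow> loc_dform U u (u p) (tangent_coord u v) y = 0"]
      by simp
  qed
  have "(\<forall>v\<in>horizontal A \<eta> p. (\<forall>w\<in>horizontal A \<eta> p. exterior_derivative A \<eta> p v w = 0) \<longrightarrow> v = tangent_zero A p) \<longleftrightarrow>
      (\<forall>v\<in>tangent_space A p. loc U u (u p) (tangent_coord u v) = 0 \<longrightarrow>
        (\<forall>y. loc U u (u p) y = 0 \<longrightarrow> loc_dform U u (u p) (tangent_coord u v) y = 0) \<longrightarrow> tangent_coord u v = 0)"
    using inner horizontal_iff tangent_coord_eq_0_iff by (auto simp: horizontal_def)
  then show ?thesis
    using ball_tangent_space_iff[OF u, of "\<lambda>x. loc U u (u p) x = 0 \<longrightarrow>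
        (\<forall>y. loc U u (u p) y = 0 \<longrightarrow> loc_dform U u (u p) x y = 0) \<longrightarrow> x = 0"] by simp
qed

text \<open>Taking coordinates of both entries is a bijection from pairs of tangent vectors to pairs
  of model vectors, which transports unique existence. \<open>P\<close> and \<open>Q\<close> use
  \<open>fst\<close> and \<open>snd\<close>, the form into which \<open>case_prod_beta\<close>
  brings the quantified pairs.\<close>

lemma whitney_at_iff:
  "(\<forall>v\<in>tangent_space A p. \<exists>!(h, k). h \<in> horizontal A \<eta> p \<and> k \<in> vertical A \<eta> p \<and> v = tangent_add A p h k) \<longleftrightarrow>
   (\<forall>x. \<exists>!(h, k). loc U u (u p) h = 0 \<and> (\<forall>y. loc_dform U u (u p) k y = 0) \<and> x = h + k)"
proof -
  let ?\<kappa> = "tangent_coord u" and ?T = "tangent_space A p"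
  define P where "P v z \<longleftrightarrow> fst z \<in> horizontal A \<eta> p \<and> snd z \<in> vertical A \<eta> p \<and> v = tangent_add A p (fst z) (snd z)" for v z
  define Q where "Q x z \<longleftrightarrow> loc U u (u p) (fst z) = 0 \<and> (\<forall>y. loc_dform U u (u p) (snd z) y = 0) \<and> x = fst z + snd z" for x z
  have PT: "fst z \<in> ?T" "snd z \<in> ?T" if "P v z" for v z
    using that by (auto simp: P_def horizontal_def vertical_def)
  have PQ: "P v z \<longleftrightarrow> Q (?\<kappa> v) (map_prod ?\<kappa> ?\<kappa> z)" if "v \<in> ?T" "fst z \<in> ?T" "snd z \<in> ?T" for v z
  proof -
    have "v = tangent_add A p (fst z) (snd z) \<longleftrightarrow> ?\<kappa> v = ?\<kappa> (fst z) + ?\<kappa> (snd z)"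
      using tangent_coord_inject[OF that(1) tangent_add(1)[OF that(2,3)] u] tangent_add(2)[OF that(2,3) u] by auto
    then show ?thesis
      by (simp add: P_def Q_def horizontal_iff[OF that(2)] vertical_iff[OF that(3)])
  qed
  have "(\<exists>!z. P v z) \<longleftrightarrow> (\<exists>!z. Q (?\<kappa> v) z)" if v: "v \<in> ?T" for v
  proof
    assume "\<exists>!z. P v z"
    then obtain z where z: "P v z" "\<And>z'. P v z' \<Longrightarrow> z' = z"
      by blast
    show "\<exists>!z. Q (?\<kappa> v) z"
    proof (rule ex1I)
      show "Q (?\<kappa> v) (map_prod ?\<kappa> ?\<kappa> z)"
        using PQ[OF v PT[OF z(1)]] z(1) by simp
      fix y
      assume y: "Q (?\<kappa> v) y"
      obtain h where h: "h \<in> ?T" "?\<kappa> h = fst y"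
        using tangent_coord_surj[OF u] .
      obtain k where k: "k \<in> ?T" "?\<kappa> k = snd y"
        using tangent_coord_surj[OF u] .
      have hk: "map_prod ?\<kappa> ?\<kappa> (h, k) = y"
        using h k by (simp add: prod_eq_iff)
      then have "P v (h, k)"
        using PQ[OF v, of "(h, k)"] h k y by simp
      then show "y = map_prod ?\<kappa> ?\<kappa> z"
        using z(2) hk by blast
    qed
  next
    assume "\<exists>!z. Q (?\<kappa> v) z"
    then obtain y where y: "Q (?\<kappa> v) y" "\<And>y'. Q (?\<kappa> v) y' \<Longrightarrow> y' = y"
      by blast
    obtain h where h: "h \<in> ?T" "?\<kappa> h = fst y"
      using tangent_coord_surj[OF u] .
    obtain k where k: "k \<in> ?T" "?\<kappa> k = snd y"
      using tangent_coord_surj[OF u] .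
    have hk: "map_prod ?\<kappa> ?\<kappa> (h, k) = y"
      using h k by (simp add: prod_eq_iff)
    show "\<exists>!z. P v z"
    proof (rule ex1I)
      show "P v (h, k)"
        using PQ[OF v, of "(h, k)"] h k y(1) hk by simp
      fix z
      assume z: "P v z"
      then have "map_prod ?\<kappa> ?\<kappa> z = y"
        using PQ[OF v PT[OF z]] y(2) by blast
      then have "?\<kappa> (fst z) = ?\<kappa> h" "?\<kappa> (snd z) = ?\<kappa> k"
        using h(2) k(2) by (auto simp: prod_eq_iff)
      then show "z = (h, k)"
        using tangent_coord_inject[OF PT(1)[OF z] h(1) u] tangent_coord_inject[OF PT(2)[OF z] k(1) u]
        by (simp add: prod_eq_iff)
    qed
  qed
  then have "(\<forall>v\<in>?T. \<exists>!z. P v z) \<longleftrightarrow> (\<forall>v\<in>?T. \<exists>!z. Q (?\<kappa> v) z)"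
    by (rule ball_cong[OF refl])
  also have "\<dots> \<longleftrightarrow> (\<forall>x. \<exists>!z. Q x z)"
    by (rule ball_tangent_space_iff[OF u])
  finally show ?thesis
    unfolding P_def Q_def case_prod_beta .
qed

text \<open>Extensional functions are equal if they agree on the tangent space; by linearity,
  injectivity then becomes a question about the kernel, posed for the difference of
  coordinates.\<close>

lemma flat_injective_at_iff:
  "inj_on (flat_at A \<eta> p) (tangent_space A p) \<longleftrightarrow>
   (\<forall>x. (\<forall>y. loc_dform U u (u p) x y + loc U u (u p) x * loc U u (u p) y = 0) \<longrightarrow> x = 0)"
proof -
  let ?\<kappa> = "tangent_coord u" and ?T = "tangent_space A p" and ?F = "loc_flat U u (u p)"
  have x: "u p \<in> u ` U"
    using u(2) by blast
  have eq: "flat_at A \<eta> p v = flat_at A \<eta> p w \<longleftrightarrow> (\<forall>y. ?F (?\<kappa> v - ?\<kappa> w) y = 0)"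
    if v: "v \<in> ?T" and w: "w \<in> ?T" for v w
  proof -
    have "flat_at A \<eta> p v = flat_at A \<eta> p w \<longleftrightarrow> (\<forall>z\<in>?T. flat_at A \<eta> p v z = flat_at A \<eta> p w z)"
    proof
      assume "\<forall>z\<in>?T. flat_at A \<eta> p v z = flat_at A \<eta> p w z"
      then show "flat_at A \<eta> p v = flat_at A \<eta> p w"
        by (intro extensionalityI[of _ ?T]) (simp_all add: flat_at_def)
    qed simp
    also have "\<dots> \<longleftrightarrow> (\<forall>z\<in>?T. ?F (?\<kappa> v - ?\<kappa> w) (?\<kappa> z) = 0)"
      by (simp add: flat_at_eq[OF u v] flat_at_eq[OF u w] linear_diff[OF linear_loc_flat(1)[OF u(1) x]])
    finally show ?thesis
      using ball_tangent_space_iff[OF u, of "\<lambda>y. ?F (?\<kappa> v - ?\<kappa> w) y = 0"] by simp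
  qed
  have "inj_on (flat_at A \<eta> p) ?T \<longleftrightarrow> (\<forall>x. (\<forall>y. ?F x y = 0) \<longrightarrow> x = 0)"
  proof
    assume inj: "inj_on (flat_at A \<eta> p) ?T"
    show "\<forall>x. (\<forall>y. ?F x y = 0) \<longrightarrow> x = 0"
    proof (intro allI impI)
      fix x
      assume x: "\<forall>y. ?F x y = 0"
      obtain v where v: "v \<in> ?T" "?\<kappa> v = x"
        using tangent_coord_surj[OF u] .
      have p: "p \<in> M"
        using tangent_space_in_M[OF v(1)] .
      have "flat_at A \<eta> p v = flat_at A \<eta> p (tangent_zero A p)"
        using eq[OF v(1) tangent_zero(1)[OF p]] x v(2) by (simp add: tangent_zero(2)[OF p u])
      then have "v = tangent_zero A p"
        using inj_onD[OF inj] v(1) tangent_zero(1)[OF p] by blast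
      then show "x = 0"
        using v(2) tangent_zero(2)[OF p u] by simp
    qed
  next
    assume N: "\<forall>x. (\<forall>y. ?F x y = 0) \<longrightarrow> x = 0"
    show "inj_on (flat_at A \<eta> p) ?T"
    proof (rule inj_onI)
      fix v w
      assume vw: "v \<in> ?T" "w \<in> ?T" and "flat_at A \<eta> p v = flat_at A \<eta> p w"
      then have "?\<kappa> v - ?\<kappa> w = 0"
        using eq N by blast
      then show "v = w"
        by (intro tangent_coord_inject[OF vw u]) simp
    qed
  qed
  then show ?thesis
    by (simp add: loc_flat_def)
qed

lemma vertical_nonzero:
  assumes "v \<in> vertical A \<eta> p" "v \<noteq> tangent_zero A p"
  shows "tangent_coord u v \<noteq> 0" "loc_dform U u (u p) (tangent_coord u v) y = 0"
proof -
  have v: "v \<in> tangent_space A p"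
    using assms(1) by (simp add: vertical_def)
  show "tangent_coord u v \<noteq> 0" "loc_dform U u (u p) (tangent_coord u v) y = 0"
    using assms vertical_iff[OF v] tangent_coord_eq_0_iff[OF v] by auto
qed

lemma antisymmetric_bilinear_exterior_derivative:
  assumes S: "S \<subseteq> tangent_space A p"
  shows "antisymmetric_bilinear_on A p S (exterior_derivative A \<eta> p)"
proof -
  have x: "u p \<in> u ` U"
    using u(2) by blast
  note lin = linear_loc_dform(1)[OF u(1) x]
  show ?thesis
    unfolding antisymmetric_bilinear_on_def
  proof (intro conjI ballI allI)
    fix v w z r
    assume "v \<in> S" "w \<in> S"
    then have v: "v \<in> tangent_space A p" and w: "w \<in> tangent_space A p"
      using S by auto
    show "exterior_derivative A \<eta> p v w = - exterior_derivative A \<eta> p w v"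
      using exterior_derivative_eq[OF u v w] exterior_derivative_eq[OF u w v]
        loc_dform_antisym[of "u p" "tangent_coord u v"] by simp
    assume "z \<in> S"
    then have z: "z \<in> tangent_space A p"
      using S by auto
    show "exterior_derivative A \<eta> p (tangent_add A p v w) z
        = exterior_derivative A \<eta> p v z + exterior_derivative A \<eta> p w z"
      using exterior_derivative_eq[OF u tangent_add(1)[OF v w] z] exterior_derivative_eq[OF u v z]
        exterior_derivative_eq[OF u w z] by (simp add: tangent_add(2)[OF v w u] linear_add[OF lin])
  next
    fix v z r
    assume "v \<in> S" "z \<in> S"
    then have v: "v \<in> tangent_space A p" and z: "z \<in> tangent_space A p"
      using S by auto
    show "exterior_derivative A \<eta> p (tangent_scale A p r v) z = r * exterior_derivative A \<eta> p v z"
      using exterior_derivative_eq[OF u tangent_scale(1)[OF v] z] exterior_derivative_eq[OF u v z]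
      by (simp add: tangent_scale(2)[OF v u] linear_cmul[OF lin])
  qed
qed

text \<open>With \<open>l\<^sub>x\<close> the local representative of the form and \<open>l\<^sub>0 e = 1\<close> at the base point \<open>0\<close>, the map
  \<open>y \<mapsto> y + ((l\<^sub>0 y - l\<^sub>x y) / l\<^sub>x e) e\<close> carries \<open>ker l\<^sub>0\<close> to \<open>ker l\<^sub>x\<close>, with inverse
  \<open>y \<mapsto> y + (l\<^sub>x y - l\<^sub>0 y) e\<close>.\<close>

lemma horizontal_subbundle_at:
  assumes e: "loc U u (u p) e = 1"
  shows "\<exists>W F \<psi> \<phi>. p \<in> W \<and> W \<subseteq> U \<and> cinf_open (u ` W) \<and> subspace F \<and> closedin cinf_topology F \<and>
    smooth_on (u ` W \<times> UNIV) (\<lambda>(x, y). \<psi> x y) \<and> smooth_on (u ` W \<times> UNIV) (\<lambda>(x, y). \<phi> x y) \<and>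
    (\<forall>x\<in>u ` W. linear (\<psi> x) \<and> (\<forall>y. \<phi> x (\<psi> x y) = y \<and> \<psi> x (\<phi> x y) = y)) \<and>
    (\<forall>q\<in>W. tangent_coord u ` horizontal A \<eta> q = \<psi> (u q) ` F)"
proof -
  define l where "l = loc U u"
  define l0 where "l0 = l (u p)"
  have l: "l x (y + z) = l x y + l x z" "l x (r *\<^sub>R y) = r * l x y" for x y z r
    using linear_add[OF linear_loc] linear_cmul[OF linear_loc] by (auto simp: l_def)
  have l0: "l0 (y + z) = l0 y + l0 z" "l0 (r *\<^sub>R y) = r * l0 y" "l0 e = 1" for y z r
    using l e by (simp_all add: l0_def l_def)
  define W where "W = {q \<in> U. l (u q) e \<noteq> 0}"
  define F where "F = {y. l0 y = 0}"
  define \<psi> where "\<psi> x y = y + ((l0 y - l x y) / l x e) *\<^sub>R e" for x y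
  define \<phi> where "\<phi> x y = y + (l x y - l0 y) *\<^sub>R e" for x y
  have uW: "u ` W = {x \<in> u ` U. l x e \<noteq> 0}"
    by (auto simp: W_def)
  \<comment> \<open>Tested along a smooth curve: near a time in the preimage, the curve remains in
    the chart image and the smooth function \<open>l (c s) e\<close> remains nonzero.\<close>
  have W_open: "cinf_open (u ` W)"
    unfolding cinf_open_def
  proof (intro allI impI)
    fix c :: "real \<Rightarrow> 'e"
    assume c: "smooth_curve c"
    show "open (c -` (u ` W))"
    proof (subst open_subopen, intro ballI)
      fix t
      assume "t \<in> c -` (u ` W)"
      then have t: "c t \<in> u ` U" "l (c t) e \<noteq> 0"
        unfolding uW by auto
      have near: "smooth_near c t"
        by (rule smooth_curve_imp_smooth_near[OF c])
      have "smooth_near (\<lambda>s. l (c s) e) t"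
        unfolding l_def by (rule smooth_on_smooth_near[OF smooth_on_loc[OF u(1)] chart_open[OF u(1)] near t(1)])
      then have "\<forall>\<^sub>F s in nhds t. l (c s) e \<noteq> 0"
        using smooth_at_imp_tendsto[OF smooth_near_imp_smooth_at] t(2)
        by (intro tendsto_imp_eventually_ne) auto
      with smooth_near_eventually_in[OF near chart_open[OF u(1)] t(1)]
      have "\<forall>\<^sub>F s in nhds t. s \<in> c -` (u ` W)"
        unfolding uW by eventually_elim simp
      then show "\<exists>T. open T \<and> t \<in> T \<and> T \<subseteq> c -` (u ` W)"
        unfolding eventually_nhds by blast
    qed
  qed
  have ls: "smooth_curve (\<lambda>t. l (x t) (y t))" if "smooth_curve x" "range x \<subseteq> u ` W" "smooth_curve y" for x y
    unfolding l_def using that uW by (intro loc_smooth[OF u(1)]) auto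
  have l0s: "smooth_curve (\<lambda>t. l0 (y t))" if "smooth_curve y" for y
    unfolding l0_def l_def loc_def using that by (rule smooth_curve_dual_apply)
  have pairs: "smooth_curve (\<lambda>t. fst (c t))" "range (\<lambda>t. fst (c t)) \<subseteq> u ` W" "smooth_curve (\<lambda>t. snd (c t))"
    if c: "smooth_curve c \<and> range c \<subseteq> u ` W \<times> UNIV" for c :: "real \<Rightarrow> 'e \<times> 'e"
  proof -
    show "smooth_curve (\<lambda>t. fst (c t))" "smooth_curve (\<lambda>t. snd (c t))"
      by (rule smooth_curve_on_components; use c in blast)+
    have "fst (c t) \<in> u ` W" for t
      using c rangeI[of c t] by (metis mem_Times_iff subsetD)
    then show "range (\<lambda>t. fst (c t)) \<subseteq> u ` W"
      by blast
  qed
  have s1: "smooth_on (u ` W \<times> UNIV) (\<lambda>(x, y). \<psi> x y)"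
    unfolding smooth_on_def comp_def case_prod_beta
  proof (intro allI impI)
    fix c :: "real \<Rightarrow> 'e \<times> 'e"
    assume "smooth_curve c \<and> range c \<subseteq> u ` W \<times> UNIV"
    note c = pairs[OF this]
    have ne: "l (fst (c t)) e \<noteq> 0" for t
      using c(2) uW by blast
    have "smooth_curve (\<lambda>t. (l0 (snd (c t)) - l (fst (c t)) (snd (c t))) / l (fst (c t)) e)"
      by (intro smooth_curve_divide smooth_curve_intros(4) l0s[OF c(3)] ls[OF c]
          ls[OF c(1,2) smooth_curve_intros(1)] ne)
    then show "smooth_curve (\<lambda>t. \<psi> (fst (c t)) (snd (c t)))"
      unfolding \<psi>_def by (intro smooth_curve_intros c)
  qed
  have s2: "smooth_on (u ` W \<times> UNIV) (\<lambda>(x, y). \<phi> x y)"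
    unfolding smooth_on_def comp_def case_prod_beta
  proof (intro allI impI)
    fix c :: "real \<Rightarrow> 'e \<times> 'e"
    assume "smooth_curve c \<and> range c \<subseteq> u ` W \<times> UNIV"
    note c = pairs[OF this]
    show "smooth_curve (\<lambda>t. \<phi> (fst (c t)) (snd (c t)))"
      unfolding \<phi>_def by (intro smooth_curve_intros(1,3,4,5) c ls[OF c] l0s[OF c(3)])
  qed
  have s3: "linear (\<psi> x)" for x
    by (rule linearI) (simp_all add: \<psi>_def l l0 algebra_simps add_divide_distrib diff_divide_distrib)
  \<comment> \<open>The two families exchange the functionals: \<open>\<psi> x\<close> pulls
    \<open>l x\<close> back to \<open>l0\<close>, and \<open>\<phi> x\<close> pulls
    \<open>l0\<close> back to \<open>l x\<close>. The inverse identities and the image of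
    \<open>F\<close> follow from this.\<close>
  have inv: "\<phi> x (\<psi> x y) = y \<and> \<psi> x (\<phi> x y) = y" "l x (\<psi> x y) = l0 y" if "x \<in> u ` W" for x y
  proof -
    have ne: "l x e \<noteq> 0"
      using that uW by blast
    show 1: "l x (\<psi> x y) = l0 y"
      using ne by (simp add: \<psi>_def l)
    have 2: "l0 (\<phi> x y) = l x y"
      by (simp add: \<phi>_def l0)
    have "\<phi> x (\<psi> x y) = y"
      unfolding \<phi>_def 1 by (simp add: \<psi>_def l0 algebra_simps)
    moreover have "(l x y - l x (\<phi> x y)) / l x e = - (l x y - l0 y)"
      using ne by (simp add: \<phi>_def l)
    then have "\<psi> x (\<phi> x y) = y"
      unfolding \<psi>_def 2 by (simp add: \<phi>_def scaleR_left_distrib[symmetric])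
    ultimately show "\<phi> x (\<psi> x y) = y \<and> \<psi> x (\<phi> x y) = y"
      by simp
  qed
  have s4: "tangent_coord u ` horizontal A \<eta> q = \<psi> (u q) ` F" if q: "q \<in> W" for q
  proof -
    have qU: "q \<in> U" and uq: "u q \<in> u ` W"
      using q by (auto simp: W_def)
    have "tangent_coord u ` horizontal A \<eta> q = {x. l (u q) x = 0}"
    proof (intro equalityI subsetI)
      fix x
      assume "x \<in> {x. l (u q) x = 0}"
      moreover obtain v where "v \<in> tangent_space A q" "tangent_coord u v = x"
        using tangent_coord_surj[OF u(1) qU] .
      ultimately show "x \<in> tangent_coord u ` horizontal A \<eta> q"
        using loc_eq[OF u(1) qU] by (force simp: horizontal_def l_def)
    qed (use loc_eq[OF u(1) qU] in \<open>auto simp: horizontal_def l_def\<close>)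
    also have "\<dots> = \<psi> (u q) ` F"
    proof (intro equalityI subsetI)
      fix x
      assume "x \<in> {x. l (u q) x = 0}"
      then have "\<phi> (u q) x \<in> F" "x = \<psi> (u q) (\<phi> (u q) x)"
        using inv(1)[OF uq, of x] inv(2)[OF uq, of "\<phi> (u q) x"] by (auto simp: F_def)
      then show "x \<in> \<psi> (u q) ` F"
        by blast
    qed (use inv(2)[OF uq] in \<open>auto simp: F_def\<close>)
    finally show ?thesis .
  qed
  have s5: "subspace F"
    unfolding F_def l0_def l_def by (rule linear_subspace_kernel[OF linear_loc])
  have s6: "closedin cinf_topology F"
  proof -
    have "continuous_map cinf_topology euclideanreal l0"
      unfolding l0_def l_def loc_def by (rule continuous_dual_apply)
    from closedin_continuous_map_preimage[OF this, of "{0}"] show ?thesis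
      by (simp add: F_def)
  qed
  have s7: "p \<in> W" "W \<subseteq> U"
    using u e by (auto simp: W_def l_def)
  show ?thesis
    by (intro exI[of _ W] exI[of _ F] exI[of _ \<psi>] exI[of _ \<phi>] conjI ballI allI s7 W_open s5 s6 s1 s2 s3 s4)
      (simp_all add: inv)
qed

end

section \<open>Injectivity: from the fibres to the bundle and to sections\<close>

lemma inj_on_flat_bundle_iff:
  "inj_on (flat_bundle A \<eta>) (tangent_bundle M A) \<longleftrightarrow> (\<forall>p\<in>M. inj_on (flat_at A \<eta> p) (tangent_space A p))"
proof safe
  fix p
  assume inj: "inj_on (flat_bundle A \<eta>) (tangent_bundle M A)" and p: "p \<in> M"
  show "inj_on (flat_at A \<eta> p) (tangent_space A p)"
  proof (rule inj_onI)
    fix v w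
    assume "v \<in> tangent_space A p" "w \<in> tangent_space A p" "flat_at A \<eta> p v = flat_at A \<eta> p w"
    then show "v = w"
      using p by (intro inj_onD[OF inj]) (auto simp: flat_bundle_def tangent_bundle_iff footpoint_eq)
  qed
next
  assume inj: "\<forall>p\<in>M. inj_on (flat_at A \<eta> p) (tangent_space A p)"
  show "inj_on (flat_bundle A \<eta>) (tangent_bundle M A)"
  proof (rule inj_onI)
    fix v w
    assume v: "v \<in> tangent_bundle M A" and w: "w \<in> tangent_bundle M A"
      and eq: "flat_bundle A \<eta> v = flat_bundle A \<eta> w"
    have fp: "footpoint w = footpoint v"
      using eq by (simp add: flat_bundle_def)
    have "flat_at A \<eta> (footpoint v) v = flat_at A \<eta> (footpoint v) w"
      using eq unfolding flat_bundle_def fp by simp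
    moreover have "footpoint v \<in> M" "v \<in> tangent_space A (footpoint v)" "w \<in> tangent_space A (footpoint v)"
      using v w unfolding tangent_bundle_iff fp by blast+
    ultimately show "v = w"
      using inj_onD[OF bspec[OF inj]] by blast
  qed
qed

lemma inj_on_flat_sections:
  assumes "\<forall>p\<in>M. inj_on (flat_at A \<eta> p) (tangent_space A p)"
  shows "inj_on (flat_sections M A \<eta>) (vector_fields M A)"
proof (rule inj_onI)
  fix X Y
  assume XY: "X \<in> vector_fields M A" "Y \<in> vector_fields M A" and eq: "flat_sections M A \<eta> X = flat_sections M A \<eta> Y"
  then have PiE: "X \<in> Pi\<^sub>E M (tangent_space A)" "Y \<in> Pi\<^sub>E M (tangent_space A)"
    by (auto simp: vector_fields_def)
  show "X = Y"
  proof (rule PiE_ext[OF PiE])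
    fix p
    assume p: "p \<in> M"
    have "flat_at A \<eta> p (X p) = flat_at A \<eta> p (Y p)"
      using fun_cong[OF eq, of p] p by (simp add: flat_sections_def)
    then show "X p = Y p"
      using inj_onD[OF bspec[OF assms p]] PiE_mem[OF PiE(1) p] PiE_mem[OF PiE(2) p] by blast
  qed
qed

end

theorem theorem3p2:
  fixes M :: "'m set"
    and A :: "('m, 'e::convenient_vector_space) chart set"
    and \<eta> :: "'m \<Rightarrow> 'm cotangent"
  assumes manifold: "smooth_manifold M A"
    and dimension: "infinite_dimensional TYPE('e)"
    and form: "\<eta> \<in> one_forms M A"
    and degenerate: "\<forall>p\<in>M. \<exists>v\<in>vertical A \<eta> p. v \<noteq> tangent_zero A p"
  shows
    "(tangent_whitney_sum M A (horizontal A \<eta>) (vertical A \<eta>)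
        \<longleftrightarrow> weakly_nondegenerate_on M A (horizontal A \<eta>) (exterior_derivative A \<eta>)) \<and>
     (weakly_nondegenerate_on M A (horizontal A \<eta>) (exterior_derivative A \<eta>)
        \<longleftrightarrow> weakly_symplectic_bundle M A (horizontal A \<eta>) (exterior_derivative A \<eta>)) \<and>
     (weakly_nondegenerate_on M A (horizontal A \<eta>) (exterior_derivative A \<eta>)
        \<longleftrightarrow> bundle_hom_tangent_cotangent M A (flat_bundle A \<eta>) \<and>
            inj_on (flat_bundle A \<eta>) (tangent_bundle M A)) \<and>
     (bundle_hom_tangent_cotangent M A (flat_bundle A \<eta>) \<and>
      inj_on (flat_bundle A \<eta>) (tangent_bundle M A)
        \<longrightarrow> module_hom_fields_forms M A (flat_sections M A \<eta>) \<and>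
            inj_on (flat_sections M A \<eta>) (vector_fields M A))"
proof -
  interpret manifold_one_form M A \<eta>
    by unfold_locales (rule manifold form)+
  let ?N = "\<lambda>p. \<forall>v\<in>horizontal A \<eta> p.
      (\<forall>w\<in>horizontal A \<eta> p. exterior_derivative A \<eta> p v w = 0) \<longrightarrow> v = tangent_zero A p"
  \<comment> \<open>The direct sum, nondegeneracy and injectivity are fibrewise conditions, so one
    chart and one kernel vector per point suffice to compare them.\<close>
  have at: "((\<forall>v\<in>tangent_space A p. \<exists>!(h, k). h \<in> horizontal A \<eta> p \<and> k \<in> vertical A \<eta> p \<and>
        v = tangent_add A p h k) \<longleftrightarrow> ?N p) \<and> (?N p \<longleftrightarrow> inj_on (flat_at A \<eta> p) (tangent_space A p))"
    if p: "p \<in> M" for p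
  proof -
    obtain U u where u: "(U, u) \<in> A" "p \<in> U"
      using chart_exists[OF p] .
    obtain v where v: "v \<in> vertical A \<eta> p" "v \<noteq> tangent_zero A p"
      using degenerate p by blast
    have x: "u p \<in> u ` U"
      using u(2) by blast
    note iffs = hyperplane_complement_iff[of "loc U u (u p)" "loc_dform U u (u p)",
        OF linear_loc linear_loc_dform(1)[OF u(1) x] loc_dform_antisym[OF u] vertical_nonzero[OF u v]]
    show ?thesis
      by (rule conjI[OF trans[OF whitney_at_iff[OF u] trans[OF iffs(1) nondegenerate_at_iff[OF u, symmetric]]]
            trans[OF nondegenerate_at_iff[OF u] trans[OF iffs(2) flat_injective_at_iff[OF u, symmetric]]]])
  qed
  have whitney: "tangent_whitney_sum M A (horizontal A \<eta>) (vertical A \<eta>)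
      \<longleftrightarrow> weakly_nondegenerate_on M A (horizontal A \<eta>) (exterior_derivative A \<eta>)"
    unfolding tangent_whitney_sum_def weakly_nondegenerate_on_def
    by (rule ball_cong[OF refl conjunct1[OF at]])
  have flat: "weakly_nondegenerate_on M A (horizontal A \<eta>) (exterior_derivative A \<eta>)
      \<longleftrightarrow> (\<forall>p\<in>M. inj_on (flat_at A \<eta> p) (tangent_space A p))"
    unfolding weakly_nondegenerate_on_def by (rule ball_cong[OF refl conjunct2[OF at]])
  \<comment> \<open>The converse is part of the definition. This direction has to construct the
    subbundle and to check antisymmetry and bilinearity.\<close>
  have "weakly_symplectic_bundle M A (horizontal A \<eta>) (exterior_derivative A \<eta>)"
    if N: "weakly_nondegenerate_on M A (horizontal A \<eta>) (exterior_derivative A \<eta>)"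
    unfolding weakly_symplectic_bundle_def
  proof (intro conjI ballI)
    show "antisymmetric_bilinear_on A p (horizontal A \<eta> p) (exterior_derivative A \<eta> p)" if p: "p \<in> M" for p
    proof -
      obtain U u where u: "(U, u) \<in> A" "p \<in> U"
        using chart_exists[OF p] .
      show ?thesis
        by (rule antisymmetric_bilinear_exterior_derivative[OF u]) (auto simp: horizontal_def)
    qed
    show "vector_subbundle M A (horizontal A \<eta>)"
      unfolding vector_subbundle_def
    proof (intro conjI ballI)
      show "horizontal A \<eta> p \<subseteq> tangent_space A p" for p
        by (auto simp: horizontal_def)
      fix p
      assume p: "p \<in> M"
      obtain U u where u: "(U, u) \<in> A" "p \<in> U"
        using chart_exists[OF p] .
      obtain v where v: "v \<in> vertical A \<eta> p" "v \<noteq> tangent_zero A p"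
        using degenerate p by blast
      then have vT: "v \<in> tangent_space A p" "\<forall>w\<in>tangent_space A p. exterior_derivative A \<eta> p v w = 0"
        by (auto simp: vertical_def)
      \<comment> \<open>Otherwise \<open>v\<close> would be a nonzero horizontal vector in the
        kernel of the restricted form. Nondegeneracy thus makes the form nonzero at
        \<open>p\<close>.\<close>
      have "\<eta> p v \<noteq> 0"
      proof
        assume "\<eta> p v = 0"
        then have "v \<in> horizontal A \<eta> p"
          using vT(1) by (simp add: horizontal_def)
        then show False
          using N p v(2) vT(2) unfolding weakly_nondegenerate_on_def horizontal_def by blast
      qed
      \<comment> \<open>The rescaled kernel vector serves as the direction \<open>e\<close> that
        trivialises the horizontal distribution near \<open>p\<close>.\<close>
      then have "loc U u (u p) (inverse (\<eta> p v) *\<^sub>R tangent_coord u v) = 1"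
        by (simp add: linear_cmul[OF linear_loc] loc_eq[OF u vT(1)])
      from horizontal_subbundle_at[OF u this] u(1)
      show "\<exists>(U, u)\<in>A. \<exists>W F \<psi> \<phi>.
        p \<in> W \<and> W \<subseteq> U \<and> cinf_open (u ` W) \<and>
        subspace F \<and> closedin cinf_topology F \<and>
        smooth_on (u ` W \<times> UNIV) (\<lambda>(x, y). \<psi> x y) \<and>
        smooth_on (u ` W \<times> UNIV) (\<lambda>(x, y). \<phi> x y) \<and>
        (\<forall>x\<in>u ` W. linear (\<psi> x) \<and> (\<forall>y. \<phi> x (\<psi> x y) = y \<and> \<psi> x (\<phi> x y) = y)) \<and>
        (\<forall>q\<in>W. tangent_coord u ` horizontal A \<eta> q = \<psi> (u q) ` F)"
        by (intro bexI[of _ "(U, u)"]) simp_all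
    qed
  qed (rule N)
  then have symplectic: "weakly_nondegenerate_on M A (horizontal A \<eta>) (exterior_derivative A \<eta>)
      \<longleftrightarrow> weakly_symplectic_bundle M A (horizontal A \<eta>) (exterior_derivative A \<eta>)"
    unfolding weakly_symplectic_bundle_def by blast
  show ?thesis
    using whitney symplectic flat inj_on_flat_bundle_iff bundle_hom_flat module_hom_flat inj_on_flat_sections
    by blast
qed

end
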